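(* Let $T>0$. Assume that the stored-energy function $$\sigma(j_1,j_2)=\sum_{r=1}^2\sigma_rj_r+\sum_{r=1}^2\sum_{s=1}^2\frac{\sigma_{rs}}{2}j_rj_s+\frac{\sigma_{111}}{6}j_1^3$$ (with real constants $\sigma_r,\sigma_{rs}=\sigma_{sr},\sigma_{111}$) satisfies $$\sigma_1=0,\quad \mu:=-2\sigma_2>0,\quad \lambda:=4\sigma_{11}+4\sigma_2>0,\quad \sigma_{11}\sigma_{22}-\sigma_{12}^2>0,$$ $$3\sigma_{11}+2\sigma_{111}=0,\qquad \sigma^*:=2\sigma_{11}+8\sigma_{12}+2\sigma_2+4\sigma_{111}\neq0.$$ Then there exists a nontrivial (i.e. not identically zero) weak solution $u\in C^1([0,T]\times\mathbb{T}^2;\mathbb{R}^2)$ of the elastodynamic system $$\partial_{tt}u-\operatorname{div}\big((\mathrm{Id}+G)\Sigma_G\big)=0\ \text{ in }(0,T)\times\mathbb{T}^2,\qquad u(0,\cdot)=u_0,\quad \partial_tu(0,\cdot)=u_1,\qquad G=\nabla u,$$ emanating from the zero initial data $u_0=0$, $u_1=0$.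
   Context: $\mathbb{T}^2=[-\pi,\pi]^2$ is the flat torus with periodic boundary conditions. The unknown $u:[0,T]\times\mathbb{T}^2\to\mathbb{R}^2$ is the displacement, $G=\nabla u$ with $G_{ij}=\partial_{x_j}u_i$, and $(\operatorname{div}P)_i=\sum_j\partial_{x_j}P_{ij}$ for a matrix field $P$. Set $$C=G+G^\top+GG^\top,\qquad D=G+G^\top+G^\top G,\qquad j_1=\operatorname{tr}C,\qquad j_2=\det C=\tfrac12\big((\operatorname{tr}C)^2-\operatorname{tr}(C^2)\big).$$ The second Piola--Kirchhoff stress tensor (under the assumption $\sigma_1=0$) is the symmetric matrix $$\Sigma_G=\Lambda_1\,\mathrm{Id}+\Lambda_2\,(\operatorname{tr}C\,\mathrm{Id}-D),\qquad \Lambda_1=2\Big(\sigma_{11}j_1+\sigma_{12}j_2+\frac{\sigma_{111}}2j_1^2\Big),\qquad \Lambda_2=2\big(\sigma_2+\sigma_{12}j_1+\sigma_{22}j_2\big);$$ equivalently $(\mathrm{Id}+G)\Sigma_G=\partial\sigma/\partial G$ is the first Piola--Kirchhoff stress. Weak solution: a weak solution on $[0,T]$ is a function $u\in C([0,T];H^1(\mathbb{T}^2))\cap C^1([0,T];L^2(\mathbb{T}^2))$ with $\partial_{tt}u\in L^2(0,T;H^{-1}(\mathbb{T}^2))$, such that, with $G:=\nabla u$, $(\mathrm{Id}+G)\Sigma_G\in L^2((0,T)\times\mathbb{T}^2)$, $u(0,\cdot)=u_0$, $\partial_tu(0,\cdot)=u_1$, and $$\int_0^T\int_{\mathbb{T}^2}\big(\partial_tu\cdot\partial_t\eta-(\mathrm{Id}+G)\Sigma_G:\nabla\eta\big)\,dx\,dt=-\int_{\mathbb{T}^2}u_1(x)\cdot\eta(0,x)\,dx$$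 for every $\eta\in C_c^\infty([0,T)\times\mathbb{T}^2;\mathbb{R}^2)$. *)

theory Defs
  imports "HOL-Analysis.Analysis"
begin

section \<open>Stored energy and stress\<close>

text \<open>
  The constants of the stored-energy function are passed as functions on the index type
  \<^typ>\<open>2\<close>, whose elements are 1 and 2: \<open>a r\<close> is \<open>\<sigma>\<^sub>r\<close>, \<open>b r s\<close> is
  \<open>\<sigma>\<^sub>r\<^sub>s\<close>, and \<open>c\<close> is \<open>\<sigma>\<^sub>1\<^sub>1\<^sub>1\<close>.
\<close>

definition stored_energy ::
    "(2 \<Rightarrow> real) \<Rightarrow> (2 \<Rightarrow> 2 \<Rightarrow> real) \<Rightarrow> real \<Rightarrow> real^2 \<Rightarrow> real" where
  "stored_energy a b c j =
     (\<Sum>r\<in>UNIV. a r * j $ r) + (\<Sum>r\<in>UNIV. \<Sum>s\<in>UNIV. b r s / 2 * j $ r * j $ s)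
     + c / 6 * (j $ 1) ^ 3"

definition C_mat :: "real^2^2 \<Rightarrow> real^2^2" where
  "C_mat G = G + transpose G + G ** transpose G"

definition D_mat :: "real^2^2 \<Rightarrow> real^2^2" where
  "D_mat G = G + transpose G + transpose G ** G"

definition j1 :: "real^2^2 \<Rightarrow> real" where
  "j1 G = trace (C_mat G)"

definition j2 :: "real^2^2 \<Rightarrow> real" where
  "j2 G = det (C_mat G)"

definition Lambda1 :: "(2 \<Rightarrow> 2 \<Rightarrow> real) \<Rightarrow> real \<Rightarrow> real^2^2 \<Rightarrow> real" where
  "Lambda1 b c G = 2 * (b 1 1 * j1 G + b 1 2 * j2 G + c / 2 * (j1 G)\<^sup>2)"

definition Lambda2 :: "(2 \<Rightarrow> real) \<Rightarrow> (2 \<Rightarrow> 2 \<Rightarrow> real) \<Rightarrow> real^2^2 \<Rightarrow> real" where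
  "Lambda2 a b G = 2 * (a 2 + b 1 2 * j1 G + b 2 2 * j2 G)"

definition second_PK ::
    "(2 \<Rightarrow> real) \<Rightarrow> (2 \<Rightarrow> 2 \<Rightarrow> real) \<Rightarrow> real \<Rightarrow> real^2^2 \<Rightarrow> real^2^2" where
  "second_PK a b c G =
     Lambda1 b c G *\<^sub>R mat 1 + Lambda2 a b G *\<^sub>R (trace (C_mat G) *\<^sub>R mat 1 - D_mat G)"

definition first_PK ::
    "(2 \<Rightarrow> real) \<Rightarrow> (2 \<Rightarrow> 2 \<Rightarrow> real) \<Rightarrow> real \<Rightarrow> real^2^2 \<Rightarrow> real^2^2" where
  "first_PK a b c G = (mat 1 + G) ** second_PK a b c G"

text \<open>When \<open>a 1 = 0\<close>, the first Piola--Kirchhoff stress is the gradient of the stored energy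
  in \<open>G\<close>; the inner product on \<^typ>\<open>real^2^2\<close> is the Frobenius one.\<close>

lemma j2_eq: "j2 G = ((trace (C_mat G))\<^sup>2 - trace (C_mat G ** C_mat G)) / 2"
  by (simp add: j2_def det_2 trace_def matrix_matrix_mult_def sum_2 power2_eq_square field_simps)

lemma has_derivative_entry [derivative_intros]:
  "((\<lambda>G::real^2^2. G $ i $ j) has_derivative (\<lambda>H. H $ i $ j)) F"
  by (intro bounded_linear_imp_has_derivative bounded_linear_compose[OF bounded_linear_vec_nth]
        bounded_linear_vec_nth)

lemma has_derivative_j1: "(j1 has_derivative (\<lambda>H. 2 * ((mat 1 + G) \<bullet> H))) (at G)"
proof -
  have j1: "j1 = (\<lambda>G. 2 * (G$1$1 + G$2$2)
      + G$1$1 * G$1$1 + G$1$2 * G$1$2 + G$2$1 * G$2$1 + G$2$2 * G$2$2)"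
    by (rule ext) (simp add: j1_def C_mat_def trace_def transpose_def matrix_matrix_mult_def sum_2)
  show ?thesis
    unfolding j1
    by (rule derivative_eq_intros | rule refl)+
       (simp add: inner_vec_def sum_2 mat_def algebra_simps fun_eq_iff)
qed

lemma has_derivative_j2:
  "(j2 has_derivative
     (\<lambda>H. 2 * (((mat 1 + G) ** (trace (C_mat G) *\<^sub>R mat 1 - D_mat G)) \<bullet> H))) (at G)"
proof -
  have j2: "j2 = (\<lambda>G.
      (2 * G$1$1 + (G$1$1 * G$1$1 + G$1$2 * G$1$2)) * (2 * G$2$2 + (G$2$1 * G$2$1 + G$2$2 * G$2$2))
      - (G$1$2 + G$2$1 + (G$1$1 * G$2$1 + G$1$2 * G$2$2))
        * (G$1$2 + G$2$1 + (G$1$1 * G$2$1 + G$1$2 * G$2$2)))"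
    by (rule ext)
       (simp add: j2_def det_2 C_mat_def transpose_def matrix_matrix_mult_def sum_2 algebra_simps)
  show ?thesis
    unfolding j2
    apply (rule derivative_eq_intros | rule refl)+
    apply (rule ext)
    apply (simp add: inner_vec_def sum_2 mat_def C_mat_def D_mat_def trace_def transpose_def
        matrix_matrix_mult_def)
    apply algebra
    done
qed

lemma first_PK_is_energy_gradient:
  assumes "a 1 = 0" and "\<And>r s. b r s = b s r"
  shows "((\<lambda>G. stored_energy a b c (vector [j1 G, j2 G])) has_derivative
           (\<lambda>H. first_PK a b c G \<bullet> H)) (at G)"
proof -
  have b: "b 2 1 = b 1 2" using assms(2) .
  have energy: "stored_energy a b c (vector [x, y]) =
      a 2 * y + b 1 1 / 2 * x^2 + b 1 2 * x * y + b 2 2 / 2 * y^2 + c / 6 * x^3" for x y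
    by (simp add: stored_energy_def sum_2 assms(1) b power2_eq_square field_simps)
  have PK: "first_PK a b c G = Lambda1 b c G *\<^sub>R (mat 1 + G)
      + Lambda2 a b G *\<^sub>R ((mat 1 + G) ** (trace (C_mat G) *\<^sub>R mat 1 - D_mat G))"
    by (simp add: first_PK_def second_PK_def matrix_add_ldistrib matrix_scalar_ac
        scalar_matrix_assoc flip: scalar_matrix_assoc scalar_mult_eq_scaleR)
  show ?thesis
    unfolding energy
    apply (rule derivative_eq_intros has_derivative_j1 has_derivative_j2 | rule refl)+
    apply (rule ext)
    apply (simp add: PK inner_add_left Lambda1_def Lambda2_def)
    apply (simp add: field_simps power2_eq_square)
    done
qed


section \<open>Smooth functions and functions on the torus\<close>

primrec C_k :: "nat \<Rightarrow> ('a::euclidean_space \<Rightarrow> 'b::euclidean_space) \<Rightarrow> bool" where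
  "C_k 0 f \<longleftrightarrow> continuous_on UNIV f"
| "C_k (Suc k) f \<longleftrightarrow>
     (\<forall>x. f differentiable (at x)) \<and> (\<forall>v. C_k k (\<lambda>x. frechet_derivative f (at x) v))"

definition smooth :: "('a::euclidean_space \<Rightarrow> 'b::euclidean_space) \<Rightarrow> bool" where
  "smooth f \<longleftrightarrow> (\<forall>k. C_k k f)"

text \<open>Functions on the torus are represented by functions on the plane that are
  \<open>2\<pi>\<close>-periodic in each coordinate; norms and integrals are taken over the fundamental square.\<close>

definition torus :: "(real^2) set" where
  "torus = cbox (\<chi> i. - pi) (\<chi> i. pi)"

definition torus_periodic :: "(real^2 \<Rightarrow> 'b) \<Rightarrow> bool" where
  "torus_periodic f \<longleftrightarrow> (\<forall>x i. f (x + (2 * pi) *\<^sub>R axis i 1) = f x)"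


section \<open>Lebesgue and Sobolev spaces\<close>

text \<open>The elements of these spaces are representatives rather than almost-everywhere classes.
  For matrix-valued functions, \<^const>\<open>norm\<close> is the Frobenius norm.\<close>

definition L2_on :: "'a::euclidean_space set \<Rightarrow> ('a \<Rightarrow> 'b::euclidean_space) set" where
  "L2_on S = {f. f \<in> borel_measurable (lebesgue_on S) \<and>
                 integrable (lebesgue_on S) (\<lambda>x. (norm (f x))\<^sup>2)}"

definition L2_torus :: "(real^2 \<Rightarrow> 'b::euclidean_space) set" where
  "L2_torus = {f. torus_periodic f \<and> f \<in> L2_on torus}"

definition L2_norm :: "(real^2 \<Rightarrow> 'b::euclidean_space) \<Rightarrow> real" where
  "L2_norm f = sqrt (\<integral>x. (norm (f x))\<^sup>2 \<partial>lebesgue_on torus)"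

definition L2_inner :: "(real^2 \<Rightarrow> 'b::euclidean_space) \<Rightarrow> (real^2 \<Rightarrow> 'b) \<Rightarrow> real" where
  "L2_inner f g = (\<integral>x. f x \<bullet> g x \<partial>lebesgue_on torus)"

text \<open>The weak gradient on the torus, with \<open>G x $ i $ j\<close> the derivative of the \<open>i\<close>-th component in
  the \<open>j\<close>-th coordinate. The test functions are periodic, so that no boundary term arises.\<close>

definition has_weak_gradient :: "(real^2 \<Rightarrow> real^2) \<Rightarrow> (real^2 \<Rightarrow> real^2^2) \<Rightarrow> bool" where
  "has_weak_gradient w G \<longleftrightarrow> w \<in> L2_torus \<and> G \<in> L2_torus \<and>
     (\<forall>\<phi>::real^2 \<Rightarrow> real. smooth \<phi> \<and> torus_periodic \<phi> \<longrightarrow>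
        (\<forall>i j. (\<integral>x. w x $ i * frechet_derivative \<phi> (at x) (axis j 1) \<partial>lebesgue_on torus)
             = - (\<integral>x. G x $ i $ j * \<phi> x \<partial>lebesgue_on torus)))"

definition H1 :: "(real^2 \<Rightarrow> real^2) set" where
  "H1 = {w. \<exists>G. has_weak_gradient w G}"

text \<open>A weak gradient is unique up to a null set; this selects a representative.\<close>

definition weak_gradient :: "(real^2 \<Rightarrow> real^2) \<Rightarrow> real^2 \<Rightarrow> real^2^2" where
  "weak_gradient w = (SOME G. has_weak_gradient w G)"

definition H1_norm :: "(real^2 \<Rightarrow> real^2) \<Rightarrow> real" where
  "H1_norm w = sqrt ((L2_norm w)\<^sup>2 + (L2_norm (weak_gradient w))\<^sup>2)"

text \<open>The space \<open>H\<^sup>-\<^sup>1\<close> is the dual of \<open>H\<^sup>1\<close>: the bounded linear functionals on \<^const>\<open>H1\<close>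
  (their values off \<^const>\<open>H1\<close> are irrelevant), with the operator norm.\<close>

definition H_minus1 :: "((real^2 \<Rightarrow> real^2) \<Rightarrow> real) set" where
  "H_minus1 = {F.
     (\<forall>w\<in>H1. \<forall>z\<in>H1. \<forall>r s. F (\<lambda>x. r *\<^sub>R w x + s *\<^sub>R z x) = r * F w + s * F z) \<and>
     (\<exists>K. \<forall>w\<in>H1. \<bar>F w\<bar> \<le> K * H1_norm w)}"

definition H_minus1_norm :: "((real^2 \<Rightarrow> real^2) \<Rightarrow> real) \<Rightarrow> real" where
  "H_minus1_norm F = Sup {\<bar>F w\<bar> | w. w \<in> H1 \<and> H1_norm w \<le> 1}"


section \<open>Functions of time with values in these spaces\<close>

definition C_time ::
    "real \<Rightarrow> ('x \<Rightarrow> 'b::real_vector) set \<Rightarrow> (('x \<Rightarrow> 'b) \<Rightarrow> real) \<Rightarrow> (real \<Rightarrow> 'x \<Rightarrow> 'b) set" where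
  "C_time T X N = {u. (\<forall>t\<in>{0..T}. u t \<in> X) \<and>
     (\<forall>t\<in>{0..T}. ((\<lambda>s. N (\<lambda>x. u s x - u t x)) \<longlongrightarrow> 0) (at t within {0..T}))}"

text \<open>\<open>u\<close> belongs to \<open>C\<^sup>1([0,T]; L\<^sup>2)\<close> with time derivative \<open>v\<close>; the derivative is one-sided at the
  endpoints.\<close>

definition C1_time_L2 ::
    "real \<Rightarrow> (real \<Rightarrow> real^2 \<Rightarrow> real^2) \<Rightarrow> (real \<Rightarrow> real^2 \<Rightarrow> real^2) \<Rightarrow> bool" where
  "C1_time_L2 T u v \<longleftrightarrow> u \<in> C_time T L2_torus L2_norm \<and> v \<in> C_time T L2_torus L2_norm \<and>
     (\<forall>t\<in>{0..T}. ((\<lambda>s. L2_norm (\<lambda>x. (u s x - u t x) /\<^sub>R (s - t) - v t x)) \<longlongrightarrow> 0)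
                    (at t within {0..T}))"

text \<open>\<open>L\<^sup>2(0,T; H\<^sup>-\<^sup>1)\<close> in the sense of Bochner: the function is almost everywhere a limit of
  simple functions in the norm of \<open>H\<^sup>-\<^sup>1\<close>.\<close>

definition L2_time_H_minus1 :: "real \<Rightarrow> (real \<Rightarrow> (real^2 \<Rightarrow> real^2) \<Rightarrow> real) set" where
  "L2_time_H_minus1 T = {F.
     (\<forall>t\<in>{0<..<T}. F t \<in> H_minus1) \<and>
     (\<exists>S. (\<forall>n::nat. finite (S n ` {0<..<T}) \<and> S n ` {0<..<T} \<subseteq> H_minus1 \<and>
                 (\<forall>L. {t\<in>{0<..<T}. S n t = L} \<in> sets lebesgue)) \<and>
          (AE t in lebesgue_on {0<..<T}.
             (\<lambda>n. H_minus1_norm (\<lambda>w. S n t w - F t w)) \<longlonglongrightarrow> 0)) \<and>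
     integrable (lebesgue_on {0<..<T}) (\<lambda>t. (H_minus1_norm (F t))\<^sup>2)}"

text \<open>\<open>F\<close> is the distributional time derivative of \<open>v\<close> on \<open>(0,T)\<close>, where an \<open>L\<^sup>2\<close> function acts on
  \<open>H\<^sup>1\<close> by the \<open>L\<^sup>2\<close> inner product.\<close>

definition weak_time_derivative ::
    "real \<Rightarrow> (real \<Rightarrow> real^2 \<Rightarrow> real^2) \<Rightarrow> (real \<Rightarrow> (real^2 \<Rightarrow> real^2) \<Rightarrow> real) \<Rightarrow> bool" where
  "weak_time_derivative T v F \<longleftrightarrow>
     (\<forall>\<phi>::real \<Rightarrow> real. smooth \<phi> \<and> (\<exists>\<alpha> \<beta>. 0 < \<alpha> \<and> \<beta> < T \<and> (\<forall>t. t \<notin> {\<alpha>..\<beta>} \<longrightarrow> \<phi> t = 0)) \<longrightarrow>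
        (\<forall>w\<in>H1. (\<integral>t. deriv \<phi> t * L2_inner (v t) w \<partial>lebesgue_on {0<..<T})
               = - (\<integral>t. \<phi> t * F t w \<partial>lebesgue_on {0<..<T})))"

text \<open>Test functions with compact support in \<open>[0,T) \<times> torus\<close>. They need not vanish at time 0; they
  are represented by smooth extensions to all times, of which only the values on \<open>[0,T]\<close> enter.\<close>

definition test_functions :: "real \<Rightarrow> (real \<Rightarrow> real^2 \<Rightarrow> real^2) set" where
  "test_functions T = {\<eta>. smooth (\<lambda>(t, x). \<eta> t x) \<and> (\<forall>t. torus_periodic (\<eta> t)) \<and>
     (\<exists>\<tau><T. \<forall>t>\<tau>. \<forall>x. \<eta> t x = 0)}"


section \<open>Weak solutions\<close>

text \<open>The fields \<open>G\<close> and \<open>v\<close> are jointly measurable representatives of the spatial gradient and the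
  time derivative of \<open>u\<close>. Almost everywhere they are determined by \<open>u\<close>, so the existential
  quantifiers involve no choice.\<close>

definition weak_solution ::
    "(real^2^2 \<Rightarrow> real^2^2) \<Rightarrow> real \<Rightarrow> (real^2 \<Rightarrow> real^2) \<Rightarrow> (real^2 \<Rightarrow> real^2) \<Rightarrow>
     (real \<Rightarrow> real^2 \<Rightarrow> real^2) \<Rightarrow> bool" where
  "weak_solution P T u0 u1 u \<longleftrightarrow> (\<exists>G v F.
     u \<in> C_time T H1 H1_norm \<and>
     C1_time_L2 T u v \<and>
     F \<in> L2_time_H_minus1 T \<and> weak_time_derivative T v F \<and>
     (\<forall>t\<in>{0..T}. has_weak_gradient (u t) (G t)) \<and>
     (\<lambda>(t, x). u t x) \<in> borel_measurable (lebesgue_on ({0..T} \<times> torus)) \<and>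
     (\<lambda>(t, x). v t x) \<in> borel_measurable (lebesgue_on ({0..T} \<times> torus)) \<and>
     (\<lambda>(t, x). G t x) \<in> borel_measurable (lebesgue_on ({0..T} \<times> torus)) \<and>
     (\<lambda>(t, x). P (G t x)) \<in> L2_on ({0<..<T} \<times> torus) \<and>
     (AE x in lebesgue_on torus. u 0 x = u0 x) \<and>
     (AE x in lebesgue_on torus. v 0 x = u1 x) \<and>
     (\<forall>\<eta>\<in>test_functions T.
        (\<integral>(t, x). v t x \<bullet> vector_derivative (\<lambda>s. \<eta> s x) (at t)
                 - P (G t x) \<bullet> jacobian (\<eta> t) (at x) \<partial>lebesgue_on ({0<..<T} \<times> torus))
        = - (\<integral>x. u1 x \<bullet> \<eta> 0 x \<partial>lebesgue_on torus)))"

definition C1_spacetime :: "real \<Rightarrow> (real \<Rightarrow> real^2 \<Rightarrow> real^2) \<Rightarrow> bool" where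
  "C1_spacetime T u \<longleftrightarrow> (\<forall>t\<in>{0..T}. torus_periodic (u t)) \<and>
     (\<exists>u' :: real \<times> (real^2) \<Rightarrow> (real \<times> (real^2)) \<Rightarrow>\<^sub>L (real^2).
        continuous_on ({0..T} \<times> UNIV) u' \<and>
        (\<forall>p\<in>{0..T} \<times> UNIV.
           ((\<lambda>(t, x). u t x) has_derivative blinfun_apply (u' p)) (at p within {0..T} \<times> UNIV)))"

end

theory Submission
  imports Defs "HOL-Library.Periodic_Fun"
begin

text \<open>
  The solution is built by convex integration. An approximate solution is a smooth periodic pair
  of a displacement \<open>u\<close> and a symmetric stress error \<open>R\<close>, both vanishing outside a time interval,
  with \<open>u_tt = div ((1 + \<nabla>u) (\<Sigma> + R))\<close>. If \<open>|R|\<close> is much smaller than \<open>\<delta>\<close>, one adds to \<open>R\<close> a multiple of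
  order \<open>\<delta>\<close> of the tensor \<open>det F F^-1 F^-T\<close> with \<open>F = 1 + \<nabla>u\<close>; the product with \<open>F\<close> is the cofactor matrix,
  which is divergence free by Piola's identity. The sum is a combination with positive coefficients
  of three rank-one matrices \<open>k^\<bottom> \<otimes> k^\<bottom>\<close>, and each of them is cancelled by a fast plane wave with wave vector
  \<open>k\<close>, polarised along an eigenvector of the acoustic tensor and moving with the local sound speed. Sound
  speed varies slowly, so it is discretised with a partition of unity whose pieces carry different
  integer frequencies. The hypothesis \<open>3 \<sigma>_11 + 2 \<sigma>_111 = 0\<close> makes the mean quadratic self-interaction of such
  a wave a multiple of \<open>k^\<bottom> \<otimes> k^\<bottom>\<close>, and \<open>\<sigma>* \<noteq> 0\<close> makes this multiple nonzero. What remains oscillates rapidly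
  and is removed by a symmetric inverse divergence, which is solved in the deformed coordinates
  \<open>x + u\<close> and pulled back. The increments are of size \<open>\<surd>\<delta>\<close> in \<open>C^1\<close> and arbitrarily small in \<open>C^0\<close>, while the
  error drops by the factor 4. So the iterates converge in \<open>C^1\<close> to a weak solution that vanishes
  near \<open>t = 0\<close> but not identically.
\<close>

section \<open>Smooth functions\<close>

text \<open>Two choices shape the constructions. The error \<open>R\<close> is symmetric and stands
  to the right of \<open>F = mat 1 + grad u\<close>, next to the second stress; so every correction
  has to be found in the form \<open>F ** S\<close> with \<open>S\<close> symmetric. Hence waves are
  corrected by multiples of \<open>outer X X\<close>, where \<open>F\<close> maps \<open>X\<close>
  to the polarisation, and the inverse divergence must be symmetric. The second choice is the matrix
  \<open>outer (perp k) (perp k)\<close>: it annihilates \<open>k\<close>, so the oscillating part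
  of the square of a wave, multiplied by it, has a divergence without a factor of the frequency.
  Phases are affine in time and space, because periodicity asks for integer wave vectors and a phase
  with variable speed would bend the wave vector. The price is a mismatch between frozen and local
  speed, proportional to the mesh \<open>\<tau>\<close> of the partition. The order of choice is
  therefore: bound \<open>d\<close> on strain and error, amplitude, mesh \<open>\<tau>\<close>, and
  last the frequency \<open>l\<close>. As \<open>l\<close> comes after all smooth data of a step,
  only first derivatives and the error are ever quantified along the iteration.\<close>

type_synonym mat2 = "real^2^2"

named_theorems smooth_intros

definition pd :: "'a::euclidean_space \<Rightarrow> ('a \<Rightarrow> 'b::euclidean_space) \<Rightarrow> 'a \<Rightarrow> 'b" where
  "pd v f x = frechet_derivative f (at x) v"

lemma C_k_Suc: "C_k (Suc k) f \<longleftrightarrow> (\<forall>x. f differentiable (at x)) \<and> (\<forall>v. C_k k (pd v f))"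
  by (simp add: pd_def[abs_def])

declare C_k.simps(2)[simp del]

lemma C_k_SucD: "C_k (Suc k) f \<Longrightarrow> C_k k f"
proof (induction k arbitrary: f)
  case 0
  then show ?case
    by (auto simp: C_k_Suc intro!: continuous_at_imp_continuous_on differentiable_imp_continuous_within)
next
  case (Suc k)
  then show ?case
    by (subst C_k_Suc) (auto simp: C_k_Suc[of "Suc k"])
qed

lemma smooth_C_k: "smooth f \<Longrightarrow> C_k k f"
  by (simp add: smooth_def)

lemma smooth_differentiable: "smooth f \<Longrightarrow> f differentiable (at x)"
  using smooth_C_k[of f "Suc 0"] by (auto simp: C_k_Suc)

lemma smooth_continuous_on: "smooth f \<Longrightarrow> continuous_on S f"
  using smooth_C_k[of f 0] by (auto intro: continuous_on_subset)

lemma smooth_pd [smooth_intros]: "smooth f \<Longrightarrow> smooth (pd v f)"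
  unfolding smooth_def by (meson C_k_Suc)

text \<open>Induction on \<open>k\<close> with \<open>f\<close> arbitrary; at the bottom,
  differentiability gives continuity. The rule suits classes given by a formula that differentiation
  reproduces, such as parameter integrals.\<close>

lemma smooth_coinduct:
  assumes "P f" and "\<And>f x. P f \<Longrightarrow> f differentiable (at x)" and "\<And>f v. P f \<Longrightarrow> P (pd v f)"
  shows "smooth f"
proof -
  have "P f \<longrightarrow> C_k k f" for k f
    by (induction k arbitrary: f)
       (use assms(2,3) in \<open>auto simp: C_k_Suc intro!: continuous_at_imp_continuous_on
         differentiable_imp_continuous_within\<close>)
  with assms(1) show ?thesis by (auto simp: smooth_def)
qed

lemma has_derivative_pd: "f differentiable (at x) \<Longrightarrow> (f has_derivative (\<lambda>v. pd v f x)) (at x)"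
  by (simp add: pd_def frechet_derivative_works)

lemma smooth_has_derivative: "smooth f \<Longrightarrow> (f has_derivative (\<lambda>v. pd v f x)) (at x)"
  by (simp add: has_derivative_pd smooth_differentiable)

lemma pd_eqI: "(f has_derivative D) (at x) \<Longrightarrow> pd v f x = D v"
  unfolding pd_def using frechet_derivative_at by metis

lemma pd_const [simp]: "pd v (\<lambda>x. c) = (\<lambda>x. 0)"
  by (auto intro!: pd_eqI[where D = "\<lambda>_. 0"])

lemma pd_add: "f differentiable (at x) \<Longrightarrow> g differentiable (at x) \<Longrightarrow>
    pd v (\<lambda>x. f x + g x) x = pd v f x + pd v g x"
  by (rule pd_eqI) (intro has_derivative_add has_derivative_pd)

lemma pd_diff: "f differentiable (at x) \<Longrightarrow> g differentiable (at x) \<Longrightarrow>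
    pd v (\<lambda>x. f x - g x) x = pd v f x - pd v g x"
  by (rule pd_eqI) (intro has_derivative_diff has_derivative_pd)

lemma pd_sum: "(\<And>i. i \<in> I \<Longrightarrow> f i differentiable (at x)) \<Longrightarrow>
    pd v (\<lambda>x. \<Sum>i\<in>I. f i x) x = (\<Sum>i\<in>I. pd v (f i) x)"
  by (rule pd_eqI) (intro has_derivative_sum has_derivative_pd)

lemma pd_linear: "bounded_linear L \<Longrightarrow> f differentiable (at x) \<Longrightarrow>
    pd v (\<lambda>x. L (f x)) x = L (pd v f x)"
  by (rule pd_eqI, rule bounded_linear.has_derivative[OF _ has_derivative_pd])

lemma pd_bilinear: "bounded_bilinear h \<Longrightarrow> f differentiable (at x) \<Longrightarrow> g differentiable (at x) \<Longrightarrow>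
    pd v (\<lambda>x. h (f x) (g x)) x = h (f x) (pd v g x) + h (pd v f x) (g x)"
  by (rule pd_eqI, rule bounded_bilinear.FDERIV[OF _ has_derivative_pd has_derivative_pd])

lemma pd_chain:
  assumes "g differentiable (at x)" and "f differentiable (at (g x))"
  shows "pd v (\<lambda>x. f (g x)) x = pd (pd v g x) f (g x)"
  by (rule pd_eqI, rule has_derivative_compose[OF has_derivative_pd[OF assms(1)] has_derivative_pd[OF assms(2)]])

lemma pd_linear_dir: "f differentiable (at x) \<Longrightarrow> linear (\<lambda>v. pd v f x)"
  by (rule has_derivative_linear[OF has_derivative_pd])

lemma pd_add_dir: "smooth f \<Longrightarrow> pd (v + w) f x = pd v f x + pd w f x"
  by (rule linear_add[OF pd_linear_dir[OF smooth_differentiable]])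

lemma pd_scaleR_dir: "smooth f \<Longrightarrow> pd (c *\<^sub>R v) f x = c *\<^sub>R pd v f x"
  by (rule linear_scale[OF pd_linear_dir[OF smooth_differentiable]])

text \<open>\<open>C_k\<close> controls derivatives in fixed directions. This expansion reduces a
  derivative whose direction varies with the point, as produced by the chain rule, to such
  derivatives.\<close>

lemma pd_Basis: "f differentiable (at x) \<Longrightarrow> pd v f x = (\<Sum>i\<in>Basis. (v \<bullet> i) *\<^sub>R pd i f x)"
proof -
  assume "f differentiable (at x)"
  note lin = pd_linear_dir[OF this]
  have "pd v f x = pd (\<Sum>i\<in>Basis. (v \<bullet> i) *\<^sub>R i) f x"
    by (simp add: euclidean_representation)
  also have "\<dots> = (\<Sum>i\<in>Basis. (v \<bullet> i) *\<^sub>R pd i f x)"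
    using linear_sum[OF lin, of "\<lambda>i. (v \<bullet> i) *\<^sub>R i" Basis] by (simp add: linear_scale[OF lin])
  finally show ?thesis .
qed

section \<open>Closure of smooth functions under the usual operations\<close>

lemma C_k_const [simp]: "C_k k (\<lambda>x. c)"
  by (induction k arbitrary: c) (auto simp: C_k_Suc)

lemma smooth_const [smooth_intros, simp]: "smooth (\<lambda>x. c)"
  by (simp add: smooth_def)

lemma C_k_Suc_D1: "C_k (Suc k) f \<Longrightarrow> f differentiable (at x)"
  and C_k_Suc_D2: "C_k (Suc k) f \<Longrightarrow> C_k k (pd v f)"
  by (auto simp: C_k_Suc)

lemma C_k_add: "C_k k f \<Longrightarrow> C_k k g \<Longrightarrow> C_k k (\<lambda>x. f x + g x)"
proof (induction k arbitrary: f g)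
  case (Suc k)
  have "pd v (\<lambda>x. f x + g x) = (\<lambda>x. pd v f x + pd v g x)" for v
    by (intro ext pd_add Suc.prems[THEN C_k_Suc_D1])
  with Suc show ?case by (auto simp: C_k_Suc)
qed (auto intro: continuous_intros)

lemma C_k_sum: "(\<And>i. i \<in> I \<Longrightarrow> C_k k (f i)) \<Longrightarrow> C_k k (\<lambda>x. \<Sum>i\<in>I. f i x)"
  by (induction I rule: infinite_finite_induct) (auto intro: C_k_add)

lemma C_k_linear: "bounded_linear L \<Longrightarrow> C_k k f \<Longrightarrow> C_k k (\<lambda>x. L (f x))"
proof (induction k arbitrary: f)
  case 0
  show ?case using 0(2) bounded_linear.continuous_on[OF 0(1)] by simp
next
  case (Suc k)
  have "pd v (\<lambda>x. L (f x)) = (\<lambda>x. L (pd v f x))" for v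
    by (intro ext pd_linear Suc.prems(1) Suc.prems(2)[THEN C_k_Suc_D1])
  moreover have "(\<lambda>x. L (f x)) differentiable (at x)" for x
    using bounded_linear.has_derivative[OF Suc.prems(1) has_derivative_pd] Suc.prems(2)[THEN C_k_Suc_D1]
    unfolding differentiable_def by blast
  ultimately show ?case using Suc by (auto simp: C_k_Suc)
qed

lemma C_k_bilinear:
  assumes h: "bounded_bilinear h"
  shows "C_k k f \<Longrightarrow> C_k k g \<Longrightarrow> C_k k (\<lambda>x. h (f x) (g x))"
proof (induction k arbitrary: f g)
  case 0
  then show ?case unfolding C_k.simps(1) by (rule bounded_bilinear.continuous_on[OF h])
next
  case (Suc k)
  have "pd v (\<lambda>x. h (f x) (g x)) = (\<lambda>x. h (f x) (pd v g x) + h (pd v f x) (g x))" for v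
    by (intro ext pd_bilinear h Suc.prems[THEN C_k_Suc_D1])
  moreover have "(\<lambda>x. h (f x) (g x)) differentiable (at x)" for x
    using bounded_bilinear.FDERIV[OF h has_derivative_pd has_derivative_pd] Suc.prems[THEN C_k_Suc_D1]
    unfolding differentiable_def by blast
  ultimately show ?case
    using Suc.IH Suc.prems[THEN C_k_SucD] Suc.prems[THEN C_k_Suc_D2]
    by (auto simp: C_k_Suc intro!: C_k_add)
qed

lemma C_k_compose:
  fixes f :: "'b::euclidean_space \<Rightarrow> 'c::euclidean_space" and g :: "'a::euclidean_space \<Rightarrow> 'b"
  shows "C_k k f \<Longrightarrow> C_k k g \<Longrightarrow> C_k k (\<lambda>x. f (g x))"
proof (induction k arbitrary: f)
  case 0
  then show ?case by (auto intro: continuous_on_compose2)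
next
  case (Suc k)
  have "pd v (\<lambda>x. f (g x)) = (\<lambda>x. \<Sum>i\<in>Basis. (pd v g x \<bullet> i) *\<^sub>R pd i f (g x))" for v
    using Suc.prems[THEN C_k_Suc_D1] by (subst pd_Basis[symmetric]) (auto intro!: pd_chain)
  moreover have "C_k k (\<lambda>x. (pd v g x \<bullet> i) *\<^sub>R pd i f (g x))" for v i
    using Suc by (intro C_k_bilinear[OF bounded_bilinear_scaleR] C_k_linear[OF bounded_linear_inner_left])
      (auto dest: C_k_SucD C_k_Suc_D2)
  moreover have "(\<lambda>x. f (g x)) differentiable (at x)" for x
    using has_derivative_compose[OF has_derivative_pd has_derivative_pd] Suc.prems[THEN C_k_Suc_D1]
    unfolding differentiable_def by blast
  ultimately show ?case by (auto simp: C_k_Suc intro!: C_k_sum)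
qed

lemma smooth_linear: "bounded_linear L \<Longrightarrow> smooth f \<Longrightarrow> smooth (\<lambda>x. L (f x))"
  unfolding smooth_def by (blast intro: C_k_linear[of L])

lemma smooth_bilinear: "bounded_bilinear h \<Longrightarrow> smooth f \<Longrightarrow> smooth g \<Longrightarrow> smooth (\<lambda>x. h (f x) (g x))"
  unfolding smooth_def by (blast intro: C_k_bilinear[of h])

lemma smooth_compose: "smooth f \<Longrightarrow> smooth g \<Longrightarrow> smooth (\<lambda>x. f (g x))"
  unfolding smooth_def by (blast intro: C_k_compose[of _ f g])

lemma C_k_id: "C_k k (\<lambda>x. x)"
proof (cases k)
  case (Suc k')
  have "pd v (\<lambda>x. x) = (\<lambda>x. v)" for v :: 'a
    by (auto intro!: pd_eqI has_derivative_ident)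
  then show ?thesis by (simp add: Suc C_k_Suc)
qed auto

lemma smooth_id [smooth_intros, simp]: "smooth (\<lambda>x. x)"
  by (simp add: smooth_def C_k_id)

lemma smooth_add [smooth_intros]: "smooth f \<Longrightarrow> smooth g \<Longrightarrow> smooth (\<lambda>x. f x + g x)"
  by (simp add: smooth_def C_k_add)

lemma smooth_sum [smooth_intros]: "(\<And>i. i \<in> I \<Longrightarrow> smooth (f i)) \<Longrightarrow> smooth (\<lambda>x. \<Sum>i\<in>I. f i x)"
  by (simp add: smooth_def C_k_sum)

lemma smooth_minus [smooth_intros]: "smooth f \<Longrightarrow> smooth (\<lambda>x. - f x)"
  by (rule smooth_linear[OF bounded_linear_minus[OF bounded_linear_ident]])

lemma smooth_diff [smooth_intros]: "smooth f \<Longrightarrow> smooth g \<Longrightarrow> smooth (\<lambda>x. f x - g x)"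
  using smooth_add[of f "\<lambda>x. - g x"] smooth_minus by auto

lemma smooth_mult [smooth_intros]: "smooth f \<Longrightarrow> smooth g \<Longrightarrow> smooth (\<lambda>x. f x * g x :: real)"
  by (rule smooth_bilinear[OF bounded_bilinear_mult])

lemma smooth_scaleR [smooth_intros]: "smooth f \<Longrightarrow> smooth g \<Longrightarrow> smooth (\<lambda>x. f x *\<^sub>R g x)"
  by (rule smooth_bilinear[OF bounded_bilinear_scaleR])

lemma smooth_inner [smooth_intros]: "smooth f \<Longrightarrow> smooth g \<Longrightarrow> smooth (\<lambda>x. f x \<bullet> g x)"
  by (rule smooth_bilinear[OF bounded_bilinear_inner])

lemma smooth_power [smooth_intros]: "smooth f \<Longrightarrow> smooth (\<lambda>x. f x ^ n :: real)"
  by (induction n) (auto intro: smooth_intros)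

lemma smooth_fst [smooth_intros]: "smooth f \<Longrightarrow> smooth (\<lambda>x. fst (f x))"
  and smooth_snd [smooth_intros]: "smooth f \<Longrightarrow> smooth (\<lambda>x. snd (f x))"
  by (rule smooth_linear[OF bounded_linear_fst], assumption, rule smooth_linear[OF bounded_linear_snd])

lemma smooth_Pair [smooth_intros]:
  assumes "smooth f" "smooth g" shows "smooth (\<lambda>x. (f x, g x))"
proof -
  have "bounded_linear (\<lambda>y. (y, 0))" "bounded_linear (\<lambda>y. (0, y))"
    by (auto intro!: bounded_linear_Pair bounded_linear_ident bounded_linear_zero)
  from smooth_add[OF smooth_linear[OF this(1) assms(1)] smooth_linear[OF this(2) assms(2)]]
  show ?thesis by simp
qed

lemma bounded_linear_axis: "bounded_linear (axis i :: 'a::euclidean_space \<Rightarrow> 'a^'n)"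
  unfolding linear_conv_bounded_linear[symmetric] by (auto simp: linear_iff vec_eq_iff axis_def)

lemma vec_lambda_sum_axis: "(\<chi> i. y i) = (\<Sum>i\<in>UNIV. axis i (y i) :: 'a::euclidean_space^'n)"
  by (auto simp: vec_eq_iff axis_def sum.delta' cong: if_cong)

lemma smooth_vec_lambda [smooth_intros]:
  fixes f :: "'n::finite \<Rightarrow> 'a::euclidean_space \<Rightarrow> 'b::euclidean_space"
  assumes "\<And>i. smooth (f i)"
  shows "smooth (\<lambda>x. \<chi> i. f i x)"
  unfolding vec_lambda_sum_axis
  by (intro smooth_sum smooth_linear[OF bounded_linear_axis] assms)

lemma smooth_vec_nth [smooth_intros]: "smooth f \<Longrightarrow> smooth (\<lambda>x. f x $ i)"
  by (rule smooth_linear[OF bounded_linear_vec_nth])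

lemma pd_vec_nth: "f differentiable (at x) \<Longrightarrow> pd v (\<lambda>x. f x $ i) x = pd v f x $ i"
  by (rule pd_linear[OF bounded_linear_vec_nth])

text \<open>The derivative is a product of the reciprocal, taken twice, with a derivative of
  \<open>f\<close>, so the induction hypothesis applies to it again.\<close>

lemma C_k_inverse:
  fixes f :: "'a::euclidean_space \<Rightarrow> real"
  assumes nz: "\<And>x. f x \<noteq> 0"
  shows "C_k k f \<Longrightarrow> C_k k (\<lambda>x. inverse (f x))"
proof (induction k)
  case 0
  then show ?case using nz by (auto intro: continuous_intros)
next
  case (Suc k)
  have *: "((\<lambda>x. inverse (f x)) has_derivative (\<lambda>v. - (inverse (f x) * pd v f x * inverse (f x)))) (at x)" for x
    by (rule Deriv.has_derivative_inverse[where f = f, OF nz has_derivative_pd]) (use Suc in \<open>auto dest: C_k_Suc_D1\<close>)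
  have "pd v (\<lambda>x. inverse (f x)) = (\<lambda>x. - (inverse (f x) * pd v f x * inverse (f x)))" for v
    by (rule ext) (rule pd_eqI[OF *])
  moreover have "(\<lambda>x. inverse (f x)) differentiable (at x)" for x
    using * differentiable_def by blast
  moreover have "C_k k (\<lambda>x. - (inverse (f x) * pd v f x * inverse (f x)))" for v
    using Suc by (intro C_k_linear[OF bounded_linear_minus[OF bounded_linear_ident]] C_k_bilinear[OF bounded_bilinear_mult])
      (auto dest: C_k_SucD C_k_Suc_D2)
  ultimately show ?case by (auto simp: C_k_Suc)
qed

lemma smooth_inverse [smooth_intros]:
  "smooth f \<Longrightarrow> (\<And>x. f x \<noteq> 0) \<Longrightarrow> smooth (\<lambda>x. inverse (f x :: real))"
  unfolding smooth_def by (blast intro: C_k_inverse[of f])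

lemma smooth_divide [smooth_intros]:
  "smooth f \<Longrightarrow> smooth g \<Longrightarrow> (\<And>x. g x \<noteq> 0) \<Longrightarrow> smooth (\<lambda>x. f x / g x :: real)"
  by (simp add: divide_inverse smooth_mult smooth_inverse)

lemma C_k_sqrt:
  fixes f :: "'a::euclidean_space \<Rightarrow> real"
  assumes pos: "\<And>x. f x > 0"
  shows "C_k k f \<Longrightarrow> C_k k (\<lambda>x. sqrt (f x))"
proof (induction k)
  case 0
  then show ?case by (auto intro: continuous_intros)
next
  case (Suc k)
  have *: "((\<lambda>x. sqrt (f x)) has_derivative (\<lambda>v. pd v f x * (inverse (sqrt (f x)) / 2))) (at x)" for x
    by (rule DERIV_compose_FDERIV[where f = sqrt and g = f, OF DERIV_real_sqrt[OF pos] has_derivative_pd])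
       (use Suc in \<open>auto dest: C_k_Suc_D1\<close>)
  have "pd v (\<lambda>x. sqrt (f x)) = (\<lambda>x. pd v f x * (inverse (sqrt (f x)) / 2))" for v
    by (rule ext) (rule pd_eqI[OF *])
  moreover have "(\<lambda>x. sqrt (f x)) differentiable (at x)" for x
    using * differentiable_def by blast
  moreover have "sqrt (f x) \<noteq> 0" for x using pos[of x] by simp
  then have "C_k k (\<lambda>x. pd v f x * (inverse (sqrt (f x)) / 2))" for v
    using Suc by (intro C_k_bilinear[OF bounded_bilinear_mult] C_k_linear[OF bounded_linear_divide] C_k_inverse)
      (auto dest: C_k_SucD C_k_Suc_D2)
  ultimately show ?case by (auto simp: C_k_Suc)
qed

lemma smooth_sqrt [smooth_intros]:
  "smooth f \<Longrightarrow> (\<And>x. f x > 0) \<Longrightarrow> smooth (\<lambda>x. sqrt (f x))"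
  unfolding smooth_def by (blast intro: C_k_sqrt[of f])

lemma C_k_sin_cos: "C_k k (sin :: real \<Rightarrow> real) \<and> C_k k (cos :: real \<Rightarrow> real)"
proof (induction k)
  case (Suc k)
  have "(sin has_derivative (\<lambda>v. v * cos x)) (at x)" "(cos has_derivative (\<lambda>v. v * - sin x)) (at x)" for x :: real
  proof -
    have "(*) y = (\<lambda>v. v * y)" for y :: real by (simp add: fun_eq_iff)
    then show "(sin has_derivative (\<lambda>v. v * cos x)) (at x)" "(cos has_derivative (\<lambda>v. v * - sin x)) (at x)"
      using DERIV_sin[of x] DERIV_cos[of x] unfolding has_field_derivative_def by metis+
  qed
  note d = this
  have "pd v sin = (\<lambda>x. v * cos x)" "pd v cos = (\<lambda>x. v * - sin x)" for v :: real
    by (rule ext, rule pd_eqI[OF d(1)], rule ext, rule pd_eqI[OF d(2)])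
  moreover have "sin differentiable (at x)" "cos differentiable (at x)" for x :: real
    using d differentiable_def by blast+
  moreover have "C_k k (\<lambda>x. v * cos x)" "C_k k (\<lambda>x. v * - sin x)" for v :: real
    using C_k_linear[OF bounded_linear_mult_right, of k cos v]
      C_k_linear[OF bounded_linear_mult_right, of k sin "- v"] Suc.IH by simp_all
  ultimately show ?case
    by (simp add: C_k_Suc)
qed (simp add: continuous_at_imp_continuous_on)

lemma smooth_sin [smooth_intros]: "smooth f \<Longrightarrow> smooth (\<lambda>x. sin (f x :: real))"
  and smooth_cos [smooth_intros]: "smooth f \<Longrightarrow> smooth (\<lambda>x. cos (f x :: real))"
  using smooth_compose[of sin f] smooth_compose[of cos f] C_k_sin_cos by (auto simp: smooth_def)

section \<open>Second derivatives, parameter integrals, inverse functions\<close>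

lemma smooth_line_derivative:
  assumes "smooth f"
  shows "((\<lambda>s. f (x + s *\<^sub>R v)) has_vector_derivative pd v f (x + s *\<^sub>R v)) (at s within S)"
proof -
  have "((\<lambda>s. f (x + s *\<^sub>R v)) has_derivative (\<lambda>h. pd (h *\<^sub>R v) f (x + s *\<^sub>R v))) (at s within S)"
    by (rule has_derivative_compose[where g = f, OF _ smooth_has_derivative[OF assms]])
       (auto intro!: derivative_eq_intros)
  then show ?thesis
    unfolding has_vector_derivative_def by (simp add: pd_scaleR_dir[OF assms])
qed

text \<open>The increment of \<open>f\<close> along \<open>w\<close> is an integral of
  \<open>pd w f\<close>. Differentiating it along \<open>v\<close> under the integral and then in
  the upper limit gives one order of differentiation; differentiating the increment directly gives
  the other.\<close>

lemma pd_commute: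
  assumes f: "smooth f"
  shows "pd v (pd w f) x = pd w (pd v f) x"
proof -
  have cont: "continuous_on S (\<lambda>y. pd v' g (h y))"
    if "smooth g" "continuous_on S h" for S v' h and g :: "'a \<Rightarrow> 'b"
    using continuous_on_compose2[OF smooth_continuous_on[OF smooth_pd[OF that(1)], of UNIV] that(2)]
    by auto
  have eq: "pd v f (x + t *\<^sub>R w) - pd v f x = integral {0..t} (\<lambda>r. pd v (pd w f) (x + r *\<^sub>R w))"
    if t: "0 \<le> t" for t
  proof -
    have ftc: "integral {0..t} (\<lambda>r. pd w f (x + s *\<^sub>R v + r *\<^sub>R w)) = f (x + s *\<^sub>R v + t *\<^sub>R w) - f (x + s *\<^sub>R v)" for s
      using fundamental_theorem_of_calculus[OF t smooth_line_derivative[OF f, of "x + s *\<^sub>R v" w]]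
      by (simp add: integral_unique)
    have 1: "((\<lambda>s. f (x + t *\<^sub>R w + s *\<^sub>R v) - f (x + s *\<^sub>R v)) has_vector_derivative
        pd v f (x + t *\<^sub>R w + 0 *\<^sub>R v) - pd v f (x + 0 *\<^sub>R v)) (at 0)"
      by (intro has_vector_derivative_diff smooth_line_derivative f)
    have 2: "((\<lambda>s. integral (cbox 0 t) (\<lambda>r. pd w f (x + r *\<^sub>R w + s *\<^sub>R v))) has_vector_derivative
        integral (cbox 0 t) (\<lambda>r. pd v (pd w f) (x + r *\<^sub>R w + 0 *\<^sub>R v))) (at 0 within UNIV)"
    proof (rule leibniz_rule_vector_derivative)
      show "((\<lambda>s. pd w f (x + r *\<^sub>R w + s *\<^sub>R v)) has_vector_derivative
          pd v (pd w f) (x + r *\<^sub>R w + s *\<^sub>R v)) (at s within UNIV)" for s r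
        by (rule smooth_line_derivative[OF smooth_pd[OF f]])
      show "(\<lambda>r. pd w f (x + r *\<^sub>R w + s *\<^sub>R v)) integrable_on cbox 0 t" for s
        by (intro integrable_continuous cont f) (auto intro!: continuous_intros)
      show "continuous_on (UNIV \<times> cbox 0 t) (\<lambda>(s, r). pd v (pd w f) (x + r *\<^sub>R w + s *\<^sub>R v))"
        unfolding case_prod_beta by (intro cont smooth_pd f) (auto intro!: continuous_intros)
    qed auto
    have "(\<lambda>s. f (x + t *\<^sub>R w + s *\<^sub>R v) - f (x + s *\<^sub>R v)) = (\<lambda>s. integral (cbox 0 t) (\<lambda>r. pd w f (x + r *\<^sub>R w + s *\<^sub>R v)))"
      using ftc by (simp add: fun_eq_iff add_ac)
    with vector_derivative_unique_at[OF 1] 2 show ?thesis by simp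
  qed
  \<comment> \<open>The identity \<open>eq\<close> holds for \<open>t \<ge> 0\<close>, hence the
    one-sided derivative at 0 within \<open>{0..1}\<close>.\<close>
  have "((\<lambda>t. integral {0..t} (\<lambda>r. pd v (pd w f) (x + r *\<^sub>R w))) has_vector_derivative pd v (pd w f) (x + 0 *\<^sub>R w)) (at 0 within {0..1})"
    by (rule integral_has_vector_derivative) (auto intro!: cont smooth_pd f continuous_intros)
  then have "((\<lambda>t. pd v f (x + t *\<^sub>R w) - pd v f x) has_vector_derivative pd v (pd w f) x) (at 0 within {0..1})"
    by (intro has_vector_derivative_transform[of 0 "{0..1}" "\<lambda>t. pd v f (x + t *\<^sub>R w) - pd v f x"]) (use eq in auto)
  moreover have "((\<lambda>t. pd v f (x + t *\<^sub>R w) - pd v f x) has_vector_derivative pd w (pd v f) (x + 0 *\<^sub>R w) - 0) (at 0 within {0..1})"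
    by (intro has_vector_derivative_diff has_vector_derivative_const smooth_line_derivative smooth_pd f)
  ultimately show ?thesis
    by (intro vector_derivative_unique_within_closed_interval[of 0 1 0]) auto
qed

text \<open>The Leibniz rule is applied to derivatives with values in the bounded linear maps,
  whence the detour through \<open>Blinfun\<close>; their continuity reduces to that of the single
  directional derivatives.\<close>

lemma pd_integral:
  fixes f :: "real \<times> 'a::euclidean_space \<Rightarrow> 'b::euclidean_space"
  assumes f: "smooth f"
  shows "((\<lambda>x. integral {0..1} (\<lambda>r. f (r, x))) has_derivative
           (\<lambda>v. integral {0..1} (\<lambda>r. pd (0, v) f (r, x)))) (at x)"
proof -
  define D where "D x r = Blinfun (\<lambda>v. pd (0, v) f (r, x))" for x r
  have bl: "bounded_linear (\<lambda>v. pd (0, v) f p)" for p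
    using bounded_linear_compose[OF has_derivative_bounded_linear[OF smooth_has_derivative[OF f]],
        of "\<lambda>v. (0, v)" p]
    by (auto simp: bounded_linear_Pair bounded_linear_zero bounded_linear_ident)
  have D: "blinfun_apply (D x r) v = pd (0, v) f (r, x)" for x r v
    by (simp add: D_def bounded_linear_Blinfun_apply[OF bl])
  have cont: "continuous_on S (\<lambda>p. D (fst p) (snd p))" for S
  proof (rule continuous_on_blinfun_componentwise)
    show "continuous_on S (\<lambda>p. blinfun_apply (D (fst p) (snd p)) i)" for i
      unfolding D by (rule continuous_on_compose2[OF smooth_continuous_on[OF smooth_pd[OF f], of UNIV]])
        (auto intro!: continuous_intros)
  qed
  have "((\<lambda>x. integral (cbox 0 1) (\<lambda>r. f (r, x))) has_derivative blinfun_apply (integral (cbox 0 1) (D x))) (at x within UNIV)"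
  proof (rule leibniz_rule)
    fix x r
    show "((\<lambda>x. f (r, x)) has_derivative blinfun_apply (D x r)) (at x within UNIV)"
      unfolding D
      by (rule has_derivative_compose[where g = f, OF _ smooth_has_derivative[OF f]])
         (auto intro!: derivative_eq_intros)
    show "(\<lambda>r. f (r, x)) integrable_on cbox 0 1"
      by (intro integrable_continuous continuous_on_compose2[OF smooth_continuous_on[OF f, of UNIV]])
        (auto intro!: continuous_intros)
    show "continuous_on (UNIV \<times> cbox 0 1) (\<lambda>(x, r). D x r)"
      using cont by (simp add: case_prod_beta)
  qed auto
  moreover have "blinfun_apply (integral (cbox 0 1) (D x)) = (\<lambda>v. integral {0..1} (\<lambda>r. pd (0, v) f (r, x)))"
  proof (rule ext)
    fix v
    have "continuous_on (cbox 0 1) (\<lambda>r. D x r)"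
      using continuous_on_compose2[OF cont[of UNIV] continuous_on_Pair[OF continuous_on_const continuous_on_id], of x "cbox 0 1"]
      by simp
    then have "D x integrable_on cbox 0 1" by (rule integrable_continuous)
    then show "blinfun_apply (integral (cbox 0 1) (D x)) v = integral {0..1} (\<lambda>r. pd (0, v) f (r, x))"
      by (subst blinfun_apply_integral) (auto simp: D)
  qed
  ultimately show ?thesis by simp
qed

text \<open>Integrals over \<open>{0..1}\<close> of smooth integrands form a class closed under
  \<open>pd\<close>, which acts on the integrand.\<close>

lemma smooth_integral:
  fixes f :: "real \<times> 'a::euclidean_space \<Rightarrow> 'b::euclidean_space"
  assumes "smooth f"
  shows "smooth (\<lambda>x. integral {0..1} (\<lambda>r. f (r, x)))"
proof (rule smooth_coinduct[where P = "\<lambda>F. \<exists>f::real \<times> 'a \<Rightarrow> 'b. smooth f \<and> F = (\<lambda>x. integral {0..1} (\<lambda>r. f (r, x)))"])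
  show "\<exists>f' :: real \<times> 'a \<Rightarrow> 'b. smooth f' \<and> (\<lambda>x. integral {0..1} (\<lambda>r. f (r, x))) = (\<lambda>x. integral {0..1} (\<lambda>r. f' (r, x)))"
    by (intro exI[of _ f] conjI assms refl)
next
  fix F x assume "\<exists>f::real \<times> 'a \<Rightarrow> 'b. smooth f \<and> F = (\<lambda>x. integral {0..1} (\<lambda>r. f (r, x)))"
  then show "F differentiable at x" using pd_integral unfolding differentiable_def by blast
next
  fix F v assume "\<exists>f::real \<times> 'a \<Rightarrow> 'b. smooth f \<and> F = (\<lambda>x. integral {0..1} (\<lambda>r. f (r, x)))"
  then obtain f :: "real \<times> 'a \<Rightarrow> 'b" where f: "smooth f" "F = (\<lambda>x. integral {0..1} (\<lambda>r. f (r, x)))"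
    by (elim exE conjE)
  have "pd v F = (\<lambda>x. integral {0..1} (\<lambda>r. pd (0, v) f (r, x)))"
    unfolding f(2) by (rule ext, rule pd_eqI[OF pd_integral[OF f(1)]])
  then show "\<exists>f' :: real \<times> 'a \<Rightarrow> 'b. smooth f' \<and> pd v F = (\<lambda>x. integral {0..1} (\<lambda>r. f' (r, x)))"
    by (intro exI[of _ "pd (0, v) f"] conjI smooth_pd f(1))
qed

text \<open>\<open>A x\<close> is the inverse of the derivative of \<Phi> at \<open>x\<close>. The
  derivative of \<Psi> is \<open>A\<close> evaluated along \<Psi>, so regularity bootstraps: if
  \<Psi> is \<open>C_k\<close>, then so is its derivative.\<close>

lemma smooth_inverse_function:
  fixes \<Phi> \<Psi> :: "'a::euclidean_space \<Rightarrow> 'a"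
  assumes \<Phi>: "smooth \<Phi>" and inv: "\<And>y. \<Phi> (\<Psi> y) = y" and cont: "continuous_on UNIV \<Psi>"
    and A: "\<And>v. smooth (\<lambda>x. A x v)" "\<And>x. bounded_linear (A x)" "\<And>x v. A x (pd v \<Phi> x) = v"
  shows "smooth \<Psi>" "pd v \<Psi> y = A (\<Psi> y) v"
proof -
  have d: "(\<Psi> has_derivative A (\<Psi> y)) (at y)" for y
    by (rule has_derivative_inverse_basic[OF smooth_has_derivative[OF \<Phi>] A(2), where T = UNIV])
      (use A(3) inv cont in \<open>auto simp: fun_eq_iff continuous_on_eq_continuous_at\<close>)
  have pd: "pd v \<Psi> y = A (\<Psi> y) v" for v y by (rule pd_eqI[OF d])
  then show "pd v \<Psi> y = A (\<Psi> y) v" .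
  have "C_k k \<Psi>" for k
  proof (induction k)
    case (Suc k)
    have "C_k k (\<lambda>y. A (\<Psi> y) v)" for v
      by (rule C_k_compose[OF smooth_C_k[OF A(1)] Suc])
    moreover have "\<Psi> differentiable at y" for y
      using d unfolding differentiable_def by blast
    ultimately show ?case by (simp add: C_k_Suc pd[abs_def])
  qed (use cont in simp)
  then show "smooth \<Psi>" by (simp add: smooth_def)
qed

section \<open>Bump functions and cutoffs\<close>

definition flat_exp :: "nat \<Rightarrow> real \<Rightarrow> real" where
  "flat_exp n x = (if x > 0 then exp (- inverse x) * inverse x ^ n else 0)"

text \<open>The powers of \<open>inverse x\<close> are there to make the family closed under
  differentiation. At 0 the difference quotient of \<open>flat_exp n\<close> is
  \<open>flat_exp (n + 1)\<close> itself, which tends to 0 because the exponential beats every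
  power.\<close>

lemma flat_exp_derivative:
  "(flat_exp n has_real_derivative (flat_exp (n + 2) x - n * flat_exp (n + 1) x)) (at x)"
proof (cases "x = 0")
  case True
  have "((\<lambda>y::real. y ^ (n + 1) / exp y) \<longlongrightarrow> 0) at_top" by (rule tendsto_power_div_exp_0)
  then have "((\<lambda>x::real. inverse x ^ (n + 1) / exp (inverse x)) \<longlongrightarrow> 0) (at_right 0)"
    by (rule filterlim_compose[OF _ filterlim_inverse_at_top_right])
  moreover have "\<forall>\<^sub>F x in at_right 0. inverse x ^ (n + 1) / exp (inverse x) = flat_exp (n + 1) x"
    by (rule eventually_mono[OF eventually_at_right_less]) (simp add: flat_exp_def exp_minus divide_inverse mult.commute)
  ultimately have "(flat_exp (n + 1) \<longlongrightarrow> 0) (at_right 0)"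
    by (rule Lim_transform_eventually)
  moreover have "\<forall>\<^sub>F x in at_left 0. 0 = flat_exp (n + 1) x"
    by (simp add: flat_exp_def eventually_at_filter)
  then have "(flat_exp (n + 1) \<longlongrightarrow> 0) (at_left 0)"
    by (rule Lim_transform_eventually[OF tendsto_const])
  ultimately have "(flat_exp (n + 1) \<longlongrightarrow> 0) (at 0)" by (simp add: filterlim_split_at)
  moreover have "flat_exp (n + 1) = (\<lambda>h. (flat_exp n (0 + h) - flat_exp n 0) / h)"
    by (simp add: fun_eq_iff flat_exp_def divide_inverse)
  ultimately have "((\<lambda>h. (flat_exp n (0 + h) - flat_exp n 0) / h) \<longlongrightarrow> 0) (at 0)"
    by simp
  then show ?thesis by (simp add: True DERIV_def flat_exp_def)
next
  case False
  show ?thesis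
  proof (cases "x > 0")
    case True
    have 1: "((\<lambda>x. exp (- inverse x)) has_real_derivative exp (- inverse x) * inverse x ^ 2) (at x)"
      using True by (auto intro!: derivative_eq_intros simp: power2_eq_square)
    have 2: "((\<lambda>x. inverse x ^ n) has_real_derivative - (n * inverse x ^ (n + 1))) (at x)"
    proof (cases n)
      case (Suc m)
      show ?thesis unfolding Suc
        by (rule DERIV_cong[OF DERIV_power_Suc[OF DERIV_inverse]]) (use True in \<open>auto simp: algebra_simps\<close>)
    qed simp
    have "((\<lambda>x. exp (- inverse x) * inverse x ^ n) has_real_derivative (flat_exp (n + 2) x - n * flat_exp (n + 1) x)) (at x)"
      by (rule DERIV_cong[OF DERIV_mult[OF 1 2]])
        (use True in \<open>simp add: flat_exp_def power2_eq_square algebra_simps\<close>)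
    then show ?thesis
      by (rule has_field_derivative_transform_within_open[where S = "{0<..}"])
        (use True in \<open>auto simp: flat_exp_def\<close>)
  next
    case neg: False
    have "((\<lambda>x. 0) has_real_derivative (flat_exp (n + 2) x - n * flat_exp (n + 1) x)) (at x)"
      using neg by (simp add: flat_exp_def)
    then show ?thesis
      by (rule has_field_derivative_transform_within_open[where S = "{..<0}"])
        (use neg False in \<open>auto simp: flat_exp_def\<close>)
  qed
qed

lemma smooth_flat_exp: "smooth (flat_exp n)"
proof -
  have "C_k k (flat_exp n)" for k n
  proof (induction k arbitrary: n)
    case 0
    show ?case
      using flat_exp_derivative[THEN DERIV_isCont] by (simp add: continuous_at_imp_continuous_on)
  next
    case (Suc k)
    have d: "(flat_exp n has_derivative (\<lambda>v. (flat_exp (n + 2) x - n * flat_exp (n + 1) x) * v)) (at x)" for x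
      using flat_exp_derivative by (simp add: has_field_derivative_def)
    have "pd v (flat_exp n) = (\<lambda>x. (flat_exp (n + 2) x + (- real n) * flat_exp (n + 1) x) * v)" for v
      by (rule ext, subst pd_eqI[OF d]) simp
    moreover have "C_k k (\<lambda>x. (flat_exp (n + 2) x + (- real n) * flat_exp (n + 1) x) * v)" for v
      by (intro C_k_linear[OF bounded_linear_mult_left] C_k_add C_k_linear[OF bounded_linear_mult_right] Suc)
    moreover have "flat_exp n differentiable at x" for x
      using d unfolding differentiable_def by blast
    ultimately show ?case by (simp add: C_k_Suc)
  qed
  then show ?thesis by (simp add: smooth_def)
qed

definition bump :: "real \<Rightarrow> real" where
  "bump x = flat_exp 0 (1 - x\<^sup>2)"

lemma smooth_bump: "smooth bump"
  unfolding bump_def[abs_def]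
  by (rule smooth_compose[OF smooth_flat_exp]) (intro smooth_intros)

lemma bump_pos: "\<bar>x\<bar> < 1 \<Longrightarrow> bump x > 0"
  and bump_zero: "\<bar>x\<bar> \<ge> 1 \<Longrightarrow> bump x = 0"
  and bump_nonneg: "bump x \<ge> 0"
  using abs_square_less_1[of x] by (auto simp: bump_def flat_exp_def)

lemma smooth_cutoff:
  fixes a a' b b' :: real
  assumes "a' < a" "a \<le> b" "b < b'"
  obtains \<rho> :: "real \<Rightarrow> real" where "smooth \<rho>" "\<And>t. 0 \<le> \<rho> t \<and> \<rho> t \<le> 1"
    "\<And>t. t \<in> {a..b} \<Longrightarrow> \<rho> t = 1" "\<And>t. t \<notin> {a'..b'} \<Longrightarrow> \<rho> t = 0"
proof -
  \<comment> \<open>A smooth step, 0 on the negative axis and 1 from 1 on. The denominator is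
    positive because \<open>x\<close> or \<open>1 - x\<close> is.\<close>
  define st where "st x = flat_exp 0 x / (flat_exp 0 x + flat_exp 0 (1 - x))" for x
  have fe: "flat_exp 0 x \<ge> 0" "flat_exp 0 x > 0 \<longleftrightarrow> x > 0" for x by (auto simp: flat_exp_def)
  have pos: "flat_exp 0 x + flat_exp 0 (1 - x) > 0" for x
    using fe(1)[of x] fe(1)[of "1 - x"] fe(2)[of x] fe(2)[of "1 - x"] by linarith
  then have nz: "flat_exp 0 x + flat_exp 0 (1 - x) \<noteq> 0" for x by (metis less_irrefl)
  have st: "smooth st" unfolding st_def[abs_def]
    by (rule smooth_divide[OF smooth_flat_exp smooth_add[OF smooth_flat_exp] nz])
      (rule smooth_compose[OF smooth_flat_exp], intro smooth_intros)
  have st01: "0 \<le> st x \<and> st x \<le> 1" for x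
    using fe(1)[of x] fe(1)[of "1 - x"] pos[of x] by (auto simp: st_def divide_simps)
  have st0: "x \<le> 0 \<Longrightarrow> st x = 0" for x by (simp add: st_def flat_exp_def)
  have st1: "x \<ge> 1 \<Longrightarrow> st x = 1" for x by (simp add: st_def flat_exp_def)
  show ?thesis
  proof (rule that[of "\<lambda>t. st ((t - a') * inverse (a - a')) * st ((b' - t) * inverse (b' - b))"])
    show "smooth (\<lambda>t. st ((t - a') * inverse (a - a')) * st ((b' - t) * inverse (b' - b)))"
      by (intro smooth_mult smooth_compose[OF st]) (intro smooth_intros smooth_const)+
    show "0 \<le> st ((t - a') * inverse (a - a')) * st ((b' - t) * inverse (b' - b)) \<and> st ((t - a') * inverse (a - a')) * st ((b' - t) * inverse (b' - b)) \<le> 1" for t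
      using st01 by (auto intro: mult_le_one)
    show "st ((t - a') * inverse (a - a')) * st ((b' - t) * inverse (b' - b)) = 1" if "t \<in> {a..b}" for t
      using that assms by (subst (1 2) st1) (auto simp: field_simps)
    show "st ((t - a') * inverse (a - a')) * st ((b' - t) * inverse (b' - b)) = 0" if "t \<notin> {a'..b'}" for t
    proof (cases "t < a'")
      case True
      then show ?thesis using assms st0[of "(t - a') * inverse (a - a')"] by (auto simp: mult_le_0_iff)
    next
      case False
      then show ?thesis using that assms st0[of "(b' - t) * inverse (b' - b)"] by (auto simp: mult_le_0_iff)
    qed
  qed
qed

section \<open>Periodic space-time fields\<close>

type_synonym pt = "real \<times> (real^2)"

definition dx :: "2 \<Rightarrow> pt" where "dx i = (0, axis i 1)"

definition dt :: pt where "dt = (1, 0)"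

lemma fst_dx [simp]: "fst (dx i) = 0"
  and snd_dx [simp]: "snd (dx i) $ j = (if j = i then 1 else 0)"
  and fst_dt [simp]: "fst dt = 1" and snd_dt [simp]: "snd dt = 0"
  by (auto simp: dx_def dt_def axis_def)

declare split_paired_All [simp del] split_paired_Ex [simp del]

named_theorems sfield_intros

text \<open>The relation \<open>Q\<close> lists the pairs of points that the field must not distinguish. \<open>Per\<close> encodes periodicity in
  space, \<open>Slab\<close> moreover constancy before and after a time interval.\<close>
definition sfield :: "(pt \<times> pt) set \<Rightarrow> (pt \<Rightarrow> 'b::euclidean_space) \<Rightarrow> bool" where
  "sfield Q f \<longleftrightarrow> smooth f \<and> (\<forall>p q. (p, q) \<in> Q \<longrightarrow> f p = f q)"

definition Per :: "(pt \<times> pt) set" where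
  "Per = {(p, p + (2 * pi) *\<^sub>R dx i) | p i. True}"

definition Slab :: "real \<Rightarrow> real \<Rightarrow> (pt \<times> pt) set" where
  "Slab t0 t1 = Per \<union> {(p, q). fst p \<notin> {t0..t1} \<and> fst q \<notin> {t0..t1}}"

lemma sfield_smooth: "sfield Q f \<Longrightarrow> smooth f"
  by (simp add: sfield_def)

lemma sfield_differentiable: "sfield Q f \<Longrightarrow> f differentiable (at p)"
  by (simp add: sfield_def smooth_differentiable)

lemma sfield_mono: "sfield Q f \<Longrightarrow> Q' \<subseteq> Q \<Longrightarrow> sfield Q' f"
  by (auto simp: sfield_def)

lemma Per_subset_Slab: "Per \<subseteq> Slab t0 t1"
  by (simp add: Slab_def)

lemma sfield_Slab_Per: "sfield (Slab t0 t1) f \<Longrightarrow> sfield Per f"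
  by (rule sfield_mono[OF _ Per_subset_Slab])

lemma sfield_Slab_mono:
  "sfield (Slab t0 t1) f \<Longrightarrow> t0' \<le> t0 \<Longrightarrow> t1 \<le> t1' \<Longrightarrow> sfield (Slab t0' t1') f"
  by (erule sfield_mono) (auto simp: Slab_def)

lemma sfield_Per: "sfield Per f \<longleftrightarrow> smooth f \<and> (\<forall>p i. f (p + (2 * pi) *\<^sub>R dx i) = f p)"
  unfolding sfield_def Per_def by auto metis+

lemma sfield_shift: "sfield Per f \<Longrightarrow> f (p + (2 * pi) *\<^sub>R dx i) = f p"
  by (simp add: sfield_Per)

lemma sfield_const [sfield_intros, simp]: "sfield Q (\<lambda>p. c)"
  by (simp add: sfield_def)

lemma sfield_linear: "bounded_linear L \<Longrightarrow> sfield Q f \<Longrightarrow> sfield Q (\<lambda>p. L (f p))"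
  unfolding sfield_def using smooth_linear[of L f] by auto

lemma sfield_bilinear: "bounded_bilinear h \<Longrightarrow> sfield Q f \<Longrightarrow> sfield Q g \<Longrightarrow> sfield Q (\<lambda>p. h (f p) (g p))"
  unfolding sfield_def using smooth_bilinear[of h f g] by auto

lemma sfield_compose: "smooth h \<Longrightarrow> sfield Q f \<Longrightarrow> sfield Q (\<lambda>p. h (f p))"
  unfolding sfield_def using smooth_compose[of h f] by auto

lemma sfield_add [sfield_intros]: "sfield Q f \<Longrightarrow> sfield Q g \<Longrightarrow> sfield Q (\<lambda>p. f p + g p)"
  and sfield_diff [sfield_intros]: "sfield Q f \<Longrightarrow> sfield Q g \<Longrightarrow> sfield Q (\<lambda>p. f p - g p)"
  and sfield_minus [sfield_intros]: "sfield Q f \<Longrightarrow> sfield Q (\<lambda>p. - f p)"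
  and sfield_scaleR [sfield_intros]: "sfield Q r \<Longrightarrow> sfield Q f \<Longrightarrow> sfield Q (\<lambda>p. r p *\<^sub>R f p)"
  and sfield_inner [sfield_intros]: "sfield Q f \<Longrightarrow> sfield Q g \<Longrightarrow> sfield Q (\<lambda>p. f p \<bullet> g p)"
  by (auto simp: sfield_def intro!: smooth_intros)

lemma sfield_sum [sfield_intros]: "(\<And>i. i \<in> I \<Longrightarrow> sfield Q (f i)) \<Longrightarrow> sfield Q (\<lambda>p. \<Sum>i\<in>I. f i p)"
  by (auto simp: sfield_def intro!: smooth_intros sum.cong)

lemma sfield_mult [sfield_intros]: "sfield Q f \<Longrightarrow> sfield Q g \<Longrightarrow> sfield Q (\<lambda>p. f p * g p :: real)"
  and sfield_power [sfield_intros]: "sfield Q f \<Longrightarrow> sfield Q (\<lambda>p. f p ^ n :: real)"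
  and sfield_divide [sfield_intros]: "sfield Q f \<Longrightarrow> sfield Q g \<Longrightarrow> (\<And>x. g x \<noteq> 0) \<Longrightarrow> sfield Q (\<lambda>p. f p / g p :: real)"
  and sfield_inverse [sfield_intros]: "sfield Q f \<Longrightarrow> (\<And>x. f x \<noteq> 0) \<Longrightarrow> sfield Q (\<lambda>p. inverse (f p) :: real)"
  and sfield_sqrt [sfield_intros]: "sfield Q f \<Longrightarrow> (\<And>x. f x > 0) \<Longrightarrow> sfield Q (\<lambda>p. sqrt (f p))"
  by (auto simp: sfield_def intro!: smooth_intros)

lemma sfield_vec_lambda [sfield_intros]:
  "(\<And>i. sfield Q (f i)) \<Longrightarrow> sfield Q (\<lambda>p. \<chi> i. f i p)"
  by (auto simp: sfield_def intro!: smooth_intros)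

lemma sfield_vec_nth [sfield_intros]: "sfield Q f \<Longrightarrow> sfield Q (\<lambda>p. f p $ i)"
  by (auto simp: sfield_def intro!: smooth_intros)

lemma pd_shift:
  assumes "smooth f"
  shows "pd v (\<lambda>p. f (p + a)) p = pd v f (p + a)"
  by (rule pd_eqI, rule has_derivative_compose[where g = f, OF _ smooth_has_derivative[OF assms]])
    (auto intro!: derivative_eq_intros)

lemma sfield_pd [sfield_intros]:
  assumes "Q = Per \<or> Q = Slab t0 t1" and f: "sfield Q f"
  shows "sfield Q (pd v f)"
proof -
  have per: "pd v f (p + (2 * pi) *\<^sub>R dx i) = pd v f p" for p i
  proof -
    have "sfield Per f" using assms sfield_Slab_Per by blast
    then have "(\<lambda>p. f (p + (2 * pi) *\<^sub>R dx i)) = f" by (auto simp: sfield_shift)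
    then show ?thesis using pd_shift[OF sfield_smooth[OF f], of v "(2 * pi) *\<^sub>R dx i" p] by simp
  qed
  \<comment> \<open>Outside \<open>{t0..t1}\<close> all values of \<open>f\<close> agree, so
    \<open>f\<close> is locally constant there, and its derivative has the common value 0 on both
    sides of the interval.\<close>
  have "pd v f p = 0" if Q: "Q = Slab t0 t1" and p: "fst p \<notin> {t0..t1}" for p
  proof -
    have o: "open (fst -` (- {t0..t1}) :: pt set)"
      by (intro open_vimage continuous_intros open_Compl closed_atLeastAtMost)
    have e: "f p = f q" if "q \<in> fst -` (- {t0..t1})" for q
    proof -
      have "(p, q) \<in> Q" using that p by (simp add: Q Slab_def)
      then show ?thesis using f unfolding sfield_def by blast
    qed
    have m: "p \<in> fst -` (- {t0..t1})" using p by simp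
    have "(f has_derivative (\<lambda>_. 0)) (at p)"
      by (rule has_derivative_transform_within_open[of "\<lambda>_. f p", OF has_derivative_const o m e])
    then show ?thesis by (rule pd_eqI)
  qed
  note zero = this
  have "pd v f p = pd v f q" if "(p, q) \<in> Q" for p q
  proof (cases "(p, q) \<in> Per")
    case True
    then obtain i where "q = p + (2 * pi) *\<^sub>R dx i" unfolding Per_def by blast
    then show ?thesis using per[of p i] by simp
  next
    case False
    then have Q: "Q = Slab t0 t1" using assms(1) that by auto
    then show ?thesis using that False zero[OF Q, of p] zero[OF Q, of q] by (simp add: Slab_def)
  qed
  then show ?thesis
    using smooth_pd[OF sfield_smooth[OF f]] unfolding sfield_def by blast
qed

lemmas sfield_pd_Per [sfield_intros] = sfield_pd[OF disjI1[OF refl]]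
lemmas sfield_pd_Slab [sfield_intros] = sfield_pd[OF disjI2[OF refl]]

text \<open>\<open>q\<close> is chosen before the field, by subtracting full periods from both
  coordinates. It lies in a compact cell at the same time, which is what bounds by compactness
  require.\<close>

lemma periodic_reduce:
  fixes p :: pt
  obtains q :: pt where "\<And>f. (\<forall>p i. f (p + (2 * pi) *\<^sub>R dx i) = f p) \<longrightarrow> f p = (f q :: 'b)"
    "fst q = fst p" "\<And>i. 0 \<le> snd q $ i" "\<And>i. snd q $ i \<le> 2 * pi"
proof -
  define n where "n i = \<lfloor>snd p $ i / (2 * pi)\<rfloor>" for i
  have steps: "f (p' + (of_int m * (2 * pi)) *\<^sub>R dx i) = f p'"
    if per: "\<forall>p i. f (p + (2 * pi) *\<^sub>R dx i) = f p" for f :: "pt \<Rightarrow> 'b" and p' m i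
  proof -
    have nat: "f (p' + (of_nat k * (2 * pi)) *\<^sub>R dx i) = f p'" for k p'
    proof (induction k)
      case (Suc k)
      have "p' + (of_nat (Suc k) * (2 * pi)) *\<^sub>R dx i = (p' + (of_nat k * (2 * pi)) *\<^sub>R dx i) + (2 * pi) *\<^sub>R dx i"
        by (simp add: algebra_simps)
      then show ?case using per Suc by metis
    qed simp
    show ?thesis
    proof (cases "m \<ge> 0")
      case True
      then show ?thesis using nat[of p' "nat m"] by simp
    next
      case False
      then show ?thesis using nat[of "p' + (of_int m * (2 * pi)) *\<^sub>R dx i" "nat (- m)"]
        by (simp add: algebra_simps)
    qed
  qed
  define q where "q = (p + (of_int (- n 1) * (2 * pi)) *\<^sub>R dx 1) + (of_int (- n 2) * (2 * pi)) *\<^sub>R dx 2"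
  have q: "snd q $ i = snd p $ i - of_int (n i) * (2 * pi)" for i
    using exhaust_2[of i] by (auto simp: q_def dx_def axis_def)
  have "0 \<le> snd q $ i \<and> snd q $ i \<le> 2 * pi" for i
  proof -
    have "of_int (n i) \<le> snd p $ i / (2 * pi)" "snd p $ i / (2 * pi) \<le> of_int (n i) + 1"
      unfolding n_def by linarith+
    then show ?thesis unfolding q by (simp add: field_simps)
  qed
  moreover have "fst q = fst p" by (simp add: q_def dx_def)
  moreover have "(\<forall>p i. f (p + (2 * pi) *\<^sub>R dx i) = f p) \<longrightarrow> f p = f q" for f :: "pt \<Rightarrow> 'b"
    unfolding q_def using steps by metis
  ultimately show ?thesis by (intro that[of q]) auto
qed

lemma sfield_bounded:
  assumes f: "sfield (Slab t0 t1) f"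
  obtains C where "C > 0" "\<And>p. norm (f p) \<le> C"
proof -
  define K :: "pt set" where "K = {t0..t1} \<times> cbox 0 (\<chi> i. 2 * pi)"
  have "compact (f ` K)"
    by (intro compact_continuous_image smooth_continuous_on[OF sfield_smooth[OF f]]) (auto simp: K_def intro!: compact_Times)
  then obtain C where C: "\<And>p. p \<in> K \<Longrightarrow> norm (f p) \<le> C"
    using compact_imp_bounded bounded_iff by (metis image_eqI)
  \<comment> \<open>Off the time interval the field has a single value, read off at this
    point.\<close>
  define q0 :: pt where "q0 = (t0 - 1, 0)"
  have "norm (f p) \<le> max (max C (norm (f q0))) 1" for p
  proof -
    obtain q where q: "f p = f q" "fst q = fst p" "\<And>i. 0 \<le> snd q $ i" "\<And>i. snd q $ i \<le> 2 * pi"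
      using periodic_reduce[of p] sfield_shift[OF sfield_Slab_Per[OF f]] by metis
    show ?thesis
    proof (cases "fst q \<in> {t0..t1}")
      case True
      then have "q \<in> K" using q by (auto simp: K_def mem_box_cart mem_Times_iff)
      then show ?thesis using C q by (simp add: le_max_iff_disj)
    next
      case False
      have "(q, q0) \<in> Slab t0 t1" using False by (auto simp: Slab_def q0_def)
      then have "f q = f q0" using f by (auto simp: sfield_def)
      then show ?thesis using q by simp
    qed
  qed
  then show ?thesis using that[of "max (max C (norm (f q0))) 1"] by simp
qed

section \<open>Averages and primitives along coordinate lines\<close>

definition dvg :: "(pt \<Rightarrow> mat2) \<Rightarrow> pt \<Rightarrow> real^2" where
  "dvg M p = (\<chi> i. \<Sum>j\<in>UNIV. pd (dx j) M p $ i $ j)"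

definition grad :: "(pt \<Rightarrow> real^2) \<Rightarrow> pt \<Rightarrow> mat2" where
  "grad u p = (\<chi> i j. pd (dx j) u p $ i)"

text \<open>The mean over one period in direction \<open>i\<close>, with the parameter scaled to
  \<open>{0..1}\<close> so that \<open>smooth_integral\<close> applies. The same scaling turns
  \<open>prim\<close> into the integral from the point with \<open>i\<close>-th coordinate 0 up to
  the given point.\<close>

definition avg :: "2 \<Rightarrow> (pt \<Rightarrow> 'b::euclidean_space) \<Rightarrow> pt \<Rightarrow> 'b" where
  "avg i f p = integral {0..1} (\<lambda>r. f (p + (2 * pi * r) *\<^sub>R dx i))"

definition prim :: "2 \<Rightarrow> (pt \<Rightarrow> 'b::euclidean_space) \<Rightarrow> pt \<Rightarrow> 'b" where
  "prim i f p = integral {0..1} (\<lambda>r. snd p $ i *\<^sub>R f (p + ((r - 1) * snd p $ i) *\<^sub>R dx i))"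

lemma smooth_avg_integrand:
  assumes f: "smooth f"
  shows "smooth (\<lambda>(r, p). f (p + (2 * pi * r) *\<^sub>R dx i))"
  unfolding case_prod_beta' by (rule smooth_compose[OF f]) (intro smooth_intros)

lemma smooth_prim_integrand:
  assumes f: "smooth f"
  shows "smooth (\<lambda>(r, p). snd p $ i *\<^sub>R f (p + ((r - 1) * snd p $ i) *\<^sub>R dx i))"
  unfolding case_prod_beta'
  by (rule smooth_scaleR[OF _ smooth_compose[OF f]]) (intro smooth_intros)+

lemma smooth_avg: "smooth f \<Longrightarrow> smooth (avg i f)"
  using smooth_integral[OF smooth_avg_integrand[of f i]] by (simp add: avg_def[abs_def])

lemma smooth_prim: "smooth f \<Longrightarrow> smooth (prim i f)"
  using smooth_integral[OF smooth_prim_integrand[of f i]] by (simp add: prim_def[abs_def])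

lemma pd_avg:
  assumes "smooth f"
  shows "pd v (avg i f) = avg i (pd v f)"
proof
  fix p
  have "pd (0, v) (\<lambda>(r, p). f (p + (2 * pi * r) *\<^sub>R dx i)) (r, p) = pd v f (p + (2 * pi * r) *\<^sub>R dx i)" for r
  proof -
    have "((\<lambda>x. snd x + (2 * pi * fst x) *\<^sub>R dx i) has_derivative (\<lambda>h. snd h + (2 * pi * fst h) *\<^sub>R dx i)) (at (r, p))"
      by (auto intro!: derivative_eq_intros)
    from pd_eqI[OF has_derivative_compose[where g = f, OF this smooth_has_derivative[OF assms]], of "(0, v)"]
    show ?thesis by (simp add: case_prod_beta')
  qed
  then show "pd v (avg i f) p = avg i (pd v f) p"
    using pd_eqI[OF pd_integral[OF smooth_avg_integrand[OF assms, of i], of p], of v]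
    by (simp add: avg_def[abs_def])
qed

lemma line_integral_periodic:
  assumes f: "smooth f"
  shows "avg i (pd (dx i) f) p = (f (p + (2 * pi) *\<^sub>R dx i) - f p) /\<^sub>R (2 * pi)"
proof -
  have "((\<lambda>r. f (p + r *\<^sub>R ((2 * pi) *\<^sub>R dx i))) has_vector_derivative
      pd ((2 * pi) *\<^sub>R dx i) f (p + r *\<^sub>R ((2 * pi) *\<^sub>R dx i))) (at r within {0..1})" for r
    by (rule smooth_line_derivative[OF f])
  then have "((\<lambda>r. pd ((2 * pi) *\<^sub>R dx i) f (p + r *\<^sub>R ((2 * pi) *\<^sub>R dx i))) has_integral
      f (p + 1 *\<^sub>R ((2 * pi) *\<^sub>R dx i)) - f (p + 0 *\<^sub>R ((2 * pi) *\<^sub>R dx i))) {0..1}"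
    by (intro fundamental_theorem_of_calculus) auto
  then have "((\<lambda>r. (2 * pi) *\<^sub>R pd (dx i) f (p + (2 * pi * r) *\<^sub>R dx i)) has_integral
      f (p + (2 * pi) *\<^sub>R dx i) - f p) {0..1}"
    by (simp add: pd_scaleR_dir[OF f] mult.commute)
  from has_integral_cmul[OF this, of "inverse (2 * pi)"] show ?thesis
    by (simp add: avg_def integral_unique)
qed

lemma avg_pd_periodic: "sfield Per f \<Longrightarrow> avg i (pd (dx i) f) = (\<lambda>p. 0)"
  by (simp add: line_integral_periodic[OF sfield_smooth] sfield_shift fun_eq_iff)

lemma sfield_avg [sfield_intros]:
  assumes f: "sfield Per f" shows "sfield Per (avg i f)"
proof -
  have "f (p + (2 * pi) *\<^sub>R dx j + c *\<^sub>R dx i) = f (p + c *\<^sub>R dx i)" for p c j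
    using sfield_shift[OF f, of "p + c *\<^sub>R dx i" j] by (simp add: algebra_simps)
  then show ?thesis
    using smooth_avg[OF sfield_smooth[OF f]] by (simp add: sfield_Per avg_def)
qed

lemma avg_const_dir: "sfield Per f \<Longrightarrow> pd (dx i) (avg i f) = (\<lambda>p. 0)"
  by (simp add: pd_avg sfield_smooth avg_pd_periodic)

lemma avg_zero [simp]: "avg i (\<lambda>p. 0) = (\<lambda>p. 0)"
  by (simp add: avg_def fun_eq_iff)

lemma prim_zero [simp]: "prim i (\<lambda>p. 0) = (\<lambda>p. 0)"
  by (simp add: prim_def fun_eq_iff)

lemma continuous_line:
  assumes "smooth f" shows "continuous_on S (\<lambda>r::real. f (p + (c * r + d) *\<^sub>R v))"
  by (rule continuous_on_compose2[OF smooth_continuous_on[OF assms, of UNIV]]) (auto intro!: continuous_intros)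

lemma avg_integrable: "smooth f \<Longrightarrow> (\<lambda>r. f (p + (2 * pi * r) *\<^sub>R dx i)) integrable_on {0..1}"
  using integrable_continuous_real[OF continuous_line[of f _ p "2 * pi" 0 "dx i"]] by simp

lemma avg_diff: "smooth f \<Longrightarrow> smooth g \<Longrightarrow> avg i (\<lambda>p. f p - g p) p = avg i f p - avg i g p"
  by (simp add: avg_def integral_diff avg_integrable)

lemma avg_add: "smooth f \<Longrightarrow> smooth g \<Longrightarrow> avg i (\<lambda>p. f p + g p) p = avg i f p + avg i g p"
  by (simp add: avg_def integral_add avg_integrable)

lemma avg_linear: "smooth f \<Longrightarrow> bounded_linear L \<Longrightarrow> avg i (\<lambda>p. L (f p)) p = L (avg i f p)"
  using integral_linear[of "\<lambda>r. f (p + (2 * pi * r) *\<^sub>R dx i)" "{0..1}" L]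
  by (simp add: avg_def avg_integrable o_def)

lemma avg_bound: "smooth f \<Longrightarrow> (\<And>r. norm (f (p + r *\<^sub>R dx i)) \<le> C) \<Longrightarrow> norm (avg i f p) \<le> C"
  unfolding avg_def using integral_norm_bound_integral[of "\<lambda>r. f (p + (2 * pi * r) *\<^sub>R dx i)" "{0..1}" "\<lambda>_. C"]
  by (simp add: avg_integrable integrable_const_ivl)

lemma constant_direction:
  assumes f: "smooth f" and z: "\<And>p. pd v f p = 0"
  shows "f (p + s *\<^sub>R v) = f p"
proof -
  have "((\<lambda>s. f (p + s *\<^sub>R v)) has_derivative (\<lambda>h. 0)) (at s within UNIV)" for s
    using smooth_line_derivative[OF f, of p v s UNIV] by (simp add: z has_vector_derivative_def)
  then have "(\<lambda>s. f (p + s *\<^sub>R v)) s = (\<lambda>s. f (p + s *\<^sub>R v)) 0"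
    by (intro has_derivative_zero_unique[of UNIV]) auto
  then show ?thesis by simp
qed

lemma avg_const:
  assumes "smooth f" "\<And>p. pd (dx i) f p = 0" shows "avg i f = f"
  using constant_direction[OF assms] by (simp add: avg_def fun_eq_iff)

lemma pd_prim:
  assumes f: "smooth f"
  shows "pd (dx i) (prim i f) p = f p"
proof -
  define q where "q r = p + ((r - 1) * snd p $ i) *\<^sub>R dx i" for r
  have 1: "pd (0, dx i) (\<lambda>(r, p). snd p $ i *\<^sub>R f (p + ((r - 1) * snd p $ i) *\<^sub>R dx i)) (r, p)
      = f (q r) + (snd p $ i * r) *\<^sub>R pd (dx i) f (q r)" for r
  proof -
    have lin: "bounded_linear (\<lambda>x. snd (snd x) $ i)" for i
      by (intro bounded_linear_compose[OF bounded_linear_vec_nth] bounded_linear_compose[OF bounded_linear_snd] bounded_linear_snd)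
    have q: "((\<lambda>x. snd x + ((fst x - 1) * snd (snd x) $ i) *\<^sub>R dx i) has_derivative
        (\<lambda>h. snd h + ((r - 1) * snd (snd h) $ i + fst h * snd p $ i) *\<^sub>R dx i)) (at (r, p))"
      by (rule derivative_eq_intros bounded_linear_imp_has_derivative[OF lin] refl)+
        (auto simp: fun_eq_iff algebra_simps)
    have "((\<lambda>x. snd (snd x) $ i *\<^sub>R f (snd x + ((fst x - 1) * snd (snd x) $ i) *\<^sub>R dx i)) has_derivative
        (\<lambda>h. snd (snd (r, p)) $ i *\<^sub>R pd (snd h + ((r - 1) * snd (snd h) $ i + fst h * snd p $ i) *\<^sub>R dx i) f (q r)
          + snd (snd h) $ i *\<^sub>R f (snd (r, p) + ((fst (r, p) - 1) * snd (snd (r, p)) $ i) *\<^sub>R dx i))) (at (r, p))"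
      by (rule has_derivative_scaleR[OF bounded_linear_imp_has_derivative[OF lin]
            has_derivative_compose[where g = f, OF q]])
        (simp add: q_def smooth_has_derivative[OF f])
    from pd_eqI[OF this, of "(0, dx i)"] show ?thesis
      using scaleR_left_distrib[of 1 "r - 1" "dx i", symmetric]
      by (simp add: case_prod_beta' q_def pd_scaleR_dir[OF f] mult.commute)
  qed
  \<comment> \<open>The differentiated integrand is the derivative of
    \<open>r *\<^sub>R f (q r)\<close> in \<open>r\<close>, so its integral is
    \<open>f (q 1) = f p\<close>.\<close>
  have "((\<lambda>r. r *\<^sub>R f (q r)) has_vector_derivative (f (q r) + (snd p $ i * r) *\<^sub>R pd (dx i) f (q r))) (at r within {0..1})" for r
  proof -
    have "((\<lambda>r. f (p - (snd p $ i) *\<^sub>R dx i + r *\<^sub>R (snd p $ i *\<^sub>R dx i))) has_vector_derivative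
        pd (snd p $ i *\<^sub>R dx i) f (p - (snd p $ i) *\<^sub>R dx i + r *\<^sub>R (snd p $ i *\<^sub>R dx i))) (at r within {0..1})"
      by (rule smooth_line_derivative[OF f])
    then have "((\<lambda>r. f (q r)) has_vector_derivative snd p $ i *\<^sub>R pd (dx i) f (q r)) (at r within {0..1})"
      by (simp add: q_def algebra_simps pd_scaleR_dir[OF f])
    from has_vector_derivative_scaleR[OF DERIV_ident this] show ?thesis
      by (simp add: algebra_simps)
  qed
  then have "((\<lambda>r. f (q r) + (snd p $ i * r) *\<^sub>R pd (dx i) f (q r)) has_integral (1 *\<^sub>R f (q 1) - 0 *\<^sub>R f (q 0))) {0..1}"
    by (intro fundamental_theorem_of_calculus) auto
  then have "integral {0..1} (\<lambda>r. f (q r) + (snd p $ i * r) *\<^sub>R pd (dx i) f (q r)) = f p"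
    by (simp add: integral_unique q_def)
  then show ?thesis
    using pd_eqI[OF pd_integral[OF smooth_prim_integrand[OF f, of i], of p], of "dx i"]
    unfolding 1 by (simp add: prim_def[abs_def])
qed

lemma pd_prim_other:
  assumes f: "smooth f" and v: "snd v $ i = 0"
  shows "pd v (prim i f) p = prim i (pd v f) p"
proof -
  have lin: "bounded_linear (\<lambda>x::real \<times> pt. snd (snd x) $ i)" for i
    by (intro bounded_linear_compose[OF bounded_linear_vec_nth] bounded_linear_compose[OF bounded_linear_snd] bounded_linear_snd)
  have 1: "pd (0, v) (\<lambda>(r, p). snd p $ i *\<^sub>R f (p + ((r - 1) * snd p $ i) *\<^sub>R dx i)) (r, p)
      = snd p $ i *\<^sub>R pd v f (p + ((r - 1) * snd p $ i) *\<^sub>R dx i)" for r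
  proof -
    have q: "((\<lambda>x. snd x + ((fst x - 1) * snd (snd x) $ i) *\<^sub>R dx i) has_derivative
        (\<lambda>h. snd h + ((r - 1) * snd (snd h) $ i + fst h * snd p $ i) *\<^sub>R dx i)) (at (r, p))"
      by (rule derivative_eq_intros bounded_linear_imp_has_derivative[OF lin] refl)+
        (auto simp: fun_eq_iff algebra_simps)
    have "((\<lambda>x. snd (snd x) $ i *\<^sub>R f (snd x + ((fst x - 1) * snd (snd x) $ i) *\<^sub>R dx i)) has_derivative
        (\<lambda>h. snd (snd (r, p)) $ i *\<^sub>R pd (snd h + ((r - 1) * snd (snd h) $ i + fst h * snd p $ i) *\<^sub>R dx i) f (p + ((r - 1) * snd p $ i) *\<^sub>R dx i)
          + snd (snd h) $ i *\<^sub>R f (snd (r, p) + ((fst (r, p) - 1) * snd (snd (r, p)) $ i) *\<^sub>R dx i))) (at (r, p))"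
      by (rule has_derivative_scaleR[OF bounded_linear_imp_has_derivative[OF lin]
            has_derivative_compose[where g = f, OF q]])
        (simp add: smooth_has_derivative[OF f])
    from pd_eqI[OF this, of "(0, v)"] show ?thesis
      using v by (simp add: case_prod_beta')
  qed
  show ?thesis
    using pd_eqI[OF pd_integral[OF smooth_prim_integrand[OF f, of i], of p], of v]
    unfolding 1 by (simp add: prim_def[abs_def])
qed

text \<open>Over a period in direction \<open>i\<close> the primitive changes by a multiple of the
  mean of \<open>f\<close> along that line, which is 0 by assumption. In the other direction it
  inherits the period of \<open>f\<close>.\<close>

lemma sfield_prim:
  assumes f: "sfield Per f" and z: "avg i f = (\<lambda>p. 0)"
  shows "sfield Per (prim i f)"
proof -
  note sm = sfield_smooth[OF f]
  have "prim i f (p + (2 * pi) *\<^sub>R dx j) = prim i f p" for p j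
  proof (cases "j = i")
    case True
    have "pd (dx i) (prim i f) = f" using pd_prim[OF sm] by blast
    then show ?thesis
      using line_integral_periodic[OF smooth_prim[OF sm], of i i p] z True by simp
  next
    case False
    have "f (p + (2 * pi) *\<^sub>R dx j + c *\<^sub>R dx i) = f (p + c *\<^sub>R dx i)" for c
      using sfield_shift[OF f, of "p + c *\<^sub>R dx i" j] by (simp add: algebra_simps)
    then show ?thesis using False by (simp add: prim_def)
  qed
  then show ?thesis by (simp add: sfield_Per smooth_prim sm)
qed

text \<open>By periodicity the point may be moved into the cell, where the integration runs over a
  length of at most \<open>2 * pi\<close>.\<close>

lemma prim_bound:
  assumes f: "sfield Per f" and z: "avg i f = (\<lambda>p. 0)" and M: "\<And>p. norm (f p) \<le> M"
  shows "norm (prim i f p) \<le> 2 * pi * M"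
proof -
  obtain q where q: "prim i f p = prim i f q" "\<And>i. 0 \<le> snd q $ i" "\<And>i. snd q $ i \<le> 2 * pi"
    using periodic_reduce[of p] sfield_shift[OF sfield_prim[OF f z]] by metis
  have "M \<ge> 0" using M[of p] norm_ge_zero by (rule order_trans[rotated])
  have b: "norm (snd q $ i *\<^sub>R f x) \<le> 2 * pi * M" for x
    using mult_mono[OF q(3) M[of x], of i] q(2)[of i] by simp
  have "norm (prim i f q) \<le> integral {0..1} (\<lambda>r::real. 2 * pi * M)"
    unfolding prim_def
  proof (rule integral_norm_bound_integral)
    have "continuous_on {0..1} (\<lambda>r. f (q + (snd q $ i * r + - (snd q $ i)) *\<^sub>R dx i))"
      by (rule continuous_line[OF sfield_smooth[OF f]])
    then have "continuous_on {0..1} (\<lambda>r. snd q $ i *\<^sub>R f (q + ((r - 1) * snd q $ i) *\<^sub>R dx i))"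
      by (intro continuous_intros) (simp add: algebra_simps)
    then show "(\<lambda>r. snd q $ i *\<^sub>R f (q + ((r - 1) * snd q $ i) *\<^sub>R dx i)) integrable_on {0..1}"
      by (rule integrable_continuous_real)
  qed (use b in auto)
  then show ?thesis using q(1) by simp
qed

text \<open>All these operators act within a time slice. Hence the solutions of divergence equations
  vanish at every time at which the data do, and supports in time do not grow.\<close>

lemma avg_zero_time: "(\<And>q. fst q = fst p \<Longrightarrow> f q = 0) \<Longrightarrow> avg i f p = 0"
  and prim_zero_time: "(\<And>q. fst q = fst p \<Longrightarrow> f q = 0) \<Longrightarrow> prim i f p = 0"
  by (simp_all add: avg_def prim_def)

lemma avg_idem: "sfield Per f \<Longrightarrow> avg i (avg i f) = avg i f"
  by (rule avg_const) (simp_all add: sfield_smooth[OF sfield_avg] avg_const_dir)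

lemma avg_diff_avg:
  assumes "sfield Per f" shows "avg i (\<lambda>p. f p - avg i f p) = (\<lambda>p. 0)"
  by (rule ext, subst avg_diff[OF sfield_smooth[OF assms] sfield_smooth[OF sfield_avg[OF assms]]])
    (simp add: avg_idem[OF assms])

lemma norm_mat_le: "norm (A :: mat2) \<le> \<bar>A$1$1\<bar> + \<bar>A$1$2\<bar> + \<bar>A$2$1\<bar> + \<bar>A$2$2\<bar>"
proof -
  have "norm A \<le> norm (A$1) + norm (A$2)"
    using L2_set_le_sum[of UNIV "\<lambda>i. norm (A$i)"] by (simp add: norm_vec_def sum_2)
  also have "norm (A$i) \<le> \<bar>A$i$1\<bar> + \<bar>A$i$2\<bar>" for i
    using norm_le_l1_cart[of "A$i"] by (simp add: sum_2)
  then have "norm (A$1) + norm (A$2) \<le> (\<bar>A$1$1\<bar> + \<bar>A$1$2\<bar>) + (\<bar>A$2$1\<bar> + \<bar>A$2$2\<bar>)"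
    by (rule add_mono) fact
  finally show ?thesis by simp
qed

lemma entry_le_norm: "\<bar>(A :: mat2) $ i $ j\<bar> \<le> norm A"
  using component_le_norm_cart[of "A$i" j] Finite_Cartesian_Product.norm_nth_le[where x = A and i = i] by simp

lemma dvg_nth: "smooth M \<Longrightarrow> dvg M p $ i = (\<Sum>j\<in>UNIV. pd (dx j) (\<lambda>p. M p $ i $ j) p)"
  by (simp add: dvg_def pd_vec_nth smooth_differentiable smooth_vec_nth)

text \<open>The \<open>i\<close>-th diagonal entry is a primitive in direction \<open>i\<close> of
  the \<open>i\<close>-th component of \<open>g\<close> minus its mean along that direction. The
  mean left over in row \<open>i\<close> does not depend on the \<open>i\<close>-th coordinate. So
  the off-diagonal entry can be a sum of two primitives, one for each row, each invisible to the
  divergence in the other row. The full means \<open>c\<close>, functions of time alone, are out of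
  reach of a periodic divergence and remain.\<close>

lemma flat_inverse_divergence:
  fixes g :: "pt \<Rightarrow> real^2"
  assumes g: "sfield Per g" and M: "\<And>p. norm (g p) \<le> M"
  obtains T c where "sfield Per T" "\<And>p. transpose (T p) = T p" "\<And>p. norm (T p) \<le> 24 * pi * M"
    "\<And>p. dvg T p = g p - c p" "smooth c" "\<And>i p. pd (dx i) c p = 0"
    "\<And>p. (\<And>q. fst q = fst p \<Longrightarrow> g q = 0) \<Longrightarrow> T p = 0"
proof -
  define g1 where "g1 p = g p $ 1" for p
  define g2 where "g2 p = g p $ 2" for p
  have g12: "sfield Per g1" "sfield Per g2"
    unfolding g1_def[abs_def] g2_def[abs_def] by (intro sfield_intros g)+
  define a1 where "a1 = avg 1 g1"
  define a2 where "a2 = avg 2 g2"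
  define c1 where "c1 = avg 2 a1"
  define c2 where "c2 = avg 1 a2"
  have a: "sfield Per a1" "sfield Per a2" "sfield Per c1" "sfield Per c2"
    unfolding a1_def a2_def c1_def c2_def by (intro sfield_intros g12)+
  have Mg: "norm (g1 p) \<le> M" "norm (g2 p) \<le> M" for p
    using M[of p] component_le_norm_cart[of "g p"] order_trans unfolding g1_def g2_def by fastforce+
  have Ma: "norm (a1 p) \<le> M" "norm (a2 p) \<le> M" for p
    unfolding a1_def a2_def using avg_bound[OF sfield_smooth[OF g12(1)] Mg(1)]
      avg_bound[OF sfield_smooth[OF g12(2)] Mg(2)] by auto
  have Mc: "norm (c1 p) \<le> M" "norm (c2 p) \<le> M" for p
    unfolding c1_def c2_def using avg_bound[OF sfield_smooth[OF a(1)] Ma(1)]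
      avg_bound[OF sfield_smooth[OF a(2)] Ma(2)] by auto
  define h where "h = (\<lambda>p. g1 p - a1 p)"
  define k where "k = (\<lambda>p. g2 p - a2 p)"
  define l where "l = (\<lambda>p. a1 p - c1 p)"
  define m where "m = (\<lambda>p. a2 p - c2 p)"
  have sf: "sfield Per h" "sfield Per k" "sfield Per l" "sfield Per m"
    unfolding h_def k_def l_def m_def by (intro sfield_intros g12 a)+
  have z: "avg 1 h = (\<lambda>p. 0)" "avg 2 k = (\<lambda>p. 0)" "avg 2 l = (\<lambda>p. 0)" "avg 1 m = (\<lambda>p. 0)"
    unfolding h_def k_def l_def m_def a1_def a2_def c1_def c2_def
    by (intro avg_diff_avg g12 sfield_avg)+
  have bd: "norm (x - y) \<le> 2 * M" if "norm x \<le> M" "norm y \<le> M" for x y :: real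
    using norm_triangle_ineq4[of x y] that by linarith
  have B: "\<And>p. norm (h p) \<le> 2 * M" "\<And>p. norm (k p) \<le> 2 * M" "\<And>p. norm (l p) \<le> 2 * M" "\<And>p. norm (m p) \<le> 2 * M"
    unfolding h_def k_def l_def m_def by (intro bd Mg Ma Mc)+
  define T :: "pt \<Rightarrow> mat2" where "T p = (\<chi> i j. if i = j then (if i = 1 then prim 1 h p else prim 2 k p)
      else prim 2 l p + prim 1 m p)" for p
  have T: "T p $ 1 $ 1 = prim 1 h p" "T p $ 2 $ 2 = prim 2 k p"
    "T p $ 1 $ 2 = prim 2 l p + prim 1 m p" "T p $ 2 $ 1 = prim 2 l p + prim 1 m p" for p
    by (auto simp: T_def)
  have P: "sfield Per (prim 1 h)" "sfield Per (prim 2 k)" "sfield Per (prim 2 l)" "sfield Per (prim 1 m)"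
    by (intro sfield_prim sf z)+
  have sT: "sfield Per T"
  proof -
    have "sfield Per (\<lambda>p. if i = j then (if i = 1 then prim 1 h p else prim 2 k p)
      else prim 2 l p + prim 1 m p)" for i j :: 2
      by (cases "i = j"; cases "i = 1") (auto intro!: sfield_intros P)
    then show ?thesis unfolding T_def[abs_def] by (intro sfield_intros)
  qed
  define c :: "pt \<Rightarrow> real^2" where "c p = (\<chi> i. if i = 1 then c1 p else c2 p)" for p
  have c: "c p $ 1 = c1 p" "c p $ 2 = c2 p" for p by (auto simp: c_def)
  have sc: "smooth c"
    unfolding c_def[abs_def]
  proof (rule smooth_vec_lambda)
    show "smooth (\<lambda>p. if i = 1 then c1 p else c2 p)" for i :: 2
      by (cases "i = 1") (auto intro!: sfield_smooth a)
  qed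
  have pc: "pd (dx i) c1 p = 0" "pd (dx i) c2 p = 0" for i p
  proof -
    have "pd (dx 1) a1 = (\<lambda>p. 0)" "pd (dx 2) a2 = (\<lambda>p. 0)"
      unfolding a1_def a2_def by (rule avg_const_dir, rule g12)+
    then have "pd (dx 1) c1 = (\<lambda>p. 0)" "pd (dx 2) c2 = (\<lambda>p. 0)"
      by (simp_all add: c1_def c2_def pd_avg sfield_smooth[OF a(1)] sfield_smooth[OF a(2)])
    moreover have "pd (dx 2) c1 = (\<lambda>p. 0)" "pd (dx 1) c2 = (\<lambda>p. 0)"
      unfolding c1_def c2_def by (rule avg_const_dir, rule a)+
    ultimately show "pd (dx i) c1 p = 0" "pd (dx i) c2 p = 0"
      using exhaust_2[of i] by auto
  qed
  show ?thesis
  proof (rule that[OF sT _ _ _ sc])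
    show "transpose (T p) = T p" for p
      by (simp add: vec_eq_iff forall_2 transpose_def T)
    \<comment> \<open>Each primitive is at most \<open>4 * pi * M\<close>; the two on the diagonal
      count once, the two in the off-diagonal entry twice, which makes six.\<close>
    show "norm (T p) \<le> 24 * pi * M" for p
    proof -
      have "norm (prim 1 h p) \<le> 2 * pi * (2 * M)" "norm (prim 2 k p) \<le> 2 * pi * (2 * M)"
        "norm (prim 2 l p) \<le> 2 * pi * (2 * M)" "norm (prim 1 m p) \<le> 2 * pi * (2 * M)"
        by (intro prim_bound sf z B)+
      then show ?thesis
        using norm_mat_le[of "T p"] unfolding T real_norm_def
        using abs_triangle_ineq[of "prim 2 l p" "prim 1 m p"] by (simp add: algebra_simps)
    qed
    show "pd (dx i) c p = 0" for i p
      by (simp add: vec_eq_iff forall_2 flip: pd_vec_nth[OF smooth_differentiable[OF sc]])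
        (simp add: c pc)
    show "dvg T p = g p - c p" for p
    proof -
      have d: "smooth (prim 2 l)" "smooth (prim 1 m)" "smooth l" "smooth m" "smooth h" "smooth k" using P sf sfield_smooth by auto
      have pl: "pd (dx 1) l = (\<lambda>p. 0)" "pd (dx 2) m = (\<lambda>p. 0)"
        using avg_const_dir[OF g12(1), of 1] avg_const_dir[OF g12(2), of 2] pc
        by (auto simp: l_def m_def fun_eq_iff pd_diff sfield_differentiable[OF a(1)]
             sfield_differentiable[OF a(2)] sfield_differentiable[OF a(3)] sfield_differentiable[OF a(4)])
           (auto simp: a1_def a2_def)
      have "pd (dx 1) (prim 2 l) p = 0" "pd (dx 2) (prim 1 m) p = 0"
        by (simp_all add: pd_prim_other d pl)
      then show ?thesis
        by (simp add: vec_eq_iff forall_2 dvg_nth[OF sfield_smooth[OF sT]] sum_2 T c pd_add smooth_differentiable d pd_prim)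
          (simp add: h_def k_def l_def m_def g1_def g2_def)
    qed
    show "T p = 0" if "\<And>q. fst q = fst p \<Longrightarrow> g q = 0" for p
    proof -
      have g0: "g1 q = 0" "g2 q = 0" if "fst q = fst p" for q using that \<open>\<And>q. fst q = fst p \<Longrightarrow> g q = 0\<close>
        by (simp_all add: g1_def g2_def)
      have a0: "a1 q = 0" "a2 q = 0" if "fst q = fst p" for q
        unfolding a1_def a2_def using that by (auto intro!: avg_zero_time g0)
      have c0: "c1 q = 0" "c2 q = 0" if "fst q = fst p" for q
        unfolding c1_def c2_def using that by (auto intro!: avg_zero_time a0)
      have "prim 1 h p = 0" "prim 2 k p = 0" "prim 2 l p = 0" "prim 1 m p = 0"
        by (rule prim_zero_time, simp add: h_def k_def l_def m_def g0 a0 c0)+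
      then show ?thesis by (simp add: vec_eq_iff forall_2 T)
    qed
  qed
qed

section \<open>Matrix fields and Piola's identity\<close>

lemma bounded_bilinear_mm: "bounded_bilinear ((**) :: mat2 \<Rightarrow> mat2 \<Rightarrow> mat2)"
  unfolding bilinear_conv_bounded_bilinear[symmetric] bilinear_def linear_iff
  by (simp add: matrix_matrix_mult_def vec_eq_iff forall_2 sum_2 algebra_simps)

lemma bounded_bilinear_mv: "bounded_bilinear ((*v) :: mat2 \<Rightarrow> real^2 \<Rightarrow> real^2)"
  unfolding bilinear_conv_bounded_bilinear[symmetric] bilinear_def linear_iff
  by (simp add: matrix_vector_mult_def vec_eq_iff forall_2 sum_2 algebra_simps)

lemma smooth_mm [smooth_intros]: "smooth A \<Longrightarrow> smooth B \<Longrightarrow> smooth (\<lambda>p. (A p :: mat2) ** (B p :: mat2))"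
  by (rule smooth_bilinear[OF bounded_bilinear_mm])

lemma smooth_mv [smooth_intros]: "smooth A \<Longrightarrow> smooth B \<Longrightarrow> smooth (\<lambda>p. (A p :: mat2) *v B p :: real^2)"
  by (rule smooth_bilinear[OF bounded_bilinear_mv])

lemma sfield_mm [sfield_intros]: "sfield Q A \<Longrightarrow> sfield Q B \<Longrightarrow> sfield Q (\<lambda>p. (A p :: mat2) ** (B p :: mat2))"
  by (rule sfield_bilinear[OF bounded_bilinear_mm])

lemma sfield_mv [sfield_intros]: "sfield Q A \<Longrightarrow> sfield Q B \<Longrightarrow> sfield Q (\<lambda>p. (A p :: mat2) *v B p :: real^2)"
  by (rule sfield_bilinear[OF bounded_bilinear_mv])

lemma bounded_linear_transpose: "bounded_linear (transpose :: mat2 \<Rightarrow> mat2)"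
  unfolding linear_conv_bounded_linear[symmetric] linear_iff
  by (simp add: transpose_def vec_eq_iff)

lemma sfield_transpose [sfield_intros]: "sfield Q A \<Longrightarrow> sfield Q (\<lambda>p. transpose (A p) :: mat2)"
  by (rule sfield_linear[OF bounded_linear_transpose])

lemma sfield_det [sfield_intros]: "sfield Q A \<Longrightarrow> sfield Q (\<lambda>p. det (A p :: mat2))"
  unfolding det_2 by (intro sfield_intros)

lemma smooth_det [smooth_intros]: "smooth A \<Longrightarrow> smooth (\<lambda>p. det (A p :: mat2))"
  unfolding det_2 by (intro smooth_intros)

definition adj :: "mat2 \<Rightarrow> mat2" where
  "adj A = (\<chi> i j. if i = j then (if i = 1 then A$2$2 else A$1$1) else - A$i$j)"

lemma adj_nth: "adj A $ 1 $ 1 = A$2$2" "adj A $ 2 $ 2 = A$1$1" "adj A $ 1 $ 2 = - A$1$2" "adj A $ 2 $ 1 = - A$2$1"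
  by (simp_all add: adj_def)

lemma adj_mult: "adj A ** A = det A *\<^sub>R mat 1" "A ** adj A = det A *\<^sub>R mat 1"
  by (simp_all add: matrix_matrix_mult_def vec_eq_iff forall_2 sum_2 adj_nth det_2 mat_def algebra_simps)

lemma bounded_linear_adj: "bounded_linear adj"
  unfolding linear_conv_bounded_linear[symmetric] linear_iff
  by (simp add: adj_nth vec_eq_iff forall_2)

lemma smooth_adj [smooth_intros]: "smooth A \<Longrightarrow> smooth (\<lambda>p. adj (A p))"
  by (rule smooth_linear[OF bounded_linear_adj])

lemma sfield_adj [sfield_intros]: "sfield Q A \<Longrightarrow> sfield Q (\<lambda>p. adj (A p))"
  by (rule sfield_linear[OF bounded_linear_adj])

definition minv :: "mat2 \<Rightarrow> mat2" where
  "minv A = inverse (det A) *\<^sub>R adj A"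

lemma minv: "det A \<noteq> 0 \<Longrightarrow> minv A ** A = mat 1" "det A \<noteq> 0 \<Longrightarrow> A ** minv A = mat 1"
  by (simp_all add: minv_def adj_mult matrix_scalar_ac flip: scalar_matrix_assoc)

lemma minv_mv: "det A \<noteq> 0 \<Longrightarrow> minv A *v (A *v x) = x" "det A \<noteq> 0 \<Longrightarrow> A *v (minv A *v x) = x"
  by (simp_all add: matrix_vector_mul_assoc minv)

lemma sfield_minv [sfield_intros]: "sfield Q A \<Longrightarrow> (\<And>p. det (A p) \<noteq> 0) \<Longrightarrow> sfield Q (\<lambda>p. minv (A p))"
  unfolding minv_def by (intro sfield_intros)

lemma smooth_grad [smooth_intros]: "smooth u \<Longrightarrow> smooth (grad u)"
  unfolding grad_def[abs_def] by (intro smooth_intros)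

lemma sfield_grad [sfield_intros]: "sfield Per u \<Longrightarrow> sfield Per (grad u)"
  "sfield (Slab t0 t1) u \<Longrightarrow> sfield (Slab t0 t1) (grad u)"
  unfolding grad_def[abs_def] by (intro sfield_intros, assumption)+

lemma smooth_dvg [smooth_intros]: "smooth M \<Longrightarrow> smooth (dvg M)"
  unfolding dvg_def[abs_def] by (intro smooth_intros)

lemma sfield_dvg [sfield_intros]: "sfield Per M \<Longrightarrow> sfield Per (dvg M)"
  "sfield (Slab t0 t1) M \<Longrightarrow> sfield (Slab t0 t1) (dvg M)"
  unfolding dvg_def[abs_def] by (intro sfield_intros, assumption)+

lemma dvg_add: "smooth A \<Longrightarrow> smooth B \<Longrightarrow> dvg (\<lambda>p. A p + B p) p = dvg A p + dvg B p"
  by (simp add: dvg_def vec_eq_iff pd_add smooth_differentiable sum.distrib)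

lemma dvg_scaleR: "smooth A \<Longrightarrow> dvg (\<lambda>p. c *\<^sub>R A p) p = c *\<^sub>R dvg A p"
  by (simp add: dvg_def vec_eq_iff pd_linear[OF bounded_linear_scaleR_right] smooth_differentiable sum_distrib_left)

lemma dvg_sum: "(\<And>i. i \<in> I \<Longrightarrow> smooth (A i)) \<Longrightarrow> dvg (\<lambda>p. \<Sum>i\<in>I. A i p) p = (\<Sum>i\<in>I. dvg (A i) p)"
  by (simp add: dvg_def vec_eq_iff pd_sum smooth_differentiable sum_component sum.swap[of _ UNIV])

lemma dvg_mm:
  fixes A K :: "pt \<Rightarrow> mat2"
  assumes "smooth A" "smooth K"
  shows "dvg (\<lambda>p. A p ** K p) p = A p *v dvg K p +
    (\<chi> i. \<Sum>j\<in>UNIV. \<Sum>l\<in>UNIV. pd (dx j) A p $ i $ l * K p $ l $ j)"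
proof -
  have "pd v (\<lambda>p. A p ** K p) p = A p ** pd v K p + pd v A p ** K p" for v
    by (rule pd_bilinear[OF bounded_bilinear_mm]) (use assms smooth_differentiable in auto)
  then show ?thesis
    by (simp add: dvg_def vec_eq_iff forall_2 matrix_matrix_mult_def matrix_vector_mult_def sum_2 algebra_simps)
qed

text \<open>Each row of the cofactor matrix is, up to a constant, a rotated gradient of a component
  of \<open>u\<close>, and the divergence of a rotated gradient is a commutator of second
  derivatives.\<close>

lemma piola:
  assumes u: "smooth u"
  shows "dvg (\<lambda>p. transpose (adj (mat 1 + grad u p))) p = 0"
proof -
  have s: "smooth (\<lambda>p. transpose (adj (mat 1 + grad u p)))"
    by (intro smooth_linear[OF bounded_linear_transpose] smooth_intros u)
  have d: "pd v (\<lambda>p. pd w u p $ i) p = pd v (pd w u) p $ i" for v w i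
    by (rule pd_vec_nth[OF smooth_differentiable[OF smooth_pd[OF u]]])
  have e: "pd v (\<lambda>p. 1 + f p) p = pd v f p" "pd v (\<lambda>p. - f p) p = - pd v f p" if "smooth f" for f :: "pt \<Rightarrow> real" and v
    using that pd_add[of "\<lambda>_. 1" p f v] pd_diff[of "\<lambda>_. 0" p f v] by (simp_all add: smooth_differentiable)
  show ?thesis
    unfolding vec_eq_iff forall_2 dvg_nth[OF s] sum_2
    by (simp add: transpose_def adj_nth grad_def mat_def e smooth_intros u d pd_commute[OF u, of "dx 2" "dx 1"])
qed

lemma grad_mv:
  assumes "smooth u" shows "grad u p *v v = pd (0, v) u p"
proof -
  have v: "(0, v) = v $ 1 *\<^sub>R dx 1 + v $ 2 *\<^sub>R dx 2"
    by (simp add: prod_eq_iff vec_eq_iff forall_2)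
  show ?thesis
    by (simp add: v pd_add_dir pd_scaleR_dir assms) (simp add: vec_eq_iff matrix_vector_mult_def sum_2 grad_def algebra_simps)
qed

lemma norm_mv_le: "norm ((A :: mat2) *v x) \<le> 2 * norm A * norm x"
proof -
  have "norm (A *v x) \<le> norm ((A *v x) $ 1) + norm ((A *v x) $ 2)"
    using L2_set_le_sum[of UNIV "\<lambda>i. norm ((A *v x)$i)"] by (simp add: norm_vec_def sum_2)
  also have "norm ((A *v x) $ i) \<le> norm A * norm x" for i
    using Cauchy_Schwarz_ineq2[of "A$i" x] mult_right_mono[OF Finite_Cartesian_Product.norm_nth_le[where x = A and i = i], of "norm x"]
    by (simp add: matrix_vector_mul_component)
  then have "norm ((A *v x) $ 1) + norm ((A *v x) $ 2) \<le> norm A * norm x + norm A * norm x"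
    by (rule add_mono) fact
  finally show ?thesis by (simp add: mult_ac)
qed

text \<open>\<open>(3/4)^2 - (1/4)^2 = 1/2\<close>. The bound 1/4 on the strain is the standing
  condition that keeps the deformation invertible, with a uniformly bounded inverse.\<close>

lemma det_near_identity:
  assumes "norm G \<le> 1/4" shows "det (mat 1 + G :: mat2) \<ge> 1/2"
proof -
  have g: "\<bar>G$i$j\<bar> \<le> 1/4" for i j using entry_le_norm[of G i j] assms by simp
  have "(3/4) * (3/4) \<le> (1 + G$1$1) * (1 + G$2$2)"
    using g[of 1 1] g[of 2 2] by (intro mult_mono) auto
  moreover have "\<bar>G$1$2 * G$2$1\<bar> \<le> 1/4 * (1/4)"
    unfolding abs_mult using g[of 1 2] g[of 2 1] by (intro mult_mono) auto
  ultimately show ?thesis by (simp add: det_2 mat_def)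
qed

section \<open>Symmetric inverse divergence on the deformed torus\<close>

definition mean :: "(pt \<Rightarrow> 'b::euclidean_space) \<Rightarrow> pt \<Rightarrow> 'b" where
  "mean f = avg 1 (avg 2 f)"

lemma avg_dvg_zero:
  assumes "sfield Per M"
  shows "mean (dvg M) = (\<lambda>p. 0)"
proof -
  have "dvg M p = (\<chi> i. pd (dx 1) M p $ i $ 1) + (\<chi> i. pd (dx 2) M p $ i $ 2)" for p
    by (simp add: dvg_def sum_2 vec_eq_iff)
  moreover have "(\<chi> i. A $ i $ j) = A *v axis j (1::real)" for A :: "mat2" and j
    by (simp add: vec_eq_iff matrix_vector_mult_def axis_def if_distrib sum.delta cong: if_cong)
  ultimately have e: "dvg M = (\<lambda>p. pd (dx 1) M p *v axis 1 1 + pd (dx 2) M p *v axis 2 1)"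
    by (simp add: fun_eq_iff)
  have bl: "bounded_linear (\<lambda>A :: mat2. A *v axis j 1)" for j
    by (rule bounded_bilinear.bounded_linear_left[OF bounded_bilinear_mv])
  note sm = sfield_smooth[OF assms]
  have 2: "avg 2 (dvg M) = (\<lambda>p. pd (dx 1) (avg 2 M) p *v axis 1 1)"
    unfolding e
    by (rule ext, subst avg_add)
      (auto intro!: smooth_linear[OF bl] smooth_pd sm simp: avg_linear[OF smooth_pd[OF sm] bl] pd_avg[OF sm]
        avg_pd_periodic[OF assms])
  show ?thesis
    unfolding mean_def 2
    by (rule ext, subst avg_linear[OF smooth_pd[OF smooth_avg[OF sm]] bl])
      (simp add: avg_pd_periodic[OF sfield_avg[OF assms]])
qed

lemma avg_scaleR_const:
  assumes "smooth c" "\<And>p. pd (dx i) c p = 0" "smooth J"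
  shows "avg i (\<lambda>p. J p *\<^sub>R c p) p = avg i J p *\<^sub>R c p"
  using avg_linear[OF assms(3) bounded_linear_scaleR_left, of i "c p" p]
  by (simp add: avg_def constant_direction[OF assms(1,2)])

lemma mean_scaleR_const:
  assumes "smooth c" "\<And>i p. pd (dx i) c p = 0" "smooth J"
  shows "mean (\<lambda>p. J p *\<^sub>R c p) p = mean J p *\<^sub>R c p"
proof -
  have "avg 2 (\<lambda>p. J p *\<^sub>R c p) = (\<lambda>p. avg 2 J p *\<^sub>R c p)"
    by (intro ext avg_scaleR_const assms)
  then show ?thesis by (simp add: mean_def avg_scaleR_const assms smooth_avg)
qed

lemma avg_lower: "smooth f \<Longrightarrow> (\<And>p. (f p :: real) \<ge> b) \<Longrightarrow> avg i f p \<ge> b"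
  unfolding avg_def
  using integral_le[OF integrable_const_ivl avg_integrable[of f p i], of b] by simp

lemma mean_lower: "smooth f \<Longrightarrow> (\<And>p. (f p :: real) \<ge> b) \<Longrightarrow> mean f p \<ge> b"
  unfolding mean_def by (intro avg_lower smooth_avg)

lemma mean_bound: "smooth f \<Longrightarrow> (\<And>p. norm (f p) \<le> C) \<Longrightarrow> norm (mean f p) \<le> C"
  unfolding mean_def by (rule avg_bound[OF smooth_avg], assumption) (rule avg_bound)

lemma mean_diff: "smooth f \<Longrightarrow> smooth g \<Longrightarrow> mean (\<lambda>p. f p - g p) p = mean f p - mean g p"
proof -
  assume fg: "smooth f" "smooth g"
  have "avg 2 (\<lambda>p. f p - g p) = (\<lambda>p. avg 2 f p - avg 2 g p)" using avg_diff[OF fg] by blast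
  then show ?thesis by (simp add: mean_def avg_diff smooth_avg fg)
qed

lemma sfield_mean: "sfield Per f \<Longrightarrow> sfield Per (mean f)"
  unfolding mean_def by (intro sfield_intros)

lemma pd_mean: "smooth f \<Longrightarrow> pd v (mean f) = mean (pd v f)"
  by (simp add: mean_def pd_avg smooth_avg)

lemma mean_const_dir: "sfield Per f \<Longrightarrow> pd (dx i) (mean f) = (\<lambda>p. 0)"
  using exhaust_2[of i] avg_const_dir[of "avg 2 f" 1] avg_const_dir[of f 2]
  by (auto simp: mean_def sfield_avg pd_avg smooth_avg sfield_smooth)

lemma mean_zero_time: "(\<And>q. fst q = fst p \<Longrightarrow> f q = 0) \<Longrightarrow> mean f p = 0"
  unfolding mean_def by (rule avg_zero_time) (simp add: avg_zero_time)

text \<open>The strain bound 1/4 and the factor 2 in \<open>norm_mv_le\<close> make \<open>u\<close>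
  Lipschitz in space with constant 1/2. So \<open>x = y - u (t, x)\<close> is a contractive fixed
  point equation, whose solution is the inverse map. Its continuity is estimated directly;
  smoothness then follows from \<open>smooth_inverse_function\<close>.\<close>

lemma lagrangian_flow:
  fixes u :: "pt \<Rightarrow> real^2"
  assumes u: "sfield Per u" and G: "\<And>p. norm (grad u p) \<le> 1/4"
  defines "\<Phi> \<equiv> \<lambda>p. (fst p, snd p + u p)"
  obtains \<Psi> where "smooth \<Psi>" "\<And>p. \<Psi> (\<Phi> p) = p" "\<And>p. \<Phi> (\<Psi> p) = p"
    "\<And>p i. \<Psi> (p + (2 * pi) *\<^sub>R dx i) = \<Psi> p + (2 * pi) *\<^sub>R dx i"
proof -
  note sm = sfield_smooth[OF u]
  have lip: "norm (u (t, x) - u (t, y)) \<le> 1/2 * norm (x - y)" for t x y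
  proof (rule differentiable_bound[of UNIV "\<lambda>x. u (t, x)" "\<lambda>x v. pd (0, v) u (t, x)"])
    show "((\<lambda>x. u (t, x)) has_derivative (\<lambda>v. pd (0, v) u (t, x))) (at x within UNIV)" for x
      by (rule has_derivative_compose[where g = u, OF _ smooth_has_derivative[OF sm]])
        (auto intro!: derivative_eq_intros)
    have "norm (grad u p *v v) \<le> 1/2 * norm v" for p v
      using norm_mv_le[of "grad u p" v] mult_right_mono[OF G[of p], of "2 * norm v"] by (simp add: algebra_simps)
    then show "onorm (\<lambda>v. pd (0, v) u (t, x)) \<le> 1/2" for x
      by (intro onorm_bound) (simp_all add: grad_mv[OF sm])
  qed auto
  have ex: "\<exists>!x. y - u (t, x) = x" for t y
    by (rule banach_fix_type[of "1/2"]) (use lip in \<open>auto simp: dist_norm norm_minus_commute\<close>)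
  define \<psi> where "\<psi> q = (THE x. snd q - u (fst q, x) = x)" for q :: pt
  have \<psi>: "snd q - u (fst q, \<psi> q) = \<psi> q" for q unfolding \<psi>_def by (rule theI'[OF ex])
  have \<psi>u: "\<psi> q = x" if "snd q - u (fst q, x) = x" for q x
    using ex[of "snd q" "fst q"] \<psi>[of q] that by auto
  define \<Psi> where "\<Psi> q = (fst q, \<psi> q)" for q :: pt
  have 1: "\<Psi> (\<Phi> p) = p" for p
    by (simp add: \<Psi>_def \<Phi>_def prod_eq_iff) (rule \<psi>u, simp)
  have 2: "\<Phi> (\<Psi> q) = q" for q
    using \<psi>[of q] by (simp add: \<Psi>_def \<Phi>_def prod_eq_iff algebra_simps)
  have 3: "\<Psi> (p + (2 * pi) *\<^sub>R dx i) = \<Psi> p + (2 * pi) *\<^sub>R dx i" for p i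
  proof -
    have "u (fst p, \<psi> p + (2 * pi) *\<^sub>R axis i 1) = u (fst p, \<psi> p)"
      using sfield_shift[OF u, of "(fst p, \<psi> p)" i] by (simp add: dx_def)
    then have "\<psi> (p + (2 * pi) *\<^sub>R dx i) = \<psi> p + (2 * pi) *\<^sub>R axis i 1"
      using \<psi>[of p] by (intro \<psi>u) (simp add: dx_def algebra_simps)
    then show ?thesis by (simp add: \<Psi>_def dx_def prod_eq_iff)
  qed
  have cont: "continuous_on UNIV \<psi>"
    unfolding continuous_on_eq_continuous_at[OF open_UNIV]
  proof (intro ballI)
    fix q
    \<comment> \<open>The factor 2 absorbs the Lipschitz term: the distance of two solutions is at
      most half of itself plus the two data terms.\<close>
    define R where "R q' = 2 * (norm (snd q' - snd q) + norm (u (fst q', \<psi> q) - u (fst q, \<psi> q)))" for q'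
    have "continuous_on UNIV (\<lambda>q'. u (fst q', \<psi> q))"
      by (rule continuous_on_compose2[OF smooth_continuous_on[OF sm, of UNIV]]) (auto intro!: continuous_intros)
    then have "continuous_on UNIV R" unfolding R_def by (intro continuous_intros)
    then have "(R \<longlongrightarrow> R q) (at q)"
      by (simp add: continuous_on_eq_continuous_at continuous_at)
    moreover have "R q = 0" by (simp add: R_def)
    ultimately have R: "(R \<longlongrightarrow> 0) (at q)" by simp
    have "norm (\<psi> q' - \<psi> q) \<le> R q'" for q'
    proof -
      have "\<psi> q' - \<psi> q = (snd q' - snd q) - (u (fst q', \<psi> q') - u (fst q', \<psi> q)) - (u (fst q', \<psi> q) - u (fst q, \<psi> q))"
        using \<psi>[of q] \<psi>[of q'] by (simp add: algebra_simps)
      then have "norm (\<psi> q' - \<psi> q) \<le> norm (snd q' - snd q) + norm (u (fst q', \<psi> q') - u (fst q', \<psi> q))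
          + norm (u (fst q', \<psi> q) - u (fst q, \<psi> q))"
        using norm_triangle_ineq4[of "snd q' - snd q" "u (fst q', \<psi> q') - u (fst q', \<psi> q)"]
          norm_triangle_ineq4[of "(snd q' - snd q) - (u (fst q', \<psi> q') - u (fst q', \<psi> q))" "u (fst q', \<psi> q) - u (fst q, \<psi> q)"]
        by simp
      with lip[of "fst q'" "\<psi> q'" "\<psi> q"] show ?thesis by (simp add: R_def)
    qed
    then have "(\<psi> \<longlongrightarrow> \<psi> q) (at q)"
      by (intro Lim_null_comparison[OF _ R, THEN Lim_null[THEN iffD2]]) (auto intro!: always_eventually)
    then show "isCont \<psi> q" by (simp add: continuous_at)
  qed
  have det: "det (mat 1 + grad u p) \<noteq> 0" for p using det_near_identity[OF G[of p]] by linarith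
  \<comment> \<open>The inverse of the derivative of the space-time map keeps the time component,
    removes the transport \<open>fst h *\<^sub>R pd dt u p\<close> and then inverts the spatial
    part.\<close>
  have "smooth \<Psi>"
  proof (rule smooth_inverse_function(1)[of \<Phi> \<Psi> "\<lambda>p h. (fst h, minv (mat 1 + grad u p) *v (snd h - fst h *\<^sub>R pd dt u p))"])
    show "smooth \<Phi>" unfolding \<Phi>_def by (intro smooth_intros sm)
    show "\<Phi> (\<Psi> y) = y" for y by (rule 2)
    show "continuous_on UNIV \<Psi>" unfolding \<Psi>_def[abs_def] by (intro continuous_intros cont)
    show "smooth (\<lambda>p. (fst v, minv (mat 1 + grad u p) *v (snd v - fst v *\<^sub>R pd dt u p)))" for v
      unfolding minv_def by (intro smooth_intros smooth_const sm det)
    show "bounded_linear (\<lambda>h. (fst h, minv (mat 1 + grad u p) *v (snd h - fst h *\<^sub>R pd dt u p)))" for p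
      by (intro bounded_linear_Pair bounded_linear_fst
          bounded_linear_compose[OF bounded_bilinear.bounded_linear_right[OF bounded_bilinear_mv]]
          bounded_linear_sub bounded_linear_snd bounded_linear_compose[OF bounded_linear_scaleR_left])
    show "(fst (pd v \<Phi> p), minv (mat 1 + grad u p) *v (snd (pd v \<Phi> p) - fst (pd v \<Phi> p) *\<^sub>R pd dt u p)) = v" for p v
    proof -
      have "(\<Phi> has_derivative (\<lambda>h. (fst h, snd h + pd h u p))) (at p)"
        unfolding \<Phi>_def
        by (intro has_derivative_Pair has_derivative_add smooth_has_derivative sm bounded_linear_imp_has_derivative
            bounded_linear_fst bounded_linear_snd)
      then have pd: "pd v \<Phi> p = (fst v, snd v + pd v u p)" by (rule pd_eqI)
      have "v = fst v *\<^sub>R dt + (0, snd v)" by (simp add: prod_eq_iff)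
      then have "pd v u p = fst v *\<^sub>R pd dt u p + grad u p *v snd v"
        using pd_add_dir[OF sm, of "fst v *\<^sub>R dt" "(0, snd v)" p] by (simp add: pd_scaleR_dir sm grad_mv)
      then have "snd (pd v \<Phi> p) - fst (pd v \<Phi> p) *\<^sub>R pd dt u p = (mat 1 + grad u p) *v snd v"
        by (simp add: pd matrix_vector_mult_add_rdistrib)
      then show ?thesis by (simp add: pd minv_mv det)
    qed
  qed
  then show ?thesis using that 1 2 3 by blast
qed

text \<open>The datum is carried to the deformed torus and divided by the Jacobian, the flat problem
  is solved there, and its solution is pulled back from both sides by the adjugate and its
  transpose, which keeps it symmetric. Multiplied by \<open>F\<close>, the result is the flat
  solution times the cofactor matrix, so Piola's identity yields the Jacobian times the flat
  divergence. \<open>K\<close> is uniform over all displacements with strain at most 1/4; this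
  matters because it will be applied to displacements that oscillate ever faster.\<close>

lemma lagrangian_inverse_divergence:
  obtains K where "K > 0" "\<And>u f M. sfield Per u \<Longrightarrow> (\<And>p. norm (grad u p) \<le> 1/4) \<Longrightarrow>
     sfield Per f \<Longrightarrow> (\<And>p. norm (f p) \<le> M) \<Longrightarrow> mean f = (\<lambda>p. 0) \<Longrightarrow>
     \<exists>S. sfield Per S \<and> (\<forall>p. transpose (S p) = S p) \<and> (\<forall>p. norm (S p) \<le> K * M) \<and>
       (\<forall>p. dvg (\<lambda>p. (mat 1 + grad u p) ** S p) p = f p) \<and>
       (\<forall>p. (\<forall>q. fst q = fst p \<longrightarrow> f q = 0) \<longrightarrow> S p = 0)"
proof -
  obtain B where B: "B > 0" "\<And>A C. norm ((A :: mat2) ** (C :: mat2)) \<le> norm A * norm C * B"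
    using bounded_bilinear.pos_bounded[OF bounded_bilinear_mm] by blast
  define N :: real where "N = 8"
  \<comment> \<open>2 for the inverse Jacobian, \<open>N\<close> for each of the two adjugates,
    \<open>24 * pi * 2\<close> for the flat solution with a datum of size \<open>2 * M\<close>, and
    \<open>B\<close> for each of the two matrix products.\<close>
  define K where "K = 2 * (N * (24 * pi * 2) * B * N * B)"
  have K: "K > 0" unfolding K_def N_def using B by simp
  have Nadj: "norm (adj (mat 1 + G)) \<le> N \<and> norm (transpose (adj (mat 1 + G))) \<le> N" if "norm G \<le> 1/4" for G
  proof -
    have g: "\<bar>G$i$j\<bar> \<le> 1/4" for i j using entry_le_norm[of G i j] that by simp
    have 8: "norm A \<le> 8" if "\<bar>A$1$1\<bar> \<le> 2" "\<bar>A$1$2\<bar> \<le> 2" "\<bar>A$2$1\<bar> \<le> 2" "\<bar>A$2$2\<bar> \<le> 2" for A :: "mat2"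
      using order_trans[OF norm_mat_le add_mono[OF add_mono[OF add_mono[OF that(1,2)] that(3)] that(4)]] by simp
    have a: "\<bar>1 + G$i$i\<bar> \<le> 2" "\<bar>G$i$j\<bar> \<le> 2" for i j using g[of i i] g[of i j] by (auto simp: abs_le_iff)
    show ?thesis
      unfolding N_def by (intro conjI 8) (simp_all add: adj_nth mat_def transpose_def a)
  qed
  have "\<exists>S. sfield Per S \<and> (\<forall>p. transpose (S p) = S p) \<and> (\<forall>p. norm (S p) \<le> K * M) \<and>
       (\<forall>p. dvg (\<lambda>p. (mat 1 + grad u p) ** S p) p = f p) \<and>
       (\<forall>p. (\<forall>q. fst q = fst p \<longrightarrow> f q = 0) \<longrightarrow> S p = 0)"
    if u: "sfield Per u" and G: "\<And>p. norm (grad u p) \<le> 1/4" and f: "sfield Per f"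
      and M: "\<And>p. norm (f p) \<le> M" and m0: "mean f = (\<lambda>p. 0)" for u f M
  proof -
    define \<Phi> where "\<Phi> p = (fst p, snd p + u p)" for p
    define F where "F p = mat 1 + grad u p" for p
    define J where "J p = det (F p)" for p
    have sF: "sfield Per F" unfolding F_def by (intro sfield_intros u)
    have sJ: "sfield Per J" unfolding J_def by (intro sfield_intros sF)
    have J: "J p \<ge> 1/2" for p unfolding J_def F_def by (rule det_near_identity[OF G])
    then have Jnz: "J p \<noteq> 0" for p by (metis not_one_le_zero linorder_not_le zero_less_divide_1_iff zero_less_numeral less_le_not_le)
    obtain \<Psi> where \<Psi>: "smooth \<Psi>" "\<And>p. \<Psi> (\<Phi> p) = p" "\<And>p. \<Phi> (\<Psi> p) = p"
      "\<And>p i. \<Psi> (p + (2 * pi) *\<^sub>R dx i) = \<Psi> p + (2 * pi) *\<^sub>R dx i"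
      using lagrangian_flow[OF u G] unfolding \<Phi>_def by metis
    have fst\<Phi>: "fst (\<Phi> p) = fst p" for p by (simp add: \<Phi>_def)
    have fst\<Psi>: "fst (\<Psi> p) = fst p" for p using fst\<Phi>[of "\<Psi> p"] \<Psi>(3) by simp
    have s\<Phi>: "smooth \<Phi>" unfolding \<Phi>_def[abs_def] by (intro smooth_intros sfield_smooth[OF u])
    define g where "g q = inverse (J (\<Psi> q)) *\<^sub>R f (\<Psi> q)" for q
    have h: "sfield Per (\<lambda>p. inverse (J p) *\<^sub>R f p)" by (intro sfield_intros sJ f Jnz)
    have sg: "sfield Per g"
      using smooth_compose[OF sfield_smooth[OF h] \<Psi>(1)] sfield_shift[OF h] by (simp add: sfield_Per g_def[abs_def] \<Psi>(4))
    have Mg: "norm (g q) \<le> 2 * M" for q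
    proof -
      have "inverse (J (\<Psi> q)) \<le> 2" using J[of "\<Psi> q"] by (simp add: field_simps)
      moreover have "0 < inverse (J (\<Psi> q))" using J[of "\<Psi> q"] by simp
      ultimately show ?thesis unfolding g_def using M[of "\<Psi> q"]
        by (simp add: mult_mono order_trans[OF norm_ge_zero M])
    qed
    obtain T c where T: "sfield Per T" "\<And>p. transpose (T p) = T p" "\<And>p. norm (T p) \<le> 24 * pi * (2 * M)"
      "\<And>p. dvg T p = g p - c p" "smooth c" "\<And>i p. pd (dx i) c p = 0"
      "\<And>p. (\<And>q. fst q = fst p \<Longrightarrow> g q = 0) \<Longrightarrow> T p = 0"
      using flat_inverse_divergence[OF sg Mg] by blast
    define T' where "T' p = T (\<Phi> p)" for p
    have sT': "sfield Per T'"
    proof -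
      have "\<Phi> (p + (2 * pi) *\<^sub>R dx i) = \<Phi> p + (2 * pi) *\<^sub>R dx i" for p i
        using sfield_shift[OF u, of p i] by (simp add: \<Phi>_def prod_eq_iff)
      then show ?thesis
        using smooth_compose[OF sfield_smooth[OF T(1)] s\<Phi>] sfield_shift[OF T(1)]
        by (simp add: sfield_Per T'_def[abs_def])
    qed
    define Kf where "Kf p = transpose (adj (F p))" for p
    have sK: "sfield Per Kf" unfolding Kf_def by (intro sfield_intros sF)
    define S where "S p = inverse (J p) *\<^sub>R (adj (F p) ** T' p ** Kf p)" for p
    have sS: "sfield Per S" unfolding S_def by (intro sfield_intros sJ Jnz sF sT' sK)
    have FS: "F p ** S p = T' p ** Kf p" for p
    proof -
      have "F p ** S p = inverse (J p) *\<^sub>R ((F p ** adj (F p)) ** (T' p ** Kf p))"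
        by (simp add: S_def matrix_mul_assoc matrix_scalar_ac flip: scalar_matrix_assoc)
      then show ?thesis using Jnz[of p] by (simp add: adj_mult flip: scalar_matrix_assoc J_def)
    qed
    have pdT': "pd (dx j) T' p = (\<Sum>m\<in>UNIV. F p $ m $ j *\<^sub>R pd (dx m) T (\<Phi> p))" for j p
    proof -
      have "(\<Phi> has_derivative (\<lambda>h. (fst h, snd h + pd h u p))) (at p)"
        unfolding \<Phi>_def
        by (intro has_derivative_Pair has_derivative_add smooth_has_derivative sfield_smooth[OF u] bounded_linear_imp_has_derivative
            bounded_linear_fst bounded_linear_snd)
      then have "pd (dx j) \<Phi> p = (fst (dx j), snd (dx j) + pd (dx j) u p)" by (rule pd_eqI)
      also have "\<dots> = (\<Sum>m\<in>UNIV. F p $ m $ j *\<^sub>R dx m)"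
        by (auto simp: sum_2 prod_eq_iff vec_eq_iff forall_2 F_def mat_def grad_def)
      finally have e: "pd (dx j) \<Phi> p = (\<Sum>m\<in>UNIV. F p $ m $ j *\<^sub>R dx m)" .
      have "pd (dx j) T' p = pd (pd (dx j) \<Phi> p) T (\<Phi> p)"
        unfolding T'_def[abs_def] by (intro pd_chain smooth_differentiable s\<Phi> sfield_smooth[OF T(1)])
      then show ?thesis
        unfolding e by (simp add: sum_2 pd_add_dir pd_scaleR_dir sfield_smooth[OF T(1)])
    qed
    have Kn: "Kf p $ 1 $ 1 = F p $ 2 $ 2" "Kf p $ 1 $ 2 = - F p $ 2 $ 1" "Kf p $ 2 $ 1 = - F p $ 1 $ 2" "Kf p $ 2 $ 2 = F p $ 1 $ 1" for p
      by (simp_all add: Kf_def transpose_def adj_nth)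
    \<comment> \<open>Piola's identity removes the derivatives of \<open>Kf\<close>; the chain rule
      for \<open>T'\<close> produces a factor \<open>F\<close>, and \<open>F ** adj F\<close> is the
      Jacobian times the identity.\<close>
    have "dvg (\<lambda>p. F p ** S p) p = J p *\<^sub>R dvg T (\<Phi> p)" for p
    proof -
      have "dvg Kf p = 0" using piola[OF sfield_smooth[OF u]] by (simp add: Kf_def[abs_def] F_def[abs_def])
      then have "dvg (\<lambda>p. F p ** S p) p = (\<chi> i. \<Sum>j\<in>UNIV. \<Sum>l\<in>UNIV. pd (dx j) T' p $ i $ l * Kf p $ l $ j)"
        unfolding FS by (simp add: dvg_mm[OF sfield_smooth[OF sT'] sfield_smooth[OF sK]])
      also have "\<dots> = J p *\<^sub>R dvg T (\<Phi> p)"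
        by (simp add: vec_eq_iff forall_2 sum_2 pdT' Kn dvg_def J_def det_2 algebra_simps)
      finally show ?thesis .
    qed
    then have d1: "dvg (\<lambda>p. F p ** S p) p = f p - J p *\<^sub>R c (\<Phi> p)" for p
      using Jnz[of p] by (simp add: T(4) g_def \<Psi>(2) scaleR_diff_right)
    have c\<Phi>: "c (\<Phi> p) = c p" for p
    proof -
      have "\<Phi> p = p + (u p $ 1) *\<^sub>R dx 1 + (u p $ 2) *\<^sub>R dx 2"
        by (auto simp: \<Phi>_def prod_eq_iff vec_eq_iff forall_2)
      then show ?thesis by (simp add: constant_direction[OF T(5,6)])
    qed
    \<comment> \<open>\<open>f\<close> and every divergence have zero mean, and \<open>c\<close>
      depends on time only. So \<open>mean J p *\<^sub>R c p\<close> vanishes, while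
      \<open>mean J\<close> is at least 1/2.\<close>
    have c0: "c p = 0" for p
    proof -
      have "0 = mean (dvg (\<lambda>p. F p ** S p)) p"
        by (subst avg_dvg_zero) (auto intro!: sfield_intros sF sS)
      also have "dvg (\<lambda>p. F p ** S p) = (\<lambda>p. f p - J p *\<^sub>R c p)" using d1 c\<Phi> by auto
      also have "mean \<dots> p = - (mean J p *\<^sub>R c p)"
        using sfield_smooth[OF f] sfield_smooth[OF sJ] T(5)
        by (subst mean_diff) (auto intro!: smooth_intros simp: m0 mean_scaleR_const T(6))
      finally have "mean J p *\<^sub>R c p = 0" by simp
      moreover have "mean J p \<ge> 1/2" by (rule mean_lower[OF sfield_smooth[OF sJ] J])
      ultimately show ?thesis by auto
    qed
    have "transpose (S p) = S p" for p
      using T(2)[of "\<Phi> p"]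
      by (simp add: S_def T'_def Kf_def transpose_scalar matrix_transpose_mul transpose_transpose matrix_mul_assoc)
    moreover have "norm (S p) \<le> K * M" for p
    proof -
      have M0: "M \<ge> 0" using M[of p] norm_ge_zero by (rule order_trans[rotated])
      have "norm (adj (F p) ** T' p ** Kf p) \<le> (N * (24 * pi * (2 * M)) * B) * N * B"
      proof -
        have a: "norm (adj (F p)) \<le> N" "norm (Kf p) \<le> N" unfolding Kf_def F_def using Nadj[OF G] by auto
        have "norm (adj (F p) ** T' p) \<le> N * (24 * pi * (2 * M)) * B"
          unfolding T'_def
          by (rule order_trans[OF B(2) mult_right_mono[OF mult_mono[OF a(1) T(3)]]]) (use B(1) in \<open>auto simp: N_def\<close>)
        then show ?thesis
          by (rule order_trans[OF B(2) mult_right_mono[OF mult_mono[OF _ a(2)]]]) (use B(1) M0 in \<open>auto simp: N_def\<close>)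
      qed
      moreover have "\<bar>inverse (J p)\<bar> \<le> 2" using J[of p] by (simp add: field_simps)
      ultimately have "norm (S p) \<le> 2 * ((N * (24 * pi * (2 * M)) * B) * N * B)"
        unfolding S_def norm_scaleR using mult_mono by (metis abs_ge_zero norm_ge_zero zero_le_numeral)
      then show ?thesis by (simp add: K_def algebra_simps)
    qed
    moreover have "dvg (\<lambda>p. (mat 1 + grad u p) ** S p) p = f p" for p
      using d1[of p] by (simp add: c\<Phi> c0 F_def)
    moreover have "S p = 0" if "\<forall>q. fst q = fst p \<longrightarrow> f q = 0" for p
    proof -
      have "T (\<Phi> p) = 0"
        by (rule T(7)) (use that in \<open>simp add: g_def fst\<Psi> fst\<Phi>\<close>)
      then show ?thesis by (simp add: S_def T'_def)
    qed
    ultimately show ?thesis using sS by blast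
  qed
  then show ?thesis using K that by blast
qed

section \<open>Expansion of the stress\<close>

definition outer :: "real^2 \<Rightarrow> real^2 \<Rightarrow> mat2" where
  "outer v w = (\<chi> i j. v $ i * w $ j)"

definition perp :: "real^2 \<Rightarrow> real^2" where
  "perp k = (\<chi> i. if i = 1 then - k $ 2 else k $ 1)"

lemma perp_nth [simp]: "perp k $ 1 = - k $ 2" "perp k $ 2 = k $ 1"
  by (simp_all add: perp_def)

lemma inner_2: "(x :: real^2) \<bullet> y = x $ 1 * y $ 1 + x $ 2 * y $ 2"
  by (simp add: inner_vec_def sum_2)

lemma outer_nth [simp]: "outer v w $ i $ j = v $ i * w $ j"
  by (simp add: outer_def)

lemma bounded_bilinear_outer: "bounded_bilinear outer"
  unfolding bilinear_conv_bounded_bilinear[symmetric] bilinear_def linear_iff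
  by (simp add: vec_eq_iff algebra_simps)

lemma smooth_outer [smooth_intros]: "smooth f \<Longrightarrow> smooth g \<Longrightarrow> smooth (\<lambda>p. outer (f p) (g p))"
  by (rule smooth_bilinear[OF bounded_bilinear_outer])

lemma sfield_outer [sfield_intros]: "sfield Q f \<Longrightarrow> sfield Q g \<Longrightarrow> sfield Q (\<lambda>p. outer (f p) (g p))"
  by (rule sfield_bilinear[OF bounded_bilinear_outer])

lemma smooth_transpose [smooth_intros]: "smooth A \<Longrightarrow> smooth (\<lambda>p. transpose (A p) :: mat2)"
  by (rule smooth_linear[OF bounded_linear_transpose])

lemma smooth_trace [smooth_intros]: "smooth A \<Longrightarrow> smooth (\<lambda>p. trace (A p :: mat2))"
  unfolding trace_def by (intro smooth_intros)

lemma outer_mv: "outer v w *v x = (w \<bullet> x) *\<^sub>R v"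
  by (simp add: vec_eq_iff matrix_vector_mult_def sum_2 inner_2 forall_2 algebra_simps)

lemma mm_outer: "A ** outer v w = outer (A *v v) w"
  by (simp add: vec_eq_iff matrix_matrix_mult_def matrix_vector_mult_def sum_2 forall_2 algebra_simps)

lemma outer_mm: "outer v w ** A = outer v (transpose A *v w)"
  by (simp add: vec_eq_iff matrix_matrix_mult_def matrix_vector_mult_def transpose_def sum_2 forall_2 algebra_simps)

lemma mm_mv: "((A :: mat2) ** (B :: mat2)) *v x = A *v (B *v x)"
  by (simp add: matrix_vector_mul_assoc)

text \<open>The polar form of the determinant:
  \<open>det (A + B) = det A + pol A B + det B\<close>.\<close>

definition pol :: "mat2 \<Rightarrow> mat2 \<Rightarrow> real" where
  "pol A B = A$1$1 * B$2$2 + A$2$2 * B$1$1 - A$1$2 * B$2$1 - A$2$1 * B$1$2"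

lemma smooth_pol [smooth_intros]: "smooth A \<Longrightarrow> smooth B \<Longrightarrow> smooth (\<lambda>p. pol (A p) (B p))"
  unfolding pol_def by (intro smooth_intros)

text \<open>Coefficients of the expansion of the strain tensors along
  \<open>G + s *\<^sub>R N\<close>, with 1 and 2 for the first and second order. \<open>e1\<close>,
  \<open>e2\<close> and \<open>mM\<close> below are the difference quotients of \<open>j1\<close>,
  \<open>j2\<close> and \<open>cM\<close>. All are polynomial in \<open>s\<close>, so the expansions
  are identities and remain meaningful at \<open>s = 0\<close>.\<close>

definition C1 :: "mat2 \<Rightarrow> mat2 \<Rightarrow> mat2" where
  "C1 G N = N + transpose N + N ** transpose G + G ** transpose N"

definition C2 :: "mat2 \<Rightarrow> mat2" where
  "C2 N = N ** transpose N"

definition D1 :: "mat2 \<Rightarrow> mat2 \<Rightarrow> mat2" where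
  "D1 G N = N + transpose N + transpose N ** G + transpose G ** N"

definition D2 :: "mat2 \<Rightarrow> mat2" where
  "D2 N = transpose N ** N"

definition e1 :: "mat2 \<Rightarrow> mat2 \<Rightarrow> real \<Rightarrow> real" where
  "e1 G N s = trace (C1 G N) + s * trace (C2 N)"

definition z2 :: "mat2 \<Rightarrow> mat2 \<Rightarrow> real \<Rightarrow> real" where
  "z2 G N s = pol (C_mat G) (C2 N) + det (C1 G N) + s * pol (C1 G N) (C2 N) + s\<^sup>2 * det (C2 N)"

definition e2 :: "mat2 \<Rightarrow> mat2 \<Rightarrow> real \<Rightarrow> real" where
  "e2 G N s = pol (C_mat G) (C1 G N) + s * z2 G N s"

definition cM :: "mat2 \<Rightarrow> mat2" where
  "cM G = trace (C_mat G) *\<^sub>R mat 1 - D_mat G"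

definition mM :: "mat2 \<Rightarrow> mat2 \<Rightarrow> real \<Rightarrow> mat2" where
  "mM G N s = e1 G N s *\<^sub>R mat 1 - (D1 G N + s *\<^sub>R D2 N)"

definition zM :: "mat2 \<Rightarrow> mat2" where
  "zM N = trace (C2 N) *\<^sub>R mat 1 - D2 N"

lemmas mat_defs = C_mat_def D_mat_def C1_def C2_def D1_def D2_def trace_def transpose_def
  matrix_matrix_mult_def sum_2 mat_def

lemma C_mat_expand: "C_mat (G + s *\<^sub>R N) = C_mat G + s *\<^sub>R C1 G N + s\<^sup>2 *\<^sub>R C2 N"
  by (simp add: mat_defs vec_eq_iff forall_2 algebra_simps power2_eq_square)

lemma D_mat_expand: "D_mat (G + s *\<^sub>R N) = D_mat G + s *\<^sub>R (D1 G N + s *\<^sub>R D2 N)"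
  by (simp add: mat_defs vec_eq_iff forall_2 algebra_simps power2_eq_square)

lemma j1_expand: "j1 (G + s *\<^sub>R N) = j1 G + s * e1 G N s"
  unfolding j1_def C_mat_expand e1_def
  by (simp add: trace_def sum_2 algebra_simps power2_eq_square)

lemma j2_expand: "j2 (G + s *\<^sub>R N) = j2 G + s * e2 G N s"
  unfolding j2_def C_mat_expand e2_def z2_def
  by (simp add: det_2 pol_def algebra_simps power2_eq_square)

lemma cM_expand: "cM (G + s *\<^sub>R N) = cM G + s *\<^sub>R mM G N s"
  using j1_expand[of G s N]
  by (simp add: cM_def mM_def D_mat_expand j1_def algebra_simps)

lemma
  assumes G: "smooth G"
  shows smooth_C_mat [smooth_intros]: "smooth (\<lambda>p. C_mat (G p))"
    and smooth_D_mat [smooth_intros]: "smooth (\<lambda>p. D_mat (G p))"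
    and smooth_j1 [smooth_intros]: "smooth (\<lambda>p. j1 (G p))"
    and smooth_j2 [smooth_intros]: "smooth (\<lambda>p. j2 (G p))"
    and smooth_cM [smooth_intros]: "smooth (\<lambda>p. cM (G p))"
    and smooth_C2 [smooth_intros]: "smooth (\<lambda>p. C2 (G p))"
    and smooth_D2 [smooth_intros]: "smooth (\<lambda>p. D2 (G p))"
    and smooth_zM [smooth_intros]: "smooth (\<lambda>p. zM (G p))"
  unfolding j1_def j2_def cM_def zM_def C_mat_def D_mat_def C2_def D2_def
  by (intro smooth_intros smooth_const G)+

lemma
  assumes G: "smooth G" and N: "smooth N"
  shows smooth_C1 [smooth_intros]: "smooth (\<lambda>p. C1 (G p) (N p))"
    and smooth_D1 [smooth_intros]: "smooth (\<lambda>p. D1 (G p) (N p))"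
  unfolding C1_def D1_def by (intro smooth_intros G N)+

lemma
  assumes G: "smooth G" and N: "smooth N" and s: "smooth s"
  shows smooth_e1 [smooth_intros]: "smooth (\<lambda>p. e1 (G p) (N p) (s p))"
    and smooth_e2 [smooth_intros]: "smooth (\<lambda>p. e2 (G p) (N p) (s p))"
    and smooth_mM [smooth_intros]: "smooth (\<lambda>p. mM (G p) (N p) (s p))"
  unfolding mM_def e1_def e2_def z2_def by (intro smooth_intros smooth_const G N s)+

locale material =
  fixes a :: "2 \<Rightarrow> real" and b :: "2 \<Rightarrow> 2 \<Rightarrow> real" and c :: real
  assumes mu_pos: "- 2 * a 2 > 0"
    and lam_pos: "4 * b 1 1 + 4 * a 2 > 0"
    and cubic: "3 * b 1 1 + 2 * c = 0"
    and sig_nz: "2 * b 1 1 + 8 * b 1 2 + 2 * a 2 + 4 * c \<noteq> 0"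
begin

definition sig :: real where "sig = 2 * b 1 1 + 8 * b 1 2 + 2 * a 2 + 4 * c"

definition Sg :: "mat2 \<Rightarrow> mat2" where "Sg = second_PK a b c"

definition l1 :: "mat2 \<Rightarrow> mat2 \<Rightarrow> real \<Rightarrow> real" where
  "l1 G N s = 2 * (b 1 1 * e1 G N s + b 1 2 * e2 G N s + c / 2 * (2 * j1 G * e1 G N s + s * (e1 G N s)\<^sup>2))"

definition l2 :: "mat2 \<Rightarrow> mat2 \<Rightarrow> real \<Rightarrow> real" where
  "l2 G N s = 2 * (b 1 2 * e1 G N s + b 2 2 * e2 G N s)"

text \<open>The derivative of the stress at \<open>G\<close> along \<open>N\<close>, assembled from
  difference quotients at \<open>s = 0\<close>. \<open>ZS\<close> below is the whole remainder
  divided by \<open>s\<^sup>2\<close>; it is again polynomial, hence smooth at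
  \<open>s = 0\<close>.\<close>

definition DS :: "mat2 \<Rightarrow> mat2 \<Rightarrow> mat2" where
  "DS G N = l1 G N 0 *\<^sub>R mat 1 + l2 G N 0 *\<^sub>R cM G + Lambda2 a b G *\<^sub>R mM G N 0"

definition zl1 :: "mat2 \<Rightarrow> mat2 \<Rightarrow> real \<Rightarrow> real" where
  "zl1 G N s = 2 * (b 1 1 * trace (C2 N) + b 1 2 * z2 G N s + c / 2 * (2 * j1 G * trace (C2 N) + (e1 G N s)\<^sup>2))"

definition zl2 :: "mat2 \<Rightarrow> mat2 \<Rightarrow> real \<Rightarrow> real" where
  "zl2 G N s = 2 * (b 1 2 * trace (C2 N) + b 2 2 * z2 G N s)"

definition ZS :: "mat2 \<Rightarrow> mat2 \<Rightarrow> real \<Rightarrow> mat2" where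
  "ZS G N s = zl1 G N s *\<^sub>R mat 1 + zl2 G N s *\<^sub>R cM G + Lambda2 a b G *\<^sub>R zM N
     + l2 G N s *\<^sub>R mM G N s"

lemma Sg_expand: "Sg (G + s *\<^sub>R N) = Sg G + s *\<^sub>R DS G N + s\<^sup>2 *\<^sub>R ZS G N s"
proof -
  have 1: "Lambda1 b c (G + s *\<^sub>R N) = Lambda1 b c G + s * l1 G N s"
    by (simp add: Lambda1_def l1_def j1_expand j2_expand power2_eq_square algebra_simps)
  have 2: "Lambda2 a b (G + s *\<^sub>R N) = Lambda2 a b G + s * l2 G N s"
    by (simp add: Lambda2_def l2_def j1_expand j2_expand algebra_simps)
  have l: "l1 G N s = l1 G N 0 + s * zl1 G N s" "l2 G N s = l2 G N 0 + s * zl2 G N s"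
    by (simp_all add: l1_def l2_def zl1_def zl2_def e1_def e2_def power2_eq_square algebra_simps)
  have m: "mM G N s = mM G N 0 + s *\<^sub>R zM N"
    by (simp add: mM_def zM_def e1_def algebra_simps)
  have S: "Sg G = Lambda1 b c G *\<^sub>R mat 1 + Lambda2 a b G *\<^sub>R cM G" for G
    by (simp add: Sg_def second_PK_def cM_def)
  have "Sg (G + s *\<^sub>R N) = Sg G + s *\<^sub>R (l1 G N s *\<^sub>R mat 1 + l2 G N s *\<^sub>R cM G + Lambda2 a b G *\<^sub>R mM G N s + s *\<^sub>R (l2 G N s *\<^sub>R mM G N s))"
    by (simp add: S 1 2 cM_expand algebra_simps)
  also have "l1 G N s *\<^sub>R mat 1 + l2 G N s *\<^sub>R cM G + Lambda2 a b G *\<^sub>R mM G N s = DS G N + s *\<^sub>R (zl1 G N s *\<^sub>R mat 1 + zl2 G N s *\<^sub>R cM G + Lambda2 a b G *\<^sub>R zM N)"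
    by (simp add: DS_def l m algebra_simps)
  finally show ?thesis
    by (simp add: ZS_def algebra_simps power2_eq_square)
qed

lemma smooth_l1 [smooth_intros]: "smooth G \<Longrightarrow> smooth N \<Longrightarrow> smooth s \<Longrightarrow> smooth (\<lambda>p. l1 (G p) (N p) (s p))"
  unfolding l1_def by (intro smooth_intros smooth_const)

lemma smooth_l2 [smooth_intros]: "smooth G \<Longrightarrow> smooth N \<Longrightarrow> smooth s \<Longrightarrow> smooth (\<lambda>p. l2 (G p) (N p) (s p))"
  unfolding l2_def by (intro smooth_intros smooth_const)

lemma smooth_Lambda1 [smooth_intros]: "smooth G \<Longrightarrow> smooth (\<lambda>p. Lambda1 b c (G p))"
  unfolding Lambda1_def by (intro smooth_intros smooth_const)

lemma smooth_Lambda2 [smooth_intros]: "smooth G \<Longrightarrow> smooth (\<lambda>p. Lambda2 a b (G p))"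
  unfolding Lambda2_def by (intro smooth_intros smooth_const)

lemma smooth_Sg [smooth_intros]: "smooth G \<Longrightarrow> smooth (\<lambda>p. Sg (G p))"
  unfolding Sg_def second_PK_def by (intro smooth_intros smooth_const)

lemma smooth_DS [smooth_intros]: "smooth G \<Longrightarrow> smooth N \<Longrightarrow> smooth (\<lambda>p. DS (G p) (N p))"
  unfolding DS_def by (intro smooth_intros smooth_const)

lemma smooth_ZS [smooth_intros]: "smooth G \<Longrightarrow> smooth N \<Longrightarrow> smooth s \<Longrightarrow> smooth (\<lambda>p. ZS (G p) (N p) (s p))"
  unfolding ZS_def zl1_def zl2_def z2_def by (intro smooth_intros smooth_const)

lemma sfield_Sg [sfield_intros]: "sfield Q G \<Longrightarrow> sfield Q (\<lambda>p. Sg (G p))"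
  by (auto simp: sfield_def intro!: smooth_intros)

lemma sfield_DS [sfield_intros]: "sfield Q G \<Longrightarrow> sfield Q N \<Longrightarrow> sfield Q (\<lambda>p. DS (G p) (N p))"
  by (auto simp: sfield_def intro!: smooth_intros)

lemma Sg_sym: "transpose (Sg G) = Sg G"
  by (simp add: Sg_def second_PK_def mat_defs vec_eq_iff forall_2)

lemma DS_sym: "transpose (DS G N) = DS G N"
  by (simp add: DS_def cM_def mM_def mat_defs vec_eq_iff forall_2) (simp add: algebra_simps)

lemma Sg_zero [simp]: "Sg 0 = 0"
  by (simp add: Sg_def second_PK_def Lambda1_def j1_def j2_def mat_defs vec_eq_iff det_2)

lemma DS_linear: "linear (DS G)"
proof -
  have *: "C1 G (x + y) = C1 G x + C1 G y" "C1 G (r *\<^sub>R x) = r *\<^sub>R C1 G x"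
    "D1 G (x + y) = D1 G x + D1 G y" "D1 G (r *\<^sub>R x) = r *\<^sub>R D1 G x"
    "pol A (x + y) = pol A x + pol A y" "pol A (r *\<^sub>R x) = r * pol A x"
    "trace (x + y) = trace x + trace y" "trace (r *\<^sub>R x) = r * trace x" for x y A :: "mat2" and r
    by (simp_all add: mat_defs pol_def vec_eq_iff algebra_simps)
  show ?thesis
    unfolding linear_iff
    by (simp add: DS_def l1_def l2_def mM_def e1_def e2_def * algebra_simps)
qed

lemma DS_scaleR: "DS G (r *\<^sub>R N) = r *\<^sub>R DS G N"
  by (rule linear_scale[OF DS_linear])

text \<open>The hypothesis \<open>cubic\<close> acts here. Since \<open>(k \<bullet> k) *\<^sub>R
  mat 1 = outer k k + outer (perp k) (perp k)\<close>, the left side has \<open>outer k k\<close>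
  with coefficient \<open>2 * (k \<bullet> k) * (3 * b 1 1 + 2 * c)\<close>, which is 0, and the
  other matrix with coefficient \<open>(k \<bullet> k) * sig\<close>. The term added to
  \<open>ZS\<close> is the value at rest of the correction that occurs in
  \<open>wdef\<close>.\<close>

lemma ZS_at_zero:
  "ZS 0 (outer k k) 0 + (4 * b 1 1 * (k \<bullet> k)) *\<^sub>R outer k k = ((k \<bullet> k) * sig) *\<^sub>R outer (perp k) (perp k)"
proof -
  have c: "c = - (3 * b 1 1 / 2)" using cubic by simp
  show ?thesis
    by (simp add: ZS_def zl1_def zl2_def z2_def l2_def e1_def e2_def cM_def mM_def zM_def Lambda2_def j1_def j2_def
      mat_defs det_2 pol_def vec_eq_iff forall_2 inner_2 sig_def)
      (simp add: c power2_eq_square algebra_simps)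
qed

text \<open>The factors are the squared speeds of longitudinal and transverse waves in the
  undeformed body, \<lambda> + 2 \<mu> and \<mu> in the notation of Lame, times
  \<open>k \<bullet> k\<close> because \<open>k\<close> is not normalised.\<close>

lemma DS_at_zero:
  "DS 0 (outer k k) *v k = (4 * b 1 1 * (k \<bullet> k)) *\<^sub>R k"
  "DS 0 (outer (perp k) k) *v k = (- 2 * a 2 * (k \<bullet> k)) *\<^sub>R perp k"
  by (simp_all add: DS_def l1_def l2_def e1_def e2_def cM_def mM_def Lambda2_def j1_def j2_def
      mat_defs det_2 pol_def vec_eq_iff forall_2 inner_2 matrix_vector_mult_def)
    (simp_all add: algebra_simps)

end

section \<open>Longitudinal plane waves\<close>

context material
begin

text \<open>The acoustic operator without the share of the prestress \<open>Sg G + R\<close>. That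
  share multiplies \<open>v\<close> by a scalar, so it affects the speed but not the polarisation;
  it enters later in \<open>sp\<close>.\<close>

definition aq :: "real^2 \<Rightarrow> real^2 \<Rightarrow> mat2 \<Rightarrow> real^2" where
  "aq k v G = (mat 1 + G) *v (DS G (outer v k) *v k)"

text \<open>Entries of the acoustic operator in the orthogonal basis \<open>k\<close>,
  \<open>perp k\<close>. \<open>ev\<close> is the larger eigenvalue and \<open>nv\<close> the
  eigenvector whose component along \<open>k\<close> is 1; the explicit formulas make the smooth
  dependence on \<open>G\<close> visible.\<close>

definition q11 where "q11 k G = aq k k G \<bullet> k / (k \<bullet> k)"
definition q21 where "q21 k G = aq k k G \<bullet> perp k / (k \<bullet> k)"
definition q12 where "q12 k G = aq k (perp k) G \<bullet> k / (k \<bullet> k)"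
definition q22 where "q22 k G = aq k (perp k) G \<bullet> perp k / (k \<bullet> k)"

definition dsc where "dsc k G = (q11 k G - q22 k G)\<^sup>2 + 4 * q12 k G * q21 k G"

definition ev where "ev k G = (q11 k G + q22 k G + sqrt (dsc k G)) / 2"

definition nv where "nv k G = k + (q21 k G / (ev k G - q22 k G)) *\<^sub>R perp k"

definition Xv where "Xv k G = minv (mat 1 + G) *v nv k G"

text \<open>Conditions that keep the formulas smooth: a positive discriminant under the root, a
  nonzero denominator in \<open>nv\<close>, an invertible \<open>mat 1 + G\<close>. The last
  condition keeps \<open>k \<bullet> Xv k G\<close>, by which the speed correction \<open>S1\<close>
  divides, away from 0.\<close>

definition good where
  "good k G \<longleftrightarrow> dsc k G > 0 \<and> ev k G - q22 k G > 0 \<and> norm G \<le> 1/4 \<and> k \<bullet> Xv k G > k \<bullet> k / 2"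

lemma smooth_aq [smooth_intros]: "smooth (aq k v)"
  unfolding aq_def[abs_def] by (intro smooth_intros smooth_const)

lemma smooth_q [smooth_intros]:
  "smooth (q11 k)" "smooth (q12 k)" "smooth (q21 k)" "smooth (q22 k)"
  unfolding q11_def[abs_def] q12_def[abs_def] q21_def[abs_def] q22_def[abs_def] divide_inverse
  by (intro smooth_intros smooth_const)+

lemma sfield_q: assumes "sfield Q G"
  shows "sfield Q (\<lambda>p. q11 k (G p))" "sfield Q (\<lambda>p. q12 k (G p))" "sfield Q (\<lambda>p. q21 k (G p))" "sfield Q (\<lambda>p. q22 k (G p))"
  by (rule sfield_compose[OF smooth_q(1) assms], rule sfield_compose[OF smooth_q(2) assms],
      rule sfield_compose[OF smooth_q(3) assms], rule sfield_compose[OF smooth_q(4) assms])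

lemma det_good: "good k G \<Longrightarrow> det (mat 1 + G) \<noteq> 0"
  using det_near_identity[of G] by (auto simp: good_def)

lemma sfield_ev [sfield_intros]:
  assumes G: "sfield Q G" and g: "\<And>p. good k (G p)"
  shows "sfield Q (\<lambda>p. ev k (G p))"
proof -
  have "sfield Q (\<lambda>p. (q11 k (G p) + q22 k (G p) + sqrt (dsc k (G p))) * (1/2))"
    unfolding dsc_def by (intro sfield_intros sfield_q G) (use g in \<open>auto simp: good_def dsc_def\<close>)
  then show ?thesis by (simp add: ev_def)
qed

lemma sfield_nv [sfield_intros]:
  assumes G: "sfield Q G" and g: "\<And>p. good k (G p)"
  shows "sfield Q (\<lambda>p. nv k (G p))"
proof -
  have "ev k (G p) - q22 k (G p) \<noteq> 0" for p using g[of p] by (auto simp: good_def)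
  then show ?thesis unfolding nv_def by (intro sfield_intros sfield_q G g)
qed

lemma sfield_Xv [sfield_intros]:
  assumes G: "sfield Q G" and g: "\<And>p. good k (G p)"
  shows "sfield Q (\<lambda>p. Xv k (G p))"
  unfolding Xv_def by (intro sfield_intros G g det_good[OF g])

lemma perp_decomp:
  assumes "k \<noteq> 0"
  shows "v = ((v \<bullet> k) / (k \<bullet> k)) *\<^sub>R k + ((v \<bullet> perp k) / (k \<bullet> k)) *\<^sub>R perp k"
proof -
  have "(k \<bullet> k) *\<^sub>R v = (v \<bullet> k) *\<^sub>R k + (v \<bullet> perp k) *\<^sub>R perp k"
    by (simp add: vec_eq_iff forall_2 inner_2 algebra_simps)
  then have "v = inverse (k \<bullet> k) *\<^sub>R ((v \<bullet> k) *\<^sub>R k + (v \<bullet> perp k) *\<^sub>R perp k)"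
    using assms by (metis inner_eq_zero_iff scaleR_left_imp_eq scaleR_scaleR scaleR_one right_inverse mult.commute)
  then show ?thesis by (simp add: scaleR_add_right divide_inverse mult.commute)
qed

text \<open>The second equation is the first one multiplied by the inverse of
  \<open>mat 1 + G\<close>. In this form it says that the symmetric matrix
  \<open>DS G (outer n k)\<close> maps \<open>k\<close> to a multiple of \<open>X\<close>, so that
  the product of the wave with its own linear response can be cancelled by a symmetric stress
  \<open>outer X X\<close>.\<close>

lemma eigen:
  assumes k: "k \<noteq> 0" and g: "good k G"
  shows "(mat 1 + G) *v (DS G (outer (nv k G) k) *v k) = ev k G *\<^sub>R nv k G"
    and "DS G (outer (nv k G) k) *v k = ev k G *\<^sub>R Xv k G"
    and "(mat 1 + G) *v Xv k G = nv k G"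
proof -
  define y where "y = q21 k G / (ev k G - q22 k G)"
  have pos: "ev k G - q22 k G > 0" "dsc k G > 0" using g by (auto simp: good_def)
  \<comment> \<open>\<open>ev\<close> is a root of the characteristic polynomial of the acoustic
    operator.\<close>
  have e: "(ev k G - q11 k G) * (ev k G - q22 k G) = q12 k G * q21 k G"
  proof -
    have "(ev k G - q11 k G) * (ev k G - q22 k G) = ((sqrt (dsc k G))\<^sup>2 - (q11 k G - q22 k G)\<^sup>2) / 4"
      by (simp add: ev_def field_simps power2_eq_square)
    then show ?thesis using pos(2) by (simp add: dsc_def)
  qed
  have q: "q21 k G = y * (ev k G - q22 k G)" using pos(1) by (simp add: y_def)
  have "(ev k G - q11 k G) * (ev k G - q22 k G) = q12 k G * y * (ev k G - q22 k G)"
    using e unfolding q by simp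
  then have "(ev k G - q11 k G - y * q12 k G) * (ev k G - q22 k G) = 0" by (simp add: algebra_simps)
  then have 1: "ev k G = q11 k G + y * q12 k G" using pos(1) by simp
  have 2: "y * ev k G = q21 k G + y * q22 k G" using q by (simp add: algebra_simps)
  have A: "aq k k G = q11 k G *\<^sub>R k + q21 k G *\<^sub>R perp k" "aq k (perp k) G = q12 k G *\<^sub>R k + q22 k G *\<^sub>R perp k"
    using perp_decomp[OF k] unfolding q11_def q12_def q21_def q22_def by auto
  have "outer (nv k G) k = outer k k + y *\<^sub>R outer (perp k) k"
    by (simp add: nv_def y_def vec_eq_iff algebra_simps)
  then have "DS G (outer (nv k G) k) = DS G (outer k k) + y *\<^sub>R DS G (outer (perp k) k)"
    using linear_add[OF DS_linear] by (simp add: DS_scaleR)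
  then have "(mat 1 + G) *v (DS G (outer (nv k G) k) *v k) = aq k k G + y *\<^sub>R aq k (perp k) G"
    by (simp add: aq_def matrix_vector_mult_add_rdistrib matrix_vector_right_distrib scaleR_matrix_vector_assoc[symmetric] matrix_vector_mult_scaleR)
  also have "\<dots> = (q11 k G + y * q12 k G) *\<^sub>R k + (q21 k G + y * q22 k G) *\<^sub>R perp k"
    by (simp add: A algebra_simps)
  also have "\<dots> = ev k G *\<^sub>R nv k G"
    unfolding 1[symmetric] 2[symmetric] by (simp add: nv_def y_def[symmetric] algebra_simps)
  finally show 3: "(mat 1 + G) *v (DS G (outer (nv k G) k) *v k) = ev k G *\<^sub>R nv k G" .
  have "DS G (outer (nv k G) k) *v k = minv (mat 1 + G) *v (ev k G *\<^sub>R nv k G)"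
    using minv_mv(1)[OF det_good[OF g], of "DS G (outer (nv k G) k) *v k"] 3 by simp
  then show "DS G (outer (nv k G) k) *v k = ev k G *\<^sub>R Xv k G"
    by (simp add: Xv_def matrix_vector_mult_scaleR)
  show "(mat 1 + G) *v Xv k G = nv k G"
    unfolding Xv_def by (rule minv_mv(2)[OF det_good[OF g]])
qed

lemma b11_pos: "b 1 1 > 0"
  using mu_pos lam_pos by simp

lemma at_zero:
  assumes k: "k \<noteq> 0"
  shows "q11 k 0 = 4 * b 1 1 * (k \<bullet> k)" "q21 k 0 = 0" "q12 k 0 = 0" "q22 k 0 = - 2 * a 2 * (k \<bullet> k)"
    "dsc k 0 > 0" "ev k 0 = 4 * b 1 1 * (k \<bullet> k)" "ev k 0 - q22 k 0 > 0" "nv k 0 = k" "Xv k 0 = k"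
proof -
  have kk: "k \<bullet> k > 0" using k by simp
  have p: "perp k \<bullet> k = 0" "k \<bullet> perp k = 0" "perp k \<bullet> perp k = k \<bullet> k" by (simp_all add: inner_2)
  show q: "q11 k 0 = 4 * b 1 1 * (k \<bullet> k)" "q21 k 0 = 0" "q12 k 0 = 0" "q22 k 0 = - 2 * a 2 * (k \<bullet> k)"
    using kk by (simp_all add: q11_def q21_def q12_def q22_def aq_def DS_at_zero p)
  have d: "q11 k 0 - q22 k 0 = (4 * b 1 1 + 2 * a 2) * (k \<bullet> k)" by (simp add: q algebra_simps)
  \<comment> \<open>This is \<lambda> + \<mu>: at rest the longitudinal eigenvalue exceeds the
    transverse one. So it is simple, and it persists with its eigenvector for small strain.\<close>
  have "4 * b 1 1 + 2 * a 2 > 0" using mu_pos lam_pos by simp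
  then have dp: "q11 k 0 - q22 k 0 > 0" using kk d by simp
  show "dsc k 0 > 0" using dp by (simp add: dsc_def q)
  show e: "ev k 0 = 4 * b 1 1 * (k \<bullet> k)"
  proof -
    have "dsc k 0 = (q11 k 0 - q22 k 0)\<^sup>2" unfolding dsc_def q(2,3) by simp
    then have "sqrt (dsc k 0) = q11 k 0 - q22 k 0" using dp by (simp only: real_sqrt_abs)
    then show ?thesis unfolding ev_def by (simp add: q(1))
  qed
  show "ev k 0 - q22 k 0 > 0" using dp unfolding e q(1) .
  show "nv k 0 = k" by (simp add: nv_def q)
  then show "Xv k 0 = k" by (simp add: Xv_def minv_def det_2 mat_def adj_def vec_eq_iff matrix_vector_mult_def sum_2 forall_2)
qed

lemma isCont_smooth: "smooth f \<Longrightarrow> isCont f x"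
  using smooth_continuous_on[of f UNIV] by (simp add: continuous_on_eq_continuous_at)

lemma continuous_at_zero:
  assumes k: "k \<noteq> 0"
  shows "isCont (dsc k) 0" "isCont (ev k) 0" "isCont (nv k) 0" "isCont (Xv k) 0"
proof -
  have q: "isCont (q11 k) 0" "isCont (q12 k) 0" "isCont (q21 k) 0" "isCont (q22 k) 0"
    by (intro isCont_smooth smooth_q)+
  show d: "isCont (dsc k) 0" unfolding dsc_def[abs_def] by (intro continuous_intros q)
  show e: "isCont (ev k) 0" unfolding ev_def[abs_def] by (intro continuous_intros q d) simp
  show n: "isCont (nv k) 0" unfolding nv_def[abs_def]
    using at_zero(7)[OF k] by (intro continuous_intros q e) simp
  have "isCont (\<lambda>G :: mat2. minv (mat 1 + G)) 0"
  proof -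
    have "isCont (\<lambda>G :: mat2. det (mat 1 + G)) 0" "isCont (\<lambda>G. adj (mat 1 + G)) 0"
      by (intro isCont_smooth smooth_intros smooth_const)+
    moreover have "det (mat 1 + 0 :: mat2) \<noteq> 0" by simp
    ultimately show ?thesis unfolding minv_def by (intro continuous_intros)
  qed
  then show "isCont (Xv k) 0" unfolding Xv_def[abs_def] using n
    by (rule bounded_bilinear.continuous[OF bounded_bilinear_mv])
qed

text \<open>\<open>wdef\<close> is, up to the factor \<open>B^2\<close>, the part of the nonlinear stress response that a wave of amplitude \<open>B\<close>
  does not balance exactly; at \<open>G = 0\<close>, \<open>B = 0\<close> it is a multiple of \<open>k^\<bottom> \<otimes> k^\<bottom>\<close>.\<close>
definition wdef where
  "wdef k G B = ZS G (outer (nv k G) k) B + (ev k G / (1 + B * (k \<bullet> Xv k G))) *\<^sub>R outer (Xv k G) (Xv k G)"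

text \<open>Multiplied from the left by the new deformation gradient, the \<open>Xv\<close> term
  becomes a multiple of \<open>outer (nv k G) (Xv k G)\<close> and cancels the product of the wave
  with its linear stress response. What remains at order \<open>B\<^sup>2\<close> is
  \<open>wdef\<close>.\<close>

lemma wave_defect:
  "Sg G + B *\<^sub>R DS G (outer (nv k G) k) - Sg (G + B *\<^sub>R outer (nv k G) k)
     - (ev k G * B\<^sup>2 / (1 + B * (k \<bullet> Xv k G))) *\<^sub>R outer (Xv k G) (Xv k G) = - (B\<^sup>2 *\<^sub>R wdef k G B)"
proof -
  have "ev k G * B\<^sup>2 / (1 + B * (k \<bullet> Xv k G)) = B\<^sup>2 * (ev k G / (1 + B * (k \<bullet> Xv k G)))" by simp
  then show ?thesis
    unfolding Sg_expand wdef_def by (simp only: scaleR_add_right scaleR_scaleR) simp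
qed

lemma isCont_tendsto_nhds: "isCont f x \<Longrightarrow> (f \<longlongrightarrow> f x) (nhds x)"
  using tendsto_at_iff_tendsto_nhds[of f x] by (simp add: continuous_at)

text \<open>All quantities are continuous at strain 0 and amplitude 0, where their values are known
  from \<open>at_zero\<close> and \<open>ZS_at_zero\<close>; a single threshold serves all the
  estimates.\<close>

lemma small_strain:
  assumes k: "k \<noteq> 0" and e: "eps > 0"
  obtains d where "d > 0" "d \<le> 1/4" "\<And>G. norm G \<le> d \<Longrightarrow> good k G \<and> \<bar>ev k G - 4 * b 1 1 * (k \<bullet> k)\<bar> \<le> eps
     \<and> norm (nv k G) \<le> 2 * norm k \<and> norm (Xv k G) \<le> 2 * norm k"
    "\<And>G B. norm G \<le> d \<Longrightarrow> \<bar>B\<bar> \<le> d \<Longrightarrow> 1 + B * (k \<bullet> Xv k G) \<ge> 1/2 \<and>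
       norm (wdef k G B - ((k \<bullet> k) * sig) *\<^sub>R outer (perp k) (perp k)) \<le> eps"
proof -
  note c = continuous_at_zero[OF k]
  note z = at_zero[OF k]
  have kk: "k \<bullet> k > 0" using k by simp
  have q22: "isCont (q22 k) 0" by (intro isCont_smooth smooth_q)
  have 1: "\<forall>\<^sub>F G in nhds 0. dsc k G > 0"
    using order_tendstoD(1)[OF isCont_tendsto_nhds[OF c(1)] z(5)] .
  have "isCont (\<lambda>G. ev k G - q22 k G) 0" by (intro continuous_intros c q22)
  from order_tendstoD(1)[OF isCont_tendsto_nhds[OF this] z(7)]
  have 2: "\<forall>\<^sub>F G in nhds 0. ev k G - q22 k G > 0" .
  have "isCont (\<lambda>G. k \<bullet> Xv k G) 0" by (intro continuous_intros c)
  from order_tendstoD(1)[OF isCont_tendsto_nhds[OF this], of "k \<bullet> k / 2"] have 3: "\<forall>\<^sub>F G in nhds 0. k \<bullet> Xv k G > k \<bullet> k / 2"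
    using kk z(9) by simp
  have "isCont (\<lambda>G. \<bar>ev k G - 4 * b 1 1 * (k \<bullet> k)\<bar>) 0" by (intro continuous_intros c)
  from order_tendstoD(2)[OF isCont_tendsto_nhds[OF this], of eps] have 4: "\<forall>\<^sub>F G in nhds 0. \<bar>ev k G - 4 * b 1 1 * (k \<bullet> k)\<bar> < eps"
    using e z(6) by simp
  have "isCont (\<lambda>G. norm (nv k G)) 0" by (intro continuous_intros c)
  from order_tendstoD(2)[OF isCont_tendsto_nhds[OF this], of "2 * norm k"] have 5: "\<forall>\<^sub>F G in nhds 0. norm (nv k G) < 2 * norm k"
    using k z(8) by simp
  have "isCont (\<lambda>G. norm (Xv k G)) 0" by (intro continuous_intros c)
  from order_tendstoD(2)[OF isCont_tendsto_nhds[OF this], of "2 * norm k"] have 6: "\<forall>\<^sub>F G in nhds 0. norm (Xv k G) < 2 * norm k"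
    using k z(9) by simp
  from eventually_conj[OF 1 eventually_conj[OF 2 eventually_conj[OF 3 eventually_conj[OF 4 eventually_conj[OF 5 6]]]]]
  obtain d1 where d1: "d1 > 0" "\<And>G. dist G 0 < d1 \<Longrightarrow> dsc k G > 0 \<and> ev k G - q22 k G > 0 \<and> k \<bullet> Xv k G > k \<bullet> k / 2 \<and>
     \<bar>ev k G - 4 * b 1 1 * (k \<bullet> k)\<bar> < eps \<and> norm (nv k G) < 2 * norm k \<and> norm (Xv k G) < 2 * norm k"
    unfolding eventually_nhds_metric by blast
  have cf: "isCont (\<lambda>x. f (fst x)) (0, 0)" if "isCont f 0" for f :: "mat2 \<Rightarrow> 'b::topological_space"
    using isCont_o2[OF continuous_fst[OF continuous_ident], of "(0, 0)" f] that by simp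
  have den: "isCont (\<lambda>x. 1 + snd x * (k \<bullet> Xv k (fst x))) (0 :: mat2, 0 :: real)"
    by (intro continuous_intros cf c)
  have "isCont (\<lambda>x. ZS (fst x) (outer (nv k (fst x)) k) (snd x)) (0 :: mat2, 0 :: real)"
  proof -
    have "smooth (\<lambda>y. ZS (fst y) (outer (fst (snd y)) k) (snd (snd y)))"
      by (intro smooth_intros smooth_const)
    from isCont_o2[OF _ isCont_smooth[OF this], of "(0, 0)" "\<lambda>x. (fst x, nv k (fst x), snd x)"]
    show ?thesis by (simp add: cf[OF c(3)] isCont_Pair continuous_fst continuous_snd)
  qed
  moreover have "isCont (\<lambda>x. outer (Xv k (fst x)) (Xv k (fst x))) (0 :: mat2, 0 :: real)"
    by (rule bounded_bilinear.continuous[OF bounded_bilinear_outer cf[OF c(4)] cf[OF c(4)]])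
  ultimately have "isCont (\<lambda>x. wdef k (fst x) (snd x)) (0 :: mat2, 0 :: real)"
    unfolding wdef_def by (intro continuous_intros cf[OF c(2)] cf[OF c(4)]) simp_all
  then have cW: "isCont (\<lambda>x. norm (wdef k (fst x) (snd x) - ((k \<bullet> k) * sig) *\<^sub>R outer (perp k) (perp k))) (0 :: mat2, 0 :: real)"
    by (intro continuous_intros)
  have "wdef k 0 0 = ((k \<bullet> k) * sig) *\<^sub>R outer (perp k) (perp k)"
    using ZS_at_zero[of k] by (simp add: wdef_def z)
  then have 7: "\<forall>\<^sub>F x in nhds (0 :: mat2, 0 :: real). norm (wdef k (fst x) (snd x) - ((k \<bullet> k) * sig) *\<^sub>R outer (perp k) (perp k)) < eps"
    using order_tendstoD(2)[OF isCont_tendsto_nhds[OF cW], of eps] e by simp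
  have 8: "\<forall>\<^sub>F x in nhds (0 :: mat2, 0 :: real). 1 + snd x * (k \<bullet> Xv k (fst x)) > 1/2"
    using order_tendstoD(1)[OF isCont_tendsto_nhds[OF den], of "1/2"] by simp
  from eventually_conj[OF 7 8]
  obtain d2 where d2: "d2 > 0" "\<And>x. dist x (0 :: mat2, 0 :: real) < d2 \<Longrightarrow>
     norm (wdef k (fst x) (snd x) - ((k \<bullet> k) * sig) *\<^sub>R outer (perp k) (perp k)) < eps \<and> 1 + snd x * (k \<bullet> Xv k (fst x)) > 1/2"
    unfolding eventually_nhds_metric by blast
  \<comment> \<open>The quotient by 4 makes \<open>norm G + \<bar>B\<bar>\<close> at most
    \<open>d2 / 2\<close>.\<close>
  define d where "d = min (min (d1 / 2) (d2 / 4)) (1/4)"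
  show ?thesis
  proof (rule that[of d])
    show "d > 0" "d \<le> 1/4" using d1(1) d2(1) by (auto simp: d_def)
    show "good k G \<and> \<bar>ev k G - 4 * b 1 1 * (k \<bullet> k)\<bar> \<le> eps \<and> norm (nv k G) \<le> 2 * norm k \<and> norm (Xv k G) \<le> 2 * norm k"
      if "norm G \<le> d" for G
    proof -
      have "dist G 0 < d1" "norm G \<le> 1/4" using that d1(1) by (auto simp: d_def)
      then show ?thesis using d1(2)[of G] by (simp add: good_def)
    qed
    show "1 + B * (k \<bullet> Xv k G) \<ge> 1/2 \<and> norm (wdef k G B - ((k \<bullet> k) * sig) *\<^sub>R outer (perp k) (perp k)) \<le> eps"
      if "norm G \<le> d" "\<bar>B\<bar> \<le> d" for G B
    proof -
      have "dist (G, B) (0, 0) \<le> norm G + \<bar>B\<bar>"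
        using sqrt_sum_squares_le_sum_abs[of "norm G" "norm B"] by (simp add: dist_Pair_Pair)
      also have "\<dots> < d2" using that d2(1) by (auto simp: d_def)
      finally show ?thesis using d2(2)[of "(G, B)"] by simp
    qed
  qed
qed

end

section \<open>Oscillating fields\<close>

definition zo :: "real \<Rightarrow> real \<Rightarrow> (pt \<Rightarrow> 'b::euclidean_space) \<Rightarrow> bool" where
  "zo t0 t1 f \<longleftrightarrow> (\<forall>p. fst p \<notin> {t0..t1} \<longrightarrow> f p = 0)"

lemma zoD: "zo t0 t1 f \<Longrightarrow> fst p \<notin> {t0..t1} \<Longrightarrow> f p = 0"
  by (simp add: zo_def)

lemma zo_pd: assumes "zo t0 t1 f" shows "zo t0 t1 (pd v f)"
  unfolding zo_def
proof (intro allI impI)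
  fix p :: pt assume p: "fst p \<notin> {t0..t1}"
  have o: "open (fst -` (- {t0..t1}) :: pt set)"
    by (intro open_vimage continuous_intros open_Compl closed_atLeastAtMost)
  have m: "p \<in> fst -` (- {t0..t1})" using p by simp
  have e: "0 = f q" if "q \<in> fst -` (- {t0..t1})" for q
    using that zoD[OF assms, of q] by simp
  have "(f has_derivative (\<lambda>_. 0)) (at p)"
    by (rule has_derivative_transform_within_open[of "\<lambda>_. 0", OF has_derivative_const o m e])
  then show "pd v f p = 0" by (rule pd_eqI)
qed

lemma zo_dvg: "zo t0 t1 M \<Longrightarrow> zo t0 t1 (dvg M)"
  using zo_pd[of t0 t1 M] by (auto simp: zo_def dvg_def vec_eq_iff)

lemma zo_grad: "zo t0 t1 u \<Longrightarrow> zo t0 t1 (grad u)"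
  using zo_pd[of t0 t1 u] by (auto simp: zo_def grad_def vec_eq_iff)

lemma dir_decomp: "(0, v) = v $ 1 *\<^sub>R dx 1 + v $ 2 *\<^sub>R dx 2"
  by (simp add: prod_eq_iff vec_eq_iff forall_2)

lemma dvg_outer:
  assumes q: "smooth q" shows "dvg (\<lambda>p. outer (q p) v) p = pd (0, v) q p"
proof -
  have "pd w (\<lambda>p. outer (q p) v) p = outer (pd w q p) v" for w
    by (rule pd_linear[OF bounded_bilinear.bounded_linear_left[OF bounded_bilinear_outer] smooth_differentiable[OF q]])
  then show ?thesis
    by (simp add: dvg_def dir_decomp pd_add_dir pd_scaleR_dir q vec_eq_iff sum_2 mult.commute)
qed

lemma dvg_scaleR_fun:
  assumes f: "smooth f" and M: "smooth M"
  shows "dvg (\<lambda>p. f p *\<^sub>R M p) p = f p *\<^sub>R dvg M p + M p *v (\<chi> j. pd (dx j) f p)"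
proof -
  have "pd w (\<lambda>p. f p *\<^sub>R M p) p = f p *\<^sub>R pd w M p + pd w f p *\<^sub>R M p" for w
    by (rule pd_bilinear[OF bounded_bilinear_scaleR smooth_differentiable[OF f] smooth_differentiable[OF M]])
  then show ?thesis
    by (simp add: dvg_def vec_eq_iff sum_2 matrix_vector_mult_def algebra_simps)
qed

lemma mv_minus: "(M :: mat2) *v (- x) = - (M *v x)"
  using matrix_vector_mult_scaleR[of M "-1" x] by simp

lemma outer_zero [simp]: "outer 0 v = 0" "outer v 0 = 0"
  by (simp_all add: vec_eq_iff)

section \<open>Families of fields oscillating along \<open>k\<close>\<close>

locale wave =
  fixes k :: "real^2" and t0 t1 :: real
  assumes k_nz: "k \<noteq> 0" and k_int: "\<And>i. k $ i \<in> \<int>"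
begin

abbreviation slow :: "(pt \<Rightarrow> 'b::euclidean_space) \<Rightarrow> bool" where
  "slow \<equiv> sfield (Slab t0 t1)"

abbreviation kp :: pt where "kp \<equiv> (0, perp k)"

text \<open>Phases depend on time and on \<open>k \<bullet> x\<close> only, so \<open>perp k\<close>
  is the one spatial direction in which differentiation costs no factor \<open>l\<close>; this is
  why its derivative alone is bounded. The index starts at 1 because of divisions by
  \<open>l\<close>.\<close>

definition osc :: "(nat \<Rightarrow> pt \<Rightarrow> 'b::euclidean_space) \<Rightarrow> bool" where
  "osc g \<longleftrightarrow> (\<forall>l\<ge>1. sfield Per (g l)) \<and>
     (\<exists>C. \<forall>l\<ge>1. \<forall>p. norm (g l p) \<le> C \<and> norm (pd kp (g l) p) \<le> C)"

lemma oscE: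
  assumes "osc g"
  obtains C where "C > 0" "\<And>l p. l \<ge> 1 \<Longrightarrow> norm (g l p) \<le> C" "\<And>l p. l \<ge> 1 \<Longrightarrow> norm (pd kp (g l) p) \<le> C"
proof -
  obtain C where "\<forall>l\<ge>1. \<forall>p. norm (g l p) \<le> C \<and> norm (pd kp (g l) p) \<le> C" using assms osc_def by blast
  then show ?thesis using that[of "max C 1"] by (simp add: le_max_iff_disj)
qed

lemma osc_sfield: "osc g \<Longrightarrow> l \<ge> 1 \<Longrightarrow> sfield Per (g l)"
  by (simp add: osc_def)

lemma osc_smooth: "osc g \<Longrightarrow> l \<ge> 1 \<Longrightarrow> smooth (g l)"
  by (rule sfield_smooth[OF osc_sfield])

lemma oscI:
  assumes "\<And>l. l \<ge> 1 \<Longrightarrow> sfield Per (g l)" "\<And>l p. l \<ge> 1 \<Longrightarrow> norm (g l p) \<le> C"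
    "\<And>l p. l \<ge> 1 \<Longrightarrow> norm (pd kp (g l) p) \<le> D"
  shows "osc g"
  unfolding osc_def using assms by (intro conjI allI impI exI[of _ "max C D"]) (auto simp: le_max_iff_disj)

lemma osc_slow: assumes f: "slow f" shows "osc (\<lambda>l. f)"
proof -
  obtain C where C: "\<And>p. norm (f p) \<le> C" using sfield_bounded[OF f] by blast
  obtain D where D: "\<And>p. norm (pd kp f p) \<le> D" using sfield_bounded[OF sfield_pd_Slab[OF f]] by blast
  show ?thesis by (rule oscI[OF sfield_Slab_Per[OF f] C D])
qed

lemma osc_const: "osc (\<lambda>l p. c)"
  by (rule osc_slow) simp

lemma osc_linear: assumes L: "bounded_linear L" and f: "osc f" shows "osc (\<lambda>l p. L (f l p))"
proof -
  obtain C where C: "C > 0" "\<And>l p. l \<ge> 1 \<Longrightarrow> norm (f l p) \<le> C" "\<And>l p. l \<ge> 1 \<Longrightarrow> norm (pd kp (f l) p) \<le> C"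
    using oscE[OF f] by blast
  obtain K where K: "K > 0" "\<And>x. norm (L x) \<le> norm x * K" using bounded_linear.pos_bounded[OF L] by blast
  show ?thesis
  proof (rule oscI)
    fix l :: nat and p assume l: "l \<ge> 1"
    show "sfield Per (\<lambda>p. L (f l p))" by (rule sfield_linear[OF L osc_sfield[OF f l]])
    show "norm (L (f l p)) \<le> C * K"
      using K(2)[of "f l p"] mult_right_mono[OF C(2)[OF l, of p], of K] K(1) by linarith
    have "pd kp (\<lambda>p. L (f l p)) p = L (pd kp (f l) p)"
      by (rule pd_linear[OF L smooth_differentiable[OF osc_smooth[OF f l]]])
    then show "norm (pd kp (\<lambda>p. L (f l p)) p) \<le> C * K"
      using order_trans[OF K(2) mult_right_mono[OF C(3)[OF l]]] K(1) by simp
  qed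
qed

lemma osc_bilinear:
  assumes h: "bounded_bilinear h" and f: "osc f" and g: "osc g"
  shows "osc (\<lambda>l p. h (f l p) (g l p))"
proof -
  obtain C where C: "C > 0" "\<And>l p. l \<ge> 1 \<Longrightarrow> norm (f l p) \<le> C" "\<And>l p. l \<ge> 1 \<Longrightarrow> norm (pd kp (f l) p) \<le> C"
    using oscE[OF f] by blast
  obtain D where D: "D > 0" "\<And>l p. l \<ge> 1 \<Longrightarrow> norm (g l p) \<le> D" "\<And>l p. l \<ge> 1 \<Longrightarrow> norm (pd kp (g l) p) \<le> D"
    using oscE[OF g] by blast
  obtain K where K: "K > 0" "\<And>x y. norm (h x y) \<le> norm x * norm y * K" using bounded_bilinear.pos_bounded[OF h] by blast
  have b: "norm (h x y) \<le> C * D * K" if "norm x \<le> C" "norm y \<le> D" for x y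
    by (rule order_trans[OF K(2) mult_right_mono[OF mult_mono[OF that]]]) (use K(1) C(1) in auto)
  show ?thesis
  proof (rule oscI)
    fix l :: nat and p assume l: "l \<ge> 1"
    show "sfield Per (\<lambda>p. h (f l p) (g l p))" by (rule sfield_bilinear[OF h osc_sfield[OF f l] osc_sfield[OF g l]])
    show "norm (h (f l p) (g l p)) \<le> C * D * K" by (rule b[OF C(2)[OF l] D(2)[OF l]])
    have "pd kp (\<lambda>p. h (f l p) (g l p)) p = h (f l p) (pd kp (g l) p) + h (pd kp (f l) p) (g l p)"
      by (rule pd_bilinear[OF h smooth_differentiable[OF osc_smooth[OF f l]] smooth_differentiable[OF osc_smooth[OF g l]]])
    then show "norm (pd kp (\<lambda>p. h (f l p) (g l p)) p) \<le> C * D * K + C * D * K"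
      using norm_triangle_mono[OF b[OF C(2)[OF l] D(3)[OF l]] b[OF C(3)[OF l] D(2)[OF l]]] by simp
  qed
qed

lemma osc_add: assumes f: "osc f" and g: "osc g" shows "osc (\<lambda>l p. f l p + g l p)"
proof -
  obtain C where C: "C > 0" "\<And>l p. l \<ge> 1 \<Longrightarrow> norm (f l p) \<le> C" "\<And>l p. l \<ge> 1 \<Longrightarrow> norm (pd kp (f l) p) \<le> C"
    using oscE[OF f] by blast
  obtain D where D: "D > 0" "\<And>l p. l \<ge> 1 \<Longrightarrow> norm (g l p) \<le> D" "\<And>l p. l \<ge> 1 \<Longrightarrow> norm (pd kp (g l) p) \<le> D"
    using oscE[OF g] by blast
  show ?thesis
  proof (rule oscI)
    fix l :: nat and p assume l: "l \<ge> 1"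
    show "sfield Per (\<lambda>p. f l p + g l p)" by (intro sfield_intros osc_sfield[OF f l] osc_sfield[OF g l])
    show "norm (f l p + g l p) \<le> C + D" by (rule norm_triangle_mono[OF C(2)[OF l] D(2)[OF l]])
    have "pd kp (\<lambda>p. f l p + g l p) p = pd kp (f l) p + pd kp (g l) p"
      by (rule pd_add[OF smooth_differentiable[OF osc_smooth[OF f l]] smooth_differentiable[OF osc_smooth[OF g l]]])
    then show "norm (pd kp (\<lambda>p. f l p + g l p) p) \<le> C + D"
      using norm_triangle_mono[OF C(3)[OF l] D(3)[OF l]] by simp
  qed
qed

lemma osc_minus: "osc f \<Longrightarrow> osc (\<lambda>l p. - f l p)"
  by (rule osc_linear[OF bounded_linear_minus[OF bounded_linear_ident]])

lemma osc_diff: "osc f \<Longrightarrow> osc g \<Longrightarrow> osc (\<lambda>l p. f l p - g l p)"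
  using osc_add[OF _ osc_minus[of g], of f] by simp

lemma osc_sum: "(\<And>i. i \<in> I \<Longrightarrow> osc (f i)) \<Longrightarrow> osc (\<lambda>l p. \<Sum>i\<in>I. f i l p)"
  by (induction I rule: infinite_finite_induct) (auto intro: osc_const osc_add)

lemma osc_scaleR: "osc f \<Longrightarrow> osc g \<Longrightarrow> osc (\<lambda>l p. f l p *\<^sub>R g l p)"
  by (rule osc_bilinear[OF bounded_bilinear_scaleR])

lemma osc_mult: "osc f \<Longrightarrow> osc g \<Longrightarrow> osc (\<lambda>l p. f l p * g l p :: real)"
  by (rule osc_bilinear[OF bounded_bilinear_mult])

lemma osc_mm: "osc f \<Longrightarrow> osc g \<Longrightarrow> osc (\<lambda>l p. (f l p :: mat2) ** (g l p :: mat2))"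
  by (rule osc_bilinear[OF bounded_bilinear_mm])

lemma osc_mv: "osc f \<Longrightarrow> osc g \<Longrightarrow> osc (\<lambda>l p. (f l p :: mat2) *v (g l p :: real^2))"
  by (rule osc_bilinear[OF bounded_bilinear_mv])

lemma osc_over_l: assumes f: "osc f" shows "osc (\<lambda>l p. (1 / real l) *\<^sub>R f l p)"
proof -
  obtain C where C: "C > 0" "\<And>l p. l \<ge> 1 \<Longrightarrow> norm (f l p) \<le> C" "\<And>l p. l \<ge> 1 \<Longrightarrow> norm (pd kp (f l) p) \<le> C"
    using oscE[OF f] by blast
  have b: "norm ((1 / real l) *\<^sub>R x) \<le> C" if "l \<ge> 1" "norm x \<le> C" for l and x :: 'a
  proof -
    have "(1 / real l) * norm x \<le> 1 * C" using that C(1) by (intro mult_mono) auto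
    then show ?thesis by simp
  qed
  show ?thesis
  proof (rule oscI)
    fix l :: nat and p assume l: "l \<ge> 1"
    show "sfield Per (\<lambda>p. (1 / real l) *\<^sub>R f l p)" by (intro sfield_intros osc_sfield[OF f l])
    show "norm ((1 / real l) *\<^sub>R f l p) \<le> C" by (rule b[OF l C(2)[OF l]])
    have "pd kp (\<lambda>p. (1 / real l) *\<^sub>R f l p) p = (1 / real l) *\<^sub>R pd kp (f l) p"
      by (rule pd_linear[OF bounded_linear_scaleR_right smooth_differentiable[OF osc_smooth[OF f l]]])
    then show "norm (pd kp (\<lambda>p. (1 / real l) *\<^sub>R f l p) p) \<le> C" using b[OF l C(3)[OF l]] by simp
  qed
qed

lemma osc_inverse:
  assumes g: "osc g" and d: "\<delta> > 0" "\<And>l p. l \<ge> 1 \<Longrightarrow> g l p \<ge> \<delta>"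
  shows "osc (\<lambda>l p. inverse (g l p) :: real)"
proof -
  obtain C where C: "C > 0" "\<And>l p. l \<ge> 1 \<Longrightarrow> norm (g l p) \<le> C" "\<And>l p. l \<ge> 1 \<Longrightarrow> norm (pd kp (g l) p) \<le> C"
    using oscE[OF g] by blast
  have pos: "g l p > 0" if "l \<ge> 1" for l p using d(1) d(2)[OF that, of p] by linarith
  have inv: "norm (inverse (g l p)) \<le> inverse \<delta>" if "l \<ge> 1" for l p
    using d(1) d(2)[OF that, of p] pos[OF that, of p] by (simp add: le_imp_inverse_le)
  show ?thesis
  proof (rule oscI[OF _ inv])
    fix l :: nat and p assume l: "l \<ge> 1"
    show "sfield Per (\<lambda>p. inverse (g l p))"
      by (intro sfield_intros osc_sfield[OF g l]) (use pos[OF l] in \<open>metis less_irrefl\<close>)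
    have "pd kp (\<lambda>p. inverse (g l p)) p = - (inverse (g l p) * pd kp (g l) p * inverse (g l p))"
      by (rule pd_eqI, rule Deriv.has_derivative_inverse[where f = "g l"], use pos[OF l, of p] in simp)
        (rule smooth_has_derivative[OF osc_smooth[OF g l]])
    moreover have "norm (inverse (g l p) * pd kp (g l) p * inverse (g l p)) \<le> inverse \<delta> * C * inverse \<delta>"
      unfolding norm_mult using inv[OF l, of p] C(1) C(3)[OF l, of p] d(1)
      by (intro mult_mono) auto
    ultimately show "norm (pd kp (\<lambda>p. inverse (g l p)) p) \<le> inverse \<delta> * C * inverse \<delta>" by simp
  qed
qed

text \<open>\<open>m\<close> will be an integer, so that a full period of the torus changes the
  phase by a multiple of \<open>2 * pi\<close>; the time frequency \<open>\<omega>\<close> is a free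
  real number.\<close>

definition ph :: "real \<Rightarrow> real \<Rightarrow> nat \<Rightarrow> pt \<Rightarrow> real" where
  "ph m \<omega> l p = real l * (m * (k \<bullet> snd p) - \<omega> * fst p)"

lemma smooth_ph: "smooth (ph m \<omega> l)"
  unfolding ph_def[abs_def] by (intro smooth_intros smooth_const)

lemma ph_has_derivative: "(ph m \<omega> l has_derivative (\<lambda>v. real l * (m * (k \<bullet> snd v) - \<omega> * fst v))) (at p)"
  unfolding ph_def[abs_def] by (auto intro!: derivative_eq_intros)

lemma sfield_trig:
  assumes "m \<in> \<int>"
  shows "sfield Per (\<lambda>p. sin (ph m \<omega> l p))" "sfield Per (\<lambda>p. cos (ph m \<omega> l p))"
proof -
  have "\<exists>n::int. ph m \<omega> l (p + (2 * pi) *\<^sub>R dx i) = ph m \<omega> l p + of_int n * (2 * pi)" for p i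
  proof -
    have "real l * m * k $ i \<in> \<int>" using assms k_int by (intro Ints_mult) auto
    then obtain n :: int where n: "real l * m * k $ i = of_int n" by (elim Ints_cases)
    have "k \<bullet> snd (dx i) = k $ i" by (simp add: dx_def inner_axis)
    then have "ph m \<omega> l (p + (2 * pi) *\<^sub>R dx i) = ph m \<omega> l p + (real l * m * k $ i) * (2 * pi)"
      by (simp add: ph_def inner_add_right algebra_simps)
    then show ?thesis using n by metis
  qed
  then have "sin (ph m \<omega> l (p + (2 * pi) *\<^sub>R dx i)) = sin (ph m \<omega> l p)"
    "cos (ph m \<omega> l (p + (2 * pi) *\<^sub>R dx i)) = cos (ph m \<omega> l p)" for p i
    using sin.plus_of_int[where 'a = real] cos.plus_of_int[where 'a = real] by (metis of_real_eq_id id_apply)+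
  then show "sfield Per (\<lambda>p. sin (ph m \<omega> l p))" "sfield Per (\<lambda>p. cos (ph m \<omega> l p))"
    unfolding sfield_Per by (auto intro!: smooth_intros smooth_ph)
qed

lemma pd_sin_ph: "pd v (\<lambda>p. sin (ph m \<omega> l p)) p = cos (ph m \<omega> l p) * (real l * (m * (k \<bullet> snd v) - \<omega> * fst v))"
  and pd_cos_ph: "pd v (\<lambda>p. cos (ph m \<omega> l p)) p = - sin (ph m \<omega> l p) * (real l * (m * (k \<bullet> snd v) - \<omega> * fst v))"
proof -
  have "((\<lambda>p. sin (ph m \<omega> l p)) has_derivative (\<lambda>v. (real l * (m * (k \<bullet> snd v) - \<omega> * fst v)) * cos (ph m \<omega> l p))) (at p)"
    by (rule DERIV_compose_FDERIV[where f = sin and g = "ph m \<omega> l", OF DERIV_sin ph_has_derivative])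
  then show "pd v (\<lambda>p. sin (ph m \<omega> l p)) p = cos (ph m \<omega> l p) * (real l * (m * (k \<bullet> snd v) - \<omega> * fst v))"
    by (simp add: pd_eqI mult.commute)
  have "((\<lambda>p. cos (ph m \<omega> l p)) has_derivative (\<lambda>v. (real l * (m * (k \<bullet> snd v) - \<omega> * fst v)) * - sin (ph m \<omega> l p))) (at p)"
    by (rule DERIV_compose_FDERIV[where f = cos and g = "ph m \<omega> l", OF DERIV_cos ph_has_derivative])
  from pd_eqI[OF this]
  show "pd v (\<lambda>p. cos (ph m \<omega> l p)) p = - sin (ph m \<omega> l p) * (real l * (m * (k \<bullet> snd v) - \<omega> * fst v))"
    by simp
qed

lemma osc_trig:
  assumes "m \<in> \<int>"
  shows "osc (\<lambda>l p. sin (ph m \<omega> l p))" "osc (\<lambda>l p. cos (ph m \<omega> l p))"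
proof -
  have "k \<bullet> perp k = 0" by (simp add: inner_2)
  then show "osc (\<lambda>l p. sin (ph m \<omega> l p))" "osc (\<lambda>l p. cos (ph m \<omega> l p))"
    by (auto intro!: oscI[where C = 1 and D = 0] sfield_trig[OF assms] simp: pd_sin_ph pd_cos_ph)
qed

lemma trig_grad: "(\<chi> j. pd (dx j) (\<lambda>p. sin (ph m \<omega> l p)) p) = (cos (ph m \<omega> l p) * real l * m) *\<^sub>R k"
   "(\<chi> j. pd (dx j) (\<lambda>p. cos (ph m \<omega> l p)) p) = (- sin (ph m \<omega> l p) * real l * m) *\<^sub>R k"
  by (auto simp: vec_eq_iff pd_sin_ph pd_cos_ph dx_def inner_axis)

lemma smooth_trig: "smooth (\<lambda>p. sin (ph m \<omega> l p))" "smooth (\<lambda>p. cos (ph m \<omega> l p))"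
  by (intro smooth_intros smooth_ph)+

lemma dvg_cos: "smooth M \<Longrightarrow> dvg (\<lambda>p. cos (ph m \<omega> l p) *\<^sub>R M p) p =
    cos (ph m \<omega> l p) *\<^sub>R dvg M p - (sin (ph m \<omega> l p) * real l * m) *\<^sub>R (M p *v k)"
  by (subst dvg_scaleR_fun[OF smooth_trig(2)]) (auto simp: trig_grad matrix_vector_mult_scaleR mv_minus)

lemma dvg_sin: "smooth M \<Longrightarrow> dvg (\<lambda>p. sin (ph m \<omega> l p) *\<^sub>R M p) p =
    sin (ph m \<omega> l p) *\<^sub>R dvg M p + (cos (ph m \<omega> l p) * real l * m) *\<^sub>R (M p *v k)"
  by (subst dvg_scaleR_fun[OF smooth_trig(1)]) (auto simp: trig_grad matrix_vector_mult_scaleR mv_minus)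

section \<open>Errors removable by a small corrector\<close>

definition bdd :: "(nat \<Rightarrow> pt \<Rightarrow> 'b::euclidean_space) \<Rightarrow> bool" where
  "bdd E \<longleftrightarrow> (\<forall>l\<ge>1. sfield Per (E l) \<and> zo t0 t1 (E l)) \<and> (\<exists>C. \<forall>l\<ge>1. \<forall>p. norm (E l p) \<le> C)"

definition oscz :: "(nat \<Rightarrow> pt \<Rightarrow> 'b::euclidean_space) \<Rightarrow> bool" where
  "oscz K \<longleftrightarrow> osc K \<and> (\<forall>l\<ge>1. zo t0 t1 (K l))"

text \<open>Error terms that one more correction of size \<open>1 / l\<close> makes small: \<open>l\<close> is the frequency of the wave.\<close>
definition corr :: "(nat \<Rightarrow> pt \<Rightarrow> real^2) \<Rightarrow> bool" where
  "corr f \<longleftrightarrow> (\<exists>K E. oscz K \<and> bdd E \<and>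
     (\<forall>l\<ge>1. \<forall>p. f l p = (1 / real l) *\<^sub>R (dvg (K l) p + E l p)))"

lemma oscz_osc: "oscz K \<Longrightarrow> osc K" by (simp add: oscz_def)

lemma oscz_bdd: "oscz K \<Longrightarrow> bdd K"
  unfolding oscz_def bdd_def osc_def by blast

lemma oscz_add: "oscz f \<Longrightarrow> oscz g \<Longrightarrow> oscz (\<lambda>l p. f l p + g l p)"
  by (auto simp: oscz_def zo_def intro: osc_add)

lemma bdd_add: assumes "bdd f" "bdd g" shows "bdd (\<lambda>l p. f l p + g l p)"
proof -
  obtain C D where "\<forall>l\<ge>1. \<forall>p. norm (f l p) \<le> C" "\<forall>l\<ge>1. \<forall>p. norm (g l p) \<le> D"
    using assms unfolding bdd_def by blast
  then have "\<forall>l\<ge>1. \<forall>p. norm (f l p + g l p) \<le> C + D" by (auto intro!: norm_triangle_mono)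
  then show ?thesis using assms by (auto simp: bdd_def zo_def intro!: sfield_intros)
qed

lemma bdd_minus: "bdd f \<Longrightarrow> bdd (\<lambda>l p. - f l p)"
  by (auto simp: bdd_def zo_def intro!: sfield_intros)

lemma oscz_minus: "oscz f \<Longrightarrow> oscz (\<lambda>l p. - f l p)"
  by (auto simp: oscz_def zo_def intro!: osc_minus)

lemma corr_add: assumes "corr f" "corr g" shows "corr (\<lambda>l p. f l p + g l p)"
proof -
  obtain K E where f: "oscz K" "bdd E" "\<And>l p. l\<ge>1 \<Longrightarrow> f l p = (1 / real l) *\<^sub>R (dvg (K l) p + E l p)"
    using assms(1) unfolding corr_def by blast
  obtain K' E' where g: "oscz K'" "bdd E'" "\<And>l p. l\<ge>1 \<Longrightarrow> g l p = (1 / real l) *\<^sub>R (dvg (K' l) p + E' l p)"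
    using assms(2) unfolding corr_def by blast
  have "f l p + g l p = (1 / real l) *\<^sub>R (dvg (\<lambda>p. K l p + K' l p) p + (E l p + E' l p))" if "l \<ge> 1" for l p
    using dvg_add[OF osc_smooth[OF oscz_osc[OF f(1)] that] osc_smooth[OF oscz_osc[OF g(1)] that]]
    by (simp add: f(3)[OF that] g(3)[OF that] algebra_simps)
  then show ?thesis unfolding corr_def using oscz_add[OF f(1) g(1)] bdd_add[OF f(2) g(2)] by blast
qed

lemma dvg_minus: "smooth M \<Longrightarrow> dvg (\<lambda>p. - M p) p = - dvg M p"
  using dvg_scaleR[of M "-1" p] by simp

lemma corr_minus: assumes "corr f" shows "corr (\<lambda>l p. - f l p)"
proof -
  obtain K E where f: "oscz K" "bdd E" "\<And>l p. l\<ge>1 \<Longrightarrow> f l p = (1 / real l) *\<^sub>R (dvg (K l) p + E l p)"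
    using assms unfolding corr_def by blast
  have "- f l p = (1 / real l) *\<^sub>R (dvg (\<lambda>p. - K l p) p + - E l p)" if "l \<ge> 1" for l p
    using dvg_minus[OF osc_smooth[OF oscz_osc[OF f(1)] that]]
    by (simp add: f(3)[OF that] algebra_simps)
  then show ?thesis unfolding corr_def using oscz_minus[OF f(1)] bdd_minus[OF f(2)] by blast
qed

lemma bdd_zero: "bdd (\<lambda>l p. 0)"
  by (auto simp: bdd_def zo_def)

lemma oscz_zero: "oscz (\<lambda>l p. 0)"
  by (auto simp: oscz_def zo_def osc_const)

lemma dvg_zero [simp]: "dvg (\<lambda>p. 0) p = 0"
  by (simp add: dvg_def vec_eq_iff)

lemma corr_small: assumes "bdd E" shows "corr (\<lambda>l p. (1 / real l) *\<^sub>R E l p)"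
  unfolding corr_def using oscz_zero assms by (intro exI[of _ "\<lambda>l p. 0"] exI[of _ E]) simp

lemma corr_dvg: assumes "oscz M" shows "corr (\<lambda>l p. (1 / real l) *\<^sub>R dvg (M l) p)"
  unfolding corr_def using bdd_zero assms by (intro exI[of _ M] exI[of _ "\<lambda>l p. 0"]) simp

lemma corr_sum: "(\<And>i. i \<in> I \<Longrightarrow> corr (f i)) \<Longrightarrow> corr (\<lambda>l p. \<Sum>i\<in>I. f i l p)"
proof (induction I rule: infinite_finite_induct)
  case (insert x F)
  then show ?case by (auto intro: corr_add)
qed (use corr_small[OF bdd_zero] in simp_all)

lemma oscz_trig_scale:
  assumes "m \<in> \<int>" "slow d" "zo t0 t1 d"
  shows "oscz (\<lambda>l p. sin (ph m \<omega> l p) *\<^sub>R d p)" "oscz (\<lambda>l p. cos (ph m \<omega> l p) *\<^sub>R d p)"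
  using assms by (auto simp: oscz_def zo_def intro!: osc_scaleR osc_trig osc_slow)

text \<open>Integration by parts: the divergence of a sine times \<open>outer d' k\<close> is
  \<open>l\<close> times the given cosine term, plus a bounded term without a factor
  \<open>l\<close>. A nonzero spatial frequency \<open>m\<close> is what makes this
  possible.\<close>

lemma corr_cos:
  assumes m: "m \<in> \<int>" "m \<noteq> 0" and d: "slow d" "zo t0 t1 d"
  shows "corr (\<lambda>l p. cos (ph m \<omega> l p) *\<^sub>R d p)"
proof -
  define d' where "d' p = (1 / (m * (k \<bullet> k))) *\<^sub>R d p" for p
  have sd': "slow d'" "zo t0 t1 d'" using d by (auto simp: d'_def[abs_def] zo_def intro!: sfield_intros)
  have so: "slow (\<lambda>p. outer (d' p) k)" "zo t0 t1 (\<lambda>p. outer (d' p) k)"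
    using sd' by (auto intro!: sfield_intros simp: zo_def)
  have sp: "slow (pd (0, k) d')" "zo t0 t1 (pd (0, k) d')"
    by (auto intro!: sfield_intros sd' zo_pd)
  have kk: "k \<bullet> k \<noteq> 0" using k_nz by simp
  have "cos (ph m \<omega> l p) *\<^sub>R d p = (1 / real l) *\<^sub>R (dvg (\<lambda>p. sin (ph m \<omega> l p) *\<^sub>R outer (d' p) k) p
      + - (sin (ph m \<omega> l p) *\<^sub>R pd (0, k) d' p))" if "l \<ge> 1" for l p
    using that m(2) kk
    by (simp add: dvg_sin[OF sfield_smooth[OF so(1)]] dvg_outer[OF sfield_smooth[OF sd'(1)]] outer_mv) (simp add: d'_def)
  then show ?thesis
    unfolding corr_def
    using oscz_trig_scale(1)[OF m(1) so] bdd_minus[OF oscz_bdd[OF oscz_trig_scale(1)[OF m(1) sp]]] by blast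
qed

text \<open>A choice, linear in \<open>z\<close>, of a symmetric matrix that maps \<open>k\<close>
  to \<open>z\<close>.\<close>

definition symk :: "real^2 \<Rightarrow> mat2" where
  "symk z = (1 / (k \<bullet> k)) *\<^sub>R (outer z k + outer k z) - ((z \<bullet> k) / (k \<bullet> k)\<^sup>2) *\<^sub>R outer k k"

lemma symk_sym: "transpose (symk z) = symk z"
  by (simp add: symk_def transpose_def vec_eq_iff algebra_simps)

lemma symk_k: "symk z *v k = z"
proof -
  have kk: "k \<bullet> k \<noteq> 0" using k_nz by simp
  have "symk z *v k = (1 / (k \<bullet> k)) *\<^sub>R ((k \<bullet> k) *\<^sub>R z + (z \<bullet> k) *\<^sub>R k) - ((z \<bullet> k) / (k \<bullet> k)\<^sup>2) *\<^sub>R ((k \<bullet> k) *\<^sub>R k)"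
    by (simp add: symk_def matrix_vector_mult_diff_rdistrib matrix_vector_mult_add_rdistrib outer_mv
        flip: scaleR_matrix_vector_assoc)
  then show ?thesis using kk by (simp add: power2_eq_square algebra_simps)
qed

lemma bounded_linear_symk: "bounded_linear symk"
  unfolding linear_conv_bounded_linear[symmetric] linear_iff
  by (simp add: symk_def vec_eq_iff algebra_simps add_divide_distrib inner_add_left)

lemma osc_minv:
  assumes F: "osc F" and d: "\<And>l p. l \<ge> 1 \<Longrightarrow> det (F l p) \<ge> 1/2"
  shows "osc (\<lambda>l p. minv (F l p))"
proof -
  have n: "osc (\<lambda>l p. F l p $ i $ j)" for i j
    by (rule osc_linear[OF bounded_linear_compose[OF bounded_linear_vec_nth bounded_linear_vec_nth] F])
  have "osc (\<lambda>l p. det (F l p))" unfolding det_2 by (intro osc_diff osc_mult n)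
  from osc_inverse[OF this _ d] show ?thesis
    unfolding minv_def by (intro osc_scaleR osc_linear[OF bounded_linear_adj F]) auto
qed

text \<open>A general potential \<open>K\<close> has to be replaced by \<open>F ** S\<close> with
  \<open>S\<close> symmetric. \<open>symk\<close> allows to prescribe \<open>S *v k\<close> so that
  \<open>F ** S\<close> and \<open>K\<close> agree on \<open>k\<close>. In two dimensions their
  difference is then \<open>outer q (perp k)\<close>, whose divergence is the derivative of
  \<open>q\<close> along \<open>perp k\<close>. This is bounded in \<open>l\<close> and joins the
  remainder \<open>E\<close>.\<close>

lemma corr_solve:
  assumes f: "corr f" and F: "osc F" and d: "\<And>l p. l \<ge> 1 \<Longrightarrow> det (F l p) \<ge> 1/2"
  obtains S E where "oscz S" "bdd E" "\<And>l p. transpose (S l p) = S l p"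
    "\<And>l p. l \<ge> 1 \<Longrightarrow> f l p = (1 / real l) *\<^sub>R (dvg (\<lambda>p. F l p ** S l p) p + E l p)"
proof -
  obtain K E where K: "oscz K" "bdd E" "\<And>l p. l\<ge>1 \<Longrightarrow> f l p = (1 / real l) *\<^sub>R (dvg (K l) p + E l p)"
    using f unfolding corr_def by blast
  define S where "S l p = symk (minv (F l p) *v (K l p *v k))" for l p
  have kk: "k \<bullet> k \<noteq> 0" using k_nz by simp
  have oS: "osc S" unfolding S_def[abs_def]
    by (intro osc_linear[OF bounded_linear_symk] osc_mv osc_minv F d oscz_osc[OF K(1)] osc_const)
  have zS: "zo t0 t1 (S l)" if "l \<ge> 1" for l
    using K(1) that unfolding oscz_def zo_def S_def by (auto simp: bounded_linear.linear linear_0[OF bounded_linear.linear[OF bounded_linear_symk]])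
  define q where "q l p = (1 / (k \<bullet> k)) *\<^sub>R ((F l p ** S l p - K l p) *v perp k)" for l p
  have oq: "osc q" unfolding q_def[abs_def]
    by (intro osc_linear[OF bounded_linear_scaleR_right] osc_mv osc_diff osc_mm F oS oscz_osc[OF K(1)] osc_const)
  have zq: "zo t0 t1 (q l)" if "l \<ge> 1" for l
    using K(1) zS[OF that] that unfolding oscz_def zo_def q_def by auto
  have Q: "F l p ** S l p = K l p + outer (q l p) (perp k)" if "l \<ge> 1" for l p
  proof -
    define M where "M = F l p ** S l p - K l p"
    have "det (F l p) \<noteq> 0" using d[OF that, of p] by auto
    then have "M *v k = 0"
      by (simp add: M_def matrix_vector_mult_diff_rdistrib mm_mv S_def symk_k minv_mv)
    then have M: "M $ 1 $ 1 * k $ 1 + M $ 1 $ 2 * k $ 2 = 0" "M $ 2 $ 1 * k $ 1 + M $ 2 $ 2 * k $ 2 = 0"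
      by (simp_all add: vec_eq_iff forall_2 matrix_vector_mult_def sum_2)
    have "(k \<bullet> k) *\<^sub>R M = outer (M *v perp k) (perp k)"
      using M by (simp add: vec_eq_iff forall_2 matrix_vector_mult_def sum_2 inner_2) algebra
    then have "M = (1 / (k \<bullet> k)) *\<^sub>R outer (M *v perp k) (perp k)"
      using kk by (metis (no_types, lifting) divide_self_if scaleR_one scaleR_scaleR times_divide_eq_left mult_1)
    also have "\<dots> = outer (q l p) (perp k)"
      by (simp add: q_def M_def vec_eq_iff)
    finally show ?thesis by (simp add: M_def algebra_simps)
  qed
  define E' where "E' l p = E l p + - pd kp (q l) p" for l p
  have bq: "bdd (\<lambda>l. pd kp (q l))"
  proof -
    obtain C where C: "C > 0" "\<And>l p. l \<ge> 1 \<Longrightarrow> norm (q l p) \<le> C" "\<And>l p. l \<ge> 1 \<Longrightarrow> norm (pd kp (q l) p) \<le> C"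
      using oscE[OF oq] by blast
    show ?thesis
      unfolding bdd_def
      by (intro conjI allI impI exI[of _ C] sfield_pd_Per[OF osc_sfield[OF oq]] zo_pd[OF zq] C(3))
  qed
  have "bdd E'" unfolding E'_def[abs_def] by (intro bdd_add K(2) bdd_minus bq)
  moreover have "f l p = (1 / real l) *\<^sub>R (dvg (\<lambda>p. F l p ** S l p) p + E' l p)" if "l \<ge> 1" for l p
  proof -
    have "dvg (\<lambda>p. F l p ** S l p) p = dvg (K l) p + pd kp (q l) p"
      unfolding Q[OF that]
      using osc_smooth[OF oscz_osc[OF K(1)] that] osc_smooth[OF oq that]
      by (subst dvg_add) (auto intro!: smooth_intros simp: dvg_outer)
    then show ?thesis by (simp add: K(3)[OF that] E'_def)
  qed
  moreover have "transpose (S l p) = S l p" for l p by (simp add: S_def symk_sym)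
  ultimately show ?thesis using that oS zS unfolding oscz_def by blast
qed

text \<open>The pieces are bumps of width \<open>\<tau>\<close> in the variable \<open>s\<close>,
  centred at the multiples of \<open>\<tau>\<close>. Their squares sum to 1 because the stress
  produced by a wave is quadratic in its amplitude. At most two pieces overlap, which bounds the sum
  of their absolute values independently of \<open>\<tau>\<close>. The margin
  \<open>2 * \<tau> \<le> lo\<close> keeps the index 0, which would mean frequency 0, out of the
  sum.\<close>

lemma partition_of_unity:
  fixes s :: "pt \<Rightarrow> real"
  assumes s: "slow s" and lo: "0 < \<tau>" "2 * \<tau> \<le> lo" "\<And>p. lo \<le> s p" "\<And>p. s p \<le> hi"
  obtains J :: nat and ch :: "nat \<Rightarrow> pt \<Rightarrow> real" where "\<And>j. slow (ch j)" "\<And>p. (\<Sum>j\<in>{1..J}. (ch j p)\<^sup>2) = 1"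
    "\<And>j p. j \<in> {1..J} \<Longrightarrow> ch j p \<noteq> 0 \<Longrightarrow> \<bar>\<tau> * real j - s p\<bar> < \<tau>" "\<And>p. (\<Sum>j\<in>{1..J}. \<bar>ch j p\<bar>) \<le> 2"
proof -
  define J where "J = nat \<lceil>hi / \<tau>\<rceil>"
  define g where "g j p = bump (s p / \<tau> - real j)" for j p
  define q where "q p = (\<Sum>j\<in>{1..J}. (g j p)\<^sup>2)" for p
  have sg: "slow (g j)" for j
    unfolding g_def[abs_def] divide_inverse
    by (rule sfield_compose[OF smooth_bump]) (intro sfield_intros s)
  have sq: "slow q" unfolding q_def[abs_def] by (intro sfield_intros sg)
  have qpos: "q p > 0" for p
  proof -
    define j where "j = nat \<lfloor>s p / \<tau>\<rfloor>"
    have 2: "s p / \<tau> \<ge> 2" using lo(1) order_trans[OF lo(2,3)] by (simp add: field_simps)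
    have j: "real j = of_int \<lfloor>s p / \<tau>\<rfloor>" using 2 by (simp add: j_def)
    have "s p / \<tau> \<le> hi / \<tau>" using lo(1,4) by (simp add: divide_right_mono)
    then have "\<lfloor>s p / \<tau>\<rfloor> \<le> \<lceil>hi / \<tau>\<rceil>" by linarith
    then have jJ: "j \<in> {1..J}" using 2 by (auto simp: j_def J_def nat_mono le_nat_floor)
    have "\<bar>s p / \<tau> - real j\<bar> < 1" unfolding j by linarith
    then have "0 < (g j p)\<^sup>2" using bump_pos[of "s p / \<tau> - real j"] by (simp add: g_def)
    also have "(g j p)\<^sup>2 \<le> q p" unfolding q_def using jJ by (intro member_le_sum) auto
    finally show ?thesis .
  qed
  define ch where "ch j p = g j p / sqrt (q p)" for j p
  have qnz: "sqrt (q p) \<noteq> 0" for p using qpos[of p] by simp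
  have g0: "g j p \<ge> 0" for j p by (simp add: g_def bump_nonneg)
  have le1: "\<bar>ch j p\<bar> \<le> 1" if "j \<in> {1..J}" for j p
  proof -
    have "(g j p)\<^sup>2 \<le> q p" unfolding q_def using that by (intro member_le_sum) auto
    then have "g j p \<le> sqrt (q p)" by (rule real_le_rsqrt)
    then show ?thesis using qpos[of p] g0[of j p] by (simp add: ch_def)
  qed
  have supp: "\<bar>\<tau> * real j - s p\<bar> < \<tau>" if "ch j p \<noteq> 0" for j p
  proof -
    have "\<bar>s p / \<tau> - real j\<bar> < 1"
      using that bump_zero[of "s p / \<tau> - real j"] by (cases "\<bar>s p / \<tau> - real j\<bar> < 1") (auto simp: ch_def g_def)
    then have "\<tau> * \<bar>s p / \<tau> - real j\<bar> < \<tau>" using lo(1) by simp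
    moreover have "\<tau> * \<bar>s p / \<tau> - real j\<bar> = \<bar>\<tau> * (s p / \<tau> - real j)\<bar>" using lo(1) by (simp add: abs_mult)
    moreover have "\<tau> * (s p / \<tau> - real j) = s p - \<tau> * real j" using lo(1) by (simp add: field_simps)
    ultimately show ?thesis by (simp add: abs_minus_commute)
  qed
  have "(\<Sum>j\<in>{1..J}. \<bar>ch j p\<bar>) \<le> 2" for p
  proof -
    define n where "n = nat \<lfloor>s p / \<tau>\<rfloor>"
    have nn: "0 \<le> s p / \<tau>" using lo(1) order_trans[OF _ lo(3), of 0] lo(2) by simp
    have "{j \<in> {1..J}. ch j p \<noteq> 0} \<subseteq> {n, n + 1}"
    proof
      fix j assume "j \<in> {j \<in> {1..J}. ch j p \<noteq> 0}"
      then have "\<bar>\<tau> * real j - s p\<bar> < \<tau>" using supp by auto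
      then have "\<bar>real j - s p / \<tau>\<bar> < 1" using lo(1) by (simp add: abs_less_iff field_simps)
      then have "int j = \<lfloor>s p / \<tau>\<rfloor> \<or> int j = \<lfloor>s p / \<tau>\<rfloor> + 1" by linarith
      then show "j \<in> {n, n + 1}" using nn unfolding n_def by auto
    qed
    then have "card {j \<in> {1..J}. ch j p \<noteq> 0} \<le> card {n, n + 1}" by (intro card_mono) auto
    also have "\<dots> \<le> 2" by (simp add: card_insert_if)
    finally have c: "card {j \<in> {1..J}. ch j p \<noteq> 0} \<le> 2" .
    have "(\<Sum>j\<in>{1..J}. \<bar>ch j p\<bar>) = (\<Sum>j\<in>{j \<in> {1..J}. ch j p \<noteq> 0}. \<bar>ch j p\<bar>)"
      by (intro sum.mono_neutral_right) auto
    also have "\<dots> \<le> of_nat (card {j \<in> {1..J}. ch j p \<noteq> 0}) * 1"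
      by (intro sum_bounded_above) (use le1 in auto)
    finally show ?thesis using c by linarith
  qed
  moreover have "(\<Sum>j\<in>{1..J}. (ch j p)\<^sup>2) = 1" for p
    using qpos[of p] by (simp add: ch_def power_divide flip: sum_divide_distrib) (simp add: q_def)
  moreover have "slow (ch j)" for j
    unfolding ch_def[abs_def] by (intro sfield_intros sg sq qpos qnz)
  ultimately show ?thesis using that[of ch J] supp by blast
qed

end

section \<open>Adding one wave\<close>

lemma norm_outer_le: "norm (outer v w) \<le> 2 * norm v * norm w"
proof -
  have "norm (outer v w) \<le> norm (outer v w $ 1) + norm (outer v w $ 2)"
    using L2_set_le_sum[of UNIV "\<lambda>i. norm (outer v w $ i)"] by (simp add: norm_vec_def sum_2)
  also have "outer v w $ i = v $ i *\<^sub>R w" for i by (simp add: vec_eq_iff)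
  then have "norm (outer v w $ 1) + norm (outer v w $ 2) = (\<bar>v$1\<bar> + \<bar>v$2\<bar>) * norm w"
    by (simp add: algebra_simps)
  also have "\<dots> \<le> (norm v + norm v) * norm w"
    using component_le_norm_cart[of v 1] component_le_norm_cart[of v 2] by (intro mult_right_mono) auto
  finally show ?thesis by simp
qed

lemma sfield_Slab_zo: "sfield Per f \<Longrightarrow> zo t0 t1 f \<Longrightarrow> sfield (Slab t0 t1) f"
  unfolding sfield_def Slab_def zo_def by auto

lemmas mm_lin = bounded_bilinear.add_left[OF bounded_bilinear_mm] bounded_bilinear.add_right[OF bounded_bilinear_mm]
  bounded_bilinear.diff_left[OF bounded_bilinear_mm] bounded_bilinear.diff_right[OF bounded_bilinear_mm]
  bounded_bilinear.scaleR_left[OF bounded_bilinear_mm] bounded_bilinear.scaleR_right[OF bounded_bilinear_mm]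
  bounded_bilinear.zero_left[OF bounded_bilinear_mm] bounded_bilinear.zero_right[OF bounded_bilinear_mm]

lemmas mv_lin = bounded_bilinear.add_left[OF bounded_bilinear_mv] bounded_bilinear.add_right[OF bounded_bilinear_mv]
  bounded_bilinear.diff_left[OF bounded_bilinear_mv] bounded_bilinear.diff_right[OF bounded_bilinear_mv]
  bounded_bilinear.scaleR_left[OF bounded_bilinear_mv] bounded_bilinear.scaleR_right[OF bounded_bilinear_mv]

context material
begin

definition state :: "real \<Rightarrow> real \<Rightarrow> (pt \<Rightarrow> real^2) \<Rightarrow> (pt \<Rightarrow> mat2) \<Rightarrow> bool" where
  "state t0 t1 u R \<longleftrightarrow> sfield (Slab t0 t1) u \<and> zo t0 t1 u \<and> sfield (Slab t0 t1) R \<and> zo t0 t1 R \<and>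
     (\<forall>p. transpose (R p) = R p) \<and>
     (\<forall>p. pd dt (pd dt u) p = dvg (\<lambda>p. (mat 1 + grad u p) ** (Sg (grad u p) + R p)) p)"

lemma stateD:
  assumes "state t0 t1 u R"
  shows "sfield (Slab t0 t1) u" "zo t0 t1 u" "sfield (Slab t0 t1) R" "zo t0 t1 R" "transpose (R p) = R p"
    "pd dt (pd dt u) p = dvg (\<lambda>p. (mat 1 + grad u p) ** (Sg (grad u p) + R p)) p"
  using assms unfolding state_def by auto

end

locale substep = material a b c + wave k t0 t1
  for a b c k t0 t1 +
  fixes u :: "pt \<Rightarrow> real^2" and R :: "pt \<Rightarrow> mat2" and am :: "pt \<Rightarrow> real"
    and J :: nat and ch :: "nat \<Rightarrow> pt \<Rightarrow> real" and \<tau> A :: real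
  assumes u: "sfield (Slab t0 t1) u" "zo t0 t1 u"
    and R: "sfield (Slab t0 t1) R" "zo t0 t1 R" "\<And>p. transpose (R p) = R p"
    and am: "sfield (Slab t0 t1) am" "zo t0 t1 am" "\<And>p. \<bar>am p\<bar> \<le> A"
    and state: "\<And>p. pd dt (pd dt u) p = dvg (\<lambda>p. (mat 1 + grad u p) ** (Sg (grad u p) + R p)) p"
    and gd: "\<And>p. good k (grad u p)"
    and \<tau>: "\<tau> > 0"
    and ch: "\<And>j. sfield (Slab t0 t1) (ch j)" "\<And>p. (\<Sum>j\<in>{1..J}. (ch j p)\<^sup>2) = 1" "\<And>p. (\<Sum>j\<in>{1..J}. \<bar>ch j p\<bar>) \<le> 2"
    and ch_supp: "\<And>j p. j \<in> {1..J} \<Longrightarrow> ch j p \<noteq> 0 \<Longrightarrow>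
        \<bar>\<tau> * real j - (ev k (grad u p) + k \<bullet> ((Sg (grad u p) + R p) *v k))\<bar> < \<tau>"
    and small: "\<And>p x. \<bar>x\<bar> \<le> 2 * A \<Longrightarrow> 1 + x * (k \<bullet> Xv k (grad u p)) \<ge> 1/2"
begin

section \<open>Ansatz for the wave and for the new stress\<close>

definition "G p = grad u p"
definition "F p = mat 1 + G p"
definition "n p = nv k (G p)"
definition "X p = Xv k (G p)"
definition "e p = ev k (G p)"
text \<open>The local squared speed: the eigenvalue plus the share of the prestress. It is
  approximated by \<open>\<tau> * real j\<close> where \<open>ch j\<close> is nonzero.\<close>

definition "sp p = e p + k \<bullet> ((Sg (G p) + R p) *v k)"
definition "cc j = sqrt (\<tau> * real j)"
definition "th j = ph (real j) (real j * cc j)"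
definition "bb j p = (am p * ch j p) *\<^sub>R n p"
definition "B l p = (\<Sum>j\<in>{1..J}. cos (th j l p) * (am p * ch j p))"
text \<open>\<open>Ha\<close> and \<open>Hb\<close> are the parts of \<open>grad (w l)\<close> of
  order 1 and, up to the factor \<open>1 / l\<close>, of lower order; see
  \<open>grad_w\<close>.\<close>

definition "Ha l p = B l p *\<^sub>R outer (n p) k"
definition "Hb l p = (\<Sum>j\<in>{1..J}. (1 / real j) *\<^sub>R (sin (th j l p) *\<^sub>R grad (bb j) p))"
text \<open>Each piece is divided by its frequency \<open>l * j\<close>, which makes the gradient of
  order 1 and the displacement of order \<open>1 / l\<close>.\<close>

definition "w l p = (1 / real l) *\<^sub>R (\<Sum>j\<in>{1..J}. (1 / real j) *\<^sub>R (sin (th j l p) *\<^sub>R bb j p))"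
definition "FH l p = F p + Ha l p + (1 / real l) *\<^sub>R Hb l p"
definition "\<gamma> l p = (\<Sum>j\<in>{1..J}. cos (th j l p) * (am p * ch j p * (\<tau> * real j - sp p)))"
definition "DB l p = 1 + B l p * (k \<bullet> X p)"
text \<open>The symmetric stress that cancels \<open>Ha l p ** DS (G p) (Ha l p)\<close>. The factor
  \<open>DB\<close> is divided out because \<open>F + Ha\<close> maps \<open>X\<close> to
  \<open>DB *\<^sub>R n\<close>.\<close>

definition "Y l p = (e p * (B l p)\<^sup>2 * inverse (DB l p)) *\<^sub>R outer (X p) (X p)"
definition "S1 l p = (\<gamma> l p * inverse (DB l p) * inverse (k \<bullet> X p)) *\<^sub>R outer (X p) (X p)"
definition "M0 = ((k \<bullet> k) * sig) *\<^sub>R outer (perp k) (perp k)"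
text \<open>The nonlinear response of the stress is close to \<open>- (B l p)\<^sup>2\<close> times
  \<open>M0\<close>. Only its oscillating part is compensated, so its mean,
  \<open>(am p)\<^sup>2 / 2\<close> times \<open>M0\<close>, is subtracted from the error.\<close>

definition "So l p = ((B l p)\<^sup>2 - (am p)\<^sup>2 / 2) *\<^sub>R M0"
text \<open>The stress before the last corrections: the new error will be \<open>V\<close> minus the
  true stress at the new gradient, plus two correctors of order \<open>1 / l\<close>.\<close>

definition "V l p = Sg (G p) + R p + DS (G p) (Ha l p) - Y l p + S1 l p + So l p"
definition "M l p = Hb l p ** V l p"
text \<open>The amplitude of the \<open>j\<close>-th cosine in the part of the stress that is linear
  in the wave.\<close>

definition "N j p = (am p * ch j p) *\<^sub>R (outer (n p) ((Sg (G p) + R p) *v k) + F p ** DS (G p) (outer (n p) k)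
   + ((\<tau> * real j - sp p) * inverse (k \<bullet> X p)) *\<^sub>R outer (n p) (X p))"
definition "T1 l p = (\<Sum>j\<in>{1..J}. cos (th j l p) *\<^sub>R N j p)"
definition "T2 l p = F p ** So l p"
definition "P i j p = ((am p)\<^sup>2 * ch i p * ch j p / 2) *\<^sub>R (F p ** M0)"

lemma kk_pos: "k \<bullet> k > 0" using k_nz by simp

lemma A_nonneg: "A \<ge> 0" using am(3)[of 0] by linarith

lemma kX: "k \<bullet> X p > k \<bullet> k / 2" "k \<bullet> X p \<noteq> 0"
proof -
  show 1: "k \<bullet> X p > k \<bullet> k / 2" using gd[of p] by (simp add: good_def X_def G_def)
  show "k \<bullet> X p \<noteq> 0" using 1 kk_pos by linarith
qed

lemma slow_fields: "slow G" "slow F" "slow n" "slow X" "slow e" "slow sp" "slow (bb j)" "slow (grad (bb j))" "slow (N j)" "slow (P i j)"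
proof -
  show G: "slow G" unfolding G_def[abs_def] by (intro sfield_intros u)
  show F: "slow F" unfolding F_def[abs_def] by (intro sfield_intros G)
  show n: "slow n" unfolding n_def[abs_def] by (intro sfield_intros G) (simp add: G_def gd)
  show X: "slow X" unfolding X_def[abs_def] by (intro sfield_intros G) (simp add: G_def gd)
  show e: "slow e" unfolding e_def[abs_def] by (intro sfield_intros G) (simp add: G_def gd)
  show s: "slow sp" unfolding sp_def[abs_def] by (intro sfield_intros G R e)
  show bb: "slow (bb j)" for j unfolding bb_def[abs_def] by (intro sfield_intros am ch n)
  show "slow (grad (bb j))" by (intro sfield_intros bb)
  show "slow (N j)" unfolding N_def[abs_def] by (intro sfield_intros am ch n G R F s X kX)
  show "slow (P i j)" unfolding P_def[abs_def] divide_inverse by (intro sfield_intros am ch F)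
qed

lemma zo_fields: "zo t0 t1 (bb j)" "zo t0 t1 (grad (bb j))" "zo t0 t1 (N j)" "zo t0 t1 (P i j)" "zo t0 t1 G"
proof -
  show b: "zo t0 t1 (bb j)" for j using am(2) by (simp add: zo_def bb_def)
  show "zo t0 t1 (grad (bb j))" by (rule zo_grad[OF b])
  show "zo t0 t1 (N j)" using am(2) by (simp add: zo_def N_def)
  show "zo t0 t1 (P i j)" using am(2) by (simp add: zo_def P_def)
  show "zo t0 t1 G" using zo_grad[OF u(2)] by (simp add: G_def[abs_def])
qed

lemma osc_cos: "osc (\<lambda>l p. cos (th j l p))" "osc (\<lambda>l p. sin (th j l p))"
  unfolding th_def by (intro osc_trig; simp)+

lemma osc_B: "osc B"
  unfolding B_def[abs_def] by (intro osc_sum osc_mult osc_cos osc_slow sfield_intros am ch)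

lemma osc_Ha: "osc Ha"
  unfolding Ha_def[abs_def] by (intro osc_scaleR osc_B osc_slow sfield_intros slow_fields)

lemma osc_Hb: "osc Hb"
  unfolding Hb_def[abs_def] by (intro osc_sum osc_linear[OF bounded_linear_scaleR_right] osc_scaleR osc_cos osc_slow slow_fields)

lemma osc_FH: "osc FH"
  unfolding FH_def[abs_def] by (intro osc_add osc_over_l osc_slow osc_Ha osc_Hb slow_fields)

text \<open>The factor 2 bounds the sum of the pieces of the partition and does not depend on its
  mesh.\<close>

lemma B_bound: "\<bar>B l p\<bar> \<le> 2 * A"
proof -
  have "\<bar>B l p\<bar> \<le> (\<Sum>j\<in>{1..J}. A * \<bar>ch j p\<bar>)"
    unfolding B_def
  proof (intro order_trans[OF sum_abs] sum_mono)
    fix j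
    have "\<bar>cos (th j l p)\<bar> * (\<bar>am p\<bar> * \<bar>ch j p\<bar>) \<le> 1 * (A * \<bar>ch j p\<bar>)"
      using am(3)[of p] A_nonneg by (intro mult_mono) auto
    then show "\<bar>cos (th j l p) * (am p * ch j p)\<bar> \<le> A * \<bar>ch j p\<bar>" by (simp add: abs_mult)
  qed
  also have "\<dots> \<le> A * 2" unfolding sum_distrib_left[symmetric] by (intro mult_left_mono ch A_nonneg)
  finally show ?thesis by simp
qed

lemma DB: "DB l p \<ge> 1/2" "DB l p \<noteq> 0"
  using small[OF B_bound, of l p p] by (auto simp: DB_def X_def G_def)

lemma osc_DB: "osc (\<lambda>l p. inverse (DB l p))"
proof (rule osc_inverse)
  show "osc DB" unfolding DB_def[abs_def] by (intro osc_add osc_const osc_mult osc_B osc_slow sfield_intros slow_fields)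
  show "(1/2 :: real) > 0" by simp
qed (rule DB)

lemma osc_Y: "osc Y"
  unfolding Y_def[abs_def] power2_eq_square
  by (intro osc_scaleR osc_mult osc_B osc_DB osc_slow sfield_intros slow_fields)

lemma osc_S1: "osc S1"
proof -
  have "osc \<gamma>" unfolding \<gamma>_def[abs_def]
    by (intro osc_sum osc_mult osc_cos osc_slow sfield_intros slow_fields am ch)
  then show ?thesis unfolding S1_def[abs_def]
    by (intro osc_scaleR osc_mult osc_DB osc_slow sfield_intros slow_fields kX)
qed

lemma osc_So: "osc So"
proof -
  have "slow (\<lambda>p. (am p)\<^sup>2 / 2)" unfolding divide_inverse by (intro sfield_intros am)
  then show ?thesis unfolding So_def[abs_def] power2_eq_square
    by (intro osc_scaleR osc_diff osc_mult osc_B osc_slow osc_const) simp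
qed

lemma osc_DS: "osc (\<lambda>l p. DS (G p) (Ha l p))"
  unfolding Ha_def DS_scaleR by (intro osc_scaleR osc_B osc_slow sfield_intros slow_fields)

lemma osc_V: "osc V"
  unfolding V_def[abs_def] by (intro osc_add osc_diff osc_Y osc_S1 osc_So osc_DS osc_slow sfield_intros slow_fields R)

lemma zo_B: "fst p \<notin> {t0..t1} \<Longrightarrow> B l p = 0" "fst p \<notin> {t0..t1} \<Longrightarrow> am p = 0"
  "fst p \<notin> {t0..t1} \<Longrightarrow> G p = 0" "fst p \<notin> {t0..t1} \<Longrightarrow> \<gamma> l p = 0" "fst p \<notin> {t0..t1} \<Longrightarrow> Hb l p = 0"
  using am(2) zo_fields(2,5) by (simp_all add: zo_def B_def \<gamma>_def Hb_def)

lemma oscz_M: "oscz M"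
proof -
  have "osc M" unfolding M_def[abs_def] by (intro osc_mm osc_Hb osc_V)
  then show ?thesis by (simp add: oscz_def zo_def M_def zo_B)
qed

section \<open>Cancellations in the stress\<close>

lemma M0_k: "M0 *v k = 0" "transpose M0 = M0"
  by (simp_all add: M0_def vec_eq_iff forall_2 matrix_vector_mult_def transpose_def sum_2)

lemma eig: "F p *v (DS (G p) (outer (n p) k) *v k) = e p *\<^sub>R n p"
  "DS (G p) (outer (n p) k) *v k = e p *\<^sub>R X p" "F p *v X p = n p"
  using eigen[OF k_nz gd[of p]] by (simp_all add: F_def G_def n_def e_def X_def)

lemma N_k: "N j p *v k = (\<tau> * real j) *\<^sub>R bb j p"
proof -
  have c: "inverse (k \<bullet> X p) * (X p \<bullet> k) = 1" using kX(2) by (simp add: inner_commute)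
  have "N j p *v k = (am p * ch j p) *\<^sub>R ((((Sg (G p) + R p) *v k) \<bullet> k) *\<^sub>R n p + e p *\<^sub>R n p + (\<tau> * real j - sp p) *\<^sub>R n p)"
    by (simp add: N_def mv_lin outer_mv mm_mv eig(1) mult.assoc c)
  also have "(((Sg (G p) + R p) *v k) \<bullet> k) *\<^sub>R n p + e p *\<^sub>R n p + (\<tau> * real j - sp p) *\<^sub>R n p = (\<tau> * real j) *\<^sub>R n p"
    by (simp add: sp_def inner_commute[of k] flip: scaleR_add_left)
  finally show ?thesis by (simp add: bb_def mult.commute)
qed

lemma matrix_sum_left: "(\<Sum>i\<in>I. f i *\<^sub>R (D :: mat2)) = (\<Sum>i\<in>I. f i) *\<^sub>R D"
  by (simp add: scaleR_left.sum)

text \<open>\<open>DB\<close> cancels in \<open>(F p + Ha l p) ** S1 l p\<close>, which is therefore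
  linear in the cosines although \<open>S1\<close> is not. So this part of the stress splits into
  single frequencies.\<close>

lemma T1_eq: "T1 l p = Ha l p ** (Sg (G p) + R p) + F p ** DS (G p) (Ha l p) + (F p + Ha l p) ** S1 l p"
proof -
  have tr: "transpose (Sg (G p) + R p) = Sg (G p) + R p"
    using R(3)[of p] Sg_sym by (simp add: transpose_def vec_eq_iff)
  have 1: "Ha l p ** (Sg (G p) + R p) = B l p *\<^sub>R outer (n p) ((Sg (G p) + R p) *v k)"
    by (simp add: Ha_def outer_mm tr flip: scalar_matrix_assoc)
  have 2: "F p ** DS (G p) (Ha l p) = B l p *\<^sub>R (F p ** DS (G p) (outer (n p) k))"
    by (simp add: Ha_def DS_scaleR matrix_scalar_ac flip: scalar_matrix_assoc)
  have "(F p + Ha l p) ** outer (X p) (X p) = outer (n p + (B l p * (k \<bullet> X p)) *\<^sub>R n p) (X p)"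
    by (simp add: mm_outer matrix_vector_mult_add_rdistrib eig Ha_def outer_mv flip: scaleR_matrix_vector_assoc)
  also have "\<dots> = DB l p *\<^sub>R outer (n p) (X p)"
    by (simp add: DB_def vec_eq_iff algebra_simps)
  finally have "(F p + Ha l p) ** S1 l p = (\<gamma> l p * inverse (DB l p) * inverse (k \<bullet> X p)) *\<^sub>R (DB l p *\<^sub>R outer (n p) (X p))"
    by (simp add: S1_def matrix_scalar_ac flip: scalar_matrix_assoc)
  then have 3: "(F p + Ha l p) ** S1 l p = (\<gamma> l p * inverse (k \<bullet> X p)) *\<^sub>R outer (n p) (X p)"
    using DB(2)[of l p] by simp
  have "T1 l p = (\<Sum>j\<in>{1..J}. (cos (th j l p) * (am p * ch j p)) *\<^sub>R (outer (n p) ((Sg (G p) + R p) *v k) + F p ** DS (G p) (outer (n p) k))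
     + (cos (th j l p) * (am p * ch j p * (\<tau> * real j - sp p))) *\<^sub>R (inverse (k \<bullet> X p) *\<^sub>R outer (n p) (X p)))"
    unfolding T1_def N_def by (intro sum.cong refl) (simp add: algebra_simps)
  also have "\<dots> = B l p *\<^sub>R (outer (n p) ((Sg (G p) + R p) *v k) + F p ** DS (G p) (outer (n p) k))
     + \<gamma> l p *\<^sub>R (inverse (k \<bullet> X p) *\<^sub>R outer (n p) (X p))"
    by (simp only: sum.distrib matrix_sum_left B_def \<gamma>_def)
  finally show ?thesis unfolding 1 2 3 by (simp add: algebra_simps)
qed

text \<open>Both sides are \<open>e p * (B l p)\<^sup>2\<close> times
  \<open>outer (n p) (X p)\<close>: on the left by the symmetry of \<open>DS\<close> and the second
  equation of \<open>eigen\<close>, on the right by the division by \<open>DB\<close>.\<close>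

lemma Y_cancel: "Ha l p ** DS (G p) (Ha l p) = (F p + Ha l p) ** Y l p"
proof -
  have "Ha l p ** DS (G p) (Ha l p) = ((B l p)\<^sup>2 * e p) *\<^sub>R outer (n p) (X p)"
    by (simp add: Ha_def DS_scaleR outer_mm DS_sym eig matrix_scalar_ac power2_eq_square flip: scalar_matrix_assoc)
      (simp add: vec_eq_iff algebra_simps)
  moreover have "(F p + Ha l p) ** outer (X p) (X p) = DB l p *\<^sub>R outer (n p) (X p)"
    by (simp add: mm_outer matrix_vector_mult_add_rdistrib eig Ha_def outer_mv flip: scaleR_matrix_vector_assoc)
      (simp add: DB_def vec_eq_iff algebra_simps)
  then have "(F p + Ha l p) ** Y l p = (e p * (B l p)\<^sup>2 * inverse (DB l p)) *\<^sub>R (DB l p *\<^sub>R outer (n p) (X p))"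
    by (simp add: Y_def matrix_scalar_ac flip: scalar_matrix_assoc)
  ultimately show ?thesis using DB(2)[of l p] by simp
qed

text \<open>What the new stress has in excess of the old one is sorted by type: \<open>T1\<close> is
  linear in the cosines, \<open>T2\<close> quadratic without mean, \<open>M\<close> of order
  \<open>1 / l\<close>. The product \<open>Ha ** So\<close> drops out because \<open>M0\<close>
  annihilates \<open>k\<close>.\<close>

lemma stress_identity:
  "FH l p ** (V l p - Sg (G p + Ha l p + (1 / real l) *\<^sub>R Hb l p)) =
     F p ** (Sg (G p) + R p) - FH l p ** Sg (G p + Ha l p + (1 / real l) *\<^sub>R Hb l p)
     + (T1 l p + T2 l p + (1 / real l) *\<^sub>R M l p)"
proof -
  have HaSo: "Ha l p ** So l p = 0"
    by (simp add: Ha_def So_def outer_mm M0_k matrix_scalar_ac flip: scalar_matrix_assoc)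
  have "FH l p ** V l p = (F p + Ha l p) ** V l p + (1 / real l) *\<^sub>R M l p"
    by (simp add: FH_def M_def mm_lin)
  also have "(F p + Ha l p) ** V l p = F p ** (Sg (G p) + R p) + Ha l p ** (Sg (G p) + R p) + F p ** DS (G p) (Ha l p)
      + (Ha l p ** DS (G p) (Ha l p) - (F p + Ha l p) ** Y l p) + (F p + Ha l p) ** S1 l p + F p ** So l p + Ha l p ** So l p"
    by (simp add: V_def mm_lin algebra_simps)
  finally show ?thesis
    by (simp add: T1_eq T2_def Y_cancel HaSo mm_lin)
qed

text \<open>The product formula for cosines. The difference phases of the diagonal contribute the
  mean, which is exactly \<open>(am p)\<^sup>2 / 2\<close> as the squares of the pieces sum to 1.
  The phases that remain have spatial frequency \<open>i + j\<close>, or \<open>i - j\<close> with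
  \<open>i \<noteq> j\<close>, and never 0.\<close>

lemma B_square: "(B l p)\<^sup>2 - (am p)\<^sup>2 / 2 = (\<Sum>i\<in>{1..J}. \<Sum>j\<in>{1..J}.
    (am p)\<^sup>2 * ch i p * ch j p / 2 * (cos (ph (real i + real j) (real i * cc i + real j * cc j) l p)
      + (if i = j then 0 else cos (ph (real i - real j) (real i * cc i - real j * cc j) l p))))"
proof -
  have th: "ph (real i + real j) (real i * cc i + real j * cc j) l p = th i l p + th j l p"
    "ph (real i - real j) (real i * cc i - real j * cc j) l p = th i l p - th j l p" for i j
    by (simp_all add: th_def ph_def algebra_simps)
  have "(B l p)\<^sup>2 = (\<Sum>i\<in>{1..J}. \<Sum>j\<in>{1..J}. (am p)\<^sup>2 * ch i p * ch j p * (cos (th i l p) * cos (th j l p)))"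
    unfolding B_def power2_eq_square sum_product by (intro sum.cong refl) (simp add: algebra_simps)
  also have "\<dots> = (\<Sum>i\<in>{1..J}. \<Sum>j\<in>{1..J}. (am p)\<^sup>2 * ch i p * ch j p / 2 * (cos (th i l p + th j l p)
      + (if i = j then 0 else cos (th i l p - th j l p))) + (if i = j then (am p)\<^sup>2 * ch i p * ch j p / 2 else 0))"
    by (intro sum.cong refl) (auto simp: cos_times_cos algebra_simps add_divide_distrib)
  also have "\<dots> = (\<Sum>i\<in>{1..J}. \<Sum>j\<in>{1..J}. (am p)\<^sup>2 * ch i p * ch j p / 2 * (cos (th i l p + th j l p)
      + (if i = j then 0 else cos (th i l p - th j l p)))) + (\<Sum>i\<in>{1..J}. (am p)\<^sup>2 / 2 * (ch i p)\<^sup>2)"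
    by (simp add: sum.distrib sum.delta power2_eq_square mult.assoc)
  also have "(\<Sum>i\<in>{1..J}. (am p)\<^sup>2 / 2 * (ch i p)\<^sup>2) = (am p)\<^sup>2 / 2"
    unfolding sum_distrib_left[symmetric] ch(2) by simp
  finally show ?thesis unfolding th by simp
qed

lemma P_k: "P i j p *v k = 0"
  by (simp add: P_def mm_mv M0_k flip: scaleR_matrix_vector_assoc)

lemma T2_eq: "T2 l p = (\<Sum>i\<in>{1..J}. \<Sum>j\<in>{1..J}. cos (ph (real i + real j) (real i * cc i + real j * cc j) l p) *\<^sub>R P i j p
      + (if i = j then 0 else cos (ph (real i - real j) (real i * cc i - real j * cc j) l p) *\<^sub>R P i j p))"
proof -
  have "T2 l p = ((B l p)\<^sup>2 - (am p)\<^sup>2 / 2) *\<^sub>R (F p ** M0)" by (simp add: T2_def So_def mm_lin)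
  also have "\<dots> = (\<Sum>i\<in>{1..J}. \<Sum>j\<in>{1..J}. cos (ph (real i + real j) (real i * cc i + real j * cc j) l p) *\<^sub>R P i j p
      + (if i = j then 0 else cos (ph (real i - real j) (real i * cc i - real j * cc j) l p) *\<^sub>R P i j p))"
    unfolding B_square scaleR_left.sum by (intro sum.cong refl) (auto simp: P_def algebra_simps)
  finally show ?thesis .
qed

text \<open>\<open>P i j\<close> annihilates \<open>k\<close>, so the gradient of the phase does not
  contribute to the divergence. What is left are cosines times slow fields, with nonzero
  frequencies, and \<open>corr_cos\<close> applies.\<close>

lemma corr_T2: "corr (\<lambda>l p. dvg (T2 l) p)"
proof -
  note sP = sfield_smooth[OF slow_fields(10)]
  have d: "dvg (\<lambda>p. cos (ph m \<omega> l p) *\<^sub>R P i j p) p = cos (ph m \<omega> l p) *\<^sub>R dvg (P i j) p" for m \<omega> l i j p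
    by (simp add: dvg_cos[OF sP] P_k)
  have sm: "smooth (\<lambda>p. cos (ph m \<omega> l p) *\<^sub>R P i j p)" for m \<omega> l i j
    by (intro smooth_scaleR smooth_trig sP)
  have e: "dvg (T2 l) p = (\<Sum>i\<in>{1..J}. \<Sum>j\<in>{1..J}. cos (ph (real i + real j) (real i * cc i + real j * cc j) l p) *\<^sub>R dvg (P i j) p
      + (if i = j then 0 else cos (ph (real i - real j) (real i * cc i - real j * cc j) l p) *\<^sub>R dvg (P i j) p))" for l p
  proof -
    define f where "f i j p = cos (ph (real i + real j) (real i * cc i + real j * cc j) l p) *\<^sub>R P i j p" for i j p
    define h where "h i j p = (if i = j then 0 else cos (ph (real i - real j) (real i * cc i - real j * cc j) l p) *\<^sub>R P i j p)" for i j p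
    have sf: "smooth (f i j)" for i j unfolding f_def[abs_def] by (rule sm)
    have sh: "smooth (h i j)" for i j unfolding h_def[abs_def] by (cases "i = j") (auto intro: sm)
    have "T2 l = (\<lambda>p. \<Sum>i\<in>{1..J}. \<Sum>j\<in>{1..J}. f i j p + h i j p)"
      by (simp add: fun_eq_iff T2_eq f_def h_def)
    then have "dvg (T2 l) p = (\<Sum>i\<in>{1..J}. \<Sum>j\<in>{1..J}. dvg (f i j) p + dvg (h i j) p)"
      by (simp add: dvg_sum dvg_add smooth_sum smooth_add sf sh)
    moreover have "dvg (h i j) p = (if i = j then 0 else cos (ph (real i - real j) (real i * cc i - real j * cc j) l p) *\<^sub>R dvg (P i j) p)" for i j
      unfolding h_def[abs_def] by (cases "i = j") (auto simp: d)
    moreover have "dvg (f i j) p = cos (ph (real i + real j) (real i * cc i + real j * cc j) l p) *\<^sub>R dvg (P i j) p" for i j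
      unfolding f_def[abs_def] by (rule d)
    ultimately show ?thesis by simp
  qed
  have "corr (\<lambda>l p. if i = j then 0 else cos (ph (real i - real j) (real i * cc i - real j * cc j) l p) *\<^sub>R dvg (P i j) p)" for i j :: nat
  proof (cases "i = j")
    case True
    then show ?thesis using corr_small[OF bdd_zero] by simp
  next
    case False
    then show ?thesis
      using corr_cos[of "real i - real j" "dvg (P i j)" "real i * cc i - real j * cc j"]
      by (simp add: zo_dvg zo_fields sfield_intros slow_fields)
  qed
  moreover have "corr (\<lambda>l p. cos (ph (real i + real j) (real i * cc i + real j * cc j) l p) *\<^sub>R dvg (P i j) p)" if "i \<in> {1..J}" for i j
    using corr_cos[of "real i + real j" "dvg (P i j)" "real i * cc i + real j * cc j"] that
    by (simp add: zo_dvg zo_fields sfield_intros slow_fields)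
  ultimately show ?thesis unfolding e by (intro corr_sum corr_add) auto
qed

section \<open>Gradient, velocity and acceleration of the wave\<close>

lemma pd_trig_scale:
  assumes d: "smooth d"
  shows "pd v (\<lambda>p. sin (ph m \<omega> l p) *\<^sub>R d p) p = sin (ph m \<omega> l p) *\<^sub>R pd v d p
      + (cos (ph m \<omega> l p) * (real l * (m * (k \<bullet> snd v) - \<omega> * fst v))) *\<^sub>R d p"
    and "pd v (\<lambda>p. cos (ph m \<omega> l p) *\<^sub>R d p) p = cos (ph m \<omega> l p) *\<^sub>R pd v d p
      - (sin (ph m \<omega> l p) * (real l * (m * (k \<bullet> snd v) - \<omega> * fst v))) *\<^sub>R d p"
  by (subst pd_bilinear[OF bounded_bilinear_scaleR smooth_differentiable[OF smooth_trig(1)] smooth_differentiable[OF d]], simp add: pd_sin_ph)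
    (subst pd_bilinear[OF bounded_bilinear_scaleR smooth_differentiable[OF smooth_trig(2)] smooth_differentiable[OF d]], simp add: pd_cos_ph)

lemma smooth_bb: "smooth (bb j)"
  by (rule sfield_smooth[OF slow_fields(7)])

lemma smooth_sin_bb: "smooth (\<lambda>p. sin (th j l p) *\<^sub>R bb j p)"
  unfolding th_def by (intro smooth_scaleR smooth_trig smooth_bb)

lemma pd_scaled_sum:
  fixes f :: "nat \<Rightarrow> pt \<Rightarrow> real^2"
  assumes "\<And>j. smooth (f j)"
  shows "pd v (\<lambda>p. r *\<^sub>R (\<Sum>j\<in>I. s j *\<^sub>R f j p)) p = r *\<^sub>R (\<Sum>j\<in>I. s j *\<^sub>R pd v (f j) p)"
proof -
  have 1: "smooth (\<lambda>p. s j *\<^sub>R f j p)" for j by (intro smooth_scaleR smooth_const assms)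
  have 2: "pd v (\<lambda>p. s j *\<^sub>R f j p) p = s j *\<^sub>R pd v (f j) p" for j
    by (rule pd_linear[OF bounded_linear_scaleR_right smooth_differentiable[OF assms]])
  have "pd v (\<lambda>p. r *\<^sub>R (\<Sum>j\<in>I. s j *\<^sub>R f j p)) p = r *\<^sub>R pd v (\<lambda>p. \<Sum>j\<in>I. s j *\<^sub>R f j p) p"
    by (rule pd_linear[OF bounded_linear_scaleR_right smooth_differentiable[OF smooth_sum[OF 1]]])
  also have "pd v (\<lambda>p. \<Sum>j\<in>I. s j *\<^sub>R f j p) p = (\<Sum>j\<in>I. pd v (\<lambda>p. s j *\<^sub>R f j p) p)"
    by (rule pd_sum[OF smooth_differentiable[OF 1]])
  finally show ?thesis unfolding 2 .
qed

lemma pd_w: "pd v (w l) p = (1 / real l) *\<^sub>R (\<Sum>j\<in>{1..J}. (1 / real j) *\<^sub>R (sin (th j l p) *\<^sub>R pd v (bb j) p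
    + (cos (th j l p) * (real l * (real j * (k \<bullet> snd v) - real j * cc j * fst v))) *\<^sub>R bb j p))"
  unfolding w_def[abs_def] pd_scaled_sum[OF smooth_sin_bb] unfolding th_def
  by (simp add: pd_trig_scale(1)[OF smooth_bb])

lemma grad_w: assumes "l \<ge> 1" shows "grad (w l) p = Ha l p + (1 / real l) *\<^sub>R Hb l p"
proof -
  have k: "k \<bullet> snd (dx i) = k $ i" for i by (simp add: dx_def inner_axis)
  have "grad (w l) p $ a $ i = (Ha l p + (1 / real l) *\<^sub>R Hb l p) $ a $ i" for a i
  proof -
    have "grad (w l) p $ a $ i = (\<Sum>j\<in>{1..J}. (1 / real l) * ((1 / real j) * (sin (th j l p) * pd (dx i) (bb j) p $ a
        + cos (th j l p) * (real l * (real j * k $ i)) * bb j p $ a)))"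
      by (simp add: grad_def pd_w k sum_component sum_distrib_left)
    also have "\<dots> = (\<Sum>j\<in>{1..J}. (1 / real l) * ((1 / real j) * (sin (th j l p) * grad (bb j) p $ a $ i))
        + cos (th j l p) * (am p * ch j p) * (n p $ a * k $ i))"
    proof (rule sum.cong[OF refl])
      fix j assume "j \<in> {1..J}"
      then have nz: "real j \<noteq> 0" "real l \<noteq> 0" using assms by auto
      have "(1 / real l) * ((1 / real j) * (cos (th j l p) * (real l * (real j * k $ i)) * bb j p $ a))
          = cos (th j l p) * k $ i * bb j p $ a"
        using nz by simp
      then show "(1 / real l) * ((1 / real j) * (sin (th j l p) * pd (dx i) (bb j) p $ a
        + cos (th j l p) * (real l * (real j * k $ i)) * bb j p $ a)) =
        (1 / real l) * ((1 / real j) * (sin (th j l p) * grad (bb j) p $ a $ i))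
        + cos (th j l p) * (am p * ch j p) * (n p $ a * k $ i)"
        unfolding distrib_left by (simp add: grad_def) (simp add: bb_def)
    qed
    also have "\<dots> = (Ha l p + (1 / real l) *\<^sub>R Hb l p) $ a $ i"
      by (simp add: sum.distrib Ha_def Hb_def B_def sum_component sum_distrib_left sum_distrib_right)
    finally show ?thesis .
  qed
  then show ?thesis by (simp add: vec_eq_iff)
qed

lemma pd_dt_w: assumes "l \<ge> 1"
  shows "pd dt (w l) p = (1 / real l) *\<^sub>R (\<Sum>j\<in>{1..J}. (1 / real j) *\<^sub>R (sin (th j l p) *\<^sub>R pd dt (bb j) p))
    - (\<Sum>j\<in>{1..J}. (cos (th j l p) * cc j) *\<^sub>R bb j p)"
proof -
  have "pd dt (w l) p = (\<Sum>j\<in>{1..J}. (1 / real l) *\<^sub>R ((1 / real j) *\<^sub>R (sin (th j l p) *\<^sub>R pd dt (bb j) p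
      + (cos (th j l p) * (real l * - (real j * cc j))) *\<^sub>R bb j p)))"
    by (simp add: pd_w scaleR_sum_right)
  also have "\<dots> = (\<Sum>j\<in>{1..J}. (1 / real l) *\<^sub>R ((1 / real j) *\<^sub>R (sin (th j l p) *\<^sub>R pd dt (bb j) p))
      - (cos (th j l p) * cc j) *\<^sub>R bb j p)"
  proof (rule sum.cong[OF refl])
    fix j assume "j \<in> {1..J}"
    then have nz: "real j \<noteq> 0" "real l \<noteq> 0" using assms by auto
    show "(1 / real l) *\<^sub>R ((1 / real j) *\<^sub>R (sin (th j l p) *\<^sub>R pd dt (bb j) p
      + (cos (th j l p) * (real l * - (real j * cc j))) *\<^sub>R bb j p)) =
      (1 / real l) *\<^sub>R ((1 / real j) *\<^sub>R (sin (th j l p) *\<^sub>R pd dt (bb j) p))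
      - (cos (th j l p) * cc j) *\<^sub>R bb j p"
      using nz by (simp add: vec_eq_iff divide_simps algebra_simps)
  qed
  finally show ?thesis by (simp add: sum_subtractf scaleR_sum_right)
qed

lemma pd_dt_dt_w: assumes l: "l \<ge> 1"
  shows "pd dt (pd dt (w l)) p = (\<Sum>j\<in>{1..J}. (1 / real l) *\<^sub>R ((1 / real j) *\<^sub>R (sin (th j l p) *\<^sub>R pd dt (pd dt (bb j)) p))
     + cos (th j l p) *\<^sub>R ((- 2 * cc j) *\<^sub>R pd dt (bb j) p) - (sin (th j l p) * (real l * real j)) *\<^sub>R ((\<tau> * real j) *\<^sub>R bb j p))"
proof -
  have s1: "smooth (\<lambda>p. sin (th j l p) *\<^sub>R pd dt (bb j) p)" for j
    unfolding th_def by (intro smooth_scaleR smooth_trig smooth_pd smooth_bb)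
  have s2: "smooth (\<lambda>p. cos (th j l p) *\<^sub>R bb j p)" for j
    unfolding th_def by (intro smooth_scaleR smooth_trig smooth_bb)
  have cc2: "cc j * cc j = \<tau> * real j" for j using \<tau> by (simp add: cc_def)
  have e: "pd dt (w l) = (\<lambda>p. (1 / real l) *\<^sub>R (\<Sum>j\<in>{1..J}. (1 / real j) *\<^sub>R (sin (th j l p) *\<^sub>R pd dt (bb j) p))
    - 1 *\<^sub>R (\<Sum>j\<in>{1..J}. cc j *\<^sub>R (cos (th j l p) *\<^sub>R bb j p)))"
    by (simp add: fun_eq_iff pd_dt_w[OF l] mult.commute)
  have "pd dt (pd dt (w l)) p = (1 / real l) *\<^sub>R (\<Sum>j\<in>{1..J}. (1 / real j) *\<^sub>R pd dt (\<lambda>p. sin (th j l p) *\<^sub>R pd dt (bb j) p) p)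
     - 1 *\<^sub>R (\<Sum>j\<in>{1..J}. cc j *\<^sub>R pd dt (\<lambda>p. cos (th j l p) *\<^sub>R bb j p) p)"
    unfolding e
    by (subst pd_diff) (auto intro!: smooth_differentiable smooth_scaleR smooth_sum smooth_const s1 s2 simp only: pd_scaled_sum[OF s1] pd_scaled_sum[OF s2])
  also have "\<dots> = (\<Sum>j\<in>{1..J}. (1 / real l) *\<^sub>R ((1 / real j) *\<^sub>R pd dt (\<lambda>p. sin (th j l p) *\<^sub>R pd dt (bb j) p) p)
      - cc j *\<^sub>R pd dt (\<lambda>p. cos (th j l p) *\<^sub>R bb j p) p)"
    by (simp add: scaleR_sum_right sum_subtractf)
  also have "\<dots> = (\<Sum>j\<in>{1..J}. (1 / real l) *\<^sub>R ((1 / real j) *\<^sub>R (sin (th j l p) *\<^sub>R pd dt (pd dt (bb j)) p))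
     + cos (th j l p) *\<^sub>R ((- 2 * cc j) *\<^sub>R pd dt (bb j) p) - (sin (th j l p) * (real l * real j)) *\<^sub>R ((\<tau> * real j) *\<^sub>R bb j p))"
  proof (rule sum.cong[OF refl])
    fix j assume j: "j \<in> {1..J}"
    have 1: "(1 / real l) *\<^sub>R ((1 / real j) *\<^sub>R pd dt (\<lambda>p. sin (th j l p) *\<^sub>R pd dt (bb j) p) p)
       = (1 / real l) *\<^sub>R ((1 / real j) *\<^sub>R (sin (th j l p) *\<^sub>R pd dt (pd dt (bb j)) p)) - (cos (th j l p) * cc j) *\<^sub>R pd dt (bb j) p"
      using j l unfolding th_def pd_trig_scale(1)[OF smooth_pd[OF smooth_bb]]
      by (simp add: algebra_simps)
    have 2: "cc j *\<^sub>R pd dt (\<lambda>p. cos (th j l p) *\<^sub>R bb j p) p = (cos (th j l p) * cc j) *\<^sub>R pd dt (bb j) p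
       + (sin (th j l p) * (real l * real j) * (cc j * cc j)) *\<^sub>R bb j p"
      unfolding th_def pd_trig_scale(2)[OF smooth_bb] by (simp add: algebra_simps)
    show "(1 / real l) *\<^sub>R ((1 / real j) *\<^sub>R pd dt (\<lambda>p. sin (th j l p) *\<^sub>R pd dt (bb j) p) p)
      - cc j *\<^sub>R pd dt (\<lambda>p. cos (th j l p) *\<^sub>R bb j p) p =
      (1 / real l) *\<^sub>R ((1 / real j) *\<^sub>R (sin (th j l p) *\<^sub>R pd dt (pd dt (bb j)) p))
     + cos (th j l p) *\<^sub>R ((- 2 * cc j) *\<^sub>R pd dt (bb j) p) - (sin (th j l p) * (real l * real j)) *\<^sub>R ((\<tau> * real j) *\<^sub>R bb j p)"
      unfolding 1 2 cc2 by (simp add: vec_eq_iff algebra_simps)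
  qed
  finally show ?thesis .
qed

lemma smooth_T1: "smooth (T1 l)"
  unfolding T1_def[abs_def] th_def by (intro smooth_sum smooth_scaleR smooth_trig sfield_smooth[OF slow_fields(9)])

text \<open>The terms of order \<open>l\<close> cancel by \<open>N_k\<close>. There remain cosines
  times the slow fields \<open>d j\<close>, treated by \<open>corr_cos\<close>, and the second time
  derivatives of the amplitudes, which carry the factor \<open>1 / l\<close>.\<close>

lemma corr_T1: "corr (\<lambda>l p. pd dt (pd dt (w l)) p - dvg (T1 l) p)"
proof -
  define d where "d j p = (- 2 * cc j) *\<^sub>R pd dt (bb j) p - dvg (N j) p" for j p
  have sd: "slow (d j)" "zo t0 t1 (d j)" for j
    using zo_pd[OF zo_fields(1), of dt j] zo_dvg[OF zo_fields(3), of j]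
    by (auto simp: d_def[abs_def] zo_def intro!: sfield_intros slow_fields)
  have "pd dt (pd dt (w l)) p - dvg (T1 l) p = (\<Sum>j\<in>{1..J}. (1 / real l) *\<^sub>R ((1 / real j) *\<^sub>R (sin (th j l p) *\<^sub>R pd dt (pd dt (bb j)) p))
     + cos (th j l p) *\<^sub>R d j p)" if "l \<ge> 1" for l p
  proof -
    have "dvg (T1 l) p = (\<Sum>j\<in>{1..J}. dvg (\<lambda>p. cos (th j l p) *\<^sub>R N j p) p)"
      unfolding T1_def[abs_def] th_def
      by (rule dvg_sum) (intro smooth_scaleR smooth_trig sfield_smooth[OF slow_fields(9)])
    also have "\<dots> = (\<Sum>j\<in>{1..J}. cos (th j l p) *\<^sub>R dvg (N j) p - (sin (th j l p) * (real l * real j)) *\<^sub>R ((\<tau> * real j) *\<^sub>R bb j p))"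
      unfolding th_def by (intro sum.cong refl) (simp add: dvg_cos[OF sfield_smooth[OF slow_fields(9)]] N_k mult.assoc)
    finally show ?thesis
      unfolding pd_dt_dt_w[OF that] by (simp add: d_def algebra_simps flip: sum_subtractf)
  qed
  moreover have "corr (\<lambda>l p. \<Sum>j\<in>{1..J}. (1 / real l) *\<^sub>R ((1 / real j) *\<^sub>R (sin (th j l p) *\<^sub>R pd dt (pd dt (bb j)) p))
     + cos (th j l p) *\<^sub>R d j p)"
  proof (intro corr_sum corr_add)
    fix j assume j: "j \<in> {1..J}"
    have "oscz (\<lambda>l p. sin (th j l p) *\<^sub>R ((1 / real j) *\<^sub>R pd dt (pd dt (bb j)) p))"
      unfolding th_def
      using zo_pd[OF zo_pd[OF zo_fields(1)], of dt dt j]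
      by (intro oscz_trig_scale) (auto intro!: sfield_intros slow_fields simp: zo_def)
    from corr_small[OF oscz_bdd[OF this]]
    show "corr (\<lambda>l p. (1 / real l) *\<^sub>R ((1 / real j) *\<^sub>R (sin (th j l p) *\<^sub>R pd dt (pd dt (bb j)) p)))"
      by (simp add: mult.commute)
    show "corr (\<lambda>l p. cos (th j l p) *\<^sub>R d j p)"
      unfolding th_def using j by (intro corr_cos sd) auto
  qed
  ultimately show ?thesis by (simp add: corr_def)
qed

lemma corr_total: "corr (\<lambda>l p. pd dt (pd dt (w l)) p - dvg (T1 l) p - dvg (T2 l) p - (1 / real l) *\<^sub>R dvg (M l) p)"
  using corr_add[OF corr_add[OF corr_T1 corr_minus[OF corr_T2]] corr_minus[OF corr_dvg[OF oscz_M]]]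
  by simp

end

text \<open>The determinant bound for \<open>FH\<close> is known from some frequency on. Exchanging
  finitely many members of the family makes \<open>corr_solve\<close> applicable, whose hypotheses
  concern all \<open>l \<ge> 1\<close>.\<close>

lemma osc_if: "wave.osc k f \<Longrightarrow> wave.osc k g \<Longrightarrow> wave k \<Longrightarrow> wave.osc k (\<lambda>l. if l \<ge> L then f l else g l)"
  for L :: nat
proof -
  assume f: "wave.osc k f" and g: "wave.osc k g" and w: "wave k"
  obtain C where C: "C > 0" "\<And>l p. l \<ge> 1 \<Longrightarrow> norm (f l p) \<le> C" "\<And>l p. l \<ge> 1 \<Longrightarrow> norm (pd (0, perp k) (f l) p) \<le> C"
    using wave.oscE[OF w f] by blast
  obtain D where D: "D > 0" "\<And>l p. l \<ge> 1 \<Longrightarrow> norm (g l p) \<le> D" "\<And>l p. l \<ge> 1 \<Longrightarrow> norm (pd (0, perp k) (g l) p) \<le> D"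
    using wave.oscE[OF w g] by blast
  show ?thesis
    by (rule wave.oscI[OF w, of _ "max C D" "max C D"])
      (auto simp: le_max_iff_disj wave.osc_sfield[OF w f] wave.osc_sfield[OF w g] C D)
qed

lemma eventually_small:
  assumes "\<delta> > (0::real)" shows "\<forall>\<^sub>F l in sequentially. C / real l \<le> \<delta>"
proof -
  have "((\<lambda>l. C / real l) \<longlonglongrightarrow> 0)" by (rule lim_const_over_n)
  then have "\<forall>\<^sub>F l in sequentially. C / real l < \<delta>" using assms by (rule order_tendstoD(2))
  then show ?thesis by (rule eventually_mono) simp
qed

section \<open>Estimates and choice of the frequency\<close>

context substep
begin

lemma osc_bound:
  assumes "osc g" obtains C where "C > 0" "\<And>l p. l \<ge> 1 \<Longrightarrow> norm (g l p) \<le> C"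
proof -
  obtain C where C: "C > 0" "\<And>l p. l \<ge> 1 \<Longrightarrow> norm (g l p) \<le> C" "\<And>l p. l \<ge> 1 \<Longrightarrow> norm (pd kp (g l) p) \<le> C"
    using oscE[OF assms] by blast
  show ?thesis by (rule that[OF C(1,2)])
qed

text \<open>Where \<open>ch j\<close> is nonzero the speed mismatch is below \<open>\<tau>\<close>.
  This error is linear in \<open>A\<close> and not quadratic, so it must be made small through
  \<open>\<tau>\<close> and not through the strain.\<close>

lemma S1_bound:
  assumes X: "\<And>p. norm (X p) \<le> 2 * norm k"
  shows "norm (S1 l p) \<le> 64 * A * \<tau>"
proof -
  have "\<bar>\<gamma> l p\<bar> \<le> (\<Sum>j\<in>{1..J}. (A * \<tau>) * \<bar>ch j p\<bar>)"
    unfolding \<gamma>_def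
  proof (intro order_trans[OF sum_abs] sum_mono)
    fix j assume j: "j \<in> {1..J}"
    have "\<bar>ch j p\<bar> * \<bar>\<tau> * real j - sp p\<bar> \<le> \<bar>ch j p\<bar> * \<tau>"
      using ch_supp[OF j, of p] by (cases "ch j p = 0") (auto simp: sp_def e_def G_def intro!: mult_left_mono)
    from mult_mono[OF abs_cos_le_one mult_mono[OF am(3) this]]
    have "\<bar>cos (th j l p)\<bar> * (\<bar>am p\<bar> * (\<bar>ch j p\<bar> * \<bar>\<tau> * real j - sp p\<bar>)) \<le> 1 * (A * (\<bar>ch j p\<bar> * \<tau>))"
      using A_nonneg by simp
    then show "\<bar>cos (th j l p) * (am p * ch j p * (\<tau> * real j - sp p))\<bar> \<le> A * \<tau> * \<bar>ch j p\<bar>"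
      by (simp add: abs_mult mult_ac)
  qed
  also have "\<dots> \<le> (A * \<tau>) * 2"
    unfolding sum_distrib_left[symmetric] by (intro mult_left_mono ch) (use A_nonneg \<tau> in simp)
  finally have g: "\<bar>\<gamma> l p\<bar> \<le> 2 * A * \<tau>" by simp
  have i1: "\<bar>inverse (DB l p)\<bar> \<le> 2" using DB(1)[of l p] by (simp add: field_simps)
  have kX0: "k \<bullet> X p > 0" using kX(1)[of p] kk_pos by linarith
  have i2: "\<bar>inverse (k \<bullet> X p)\<bar> \<le> 2 / (k \<bullet> k)"
    using kX(1)[of p] kk_pos kX0 by (simp add: field_simps)
  have "norm (outer (X p) (X p)) \<le> 2 * norm (X p) * norm (X p)" by (rule norm_outer_le)
  also have "\<dots> \<le> 2 * (2 * norm k) * (2 * norm k)" using X[of p] by (intro mult_mono) auto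
  finally have i3: "norm (outer (X p) (X p)) \<le> 8 * (k \<bullet> k)" by (simp add: dot_square_norm power2_eq_square)
  have "norm (S1 l p) = \<bar>\<gamma> l p\<bar> * \<bar>inverse (DB l p)\<bar> * \<bar>inverse (k \<bullet> X p)\<bar> * norm (outer (X p) (X p))"
    by (simp add: S1_def abs_mult)
  also have "\<dots> \<le> (2 * A * \<tau>) * 2 * (2 / (k \<bullet> k)) * (8 * (k \<bullet> k))"
    using A_nonneg \<tau> kk_pos by (intro mult_mono g i1 i2 i3) auto
  also have "\<dots> = 64 * A * \<tau>" using kk_pos by simp
  finally show ?thesis .
qed

lemma Ha_bound:
  assumes nb: "\<And>p. norm (n p) \<le> 2 * norm k"
  shows "norm (Ha l p) \<le> 8 * A * (k \<bullet> k)"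
proof -
  have "norm (Ha l p) = \<bar>B l p\<bar> * norm (outer (n p) k)" by (simp add: Ha_def)
  also have "\<dots> \<le> (2 * A) * (2 * (2 * norm k) * norm k)"
    by (intro mult_mono B_bound order_trans[OF norm_outer_le] nb) (use A_nonneg in auto)
  finally show ?thesis by (simp add: dot_square_norm power2_eq_square)
qed

lemma velocity_bound:
  assumes nb: "\<And>p. norm (n p) \<le> 2 * norm k" and Q: "\<And>j p. j \<in> {1..J} \<Longrightarrow> ch j p \<noteq> 0 \<Longrightarrow> \<tau> * real j \<le> Q"
    and Q0: "Q \<ge> 0"
  shows "norm (\<Sum>j\<in>{1..J}. (cos (th j l p) * cc j) *\<^sub>R bb j p) \<le> 4 * A * sqrt Q * norm k"
proof -
  have "norm (\<Sum>j\<in>{1..J}. (cos (th j l p) * cc j) *\<^sub>R bb j p) \<le> (\<Sum>j\<in>{1..J}. (sqrt Q * A * (2 * norm k)) * \<bar>ch j p\<bar>)"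
  proof (intro order_trans[OF norm_sum] sum_mono)
    fix j assume j: "j \<in> {1..J}"
    have cc0: "cc j \<ge> 0" using \<tau> by (simp add: cc_def)
    have 1: "cc j * \<bar>ch j p\<bar> \<le> sqrt Q * \<bar>ch j p\<bar>"
      using Q[OF j, of p] by (cases "ch j p = 0") (auto simp: cc_def intro!: mult_right_mono)
    have "norm ((cos (th j l p) * cc j) *\<^sub>R bb j p) = \<bar>cos (th j l p)\<bar> * (\<bar>am p\<bar> * (norm (n p) * (cc j * \<bar>ch j p\<bar>)))"
      using cc0 by (simp add: bb_def abs_mult)
    also have "\<dots> \<le> 1 * (A * ((2 * norm k) * (sqrt Q * \<bar>ch j p\<bar>)))"
      using cc0 A_nonneg by (intro mult_mono nb 1 am(3)) auto
    finally show "norm ((cos (th j l p) * cc j) *\<^sub>R bb j p) \<le> (sqrt Q * A * (2 * norm k)) * \<bar>ch j p\<bar>"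
      by (simp add: mult_ac)
  qed
  also have "\<dots> \<le> (sqrt Q * A * (2 * norm k)) * 2"
    unfolding sum_distrib_left[symmetric] by (intro mult_left_mono ch) (use A_nonneg Q0 in simp)
  finally show ?thesis by (simp add: mult_ac)
qed

lemma defect_bound:
  assumes wd: "\<And>p x. \<bar>x\<bar> \<le> 2 * A \<Longrightarrow> norm (wdef k (G p) x - M0) \<le> eps"
  shows "norm (Sg (G p) + DS (G p) (Ha l p) - Sg (G p + Ha l p) - Y l p + (B l p)\<^sup>2 *\<^sub>R M0) \<le> 4 * A\<^sup>2 * eps"
proof -
  have "Sg (G p) + DS (G p) (Ha l p) - Sg (G p + Ha l p) - Y l p = - ((B l p)\<^sup>2 *\<^sub>R wdef k (G p) (B l p))"
    using wave_defect[of "G p" "B l p" k]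
    by (simp add: Ha_def DS_scaleR Y_def DB_def e_def X_def n_def divide_inverse)
  then have "norm (Sg (G p) + DS (G p) (Ha l p) - Sg (G p + Ha l p) - Y l p + (B l p)\<^sup>2 *\<^sub>R M0)
      = (B l p)\<^sup>2 * norm (wdef k (G p) (B l p) - M0)"
    by (metis (no_types, lifting) add.commute add_uminus_conv_diff scaleR_right_diff_distrib norm_minus_commute norm_scaleR abs_power2)
  also have "\<dots> \<le> (2 * A)\<^sup>2 * eps"
    using power_mono[OF B_bound[of l p], of 2] by (intro mult_mono wd B_bound) auto
  finally show ?thesis by (simp add: power2_eq_square)
qed

text \<open>\<open>l\<close> is chosen after all constants that belong to the fixed data of the
  step, which leaves \<open>eta\<close> at will. The velocity estimate counts the bound of
  \<open>velocity_bound\<close> twice, for the wave and for its spatial mean, which is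
  subtracted.\<close>

lemma substep_result:
  assumes Gb: "\<And>p. norm (G p) \<le> 1/16" and nb: "\<And>p. norm (n p) \<le> 2 * norm k" and Xb: "\<And>p. norm (X p) \<le> 2 * norm k"
    and Ab: "8 * A * (k \<bullet> k) \<le> 1/16"
    and wd: "\<And>p x. \<bar>x\<bar> \<le> 2 * A \<Longrightarrow> norm (wdef k (G p) x - M0) \<le> eps"
    and Q: "\<And>j p. j \<in> {1..J} \<Longrightarrow> ch j p \<noteq> 0 \<Longrightarrow> \<tau> * real j \<le> Q" "Q \<ge> 0" and eta: "eta > 0"
  shows "\<exists>u' R'. state t0 t1 u' R' \<and>
    (\<forall>p. norm (u' p - u p) \<le> eta) \<and> (\<forall>p. norm (grad u' p - grad u p) \<le> 8 * A * (k \<bullet> k) + eta) \<and>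
    (\<forall>p. norm (pd dt u' p - pd dt u p) \<le> 8 * A * sqrt Q * norm k + eta) \<and>
    (\<forall>p. norm (R' p - (R p - ((am p)\<^sup>2 / 2) *\<^sub>R M0)) \<le> 4 * A\<^sup>2 * eps + 64 * A * \<tau> + eta)"
proof -
  have wv: "wave k" by unfold_locales
  obtain CH where CH: "CH > 0" "\<And>l p. l \<ge> 1 \<Longrightarrow> norm (Hb l p) \<le> CH" using osc_bound[OF osc_Hb] by blast
  have Hb_small: "norm ((1 / real l) *\<^sub>R Hb l p) \<le> CH / real l" if "l \<ge> 1" for l p
    using CH(2)[OF that, of p] that by (simp add: divide_right_mono)
  have "\<forall>\<^sub>F l in sequentially. l \<ge> 1 \<and> CH / real l \<le> 1/16"
    by (intro eventually_conj eventually_ge_at_top eventually_small) simp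
  then obtain L where L: "\<And>l. l \<ge> L \<Longrightarrow> l \<ge> 1 \<and> CH / real l \<le> 1/16" unfolding eventually_sequentially by blast
  define FH' where "FH' l = (if l \<ge> L then FH l else F)" for l
  have oF: "osc FH'" unfolding FH'_def[abs_def] by (rule osc_if[OF osc_FH osc_slow[OF slow_fields(2)] wv])
  have Gtot: "norm (G p + Ha l p + (1 / real l) *\<^sub>R Hb l p) \<le> 1/4" if "l \<ge> L" for l p
  proof -
    have l1: "l \<ge> 1" "CH / real l \<le> 1/16" using L[OF that] by auto
    have "norm (G p + Ha l p + (1 / real l) *\<^sub>R Hb l p) \<le> 1/16 + 1/16 + 1/16"
      by (intro norm_triangle_mono Gb order_trans[OF Ha_bound[OF nb] Ab] order_trans[OF Hb_small[OF l1(1)] l1(2)])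
    then show ?thesis by simp
  qed
  have dF: "det (FH' l p) \<ge> 1/2" for l p
  proof (cases "l \<ge> L")
    case True
    then show ?thesis using det_near_identity[OF Gtot[OF True, of p]] by (simp add: FH'_def FH_def F_def add.assoc)
  next
    case False
    then show ?thesis using det_near_identity[of "G p"] Gb[of p] by (simp add: FH'_def F_def)
  qed
  obtain S E where S: "oscz S" "bdd E" "\<And>l p. transpose (S l p) = S l p"
    "\<And>l p. l \<ge> 1 \<Longrightarrow> pd dt (pd dt (w l)) p - dvg (T1 l) p - dvg (T2 l) p - (1 / real l) *\<^sub>R dvg (M l) p
      = (1 / real l) *\<^sub>R (dvg (\<lambda>p. FH' l p ** S l p) p + E l p)"
    using corr_solve[OF corr_total oF dF] by blast
  obtain CS where CS: "CS > 0" "\<And>l p. l \<ge> 1 \<Longrightarrow> norm (S l p) \<le> CS" using osc_bound[OF oscz_osc[OF S(1)]] by blast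
  obtain CE where CE: "\<And>l p. l \<ge> 1 \<Longrightarrow> norm (E l p) \<le> CE" using S(2) unfolding bdd_def by blast
  obtain K where K: "K > 0" "\<And>u f M. sfield Per u \<Longrightarrow> (\<And>p. norm (grad u p) \<le> 1/4) \<Longrightarrow>
     sfield Per f \<Longrightarrow> (\<And>p. norm (f p) \<le> M) \<Longrightarrow> mean f = (\<lambda>p. 0) \<Longrightarrow>
     \<exists>S. sfield Per S \<and> (\<forall>p. transpose (S p) = S p) \<and> (\<forall>p. norm (S p) \<le> K * M) \<and>
       (\<forall>p. dvg (\<lambda>p. (mat 1 + grad u p) ** S p) p = f p) \<and>
       (\<forall>p. (\<forall>q. fst q = fst p \<longrightarrow> f q = 0) \<longrightarrow> S p = 0)"
    using lagrangian_inverse_divergence by blast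
  have obb: "oscz (\<lambda>l p. \<Sum>j\<in>{1..J}. (1 / real j) *\<^sub>R (sin (th j l p) *\<^sub>R bb j p))"
  proof -
    have "osc (\<lambda>l p. \<Sum>j\<in>{1..J}. (1 / real j) *\<^sub>R (sin (th j l p) *\<^sub>R bb j p))"
      by (intro osc_sum osc_linear[OF bounded_linear_scaleR_right] osc_scaleR osc_cos osc_slow slow_fields)
    then show ?thesis using zo_fields(1) by (simp add: oscz_def zo_def)
  qed
  obtain Cw where Cw: "Cw > 0" "\<And>l p. l \<ge> 1 \<Longrightarrow> norm (\<Sum>j\<in>{1..J}. (1 / real j) *\<^sub>R (sin (th j l p) *\<^sub>R bb j p)) \<le> Cw"
    using osc_bound[OF oscz_osc[OF obb]] by blast
  have ot: "osc (\<lambda>l p. \<Sum>j\<in>{1..J}. (1 / real j) *\<^sub>R (sin (th j l p) *\<^sub>R pd dt (bb j) p))"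
    by (intro osc_sum osc_linear[OF bounded_linear_scaleR_right] osc_scaleR osc_cos osc_slow sfield_intros slow_fields)
  obtain Ct where Ct: "Ct > 0" "\<And>l p. l \<ge> 1 \<Longrightarrow> norm (\<Sum>j\<in>{1..J}. (1 / real j) *\<^sub>R (sin (th j l p) *\<^sub>R pd dt (bb j) p)) \<le> Ct"
    using osc_bound[OF ot] by blast
  \<comment> \<open>Uniform continuity allows to drop the part
    \<open>(1 / real l) *\<^sub>R Hb l p\<close> of the gradient from the argument of
    \<open>Sg\<close>.\<close>
  have "uniformly_continuous_on (cball 0 1) Sg"
    by (rule compact_uniformly_continuous[OF smooth_continuous_on[OF smooth_Sg[OF smooth_id]]]) simp
  then obtain d where d: "d > 0" "\<And>x y. x \<in> cball 0 1 \<Longrightarrow> y \<in> cball 0 1 \<Longrightarrow> dist y x < d \<Longrightarrow> dist (Sg y) (Sg x) < eta / 4"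
    unfolding uniformly_continuous_on_def using eta by (metis divide_pos_pos zero_less_numeral)
  have "\<forall>\<^sub>F l in sequentially. l \<ge> 1 \<and> l \<ge> L \<and> CH / real l \<le> d / 2 \<and> CH / real l \<le> eta \<and> (2 * Cw) / real l \<le> eta
      \<and> (2 * Ct) / real l \<le> eta \<and> CS / real l \<le> eta / 4 \<and> (K * (2 * CE)) / real l \<le> eta / 4"
    by (intro eventually_conj eventually_ge_at_top eventually_small) (use eta d(1) in auto)
  then obtain l where l: "l \<ge> 1" "l \<ge> L" "CH / real l \<le> d / 2" "CH / real l \<le> eta" "(2 * Cw) / real l \<le> eta"
      "(2 * Ct) / real l \<le> eta" "CS / real l \<le> eta / 4" "(K * (2 * CE)) / real l \<le> eta / 4"
    unfolding eventually_sequentially by blast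
  have lpos: "real l > 0" using l(1) by simp
  \<comment> \<open>The mean depends on time only. Subtracting it leaves the gradient unchanged and
    gives the acceleration zero mean; otherwise the last remainder could not be a
    divergence.\<close>
  define W where "W = mean (w l)"
  have sw: "sfield Per (w l)" "zo t0 t1 (w l)"
  proof -
    show "sfield Per (w l)" unfolding w_def[abs_def]
      by (rule sfield_scaleR[OF sfield_const osc_sfield[OF oscz_osc[OF obb] l(1)]])
    show "zo t0 t1 (w l)" using obb l(1) unfolding oscz_def zo_def w_def by simp
  qed
  have sW: "sfield Per W" unfolding W_def by (rule sfield_mean[OF sw(1)])
  have zW: "zo t0 t1 W" unfolding W_def zo_def using zoD[OF sw(2)] by (auto intro!: mean_zero_time)
  have slw: "slow (w l)" "slow W" using sfield_Slab_zo sw sW zW by auto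
  define u' where "u' p = u p + (w l p - W p)" for p
  have su': "slow u'" unfolding u'_def[abs_def] by (intro sfield_intros u slw)
  have zu': "zo t0 t1 u'" using u(2) sw(2) zW by (simp add: zo_def u'_def)
  note smu = sfield_smooth[OF u(1)] and smw = sfield_smooth[OF sw(1)] and smW = sfield_smooth[OF sW]
  have pdu': "pd v u' = (\<lambda>p. pd v u p + (pd v (w l) p - pd v W p))" for v
    unfolding u'_def[abs_def]
    by (rule ext) (simp add: pd_add pd_diff smooth_differentiable smooth_diff smu smw smW)
  have pdW: "pd (dx i) W = (\<lambda>p. 0)" for i unfolding W_def by (rule mean_const_dir[OF sw(1)])
  have gu': "grad u' p = G p + Ha l p + (1 / real l) *\<^sub>R Hb l p" for p
  proof -
    have "grad u' p = grad u p + grad (w l) p" by (simp add: grad_def pdu' pdW vec_eq_iff)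
    then show ?thesis by (simp add: grad_w[OF l(1)] G_def)
  qed
  have F': "mat 1 + grad u' p = FH l p" for p by (simp add: gu' FH_def F_def)
  have FHL: "FH' l = FH l" using l(2) by (simp add: FH'_def)
  note smT = smooth_T1[of l]
  have smT2: "smooth (T2 l)" unfolding T2_def[abs_def]
    by (intro smooth_mm osc_smooth[OF osc_So l(1)] sfield_smooth[OF slow_fields(2)])
  have smM: "smooth (M l)" by (rule osc_smooth[OF oscz_osc[OF oscz_M] l(1)])
  have smF: "smooth (FH l)" by (rule osc_smooth[OF osc_FH l(1)])
  have smS: "smooth (S l)" by (rule osc_smooth[OF oscz_osc[OF S(1)] l(1)])
  define ZZ where "ZZ p = T1 l p + T2 l p + (1 / real l) *\<^sub>R M l p + (1 / real l) *\<^sub>R (FH l p ** S l p)" for p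
  have sZ: "sfield Per ZZ"
  proof -
    have "sfield Per (T1 l)" unfolding T1_def[abs_def]
      by (intro sfield_intros osc_sfield[OF osc_cos(1) l(1)] sfield_Slab_Per[OF slow_fields(9)])
    moreover have "sfield Per (T2 l)" unfolding T2_def[abs_def]
      by (intro sfield_intros osc_sfield[OF osc_So l(1)] sfield_Slab_Per[OF slow_fields(2)])
    ultimately show ?thesis unfolding ZZ_def[abs_def]
      by (intro sfield_intros osc_sfield[OF oscz_osc[OF oscz_M] l(1)] osc_sfield[OF osc_FH l(1)] osc_sfield[OF oscz_osc[OF S(1)] l(1)])
  qed
  have dZ: "dvg ZZ p = dvg (T1 l) p + dvg (T2 l) p + (1 / real l) *\<^sub>R dvg (M l) p + (1 / real l) *\<^sub>R dvg (\<lambda>p. FH l p ** S l p) p" for p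
    unfolding ZZ_def[abs_def]
    by (simp add: dvg_add dvg_scaleR smooth_add smooth_scaleR smooth_mm smT smT2 smM smF smS)
  have El: "(1 / real l) *\<^sub>R E l p = pd dt (pd dt (w l)) p - dvg ZZ p" for p
    using S(4)[OF l(1), of p] unfolding FHL dZ by (simp add: algebra_simps)
  have sE: "sfield Per (E l)" "zo t0 t1 (E l)" using S(2) l(1) by (auto simp: bdd_def)
  have Wtt: "pd dt (pd dt W) = mean (pd dt (pd dt (w l)))"
    unfolding W_def by (simp add: pd_mean smw smooth_pd)
  \<comment> \<open>Divergences have zero mean, so the mean of the remainder is exactly the
    acceleration of \<open>W\<close>.\<close>
  have mE: "mean (\<lambda>p. (1 / real l) *\<^sub>R E l p) p = pd dt (pd dt W) p" for p
  proof -
    have "(\<lambda>p. (1 / real l) *\<^sub>R E l p) = (\<lambda>p. pd dt (pd dt (w l)) p - dvg ZZ p)" using El by auto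
    then show ?thesis
      by (simp add: mean_diff smooth_pd smw smooth_dvg sfield_smooth[OF sZ] avg_dvg_zero[OF sZ] Wtt)
  qed
  define f3 where "f3 p = (1 / real l) *\<^sub>R E l p - pd dt (pd dt W) p" for p
  have sf3: "sfield Per f3" unfolding f3_def[abs_def] by (intro sfield_intros sE sW)
  have CE0: "CE \<ge> 0" using order_trans[OF norm_ge_zero CE[OF l(1), of 0]] .
  have Elb: "norm ((1 / real l) *\<^sub>R E l p) \<le> CE / real l" for p
    using CE[OF l(1), of p] lpos by (simp add: divide_right_mono)
  have Wb: "norm (pd dt (pd dt W) p) \<le> CE / real l" for p
    unfolding mE[symmetric] by (rule mean_bound[OF _ Elb]) (intro smooth_scaleR smooth_const sfield_smooth[OF sE(1)])
  have f3b: "norm (f3 p) \<le> 2 * CE / real l" for p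
    using norm_triangle_ineq4[of "(1 / real l) *\<^sub>R E l p" "pd dt (pd dt W) p"] Elb[of p] Wb[of p] unfolding f3_def by simp
  have mf3: "mean f3 = (\<lambda>p. 0)"
  proof
    fix p
    have "mean f3 p = mean (\<lambda>p. (1 / real l) *\<^sub>R E l p) p - mean (pd dt (pd dt W)) p"
      unfolding f3_def[abs_def] by (rule mean_diff) (intro smooth_scaleR smooth_const sfield_smooth[OF sE(1)] smooth_pd smW)+
    moreover have "mean (pd dt (pd dt W)) = pd dt (pd dt W)"
    proof -
      have z: "pd (dx i) (pd dt (pd dt W)) q = 0" for i q
      proof -
        have "pd (dx i) (pd dt W) = (\<lambda>q. 0)" using pd_commute[OF smW, of "dx i" dt] pdW by auto
        then show ?thesis using pd_commute[OF smooth_pd[OF smW], of "dx i" dt] by simp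
      qed
      show ?thesis unfolding mean_def
        by (simp add: avg_const[OF smooth_pd[OF smooth_pd[OF smW]] z])
    qed
    ultimately show "mean f3 p = 0" by (simp add: mE)
  qed
  have gb: "norm (grad u' p) \<le> 1/4" for p unfolding gu' by (rule Gtot[OF l(2)])
  \<comment> \<open>\<open>K\<close> was fixed before \<open>l\<close> and serves \<open>u'\<close>,
    which depends on \<open>l\<close>; so \<open>S3\<close> is of order
    \<open>1 / l\<close>.\<close>
  obtain S3 where S3: "sfield Per S3" "\<And>p. transpose (S3 p) = S3 p" "\<And>p. norm (S3 p) \<le> K * (2 * CE / real l)"
       "\<And>p. dvg (\<lambda>p. (mat 1 + grad u' p) ** S3 p) p = f3 p"
       "\<And>p. (\<forall>q. fst q = fst p \<longrightarrow> f3 q = 0) \<Longrightarrow> S3 p = 0"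
    using K(2)[OF sfield_Slab_Per[OF su'] gb sf3 f3b mf3] by blast
  have zf3: "f3 q = 0" if "fst q \<notin> {t0..t1}" for q
    using zoD[OF sE(2) that] zoD[OF zo_pd[OF zo_pd[OF zW]] that] by (simp add: f3_def)
  define R' where "R' p = V l p - Sg (grad u' p) + (1 / real l) *\<^sub>R S l p + S3 p" for p
  have sR'P: "sfield Per R'" unfolding R'_def[abs_def]
    by (intro sfield_intros osc_sfield[OF osc_V l(1)] sfield_Slab_Per[OF su'] osc_sfield[OF oscz_osc[OF S(1)] l(1)] S3(1))
  have zR': "zo t0 t1 R'"
    unfolding zo_def
  proof (intro allI impI)
    fix p :: pt assume p: "fst p \<notin> {t0..t1}"
    have "S3 p = 0" by (rule S3(5)) (use zf3 p in simp)
    moreover have "S l p = 0" using S(1) l(1) p by (simp add: oscz_def zo_def)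
    moreover have "grad u' p = 0" using zo_grad[OF zu'] p by (simp add: zo_def)
    ultimately show "R' p = 0"
      using p R(2) by (simp add: R'_def V_def zo_B Ha_def Y_def S1_def So_def zo_def linear_0[OF DS_linear])
  qed
  have sR': "slow R'" by (rule sfield_Slab_zo[OF sR'P zR'])
  have tr: "transpose (A + B) = transpose A + transpose B" "transpose (A - B) = transpose A - transpose B"
     "transpose (r *\<^sub>R A) = r *\<^sub>R transpose A" "transpose (outer v v) = outer v v" for A B :: "mat2" and r v
    by (simp_all add: transpose_def vec_eq_iff mult.commute)
  have symR': "transpose (R' p) = R' p" for p
    by (simp add: R'_def V_def Y_def S1_def So_def tr Sg_sym DS_sym R(3) S(3) S3(2) M0_k)
  have state': "pd dt (pd dt u') p = dvg (\<lambda>p. (mat 1 + grad u' p) ** (Sg (grad u' p) + R' p)) p" for p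
  proof -
    have e1: "(mat 1 + grad u' p) ** (Sg (grad u' p) + R' p) = (mat 1 + grad u p) ** (Sg (grad u p) + R p) + ZZ p + (mat 1 + grad u' p) ** S3 p" for p
    proof -
      have "(mat 1 + grad u' p) ** (Sg (grad u' p) + R' p) = FH l p ** (V l p - Sg (grad u' p)) + FH l p ** Sg (grad u' p)
          + (1 / real l) *\<^sub>R (FH l p ** S l p) + (mat 1 + grad u' p) ** S3 p"
        unfolding F' R'_def by (simp add: mm_lin algebra_simps)
      then show ?thesis
        unfolding gu' stress_identity by (simp add: ZZ_def F_def G_def algebra_simps)
    qed
    have sm1: "smooth (\<lambda>p. (mat 1 + grad u p) ** (Sg (grad u p) + R p))"
      by (intro smooth_mm smooth_add smooth_const smooth_Sg smooth_grad smu sfield_smooth[OF R(1)])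
    have sm2: "smooth (\<lambda>p. (mat 1 + grad u' p) ** S3 p)"
      by (intro smooth_mm smooth_add smooth_const smooth_grad sfield_smooth[OF su'] sfield_smooth[OF S3(1)])
    have "dvg (\<lambda>p. (mat 1 + grad u' p) ** (Sg (grad u' p) + R' p)) p = pd dt (pd dt u) p + dvg ZZ p + f3 p"
      unfolding e1 by (simp add: dvg_add smooth_add sm1 sm2 sfield_smooth[OF sZ] S3(4) state)
    also have "\<dots> = pd dt (pd dt u) p + (pd dt (pd dt (w l)) p - pd dt (pd dt W) p)"
      by (simp add: f3_def El)
    also have "\<dots> = pd dt (pd dt u') p"
      unfolding pdu'[of dt]
      by (simp add: pd_add pd_diff smooth_differentiable smooth_diff smooth_pd smu smw smW)
    finally show ?thesis by simp
  qed
  have wb: "norm (w l p) \<le> Cw / real l" for p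
    using Cw(2)[OF l(1), of p] lpos by (simp add: w_def divide_right_mono)
  have b1: "norm (u' p - u p) \<le> eta" for p
  proof -
    have "norm (W p) \<le> Cw / real l" unfolding W_def by (rule mean_bound[OF smw wb])
    then show ?thesis using norm_triangle_ineq4[of "w l p" "W p"] wb[of p] l(5) by (simp add: u'_def)
  qed
  have b2: "norm (grad u' p - grad u p) \<le> 8 * A * (k \<bullet> k) + eta" for p
    using norm_triangle_ineq[of "Ha l p" "(1 / real l) *\<^sub>R Hb l p"] Ha_bound[OF nb, of l p] Hb_small[OF l(1), of p] l(4)
    by (simp add: gu' G_def)
  have vb: "norm (pd dt (w l) p) \<le> Ct / real l + 4 * A * sqrt Q * norm k" for p
  proof -
    have "norm ((1 / real l) *\<^sub>R (\<Sum>j\<in>{1..J}. (1 / real j) *\<^sub>R (sin (th j l p) *\<^sub>R pd dt (bb j) p))) \<le> Ct / real l"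
      using Ct(2)[OF l(1), of p] lpos by (simp add: divide_right_mono)
    moreover have "norm (\<Sum>j\<in>{1..J}. (cos (th j l p) * cc j) *\<^sub>R bb j p) \<le> 4 * A * sqrt Q * norm k"
      by (rule velocity_bound[OF nb Q])
    ultimately show ?thesis
      unfolding pd_dt_w[OF l(1)] by (intro order_trans[OF norm_triangle_ineq4] add_mono)
  qed
  have b3: "norm (pd dt u' p - pd dt u p) \<le> 8 * A * sqrt Q * norm k + eta" for p
  proof -
    have "norm (pd dt W p) \<le> Ct / real l + 4 * A * sqrt Q * norm k"
      unfolding W_def pd_mean[OF smw] by (rule mean_bound[OF smooth_pd[OF smw] vb])
    then show ?thesis
      using norm_triangle_ineq4[of "pd dt (w l) p" "pd dt W p"] vb[of p] l(6) by (simp add: pdu')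
  qed
  have b4: "norm (R' p - (R p - ((am p)\<^sup>2 / 2) *\<^sub>R M0)) \<le> 4 * A\<^sup>2 * eps + 64 * A * \<tau> + eta" for p
  proof -
    \<comment> \<open>In this order: the defect of the wave, the speed mismatch, the effect of
      dropping \<open>Hb\<close>, and the two correctors.\<close>
    have "R' p - (R p - ((am p)\<^sup>2 / 2) *\<^sub>R M0) =
        (Sg (G p) + DS (G p) (Ha l p) - Sg (G p + Ha l p) - Y l p + (B l p)\<^sup>2 *\<^sub>R M0)
        + S1 l p + (Sg (G p + Ha l p) - Sg (grad u' p)) + (1 / real l) *\<^sub>R S l p + S3 p"
      by (simp add: R'_def V_def So_def algebra_simps)
    moreover have "norm (Sg (G p + Ha l p) - Sg (grad u' p)) \<le> eta / 4"
    proof -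
      have "norm (G p + Ha l p) \<le> 1/16 + 1/16"
        using Ha_bound[OF nb, of l p] Ab by (intro norm_triangle_mono Gb) auto
      moreover have "dist (G p + Ha l p) (grad u' p) < d"
      proof -
        have "dist (G p + Ha l p) (grad u' p) = norm ((1 / real l) *\<^sub>R Hb l p)" by (simp add: gu' dist_norm)
        then show ?thesis using order_trans[OF Hb_small[OF l(1)] l(3), of p] d(1) by linarith
      qed
      moreover have "norm (grad u' p) \<le> 1" using gb[of p] by linarith
      ultimately have "dist (Sg (G p + Ha l p)) (Sg (grad u' p)) < eta / 4"
        by (intro d(2)) (simp_all add: mem_cball_0)
      then show ?thesis by (simp add: dist_norm)
    qed
    moreover have "norm ((1 / real l) *\<^sub>R S l p) \<le> eta / 4"
    proof -
      have "norm ((1 / real l) *\<^sub>R S l p) = norm (S l p) / real l" by simp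
      then show ?thesis using divide_right_mono[OF CS(2)[OF l(1)], of "real l" p] l(7) lpos by linarith
    qed
    moreover have "norm (S3 p) \<le> eta / 4" using S3(3)[of p] l(8) by simp
    ultimately have "norm (R' p - (R p - ((am p)\<^sup>2 / 2) *\<^sub>R M0)) \<le> 4 * A\<^sup>2 * eps + 64 * A * \<tau> + eta / 4 + eta / 4 + eta / 4"
      by (simp only:) (intro norm_triangle_mono defect_bound wd S1_bound Xb)
    then show ?thesis using eta by simp
  qed
  show ?thesis
    unfolding state_def by (intro exI[of _ u'] exI[of _ R'] conjI allI su' zu' sR' zR' symR' state' b1 b2 b3 b4)
qed

end

section \<open>One step of the iteration\<close>

context material
begin

definition Mz :: "real^2 \<Rightarrow> mat2" where
  "Mz k = ((k \<bullet> k) * sig) *\<^sub>R outer (perp k) (perp k)"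

text \<open>\<open>d\<close> and \<open>C\<close> are fixed before the time interval, the state and
  the amplitude, as an iteration requires. Of the two errors in the stress, \<open>eta\<close> is at
  will, whereas \<open>eps * A\<^sup>2\<close> is proportional to the effect of the wave itself and
  small only relative to it.\<close>

definition wave_step :: "real^2 \<Rightarrow> real \<Rightarrow> real \<Rightarrow> real \<Rightarrow> bool" where
  "wave_step k eps d C \<longleftrightarrow> (\<forall>t0 t1 u R am A eta. state t0 t1 u R \<longrightarrow> sfield (Slab t0 t1) am \<longrightarrow> zo t0 t1 am \<longrightarrow>
     (\<forall>p. \<bar>am p\<bar> \<le> A) \<longrightarrow> A \<le> d \<longrightarrow> (\<forall>p. norm (grad u p) \<le> d) \<longrightarrow> (\<forall>p. norm (R p) \<le> d) \<longrightarrow> eta > 0 \<longrightarrow>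
       (\<exists>u' R'. state t0 t1 u' R' \<and> (\<forall>p. norm (u' p - u p) \<le> eta) \<and>
         (\<forall>p. norm (grad u' p - grad u p) \<le> C * A + eta) \<and> (\<forall>p. norm (pd dt u' p - pd dt u p) \<le> C * A + eta) \<and>
         (\<forall>p. norm (R' p - (R p - ((am p)\<^sup>2 / 2) *\<^sub>R Mz k)) \<le> eps * A\<^sup>2 + eta)))"

lemma single_wave:
  assumes k: "k \<noteq> 0" "\<And>i. k $ i \<in> \<int>" and e: "eps > 0"
  shows "\<exists>d>0. \<exists>C>0. wave_step k eps d C"
proof -
  define \<kappa> where "\<kappa> = k \<bullet> k"
  have \<kappa>: "\<kappa> > 0" using k by (simp add: \<kappa>_def)
  define bk where "bk = b 1 1 * \<kappa>"
  have bk: "bk > 0" using b11_pos \<kappa> by (simp add: bk_def)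
  \<comment> \<open>At rest the squared speed is \<open>4 * bk\<close>. The eigenvalue may move by
    \<open>bk\<close>, the stress and the error by \<open>bk / 2\<close> each, so the squared speed
    stays between \<open>2 * bk\<close> and \<open>6 * bk\<close>.\<close>
  define eps1 where "eps1 = min (eps / 4) bk"
  have e1: "eps1 > 0" using e bk by (simp add: eps1_def)
  obtain d0 where d0: "d0 > 0" "d0 \<le> 1/4" "\<And>G. norm G \<le> d0 \<Longrightarrow> good k G \<and> \<bar>ev k G - 4 * b 1 1 * (k \<bullet> k)\<bar> \<le> eps1
     \<and> norm (nv k G) \<le> 2 * norm k \<and> norm (Xv k G) \<le> 2 * norm k"
    "\<And>G B. norm G \<le> d0 \<Longrightarrow> \<bar>B\<bar> \<le> d0 \<Longrightarrow> 1 + B * (k \<bullet> Xv k G) \<ge> 1/2 \<and>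
       norm (wdef k G B - ((k \<bullet> k) * sig) *\<^sub>R outer (perp k) (perp k)) \<le> eps1"
    using small_strain[OF k(1) e1] by blast
  have "isCont (\<lambda>G. k \<bullet> (Sg G *v k)) 0" by (intro isCont_smooth smooth_intros smooth_const)
  then have "isCont (\<lambda>G. \<bar>k \<bullet> (Sg G *v k)\<bar>) 0" by (rule isCont_rabs)
  from order_tendstoD(2)[OF isCont_tendsto_nhds[OF this], of "bk / 2"]
  have "\<forall>\<^sub>F G in nhds 0. \<bar>k \<bullet> (Sg G *v k)\<bar> < bk / 2" using bk by simp
  then obtain d1 where d1: "d1 > 0" "\<And>G. norm G < d1 \<Longrightarrow> \<bar>k \<bullet> (Sg G *v k)\<bar> < bk / 2"
    unfolding eventually_nhds_metric by auto
  \<comment> \<open>\<open>b 1 1 / 4\<close> limits the speed shift caused by the error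
    \<open>R\<close>. The last two entries make the old gradient and the leading part of the wave at
    most 1/16 each, which keeps the total strain below 1/4.\<close>
  define d where "d = Min {d0 / 2, d1 / 2, b 1 1 / 4, 1 / 16, 1 / (128 * \<kappa>)}"
  have d: "d > 0" "d \<le> d0 / 2" "d \<le> d1 / 2" "d \<le> b 1 1 / 4" "d \<le> 1 / 16" "d \<le> 1 / (128 * \<kappa>)"
    using d0(1) d1(1) b11_pos \<kappa> by (auto simp: d_def)
  define C where "C = max (8 * \<kappa>) (8 * sqrt (7 * bk) * norm k)"
  have C: "C > 0" "8 * \<kappa> \<le> C" "8 * sqrt (7 * bk) * norm k \<le> C" using \<kappa> by (auto simp: C_def)
  have "wave_step k eps d C"
    unfolding wave_step_def
  proof (intro allI impI, goal_cases)
    case (1 t0 t1 u R am A eta)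
    note st = 1(1) and am = 1(2,3) 1(4)[rule_format] and A = 1(5) and G = 1(6)[rule_format] and R = 1(7)[rule_format] and eta = 1(8)
    interpret wave k t0 t1 by unfold_locales (use k in auto)
    note st' = stateD[OF st]
    have A0: "A \<ge> 0" using am(3)[of 0] by linarith
    have G0: "norm (grad u p) \<le> d0" for p using G[of p] d(2) d0(1) by linarith
    note gg = d0(3)[OF G0]
    define s where "s p = ev k (grad u p) + k \<bullet> ((Sg (grad u p) + R p) *v k)" for p
    have sG: "slow (grad u)" by (intro sfield_intros st')
    have ss: "slow s" unfolding s_def[abs_def] by (intro sfield_intros sG st') (use gg in blast)
    have sb: "\<bar>s p - 4 * bk\<bar> \<le> 2 * bk" for p
    proof -
      have 1: "\<bar>ev k (grad u p) - 4 * bk\<bar> \<le> bk" using gg[of p] by (simp add: eps1_def bk_def \<kappa>_def mult.assoc)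
      have 2: "\<bar>k \<bullet> (Sg (grad u p) *v k)\<bar> < bk / 2" using d1(2)[of "grad u p"] G[of p] d(3) d1(1) by simp
      have "\<bar>k \<bullet> (R p *v k)\<bar> \<le> norm k * norm (R p *v k)" by (rule Cauchy_Schwarz_ineq2)
      also have "\<dots> \<le> norm k * (2 * norm (R p) * norm k)" by (intro mult_left_mono norm_mv_le) simp
      also have "\<dots> = (2 * \<kappa>) * norm (R p)" by (simp add: \<kappa>_def dot_square_norm power2_eq_square)
      also have "\<dots> \<le> (2 * \<kappa>) * (b 1 1 / 4)" using R[of p] d(4) \<kappa> by (intro mult_left_mono) auto
      also have "\<dots> = bk / 2" by (simp add: bk_def)
      finally have 3: "\<bar>k \<bullet> (R p *v k)\<bar> \<le> bk / 2" .
      have "s p - 4 * bk = (ev k (grad u p) - 4 * bk) + k \<bullet> (Sg (grad u p) *v k) + k \<bullet> (R p *v k)"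
        by (simp add: s_def mv_lin inner_add_right)
      then show ?thesis using 1 2 3 by linarith
    qed
    \<comment> \<open>The first entry gives the margin required by
      \<open>partition_of_unity\<close>, the second makes the mismatch error
      \<open>64 * A * \<tau>\<close> at most \<open>eta / 2\<close>.\<close>
    define \<tau> where "\<tau> = min bk (eta / 2 / (64 * d))"
    have \<tau>: "\<tau> > 0" "2 * \<tau> \<le> 2 * bk" using bk eta d(1) by (auto simp: \<tau>_def)
    have "64 * d * \<tau> \<le> 64 * d * (eta / 2 / (64 * d))" using d(1) by (intro mult_left_mono) (auto simp: \<tau>_def)
    then have \<tau>eta: "64 * d * \<tau> \<le> eta / 2" using d(1) by simp
    note \<tau>1 = \<tau>(1) and \<tau>2 = \<tau>(2)
    have slo: "2 * bk \<le> s p" "s p \<le> 6 * bk" for p using sb[of p] by (auto simp: abs_le_iff)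
    obtain J :: nat and ch :: "nat \<Rightarrow> pt \<Rightarrow> real" where ch: "\<And>j. slow (ch j)" "\<And>p. (\<Sum>j\<in>{1..J}. (ch j p)\<^sup>2) = 1"
      "\<And>j p. j \<in> {1..J} \<Longrightarrow> ch j p \<noteq> 0 \<Longrightarrow> \<bar>\<tau> * real j - s p\<bar> < \<tau>" "\<And>p. (\<Sum>j\<in>{1..J}. \<bar>ch j p\<bar>) \<le> 2"
      by (rule partition_of_unity[OF ss \<tau> slo]) (rule that; assumption)
    note chs = ch(3)
    interpret substep a b c k t0 t1 u R am J ch \<tau> A
    proof
      show "1 + x * (k \<bullet> Xv k (grad u p)) \<ge> 1/2" if "\<bar>x\<bar> \<le> 2 * A" for p x
        using d0(4)[OF G0, of x p] that A d(2) by simp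
      show "\<bar>\<tau> * real j - (ev k (grad u p) + k \<bullet> ((Sg (grad u p) + R p) *v k))\<bar> < \<tau>"
        if "j \<in> {1..J}" "ch j p \<noteq> 0" for j p
        using ch(3)[OF that] unfolding s_def .
      show "good k (grad u p)" for p using gg by blast
    qed (fact st' am ch \<tau>)+
    have fold: "G p = grad u p" "n p = nv k (grad u p)" "X p = Xv k (grad u p)" for p
      by (simp_all add: G_def n_def X_def)
    have Ab: "8 * A * (k \<bullet> k) \<le> 1/16"
    proof -
      have "A * \<kappa> \<le> (1 / (128 * \<kappa>)) * \<kappa>" using A d(6) \<kappa> by (intro mult_right_mono) auto
      then show ?thesis using \<kappa> by (simp add: \<kappa>_def)
    qed
    have "\<exists>u' R'. state t0 t1 u' R' \<and>
      (\<forall>p. norm (u' p - u p) \<le> eta / 2) \<and> (\<forall>p. norm (grad u' p - grad u p) \<le> 8 * A * (k \<bullet> k) + eta / 2) \<and>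
      (\<forall>p. norm (pd dt u' p - pd dt u p) \<le> 8 * A * sqrt (7 * bk) * norm k + eta / 2) \<and>
      (\<forall>p. norm (R' p - (R p - ((am p)\<^sup>2 / 2) *\<^sub>R M0)) \<le> 4 * A\<^sup>2 * eps1 + 64 * A * \<tau> + eta / 2)"
      (is "\<exists>u' R'. ?Q u' R'")
    proof (rule substep_result)
      show "norm (G p) \<le> 1/16" for p using G[of p] d(5) unfolding fold by linarith
      show "norm (n p) \<le> 2 * norm k" "norm (X p) \<le> 2 * norm k" for p using gg[of p] unfolding fold by auto
      show "norm (wdef k (G p) x - M0) \<le> eps1" if "\<bar>x\<bar> \<le> 2 * A" for p x
        using d0(4)[OF G0, of x p] that A d(2) unfolding fold M0_def by simp
      show "\<tau> * real j \<le> 7 * bk" if "j \<in> {1..J}" "ch j p \<noteq> 0" for j p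
        using chs[OF that] slo(2)[of p] \<tau>2 by linarith
      show "8 * A * (k \<bullet> k) \<le> 1/16" by (rule Ab)
      show "7 * bk \<ge> 0" "eta / 2 > 0" using bk eta by auto
    qed
    then obtain u' R' where q: "?Q u' R'" by (elim exE) (rule that)
    have r1: "state t0 t1 u' R'" using q by (elim conjE)
    have r2: "\<And>p. norm (u' p - u p) \<le> eta / 2" using q by (elim conjE) (erule spec)
    have r3: "\<And>p. norm (grad u' p - grad u p) \<le> 8 * A * (k \<bullet> k) + eta / 2" using q by (elim conjE) (erule spec)
    have r4: "\<And>p. norm (pd dt u' p - pd dt u p) \<le> 8 * A * sqrt (7 * bk) * norm k + eta / 2" using q by (elim conjE) (erule spec)
    have r5: "\<And>p. norm (R' p - (R p - ((am p)\<^sup>2 / 2) *\<^sub>R M0)) \<le> 4 * A\<^sup>2 * eps1 + 64 * A * \<tau> + eta / 2"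
      using q by (elim conjE) (erule spec)
    note r = r1 r2 r3 r4 r5
    have c1: "8 * A * (k \<bullet> k) \<le> C * A" using mult_left_mono[OF C(2) A0] by (simp add: \<kappa>_def mult_ac)
    have c2: "8 * A * sqrt (7 * bk) * norm k \<le> C * A" using mult_left_mono[OF C(3) A0] by (simp add: mult_ac)
    have "4 * A\<^sup>2 * eps1 \<le> 4 * A\<^sup>2 * (eps / 4)" by (intro mult_left_mono) (auto simp: eps1_def)
    then have "4 * A\<^sup>2 * eps1 \<le> eps * A\<^sup>2" by (simp add: mult.commute)
    moreover have "64 * A * \<tau> \<le> 64 * d * \<tau>" using A \<tau>1 by (intro mult_right_mono) auto
    ultimately have c3: "4 * A\<^sup>2 * eps1 + 64 * A * \<tau> + eta / 2 \<le> eps * A\<^sup>2 + eta" using \<tau>eta by linarith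
    have "norm (u' p - u p) \<le> eta" for p using r(2)[of p] eta by linarith
    moreover have "norm (grad u' p - grad u p) \<le> C * A + eta" for p using r(3)[of p] c1 eta by linarith
    moreover have "norm (pd dt u' p - pd dt u p) \<le> C * A + eta" for p using r(4)[of p] c2 eta by linarith
    moreover have "norm (R' p - (R p - ((am p)\<^sup>2 / 2) *\<^sub>R Mz k)) \<le> eps * A\<^sup>2 + eta" for p
      using r(5)[of p] c3 unfolding M0_def Mz_def by linarith
    ultimately show ?case
      using r(1) by (intro exI[of _ u'] exI[of _ R'] conjI allI)
  qed
  then show ?thesis using d(1) C(1) by blast
qed

text \<open>Three directions for which the matrices \<open>k^\<bottom> \<otimes> k^\<bottom>\<close> span the symmetric matrices and the identity has
  positive coefficients \<open>wg\<close>.\<close>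
definition wk :: "nat \<Rightarrow> real^2" where
  "wk i = (\<chi> j. if j = 1 then (if i = 0 then 0 else if i = 1 then 2 else -2) else -1)"

definition wg :: "nat \<Rightarrow> mat2 \<Rightarrow> real" where
  "wg i M = (if i = 0 then M$1$1 - (1/4) * M$2$2
     else if i = 1 then (1/8) * M$2$2 + (1/4) * M$1$2 else (1/8) * M$2$2 - (1/4) * M$1$2)"

lemma wk: "wk i \<noteq> 0" "wk i $ j \<in> \<int>" "wk i \<bullet> wk i \<ge> 1"
  by (auto simp: wk_def vec_eq_iff inner_2 forall_2)

lemma decomposition:
  assumes "transpose M = M"
  shows "(\<Sum>i<3. wg i M *\<^sub>R outer (perp (wk i)) (perp (wk i))) = M"
proof -
  have "transpose M $ 1 $ 2 = M $ 1 $ 2" using assms by simp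
  then have M: "M $ 2 $ 1 = M $ 1 $ 2" by (simp only: transpose_def vec_lambda_beta)
  have w: "wk 0 = vector [0, -1]" "wk 1 = vector [2, -1]" "wk 2 = vector [-2, -1]"
    by (simp_all add: wk_def vec_eq_iff forall_2)
  have "(\<Sum>i<3. f i) = f 0 + f 1 + f 2" for f :: "nat \<Rightarrow> mat2" by (simp add: eval_nat_numeral)
  then have "(\<Sum>i<3. wg i M *\<^sub>R outer (perp (wk i)) (perp (wk i))) = wg 0 M *\<^sub>R outer (perp (wk 0)) (perp (wk 0))
    + wg 1 M *\<^sub>R outer (perp (wk 1)) (perp (wk 1)) + wg 2 M *\<^sub>R outer (perp (wk 2)) (perp (wk 2))" .
  then show ?thesis
    by (simp only: w) (simp add: wg_def vec_eq_iff forall_2 outer_def perp_def M)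
qed

text \<open>At the identity the coefficients are 3/4, 1/8 and 1/8; entries of size 1/16 move the two
  small ones by at most 3/128.\<close>

lemma wg_bounds:
  assumes "\<And>i j. \<bar>S $ i $ j\<bar> \<le> 1/16" "i < 3"
  shows "wg i (mat 1 + S) > 0" "wg i (mat 1 + S) \<le> 2"
proof -
  have "S$1$1 \<le> 1/16" "S$1$1 \<ge> -1/16" "S$2$2 \<le> 1/16" "S$2$2 \<ge> -1/16" "S$1$2 \<le> 1/16" "S$1$2 \<ge> -1/16"
    using assms(1)[of 1 1] assms(1)[of 2 2] assms(1)[of 1 2] by (simp_all add: abs_le_iff)
  then have "wg i (mat 1 + S) > 0 \<and> wg i (mat 1 + S) \<le> 2"
    by (auto simp: wg_def mat_def field_simps)
  then show "wg i (mat 1 + S) > 0" "wg i (mat 1 + S) \<le> 2" by auto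
qed

lemma sfield_wg: assumes "sfield Q M" shows "sfield Q (\<lambda>p. wg i (M p))"
proof -
  have 1: "sfield Q (\<lambda>p. M p$1$1 - (1/4) * M p$2$2)" by (intro sfield_intros assms)
  have 2: "sfield Q (\<lambda>p. (1/8) * M p$2$2 + (1/4) * M p$1$2)" by (intro sfield_intros assms)
  have 3: "sfield Q (\<lambda>p. (1/8) * M p$2$2 - (1/4) * M p$1$2)" by (intro sfield_intros assms)
  have "(\<lambda>p. wg i (M p)) = (if i = 0 then (\<lambda>p. M p$1$1 - (1/4) * M p$2$2)
     else if i = 1 then (\<lambda>p. (1/8) * M p$2$2 + (1/4) * M p$1$2) else (\<lambda>p. (1/8) * M p$2$2 - (1/4) * M p$1$2))"
    by (auto simp: wg_def)
  then show ?thesis using 1 2 3 by simp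
qed

end

context material
begin

lemma wave_step_mono:
  assumes W: "wave_step k eps d C" and d: "d' \<le> d" "C \<le> C'"
  shows "wave_step k eps d' C'"
  unfolding wave_step_def
proof (intro allI impI, goal_cases)
  case (1 t0 t1 u R am A eta)
  have A: "A \<ge> 0" using 1(4)[rule_format, of 0] by linarith
  have CA: "C * A \<le> C' * A" using A d(2) by (rule mult_right_mono[rotated])
  have "A \<le> d" "\<forall>p. norm (grad u p) \<le> d" "\<forall>p. norm (R p) \<le> d" using 1(5-7) d(1) by (meson order_trans)+
  from W[unfolded wave_step_def, rule_format, OF 1(1-3) _ this(1) _ _ 1(8)] 1(4) this(2,3)
  obtain u' R' where "state t0 t1 u' R' \<and> (\<forall>p. norm (u' p - u p) \<le> eta) \<and>
         (\<forall>p. norm (grad u' p - grad u p) \<le> C * A + eta) \<and> (\<forall>p. norm (pd dt u' p - pd dt u p) \<le> C * A + eta) \<and>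
         (\<forall>p. norm (R' p - (R p - ((am p)\<^sup>2 / 2) *\<^sub>R Mz k)) \<le> eps * A\<^sup>2 + eta)" by blast
  moreover have "x \<le> C' * A + eta" if "x \<le> C * A + eta" for x using that CA by linarith
  ultimately show ?case by blast
qed

text \<open>The waves are added one after the other, each on top of the state left by its
  predecessors. The hypothesis on \<open>R\<close> speaks of every partial sum because each
  intermediate error has to meet the smallness condition of \<open>wave_step\<close>.\<close>

lemma wave_iteration:
  assumes W: "\<And>i. i < n \<Longrightarrow> wave_step (k i) eps d C" and st: "state t0 t1 u R"
    and am: "\<And>i. i < n \<Longrightarrow> sfield (Slab t0 t1) (am i)" "\<And>i. i < n \<Longrightarrow> zo t0 t1 (am i)"
      "\<And>i p. i < n \<Longrightarrow> \<bar>am i p\<bar> \<le> A" "A \<le> d" "A \<ge> 0" "C > 0" "eps > 0"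
    and eta: "eta > 0"
    and u: "\<And>p. norm (grad u p) + real n * (C * A + eta) \<le> d"
    and R: "\<And>m p. m \<le> n \<Longrightarrow> norm (R p - (\<Sum>i<m. ((am i p)\<^sup>2 / 2) *\<^sub>R Mz (k i))) + real n * (eps * A\<^sup>2 + eta) \<le> d"
  shows "m \<le> n \<Longrightarrow> \<exists>u' R'. state t0 t1 u' R' \<and> (\<forall>p. norm (u' p - u p) \<le> real m * eta) \<and>
         (\<forall>p. norm (grad u' p - grad u p) \<le> real m * (C * A + eta)) \<and> (\<forall>p. norm (pd dt u' p - pd dt u p) \<le> real m * (C * A + eta)) \<and>
         (\<forall>p. norm (R' p - (R p - (\<Sum>i<m. ((am i p)\<^sup>2 / 2) *\<^sub>R Mz (k i)))) \<le> real m * (eps * A\<^sup>2 + eta))"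
proof (induction m)
  case 0
  then show ?case using st by (intro exI[of _ u] exI[of _ R]) simp
next
  case (Suc m)
  then have m: "m \<le> n" "m < n" by auto
  from Suc.IH[OF m(1)] obtain u1 R1 where 1: "state t0 t1 u1 R1" "\<And>p. norm (u1 p - u p) \<le> real m * eta"
    "\<And>p. norm (grad u1 p - grad u p) \<le> real m * (C * A + eta)" "\<And>p. norm (pd dt u1 p - pd dt u p) \<le> real m * (C * A + eta)"
    "\<And>p. norm (R1 p - (R p - (\<Sum>i<m. ((am i p)\<^sup>2 / 2) *\<^sub>R Mz (k i)))) \<le> real m * (eps * A\<^sup>2 + eta)" by blast
  have mn: "real m * x \<le> real n * x" if "x \<ge> 0" for x using m(1) that by (intro mult_right_mono) auto
  have g1: "norm (grad u1 p) \<le> d" for p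
  proof -
    have "norm (grad u1 p) \<le> norm (grad u1 p - grad u p) + norm (grad u p)" using norm_triangle_sub by (simp add: add.commute)
    then show ?thesis using 1(3)[of p] mn[of "C * A + eta"] u[of p] am eta by (smt (verit) mult_nonneg_nonneg)
  qed
  have r1: "norm (R1 p) \<le> d" for p
  proof -
    define X where "X = R p - (\<Sum>i<m. ((am i p)\<^sup>2 / 2) *\<^sub>R Mz (k i))"
    have "norm (R1 p) \<le> norm (R1 p - X) + norm X" using norm_triangle_sub by (simp add: add.commute)
    moreover have "0 \<le> eps * A\<^sup>2 + eta" using am eta by simp
    ultimately show ?thesis using 1(5)[of p] mn[of "eps * A\<^sup>2 + eta"] R[OF m(1), of p] unfolding X_def[symmetric] by linarith
  qed
  from W[OF m(2), unfolded wave_step_def, rule_format, OF 1(1) am(1,2)[OF m(2)] am(3)[OF m(2)] am(4) g1 r1 eta]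
  obtain u' R' where 2: "state t0 t1 u' R'" "\<And>p. norm (u' p - u1 p) \<le> eta"
         "\<And>p. norm (grad u' p - grad u1 p) \<le> C * A + eta" "\<And>p. norm (pd dt u' p - pd dt u1 p) \<le> C * A + eta"
         "\<And>p. norm (R' p - (R1 p - ((am m p)\<^sup>2 / 2) *\<^sub>R Mz (k m))) \<le> eps * A\<^sup>2 + eta" by blast
  have tri: "norm (x - z) \<le> real (Suc m) * c" if "norm (x - y) \<le> c" "norm (y - z) \<le> real m * c" for x y z :: "'z::real_normed_vector" and c
    using norm_triangle_ineq[of "x - y" "y - z"] that by (simp add: algebra_simps)
  have R3: "norm (R' p - (R p - (\<Sum>i<Suc m. ((am i p)\<^sup>2 / 2) *\<^sub>R Mz (k i)))) \<le> real (Suc m) * (eps * A\<^sup>2 + eta)" for p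
    using tri[of "R' p" "R1 p - ((am m p)\<^sup>2 / 2) *\<^sub>R Mz (k m)" "eps * A\<^sup>2 + eta" "R p - (\<Sum>i<Suc m. ((am i p)\<^sup>2 / 2) *\<^sub>R Mz (k i))"]
      2(5)[of p] 1(5)[of p] by (simp add: algebra_simps)
  show ?case
    using 2(1) tri[OF 2(2) 1(2)] tri[OF 2(3) 1(3)] tri[OF 2(4) 1(4)] R3 by (intro exI[of _ u'] exI[of _ R'] conjI allI)
qed

section \<open>The pressure tensor\<close>

definition pt0 :: "mat2 \<Rightarrow> mat2" where
  "pt0 G = minv (mat 1 + G) ** transpose (adj (mat 1 + G))"

lemma pt0_zero: "pt0 0 = mat 1"
  by (simp add: pt0_def minv_def vec_eq_iff forall_2 mat_def adj_nth transpose_def matrix_matrix_mult_def sum_2 det_2)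

lemma pt0_near: assumes "e > 0" obtains d where "d > 0" "\<And>G. norm G < d \<Longrightarrow> norm (pt0 G - mat 1) < e"
proof -
  have a: "isCont (\<lambda>G::mat2. adj (mat 1 + G)) 0"
    by (intro isCont_smooth smooth_intros smooth_const)
  have d: "isCont (\<lambda>G::mat2. det (mat 1 + G)) 0"
    by (intro isCont_smooth smooth_intros smooth_const)
  have "isCont (\<lambda>G. minv (mat 1 + G)) 0"
    using a d unfolding minv_def by (intro continuous_intros) simp_all
  moreover have "isCont (\<lambda>G::mat2. transpose (adj (mat 1 + G))) 0"
    by (rule bounded_linear.isCont[OF bounded_linear_transpose a])
  ultimately have "isCont pt0 0"
    unfolding pt0_def[abs_def] by (rule bounded_bilinear.isCont[OF bounded_bilinear_mm])
  then have "isCont (\<lambda>G. norm (pt0 G - mat 1)) 0" by (intro continuous_intros)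
  from order_tendstoD(2)[OF isCont_tendsto_nhds[OF this], of e]
  have "\<forall>\<^sub>F G in nhds 0. norm (pt0 G - mat 1) < e"
    using assms by (simp add: pt0_zero)
  then show ?thesis using that unfolding eventually_nhds_metric by auto
qed

lemma sfield_time: assumes "smooth \<rho>" "\<And>t. t \<notin> {t0..t1} \<Longrightarrow> \<rho> t = 0"
  shows "sfield (Slab t0 t1) (\<lambda>p::pt. \<rho> (fst p))" "zo t0 t1 (\<lambda>p::pt. \<rho> (fst p))"
    "pd (dx j) (\<lambda>p::pt. \<rho> (fst p)) p = 0"
proof -
  have s: "smooth (\<lambda>p::pt. \<rho> (fst p))" by (rule smooth_compose[OF assms(1)]) (intro smooth_intros smooth_id)
  then show "sfield (Slab t0 t1) (\<lambda>p::pt. \<rho> (fst p))"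
    using assms(2) by (auto simp: sfield_def Slab_def Per_def)
  show "zo t0 t1 (\<lambda>p::pt. \<rho> (fst p))" using assms(2) by (simp add: zo_def)
  have "((\<lambda>p::pt. \<rho> (fst p)) has_derivative (\<lambda>v. pd (fst v) \<rho> (fst p))) (at p)"
    by (rule has_derivative_compose[where g = \<rho>, OF _ smooth_has_derivative[OF assms(1)]])
       (rule bounded_linear_imp_has_derivative[OF bounded_linear_fst])
  from pd_eqI[OF this, of "dx j"] show "pd (dx j) (\<lambda>p::pt. \<rho> (fst p)) p = 0"
    using pd_scaleR_dir[OF assms(1), of 0 0] by simp
qed

text \<open>Multiplied by \<open>mat 1 + grad u\<close>, \<open>pt0\<close> becomes the
  divergence-free cofactor matrix, and a factor depending on time alone passes through the
  divergence. So the equation does not notice a shift of the error by a multiple of a matrix near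
  the identity.\<close>

lemma state_add_pressure:
  assumes st: "state t0 t1 u R" and a: "t0' \<le> t0" "t1 \<le> t1'" and g: "smooth g" "\<And>t. t \<notin> {t0'..t1'} \<Longrightarrow> g t = 0"
    and u: "\<And>p. norm (grad u p) \<le> 1/4"
  shows "state t0' t1' u (\<lambda>p. R p + g (fst p) *\<^sub>R pt0 (grad u p))"
proof -
  note st' = stateD[OF st]
  have u': "sfield (Slab t0' t1') u" "sfield (Slab t0' t1') R" using st'(1,3) a by (auto intro: sfield_Slab_mono)
  have z: "zo t0' t1' u" "zo t0' t1' R" using st'(2,4) a by (auto simp: zo_def)
  have f: "sfield (Slab t0' t1') (\<lambda>p. g (fst p))" "zo t0' t1' (\<lambda>p. g (fst p))" "pd (dx j) (\<lambda>p. g (fst p)) p = 0" for j p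
    by (rule sfield_time[OF g], assumption)+
  have det: "det (mat 1 + grad u p) \<noteq> 0" for p using det_near_identity[OF u[of p]] by linarith
  have sp: "sfield (Slab t0' t1') (\<lambda>p. pt0 (grad u p))"
    unfolding pt0_def by (intro sfield_intros u' det)
  have sR: "sfield (Slab t0' t1') (\<lambda>p. R p + g (fst p) *\<^sub>R pt0 (grad u p))" by (intro sfield_intros u' f(1) sp)
  have zR: "zo t0' t1' (\<lambda>p. R p + g (fst p) *\<^sub>R pt0 (grad u p))" using z(2) f(2) by (simp add: zo_def)
  have symp: "transpose (pt0 G) = pt0 G" for G
    unfolding pt0_def minv_def by (simp add: vec_eq_iff forall_2 transpose_def matrix_matrix_mult_def sum_2)
  have tr: "transpose (R p + g (fst p) *\<^sub>R pt0 (grad u p)) = R p + g (fst p) *\<^sub>R pt0 (grad u p)" for p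
    using st'(5)[of p] symp[of "grad u p"] bounded_linear.linear[OF bounded_linear_transpose]
    by (simp add: linear_add linear_scale)
  have e: "(mat 1 + grad u q) ** (Sg (grad u q) + (R q + g (fst q) *\<^sub>R pt0 (grad u q)))
      = (mat 1 + grad u q) ** (Sg (grad u q) + R q) + g (fst q) *\<^sub>R transpose (adj (mat 1 + grad u q))" for q
  proof -
    have "(mat 1 + grad u q) ** pt0 (grad u q) = transpose (adj (mat 1 + grad u q))"
      unfolding pt0_def using minv(2)[OF det[of q]] by (simp add: matrix_mul_assoc)
    then show ?thesis by (simp add: mm_lin)
  qed
  have sm: "smooth (\<lambda>q. (mat 1 + grad u q) ** (Sg (grad u q) + R q))"
    by (rule sfield_smooth[where Q = "Slab t0' t1'"]) (intro sfield_intros u')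
  have sa: "smooth (\<lambda>q. transpose (adj (mat 1 + grad u q)))"
    by (rule sfield_smooth[where Q = "Slab t0' t1'"]) (intro sfield_intros u')
  have sga: "smooth (\<lambda>q. g (fst q) *\<^sub>R transpose (adj (mat 1 + grad u q)))"
    by (rule sfield_smooth[where Q = "Slab t0' t1'"]) (intro sfield_intros u' f(1))
  have "dvg (\<lambda>q. g (fst q) *\<^sub>R transpose (adj (mat 1 + grad u q))) p = 0" for p
    using dvg_scaleR_fun[OF sfield_smooth[OF f(1)] sa, where p = p] piola[OF sfield_smooth[OF u'(1)], of p]
    by (simp add: f(3) matrix_vector_mult_def vec_eq_iff)
  then have "dvg (\<lambda>q. (mat 1 + grad u q) ** (Sg (grad u q) + (R q + g (fst q) *\<^sub>R pt0 (grad u q)))) p =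
     dvg (\<lambda>q. (mat 1 + grad u q) ** (Sg (grad u q) + R q)) p" for p
    unfolding e using dvg_add[OF sm sga, of p] by simp
  then show ?thesis unfolding state_def using u' z(1) sR zR tr st'(6) by simp
qed

lemma sig_nonzero: "sig \<noteq> 0"
  using sig_nz by (simp add: sig_def)

text \<open>With errors of at most \<open>stress_rad * \<delta>\<close>, the entries of
  \<open>R\<close> divided by \<open>sig * \<delta>\<close> are at most 1/16, the range of
  \<open>wg_bounds\<close>.\<close>

definition stress_rad :: real where "stress_rad = \<bar>sig\<bar> / 16"

lemma step:
  obtains d C where "d > 0" "C > 0"
    "\<And>t0' t0 t1 t1' u R \<delta> eta. t0' < t0 \<Longrightarrow> t0 \<le> t1 \<Longrightarrow> t1 < t1' \<Longrightarrow> state t0 t1 u R \<Longrightarrow> (\<And>p. norm (grad u p) \<le> d) \<Longrightarrow>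
       (\<And>p. norm (R p) \<le> stress_rad * \<delta>) \<Longrightarrow> 0 < \<delta> \<Longrightarrow> \<delta> \<le> d \<Longrightarrow> 0 < eta \<Longrightarrow>
       \<exists>u' R'. state t0' t1' u' R' \<and> (\<forall>p. norm (u' p - u p) \<le> eta) \<and>
         (\<forall>p. norm (grad u' p - grad u p) \<le> C * sqrt \<delta>) \<and> (\<forall>p. norm (pd dt u' p - pd dt u p) \<le> C * sqrt \<delta>) \<and>
         (\<forall>p. norm (R' p) \<le> stress_rad * \<delta> / 4)"
proof -
  define r where "r = stress_rad"
  have r: "r > 0" "\<bar>sig\<bar> = 16 * r" using sig_nonzero by (auto simp: r_def stress_rad_def)
  \<comment> \<open>The three waves have amplitude at most \<open>2 * s\<close>, so their errors add
    up to \<open>3 * (4 * eps * \<delta> + eta')\<close>. With both summands at most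
    \<open>r * \<delta> / 48\<close> this is \<open>r * \<delta> / 8\<close>. The other half of the
    final \<open>r * \<delta> / 4\<close> comes from the distance of \<open>pt0\<close> to the
    identity, \<open>16 * r * \<delta> / 128\<close>.\<close>
  define eps where "eps = r / 192"
  have e: "eps > 0" using r by (simp add: eps_def)
  have "\<forall>i. \<exists>dc. fst dc > 0 \<and> snd dc > 0 \<and> wave_step (wk i) eps (fst dc) (snd dc)"
    using single_wave[OF wk(1,2) e] by (metis fst_conv snd_conv)
  then obtain dc where dc: "\<And>i. fst (dc i) > 0 \<and> snd (dc i) > 0 \<and> wave_step (wk i) eps (fst (dc i)) (snd (dc i))" by metis
  define dm where "dm = Min {fst (dc 0), fst (dc 1), fst (dc 2), 1}"
  define Cm where "Cm = Max {snd (dc 0), snd (dc 1), snd (dc 2)}"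
  have dm: "dm > 0" "dm \<le> 1" using dc by (auto simp: dm_def)
  have Cm: "Cm > 0" using dc[of 0] by (auto simp: Cm_def less_max_iff_disj)
  have W: "wave_step (wk i) eps dm Cm" if "i < 3" for i
  proof -
    have "i = 0 \<or> i = 1 \<or> i = 2" using that by auto
    then have "dm \<le> fst (dc i)" "snd (dc i) \<le> Cm" by (auto simp: dm_def Cm_def)
    then show ?thesis using wave_step_mono dc by blast
  qed
  obtain d2 where d2: "d2 > 0" "\<And>G. norm G < d2 \<Longrightarrow> norm (pt0 G - mat 1) < 1/128"
    using pt0_near[of "1/128"] by auto
  define Mm where "Mm = (\<Sum>i<3. norm (Mz (wk i)))"
  have Mm: "Mm \<ge> 0" by (simp add: Mm_def sum_nonneg)
  \<comment> \<open>Contributions to the intermediate errors, per \<delta>: \<open>r\<close> for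
    \<open>R\<close>, \<open>48 * r\<close> for the pressure with
    \<open>norm (pt0 G) \<le> 3\<close>, \<open>2 * Mm\<close> for the waves, and another
    \<open>r\<close> for the accumulated inaccuracies.\<close>
  define K where "K = 2 * r + 48 * r + 2 * Mm"
  have K: "K > 0" using r Mm by (simp add: K_def)
  define C where "C = 6 * Cm + 3"
  have C: "C > 0" using Cm by (simp add: C_def)
  \<comment> \<open>The later bound \<open>sqrt \<delta> \<le> e0\<close> yields the gradient budget
    \<open>C * s \<le> dm / 2\<close> and the amplitude bound \<open>2 * s \<le> dm\<close>.\<close>
  define e0 where "e0 = Min {dm / 2 / C, dm / 2}"
  have e0: "e0 > 0" "C * e0 \<le> dm / 2" "2 * e0 \<le> dm" using dm C by (auto simp: e0_def min_def field_simps)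
  define d where "d = Min {dm / 2, e0\<^sup>2, d2 / 2, dm / K, 1/4}"
  have d: "d > 0" "d \<le> dm / 2" "d \<le> e0\<^sup>2" "d \<le> d2 / 2" "d \<le> dm / K" "d \<le> 1/4"
  proof -
    show "d > 0" using dm e0 d2 K by (simp add: d_def)
  qed (unfold d_def, (rule Min_le; simp)+)
  show ?thesis
  proof (rule that[OF d(1) C])
    fix t0' t0 t1 t1' u R \<delta> eta
    assume a: "t0' < t0" "t0 \<le> t1" "t1 < t1'" and st: "state t0 t1 u R" and G: "\<And>p. norm (grad u p) \<le> d"
      and "\<And>p. norm (R p) \<le> stress_rad * \<delta>" and \<delta>: "0 < \<delta>" "\<delta> \<le> d" and eta: "0 < (eta :: real)"
    then have R: "norm (R p) \<le> r * \<delta>" for p by (simp add: r_def)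
    define s where "s = sqrt \<delta>"
    have s: "s > 0" "s\<^sup>2 = \<delta>" using \<delta> by (auto simp: s_def)
    have se: "s \<le> e0" using \<delta> d(3) e0(1) by (auto simp: s_def intro!: real_le_lsqrt)
    \<comment> \<open>The entries serve the sum of three displacements, the error budget, and the
      absorption of \<open>eta'\<close> into \<open>C * sqrt \<delta>\<close>.\<close>
    define eta' where "eta' = Min {eta / 3, r * \<delta> / 48, s}"
    have eta': "eta' > 0" "eta' \<le> eta / 3" "eta' \<le> r * \<delta> / 48" "eta' \<le> s"
    proof -
      show "eta' > 0" using eta r \<delta> s by (simp add: eta'_def)
    qed (unfold eta'_def, (rule Min_le; simp)+)
    obtain \<rho> where \<rho>: "smooth \<rho>" "\<And>t. 0 \<le> \<rho> t \<and> \<rho> t \<le> (1::real)" "\<And>t. t \<in> {t0..t1} \<Longrightarrow> \<rho> t = 1" "\<And>t. t \<notin> {t0'..t1'} \<Longrightarrow> \<rho> t = 0"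
      using smooth_cutoff[OF a] by blast
    \<comment> \<open>A wave can only change the error in the direction given by the sign of
      \<open>sig\<close>; \<open>g\<close> carries this sign, so the coefficients under the root in
      \<open>am\<close> are positive.\<close>
    define g where "g t = sig * \<delta> * (\<rho> t)\<^sup>2" for t
    define R1 where "R1 p = R p + g (fst p) *\<^sub>R pt0 (grad u p)" for p
    note st' = stateD[OF st]
    have st1: "state t0' t1' u R1"
      unfolding R1_def[abs_def]
    proof (rule state_add_pressure[OF st])
      show "smooth g" unfolding g_def[abs_def] by (intro smooth_intros smooth_const \<rho>)
      show "norm (grad u p) \<le> 1/4" for p using G[of p] d by linarith
    qed (use a \<rho> in \<open>auto simp: g_def\<close>)
    define S where "S p = inverse (sig * \<delta>) *\<^sub>R R p" for p
    have sS: "sfield (Slab t0' t1') S" unfolding S_def[abs_def]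
      using sfield_Slab_mono[OF st'(3), of t0' t1'] a by (intro sfield_intros) auto
    have Sb: "\<bar>S p $ i $ j\<bar> \<le> 1/16" for p i j
    proof -
      have "\<bar>R p $ i $ j\<bar> \<le> r * \<delta>" using entry_le_norm R order_trans by blast
      then have "\<bar>R p $ i $ j\<bar> / (\<bar>sig\<bar> * \<delta>) \<le> r * \<delta> / (\<bar>sig\<bar> * \<delta>)" using \<delta> by (intro divide_right_mono) auto
      also have "\<dots> = 1/16" using r \<delta> by simp
      finally have "\<bar>R p $ i $ j / (sig * \<delta>)\<bar> \<le> 1/16"
        unfolding abs_divide abs_mult using \<delta> by simp
      moreover have "S p $ i $ j = R p $ i $ j / (sig * \<delta>)" by (simp add: S_def divide_inverse mult.commute)
      ultimately show ?thesis by (simp only:)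
    qed
    \<comment> \<open>Solves \<open>(am i p)\<^sup>2 / 2 * ((wk i \<bullet> wk i) * sig) = g (fst p)
      * wg i (mat 1 + S p)\<close>. The cutoff stays outside the root, so its zeros do no harm to
      smoothness.\<close>
    define am where "am i p = s * \<rho> (fst p) * sqrt (2 * wg i (mat 1 + S p) / (wk i \<bullet> wk i))" for i p
    have kk: "wk i \<bullet> wk i > 0" "wk i \<bullet> wk i \<noteq> 0" for i using wk(3)[of i] by linarith+
    have wpos: "2 * wg i (mat 1 + S p) / (wk i \<bullet> wk i) > 0" if "i < 3" for i p
      using wg_bounds(1)[of "S p" i] that Sb kk by simp
    have sam: "sfield (Slab t0' t1') (am i)" if "i < 3" for i
      unfolding am_def[abs_def] by (intro sfield_intros sfield_time(1)[OF \<rho>(1,4)] sS sfield_wg wpos that kk)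
    have zam: "zo t0' t1' (am i)" for i using \<rho>(4) by (simp add: zo_def am_def)
    have bam: "\<bar>am i p\<bar> \<le> 2 * s" if "i < 3" for i p
    proof -
      have w: "wg i (mat 1 + S p) \<le> 2" "wg i (mat 1 + S p) > 0" using wg_bounds[of "S p" i] that Sb by auto
      have "2 * wg i (mat 1 + S p) / (wk i \<bullet> wk i) \<le> 4 / 1" by (rule frac_le) (use w wk(3)[of i] in auto)
      then have "sqrt (2 * wg i (mat 1 + S p) / (wk i \<bullet> wk i)) \<le> sqrt 4" by (intro real_sqrt_le_mono) simp
      then have "sqrt (2 * wg i (mat 1 + S p) / (wk i \<bullet> wk i)) \<le> 2" by simp
      moreover have "0 \<le> sqrt (2 * wg i (mat 1 + S p) / (wk i \<bullet> wk i))" using wpos[OF that] by (simp add: less_imp_le)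
      moreover have "s * \<rho> (fst p) \<le> s * 1" using \<rho>(2) s by (intro mult_left_mono) auto
      ultimately have "(s * \<rho> (fst p)) * sqrt (2 * wg i (mat 1 + S p) / (wk i \<bullet> wk i)) \<le> (s * 1) * 2"
        using s \<rho>(2) by (intro mult_mono) auto
      moreover have "0 \<le> (s * \<rho> (fst p)) * sqrt (2 * wg i (mat 1 + S p) / (wk i \<bullet> wk i))"
        using s \<rho>(2) wpos[OF that] by (intro mult_nonneg_nonneg) (auto simp: less_imp_le)
      ultimately show ?thesis by (simp add: am_def)
    qed
    define q where "q m p = (\<Sum>i<m. ((am i p)\<^sup>2 / 2) *\<^sub>R Mz (wk i))" for m p
    have q3: "q 3 p = g (fst p) *\<^sub>R mat 1 + R p" for p
    proof -
      have "((am i p)\<^sup>2 / 2) *\<^sub>R Mz (wk i) = g (fst p) *\<^sub>R (wg i (mat 1 + S p) *\<^sub>R outer (perp (wk i)) (perp (wk i)))" if "i < 3" for i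
      proof -
        have "(am i p)\<^sup>2 = \<delta> * (\<rho> (fst p))\<^sup>2 * (2 * wg i (mat 1 + S p) / (wk i \<bullet> wk i))"
          using wpos[OF that, of p] s by (simp add: am_def power_mult_distrib)
        then have "(am i p)\<^sup>2 / 2 * ((wk i \<bullet> wk i) * sig) = g (fst p) * wg i (mat 1 + S p)"
          using kk[of i] by (simp add: g_def)
        then show ?thesis by (simp add: Mz_def)
      qed
      then have "q 3 p = g (fst p) *\<^sub>R (\<Sum>i<3. wg i (mat 1 + S p) *\<^sub>R outer (perp (wk i)) (perp (wk i)))"
        by (simp add: q_def scaleR_sum_right)
      also have "\<dots> = g (fst p) *\<^sub>R (mat 1 + S p)"
        using st'(5)[of p] by (subst decomposition) (simp_all add: S_def vec_eq_iff transpose_def mat_def)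
      finally have "q 3 p = g (fst p) *\<^sub>R (mat 1 + S p)" .
      \<comment> \<open>\<rho> is 1 at all times at which \<open>R\<close> is nonzero.\<close>
      moreover have "g (fst p) *\<^sub>R S p = R p"
      proof (cases "fst p \<in> {t0..t1}")
        case True
        moreover have "sig * \<delta> \<noteq> 0" using \<delta> sig_nonzero by simp
        ultimately show ?thesis using \<rho>(3) by (simp add: g_def S_def del: inverse_mult_distrib mult_eq_0_iff)
      next
        case False
        then show ?thesis using zoD[OF st'(4)] by (simp add: S_def)
      qed
      ultimately show ?thesis by (simp add: scaleR_add_right)
    qed
    have gb: "\<bar>g t\<bar> \<le> 16 * r * \<delta>" for t
    proof -
      have "(\<rho> t)\<^sup>2 \<le> 1" using \<rho>(2)[of t] by (simp add: power_le_one)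
      then have "\<bar>sig\<bar> * \<delta> * (\<rho> t)\<^sup>2 \<le> \<bar>sig\<bar> * \<delta> * 1" using \<delta> by (intro mult_left_mono) auto
      then show ?thesis using \<delta> r by (simp add: g_def abs_mult)
    qed
    have p0: "norm (pt0 (grad u p) - mat 1) \<le> 1/128" for p
      using d2(2)[of "grad u p"] G[of p] d(4) d2(1) by (simp add: less_imp_le)
    have p1: "norm (pt0 (grad u p)) \<le> 3" for p
    proof -
      have "norm (mat 1 :: mat2) \<le> 2" using norm_mat_le[of "mat 1"] by (simp add: mat_def)
      then show ?thesis using p0[of p] norm_triangle_sub[of "pt0 (grad u p)" "mat 1"] by linarith
    qed
    have qb: "norm (q m p) \<le> 2 * \<delta> * Mm" if "m \<le> 3" for m p
    proof -
      have "norm (q m p) \<le> (\<Sum>i<m. 2 * \<delta> * norm (Mz (wk i)))"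
        unfolding q_def
      proof (rule sum_norm_le)
        fix i assume "i \<in> {..<m}"
        then have "\<bar>am i p\<bar> \<le> 2 * s" using bam that by simp
        then have "(am i p)\<^sup>2 \<le> (2 * s)\<^sup>2" by (rule abs_le_square_iff[THEN iffD1, OF order_trans]) (use s in simp)
        then have "(am i p)\<^sup>2 / 2 \<le> 2 * \<delta>" using s by (simp add: power_mult_distrib)
        then show "norm (((am i p)\<^sup>2 / 2) *\<^sub>R Mz (wk i)) \<le> 2 * \<delta> * norm (Mz (wk i))"
          unfolding norm_scaleR by (intro mult_right_mono) auto
      qed
      also have "\<dots> \<le> (\<Sum>i<3. 2 * \<delta> * norm (Mz (wk i)))" using that \<delta> by (intro sum_mono2) auto
      finally show ?thesis by (simp add: Mm_def sum_distrib_left)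
    qed
    have "K * d \<le> dm" using d(5) K by (simp add: field_simps)
    moreover have "K * \<delta> \<le> K * d" using \<delta> K by simp
    ultimately have Kd: "K * \<delta> \<le> dm" by linarith
    have es: "eps * (2 * s)\<^sup>2 = 4 * eps * \<delta>" using s by (simp add: power_mult_distrib)
    have e48: "4 * eps * \<delta> = r * \<delta> / 48" by (simp add: eps_def)
    have rd: "r * \<delta> > 0" using r \<delta> by simp
    have "3 * (x / 48 + y) \<le> x / 8" if "y \<le> x / 48" for x y :: real using that by simp
    from this[OF eta'(3)] have gen: "3 * (4 * eps * \<delta> + eta') \<le> r * \<delta> / 8" unfolding e48 .
    have Cs: "C * s \<le> dm / 2" using order_trans[OF mult_left_mono[OF se, of C] e0(2)] C by simp
    have C3: "3 * (Cm * (2 * s) + eta') \<le> C * s" using eta'(4) by (simp add: C_def algebra_simps)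
    have "\<exists>u' R'. state t0' t1' u' R' \<and> (\<forall>p. norm (u' p - u p) \<le> real 3 * eta') \<and>
         (\<forall>p. norm (grad u' p - grad u p) \<le> real 3 * (Cm * (2 * s) + eta')) \<and> (\<forall>p. norm (pd dt u' p - pd dt u p) \<le> real 3 * (Cm * (2 * s) + eta')) \<and>
         (\<forall>p. norm (R' p - (R1 p - (\<Sum>i<3. ((am i p)\<^sup>2 / 2) *\<^sub>R Mz (wk i)))) \<le> real 3 * (eps * (2 * s)\<^sup>2 + eta'))"
    proof (rule wave_iteration[OF W st1 sam zam bam _ _ Cm e eta'(1), where n = 3])
      show "2 * s \<le> dm" using se e0(3) by linarith
      show "0 \<le> 2 * s" using s by simp
      show "norm (grad u p) + real 3 * (Cm * (2 * s) + eta') \<le> dm" for p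
        using G[of p] d(2) Cs C3 by simp
      show "norm (R1 p - (\<Sum>i<m. ((am i p)\<^sup>2 / 2) *\<^sub>R Mz (wk i))) + real 3 * (eps * (2 * s)\<^sup>2 + eta') \<le> dm" if "m \<le> 3" for m p
      proof -
        have "norm (g (fst p) *\<^sub>R pt0 (grad u p)) \<le> 16 * r * \<delta> * 3"
          unfolding norm_scaleR using gb p1 r \<delta> by (intro mult_mono) auto
        then have b1: "norm (R1 p - q m p) \<le> r * \<delta> + 48 * r * \<delta> + 2 * \<delta> * Mm"
          unfolding R1_def using R[of p] qb[OF that, of p] norm_triangle_ineq[of "R p" "g (fst p) *\<^sub>R pt0 (grad u p)"]
            norm_triangle_ineq4[of "R p + g (fst p) *\<^sub>R pt0 (grad u p)" "q m p"] by linarith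
        have b2: "3 * (eps * (2 * s)\<^sup>2 + eta') \<le> r * \<delta>"
          unfolding es using gen rd by simp
        have b3: "K * \<delta> = r * \<delta> + 48 * r * \<delta> + 2 * \<delta> * Mm + r * \<delta>" by (simp add: K_def algebra_simps)
        have sum: "x + y \<le> dm" if "x \<le> X" "y \<le> Y" "K * \<delta> = X + Y" for x y X Y using that Kd by linarith
        show ?thesis using sum[OF b1 b2 b3] unfolding q_def by simp
      qed
    qed auto
    then obtain u' R' where r': "state t0' t1' u' R'" "\<And>p. norm (u' p - u p) \<le> 3 * eta'"
      "\<And>p. norm (grad u' p - grad u p) \<le> 3 * (Cm * (2 * s) + eta')" "\<And>p. norm (pd dt u' p - pd dt u p) \<le> 3 * (Cm * (2 * s) + eta')"
      "\<And>p. norm (R' p - (R1 p - q 3 p)) \<le> 3 * (4 * eps * \<delta> + eta')"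
      unfolding q_def es by auto
    have "norm (R' p) \<le> r * \<delta> / 4" for p
    proof -
      have "R1 p - q 3 p = g (fst p) *\<^sub>R (pt0 (grad u p) - mat 1)" by (simp add: q3 R1_def scaleR_diff_right)
      moreover have "norm (g (fst p) *\<^sub>R (pt0 (grad u p) - mat 1)) \<le> (16 * r * \<delta>) * (1/128)"
        unfolding norm_scaleR using gb p0 r \<delta> by (intro mult_mono) auto
      ultimately have "norm (R1 p - q 3 p) \<le> r * \<delta> / 8" by (simp add: mult.commute)
      moreover have "3 * (4 * eps * \<delta> + eta') \<le> r * \<delta> / 8" by (rule gen)
      moreover have "norm y \<le> x / 4" if "norm z \<le> x / 8" "norm (y - z) \<le> v" "v \<le> x / 8" for x v and y z :: "mat2"
        using norm_triangle_sub[of y z] that by linarith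
      ultimately show ?thesis using r'(5)[of p] by blast
    qed
    moreover have "norm (u' p - u p) \<le> eta" for p using r'(2)[of p] eta'(2) by linarith
    moreover have "norm (grad u' p - grad u p) \<le> C * sqrt \<delta>" "norm (pd dt u' p - pd dt u p) \<le> C * sqrt \<delta>" for p
      using r'(3)[of p] r'(4)[of p] C3 unfolding s_def by linarith+
    ultimately show "\<exists>u' R'. state t0' t1' u' R' \<and> (\<forall>p. norm (u' p - u p) \<le> eta) \<and>
         (\<forall>p. norm (grad u' p - grad u p) \<le> C * sqrt \<delta>) \<and> (\<forall>p. norm (pd dt u' p - pd dt u p) \<le> C * sqrt \<delta>) \<and>
         (\<forall>p. norm (R' p) \<le> stress_rad * \<delta> / 4)"
      using r'(1) unfolding r_def by (intro exI[of _ u'] exI[of _ R'] conjI allI)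
  qed
qed

end

section \<open>The approximating sequence\<close>

context material
begin

section \<open>The starting state\<close>

lemma pd_scale_const: "smooth f \<Longrightarrow> pd v (\<lambda>p. s *\<^sub>R f p) p = s *\<^sub>R pd v f p"
  by (rule pd_linear[OF bounded_linear_scaleR_right smooth_differentiable])

lemma grad_scale_const: "smooth u \<Longrightarrow> grad (\<lambda>p. s *\<^sub>R u p) p = s *\<^sub>R grad u p"
  by (simp add: grad_def pd_scale_const vec_eq_iff)

text \<open>The residual is a continuous function of \<open>s\<close> and the point and vanishes at
  \<open>s = 0\<close>. Uniform continuity on a compact cell makes the convergence uniform in the
  point.\<close>

lemma uniformly_small_residual:
  assumes w: "sfield (Slab t0 t1) w" "zo t0 t1 w" and e: "e > 0"
  obtains s0 where "s0 > 0" "\<And>s p. 0 \<le> s \<Longrightarrow> s < s0 \<Longrightarrow>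
    norm (pd dt (pd dt (\<lambda>p. s *\<^sub>R w p)) p
      - dvg (\<lambda>p. (mat 1 + grad (\<lambda>p. s *\<^sub>R w p) p) ** Sg (grad (\<lambda>p. s *\<^sub>R w p) p)) p) \<le> e"
proof -
  note sw = sfield_smooth[OF w(1)]
  define us where "us s p = s *\<^sub>R w p" for s p
  have sus: "sfield (Slab t0 t1) (us s)" "zo t0 t1 (us s)" for s
    unfolding us_def[abs_def] by (intro sfield_intros w) (use w(2) in \<open>simp add: zo_def\<close>)
  define f where "f s p = pd dt (pd dt (us s)) p - dvg (\<lambda>p. (mat 1 + grad (us s) p) ** Sg (grad (us s) p)) p" for s p
  have sf: "sfield (Slab t0 t1) (f s)" for s unfolding f_def[abs_def] by (intro sfield_intros sus)
  have zf: "zo t0 t1 (f s)" for s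
  proof -
    have "zo t0 t1 (\<lambda>p. (mat 1 + grad (us s) p) ** Sg (grad (us s) p))"
      using zo_grad[OF sus(2)[of s]] by (simp add: zo_def)
    then show ?thesis using zo_dvg zo_pd[OF zo_pd[OF sus(2)[of s]], of dt dt] by (simp add: zo_def f_def)
  qed
  define h :: "real \<times> pt \<Rightarrow> mat2" where "h q = (mat 1 + fst q *\<^sub>R grad w (snd q)) ** Sg (fst q *\<^sub>R grad w (snd q))" for q
  have gw: "smooth (\<lambda>q::real \<times> pt. grad w (snd q))"
    by (rule smooth_compose[OF smooth_grad[OF sw]]) (intro smooth_intros smooth_id)
  have sh: "smooth h" unfolding h_def[abs_def] by (intro smooth_intros smooth_const smooth_id gw)
  define F :: "real \<times> pt \<Rightarrow> real^2" where "F q = fst q *\<^sub>R pd dt (pd dt w) (snd q) - (\<chi> i. \<Sum>j\<in>UNIV. pd (0, dx j) h q $ i $ j)" for q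
  have "smooth (\<lambda>q::real \<times> pt. pd dt (pd dt w) (snd q))"
    by (rule smooth_compose[OF smooth_pd[OF smooth_pd[OF sw]]]) (intro smooth_intros smooth_id)
  then have cF: "continuous_on S F" for S
    unfolding F_def[abs_def] by (intro smooth_continuous_on smooth_intros smooth_id sh)
  have gus: "grad (us s) p = s *\<^sub>R grad w p" for s p
    unfolding us_def[abs_def] by (rule grad_scale_const[OF sw])
  have Ff: "F (s, p) = f s p" for s p
  proof -
    have 1: "pd dt (us s) = (\<lambda>p. s *\<^sub>R pd dt w p)" for s
      unfolding us_def[abs_def] by (rule ext, rule pd_scale_const[OF sw])
    have 2: "pd dt (pd dt (us s)) p = s *\<^sub>R pd dt (pd dt w) p"
      unfolding 1 by (rule pd_scale_const[OF smooth_pd[OF sw]])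
    have 3: "pd (dx j) (\<lambda>p. h (s, p)) p = pd (0, dx j) h (s, p)" for j
    proof -
      have "((\<lambda>p::pt. (s, p)) has_derivative (\<lambda>v. (0, v))) (at p)" by (auto intro!: derivative_eq_intros)
      from has_derivative_compose[OF this smooth_has_derivative[OF sh]]
      show ?thesis by (rule pd_eqI[THEN trans]) simp
    qed
    show ?thesis unfolding F_def f_def 2 gus dvg_def using 3 by (simp add: h_def)
  qed
  define K :: "pt set" where "K = {t0..t1} \<times> cbox 0 (\<chi> i. 2 * pi)"
  have "uniformly_continuous_on ({0..1} \<times> K) F"
    by (intro compact_uniformly_continuous cF compact_Times) (auto simp: K_def intro!: compact_Times)
  then obtain d where d: "d > 0" "\<And>x y. x \<in> {0..1} \<times> K \<Longrightarrow> y \<in> {0..1} \<times> K \<Longrightarrow> dist x y < d \<Longrightarrow> dist (F x) (F y) < e"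
    unfolding uniformly_continuous_on_def using e by metis
  have "norm (f s p) \<le> e" if s: "0 \<le> s" "s < min d 1" for s p
  proof -
    obtain q where q: "f s p = f s q" "fst q = fst p" "\<And>i. 0 \<le> snd q $ i" "\<And>i. snd q $ i \<le> 2 * pi"
      using periodic_reduce[of p] sfield_shift[OF sfield_Slab_Per[OF sf]] by metis
    show ?thesis
    proof (cases "fst q \<in> {t0..t1}")
      case True
      then have K: "q \<in> K" using q by (auto simp: K_def mem_box_cart mem_Times_iff)
      have "dist (F (s, q)) (F (0, q)) < e"
        using d(2)[of "(s, q)" "(0, q)"] K s by (simp add: dist_Pair_Pair)
      moreover have "f 0 q = 0"
      proof -
        have "us 0 = (\<lambda>p. 0)" "grad (us 0) = (\<lambda>p. 0)" by (rule ext, simp add: us_def gus)+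
        then show ?thesis unfolding f_def by (simp add: dvg_def vec_eq_iff)
      qed
      ultimately show ?thesis by (simp add: Ff q(1))
    next
      case False
      then show ?thesis using zoD[OF zf] q e by simp
    qed
  qed
  then show ?thesis using that[of "min d 1"] d(1) unfolding f_def us_def[abs_def] by simp
qed

text \<open>A small field has a small residual, which the inverse divergence turns into a stress
  error. The seed is taken as a derivative in the first coordinate, so that its acceleration has
  zero spatial mean, as the inversion demands.\<close>

lemma start:
  assumes T: "T > 0" and e: "0 < e" "e \<le> 1/4" and r: "r > 0"
  shows "\<exists>u R. state (T/4) (3*T/4) u R \<and> (\<forall>p. norm (grad u p) \<le> e) \<and> (\<forall>p. norm (R p) \<le> r) \<and> (\<exists>p. u p \<noteq> 0)"
proof (rule lagrangian_inverse_divergence, goal_cases)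
  case (1 K)
  note K = 1(1) and Kinv = 1(2)
  define \<psi> where "\<psi> t = bump ((t - T/2) * (4/T))" for t
  have \<psi>: "smooth \<psi>" unfolding \<psi>_def[abs_def]
    by (rule smooth_compose[OF smooth_bump]) (intro smooth_intros smooth_id smooth_const)
  have \<psi>0: "\<psi> t = 0" if "t \<notin> {T/4..3*T/4}" for t
  proof -
    have "\<bar>t - T/2\<bar> \<ge> T/4" using that T by (auto simp: abs_if)
    then have "\<bar>t - T/2\<bar> * (4/T) \<ge> T/4 * (4/T)" using T by (intro mult_right_mono) auto
    moreover have "\<bar>(t - T/2) * (4/T)\<bar> = \<bar>t - T/2\<bar> * (4/T)" using T by (subst abs_mult) simp
    moreover have "T/4 * (4/T) = 1" using T by simp
    ultimately have "\<bar>(t - T/2) * (4/T)\<bar> \<ge> 1" by (simp only:)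
    then show ?thesis unfolding \<psi>_def by (rule bump_zero)
  qed
  have \<psi>1: "\<psi> (T/2) > 0" by (simp add: \<psi>_def bump_pos)
  define W0 :: "pt \<Rightarrow> real^2" where "W0 p = (\<psi> (fst p) * sin (snd p $ 1)) *\<^sub>R axis 1 1" for p
  have s\<psi>: "sfield (Slab (T/4) (3*T/4)) (\<lambda>p::pt. \<psi> (fst p) * sin (snd p $ 1))"
  proof -
    have "smooth (\<lambda>p::pt. \<psi> (fst p) * sin (snd p $ 1))"
      by (intro smooth_intros smooth_id sfield_smooth[OF sfield_time(1)[OF \<psi> \<psi>0]])
    moreover have "sin (snd (p + (2 * pi) *\<^sub>R dx i) $ 1) = sin (snd p $ 1)" for p :: pt and i
      by (simp add: dx_def axis_def)
    ultimately show ?thesis using \<psi>0 by (auto simp: sfield_def Slab_def Per_def)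
  qed
  have sW: "sfield (Slab (T/4) (3*T/4)) W0" unfolding W0_def[abs_def] by (rule sfield_scaleR[OF s\<psi> sfield_const])
  have zW: "zo (T/4) (3*T/4) W0" using \<psi>0 by (simp add: zo_def W0_def)
  define w where "w = pd (dx 1) W0"
  have w: "sfield (Slab (T/4) (3*T/4)) w" "zo (T/4) (3*T/4) w"
    unfolding w_def by (intro sfield_intros sW, rule zo_pd[OF zW])
  have "\<exists>p. w p \<noteq> 0"
  proof (rule ccontr)
    assume "\<not> ?thesis"
    then have "pd (dx 1) W0 p = 0" for p unfolding w_def by blast
    from constant_direction[OF sfield_smooth[OF sW] this, of "(T/2, 0)" "pi/2"]
    show False using \<psi>1 by (simp add: W0_def dx_def)
  qed
  then obtain p0 where p0: "w p0 \<noteq> 0" by blast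
  obtain Cw where Cw: "Cw > 0" "\<And>p. norm (grad w p) \<le> Cw"
    using sfield_bounded[of "T/4" "3*T/4" "grad w"] w(1) by (metis sfield_grad(2))
  obtain s0 where s0: "s0 > 0" "\<And>s p. 0 \<le> s \<Longrightarrow> s < s0 \<Longrightarrow>
    norm (pd dt (pd dt (\<lambda>p. s *\<^sub>R w p)) p
      - dvg (\<lambda>p. (mat 1 + grad (\<lambda>p. s *\<^sub>R w p) p) ** Sg (grad (\<lambda>p. s *\<^sub>R w p) p)) p) \<le> r / K"
    using uniformly_small_residual[OF w, of "r / K"] r K by auto
  define s where "s = min (s0 / 2) (e / Cw)"
  have s: "0 < s" "s < s0" "s * Cw \<le> e" using s0(1) e Cw by (auto simp: s_def min_def field_simps)
  define u where "u p = s *\<^sub>R w p" for p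
  have su: "sfield (Slab (T/4) (3*T/4)) u" "zo (T/4) (3*T/4) u"
    unfolding u_def[abs_def] by (intro sfield_intros w) (use w(2) in \<open>simp add: zo_def\<close>)
  have gu: "grad u p = s *\<^sub>R grad w p" for p
    unfolding u_def[abs_def] by (rule grad_scale_const[OF sfield_smooth[OF w(1)]])
  have ge: "norm (grad u p) \<le> e" for p
    using order_trans[OF mult_left_mono[OF Cw(2)[of p], of s] s(3)] s(1) by (simp add: gu)
  define f where "f p = pd dt (pd dt u) p - dvg (\<lambda>p. (mat 1 + grad u p) ** Sg (grad u p)) p" for p
  have ssg: "sfield (Slab (T/4) (3*T/4)) (\<lambda>p. (mat 1 + grad u p) ** Sg (grad u p))" by (intro sfield_intros su)
  have zsg: "zo (T/4) (3*T/4) (\<lambda>p. (mat 1 + grad u p) ** Sg (grad u p))"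
    using zo_grad[OF su(2)] by (simp add: zo_def)
  have sf: "sfield (Slab (T/4) (3*T/4)) f" unfolding f_def[abs_def] by (intro sfield_intros su)
  have zf: "zo (T/4) (3*T/4) f"
    using zo_dvg[OF zsg] zo_pd[OF zo_pd[OF su(2)], of dt dt] by (simp add: zo_def f_def)
  have fb: "norm (f p) \<le> r / K" for p
    using s0(2)[of s p] s unfolding f_def u_def[abs_def] by simp
  have mz: "mean f = (\<lambda>p. 0)"
  proof -
    have W: "sfield Per W0" by (rule sfield_Slab_Per[OF sW])
    define V where "V p = s *\<^sub>R pd dt (pd dt W0) p" for p
    have sV: "sfield Per V" unfolding V_def[abs_def] by (intro sfield_intros W)
    have 1: "pd dt u = (\<lambda>p. s *\<^sub>R pd dt w p)"
      unfolding u_def[abs_def] by (rule ext, rule pd_scale_const[OF sfield_smooth[OF w(1)]])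
    have 2: "pd dt (pd dt u) p = s *\<^sub>R pd dt (pd dt w) p" for p
      unfolding 1 by (rule pd_scale_const[OF smooth_pd[OF sfield_smooth[OF w(1)]]])
    have 3: "pd dt (pd dt w) = pd (dx 1) (pd dt (pd dt W0))"
    proof -
      have "pd dt (pd (dx 1) W0) = pd (dx 1) (pd dt W0)" "pd dt (pd (dx 1) (pd dt W0)) = pd (dx 1) (pd dt (pd dt W0))"
        by (rule ext, rule pd_commute, intro smooth_pd sfield_smooth[OF W])+
      then show ?thesis unfolding w_def by simp
    qed
    have 4: "pd dt (pd dt u) = pd (dx 1) V"
      unfolding V_def[abs_def] by (rule ext) (simp add: 2 3 pd_scale_const smooth_pd sfield_smooth[OF W])
    have "mean f p = mean (pd (dx 1) V) p - mean (dvg (\<lambda>p. (mat 1 + grad u p) ** Sg (grad u p))) p" for p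
      unfolding f_def[abs_def] 4
      by (rule mean_diff) (intro smooth_intros sfield_smooth[OF sV] sfield_smooth[OF ssg])+
    then show ?thesis
      using pd_mean[OF sfield_smooth[OF sV], of "dx 1"] mean_const_dir[OF sV, of 1] avg_dvg_zero[OF sfield_Slab_Per[OF ssg]]
      by (simp add: fun_eq_iff)
  qed
  have ge4: "norm (grad u p) \<le> 1/4" for p using ge[of p] e by linarith
  obtain S where S: "sfield Per S" "\<forall>p. transpose (S p) = S p" "\<forall>p. norm (S p) \<le> K * (r / K)"
       "\<forall>p. dvg (\<lambda>p. (mat 1 + grad u p) ** S p) p = f p" "\<forall>p. (\<forall>q. fst q = fst p \<longrightarrow> f q = 0) \<longrightarrow> S p = 0"
    using Kinv[OF sfield_Slab_Per[OF su(1)] ge4 sfield_Slab_Per[OF sf] fb mz] by blast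
  have zS: "zo (T/4) (3*T/4) S" using S(5) zf unfolding zo_def by metis
  have sS: "sfield (Slab (T/4) (3*T/4)) S" by (rule sfield_Slab_zo[OF S(1) zS])
  have smS: "smooth (\<lambda>p. (mat 1 + grad u p) ** S p)"
    by (rule sfield_smooth[where Q = "Slab (T/4) (3*T/4)"]) (intro sfield_intros su sS)
  have "dvg (\<lambda>p. (mat 1 + grad u p) ** (Sg (grad u p) + S p)) p = pd dt (pd dt u) p" for p
    using dvg_add[OF sfield_smooth[OF ssg] smS, of p] S(4) by (simp add: mm_lin f_def)
  then have "state (T/4) (3*T/4) u S" unfolding state_def using su sS zS S(2) by simp
  moreover have "\<forall>p. norm (S p) \<le> r" using S(3) K by simp
  moreover have "u p0 \<noteq> 0" using p0 s(1) by (simp add: u_def)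
  ultimately show ?thesis using ge by blast
qed

text \<open>The stress error falls like \<open>(1/4)^n\<close>, so the first derivatives change by
  multiples of \<open>(1/2)^n\<close>, which are summable. The displacement can be changed as little
  as desired in each step; its increments at \<open>p0\<close> are made to sum to at most half of
  the initial value there, which keeps the limit nonzero.\<close>

lemma approximating_sequence:
  assumes T: "T > 0"
  obtains u :: "nat \<Rightarrow> pt \<Rightarrow> real^2" and R :: "nat \<Rightarrow> pt \<Rightarrow> mat2" and \<tau> B cl p0 where
    "\<tau> > 0" "B > 0" "cl > 0" "\<And>n. sfield Per (u n)" "\<And>n. sfield Per (R n)" "\<And>n p. fst p < \<tau> \<Longrightarrow> u n p = 0"
    "\<And>n p. pd dt (pd dt (u n)) p = dvg (\<lambda>p. (mat 1 + grad (u n) p) ** (Sg (grad (u n) p) + R n p)) p"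
    "\<And>n p. norm (u (Suc n) p - u n p) \<le> B * (1/2)^n" "\<And>n p. norm (grad (u (Suc n)) p - grad (u n) p) \<le> B * (1/2)^n"
    "\<And>n p. norm (pd dt (u (Suc n)) p - pd dt (u n) p) \<le> B * (1/2)^n"
    "\<And>n p. norm (R n p) \<le> B * (1/2)^n" "\<And>n p. norm (grad (u n) p) \<le> 1"
    "fst p0 \<in> {0..T}" "\<And>n. norm (u n p0) \<ge> cl"
proof (rule step, goal_cases)
  case (1 d1 C)
  define d where "d = min d1 (1/4)"
  have d: "d > 0" "d \<le> d1" "d \<le> 1/4" using 1(2) by (auto simp: d_def)
  note C = 1(3) and st = 1(4)
  have r: "stress_rad > 0" using sig_nonzero by (simp add: stress_rad_def)
  \<comment> \<open>Gives \<open>C * sqrt \<delta> \<le> d / 4\<close>, so that all increments of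
    the gradient together stay within \<open>d / 2\<close>.\<close>
  define \<delta> where "\<delta> = min d ((d / 4 / C)\<^sup>2)"
  have \<delta>: "\<delta> > 0" "\<delta> \<le> d" using d C by (auto simp: \<delta>_def)
  have "sqrt \<delta> \<le> d / 4 / C" using d C by (intro real_le_lsqrt) (auto simp: \<delta>_def)
  then have Cs: "C * sqrt \<delta> \<le> d / 4" using C by (simp add: field_simps)
  have d2: "0 < d / 2" "d / 2 \<le> 1/4" and r\<delta>: "stress_rad * \<delta> > 0" using d r \<delta> by auto
  obtain u0 R0 where s0: "state (T/4) (3*T/4) u0 R0" "\<And>p. norm (grad u0 p) \<le> d / 2"
    "\<And>p. norm (R0 p) \<le> stress_rad * \<delta>" "\<exists>p. u0 p \<noteq> 0"
    using start[OF T d2 r\<delta>] by blast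
  then obtain p0 where p0: "u0 p0 \<noteq> 0" by blast
  have fp0: "fst p0 \<in> {0..T}"
  proof -
    have "zo (T/4) (3*T/4) u0" using s0(1) by (simp add: state_def)
    then have "fst p0 \<in> {T/4..3*T/4}" using p0 zoD by blast
    then show ?thesis using T by auto
  qed
  define cl where "cl = norm (u0 p0)"
  have cl: "cl > 0" using p0 by (simp add: cl_def)
  \<comment> \<open>The left ends decrease from \<open>T/4\<close> towards \<open>T/8\<close>, so
    all iterates vanish before \<open>T/8\<close>. The right ends may pass \<open>T\<close>, beyond
    the times at which the solution is considered.\<close>
  define t0 where "t0 n = T/8 * (1 + (1/2)^n)" for n :: nat
  define t1 where "t1 n = 3*T/4 + T * (1 - (1/2)^n)" for n :: nat
  \<comment> \<open>The bound on the gradient grows with \<open>n\<close> but stays below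
    \<open>d\<close>; the lower bound at \<open>p0\<close> decreases but stays above
    \<open>cl / 2\<close>.\<close>
  define P where "P n x \<longleftrightarrow> state (t0 n) (t1 n) (fst x) (snd x) \<and> (\<forall>p. norm (grad (fst x) p) \<le> d / 2 + d / 2 * (1 - (1/2)^n)) \<and>
    (\<forall>p. norm (snd x p) \<le> stress_rad * (\<delta> * (1/4)^n)) \<and> norm (fst x p0) \<ge> cl * (1/2 + (1/2)^(n+1))"
    for n :: nat and x :: "(pt \<Rightarrow> real^2) \<times> (pt \<Rightarrow> mat2)"
  define Q where "Q n x y \<longleftrightarrow> (\<forall>p. norm (fst y p - fst x p) \<le> cl * (1/2)^(n+2)) \<and>
    (\<forall>p. norm (grad (fst y) p - grad (fst x) p) \<le> C * sqrt \<delta> * (1/2)^n) \<and> (\<forall>p. norm (pd dt (fst y) p - pd dt (fst x) p) \<le> C * sqrt \<delta> * (1/2)^n)"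
    for n :: nat and x y :: "(pt \<Rightarrow> real^2) \<times> (pt \<Rightarrow> mat2)"
  have "\<exists>f. \<forall>n. P n (f n) \<and> Q n (f n) (f (Suc n))"
  proof (rule dependent_nat_choice)
    have "P 0 (u0, R0)" using s0 by (simp add: P_def t0_def t1_def cl_def)
    then show "\<exists>x. P 0 x" by blast
  next
    fix x n assume x: "P n x"
    have h: "(1/2::real)^n > 0" "(1/2::real)^n \<le> 1" "(1/2::real)^Suc n = (1/2)^n / 2" by (auto simp: power_le_one)
    have a: "t0 (Suc n) < t0 n" "t0 n \<le> t1 n" "t1 n < t1 (Suc n)"
    proof -
      show "t0 (Suc n) < t0 n" "t1 n < t1 (Suc n)" using T by (simp_all add: t0_def t1_def)
      have "t0 n \<le> T/8 * 2" unfolding t0_def using T h(2) by (intro mult_left_mono) auto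
      moreover have "3*T/4 \<le> t1 n" unfolding t1_def using T h(2) by simp
      ultimately show "t0 n \<le> t1 n" using T by linarith
    qed
    have g: "norm (grad (fst x) p) \<le> d1" for p
    proof -
      have "d / 2 * (1 - (1/2)^n) \<le> d / 2 * 1" using d h by (intro mult_left_mono) auto
      then show ?thesis using x d unfolding P_def by (smt (verit, best) field_sum_of_halves mult.right_neutral)
    qed
    have dn: "0 < \<delta> * (1/4)^n" "\<delta> * (1/4)^n \<le> d1"
    proof -
      have "\<delta> * (1/4)^n \<le> \<delta> * 1" using \<delta>(1) by (intro mult_left_mono power_le_one) auto
      then show "\<delta> * (1/4)^n \<le> d1" using \<delta> d by linarith
    qed (use \<delta> in simp)
    have cn: "0 < cl * (1/2)^(n+2)" using cl by simp
    have sq: "sqrt (\<delta> * (1/4)^n) = sqrt \<delta> * (1/2)^n"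
    proof -
      have "(1/4::real)^n = ((1/2)^n)\<^sup>2" by (simp add: power2_eq_square flip: power_mult_distrib)
      then show ?thesis by (simp add: real_sqrt_mult)
    qed
    have "state (t0 n) (t1 n) (fst x) (snd x)" "\<And>p. norm (snd x p) \<le> stress_rad * (\<delta> * (1/4)^n)" using x unfolding P_def by auto
    from st[OF a this(1) g this(2) dn cn]
    obtain u' R' where n: "state (t0 (Suc n)) (t1 (Suc n)) u' R'" "\<And>p. norm (u' p - fst x p) \<le> cl * (1/2)^(n+2)"
      "\<And>p. norm (grad u' p - grad (fst x) p) \<le> C * (sqrt \<delta> * (1/2)^n)" "\<And>p. norm (pd dt u' p - pd dt (fst x) p) \<le> C * (sqrt \<delta> * (1/2)^n)"
      "\<And>p. norm (R' p) \<le> stress_rad * (\<delta> * (1/4)^n) / 4"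
      unfolding sq by blast
    have Q: "Q n x (u', R')" unfolding Q_def using n(2-4) by (simp add: mult.assoc)
    have g': "norm (grad u' p) \<le> d / 2 + d / 2 * (1 - (1/2)^Suc n)" for p
    proof -
      have "C * sqrt \<delta> * (1/2)^n \<le> d / 4 * (1/2)^n" using Cs h(1) by (intro mult_right_mono) auto
      moreover have "norm (grad (fst x) p) \<le> d / 2 + d / 2 * (1 - (1/2)^n)" using x unfolding P_def by blast
      moreover have "norm (grad u' p) \<le> norm (grad (fst x) p) + norm (grad u' p - grad (fst x) p)" by (rule norm_triangle_sub)
      moreover have "norm (grad u' p - grad (fst x) p) \<le> C * sqrt \<delta> * (1/2)^n" using n(3)[of p] by (simp add: mult.assoc)
      moreover have "d / 2 * (1 - (1/2)^Suc n) = d / 2 * (1 - (1/2)^n) + d / 4 * (1/2)^n" by (simp add: field_simps)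
      ultimately show ?thesis by linarith
    qed
    have cl': "norm (u' p0) \<ge> cl * (1/2 + (1/2)^(Suc n+1))"
    proof -
      have "cl * (1/2 + (1/2)^(n+1)) \<le> norm (fst x p0)" using x unfolding P_def by blast
      moreover have "norm (fst x p0) \<le> norm (u' p0) + norm (fst x p0 - u' p0)" by (rule norm_triangle_sub)
      moreover have "norm (fst x p0 - u' p0) \<le> cl * (1/2)^(n+2)" using n(2)[of p0] by (simp add: norm_minus_commute)
      moreover have "cl * (1/2 + (1/2)^(n+1)) = cl * (1/2 + (1/2)^(Suc n+1)) + cl * (1/2)^(n+2)" by (simp add: field_simps)
      ultimately show ?thesis by linarith
    qed
    have "P (Suc n) (u', R')" unfolding P_def using n(1,5) g' cl' by simp
    then show "\<exists>y. P (Suc n) y \<and> Q n x y" using Q by blast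
  qed
  then obtain f where f: "\<And>n. P n (f n)" "\<And>n. Q n (f n) (f (Suc n))" by blast
  define B where "B = C * sqrt \<delta> + cl + stress_rad * \<delta>"
  have B: "B > 0" "C * sqrt \<delta> \<le> B" "cl \<le> B" "stress_rad * \<delta> \<le> B" using C \<delta> cl r by (auto simp: B_def add_pos_pos)
  have Bx: "x * (1/2)^n \<le> B * (1/2)^n" if "x \<le> B" for x n using that by (intro mult_right_mono) auto
  have stn: "state (t0 n) (t1 n) (fst (f n)) (snd (f n))" for n using f(1)[of n] unfolding P_def by blast
  have h1: "(1/2::real)^n \<le> 1" "(1/4::real)^n \<le> (1/2)^n" for n by (auto simp: power_le_one intro!: power_mono)
  show ?thesis
  proof (rule 1(1)[of "T/8" B "cl/2" "\<lambda>n. fst (f n)" "\<lambda>n. snd (f n)" p0])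
    show "T/8 > 0" "B > 0" "cl/2 > 0" using T B cl by auto
    show "sfield Per (fst (f n))" "sfield Per (snd (f n))" for n
      using stn[of n] unfolding state_def by (auto intro: sfield_Slab_Per)
    show "fst (f n) p = 0" if "fst p < T/8" for n p
    proof -
      have "t0 n > T/8" using T by (simp add: t0_def)
      then have "fst p \<notin> {t0 n..t1 n}" using that by auto
      then show ?thesis using stn[of n] unfolding state_def by (blast dest: zoD)
    qed
    show "pd dt (pd dt (fst (f n))) p = dvg (\<lambda>p. (mat 1 + grad (fst (f n)) p) ** (Sg (grad (fst (f n)) p) + snd (f n) p)) p" for n p
      using stn[of n] unfolding state_def by blast
    show "norm (fst (f (Suc n)) p - fst (f n) p) \<le> B * (1/2)^n" for n p
    proof -
      have "norm (fst (f (Suc n)) p - fst (f n) p) \<le> cl * (1/2)^(n+2)" using f(2)[of n] unfolding Q_def by blast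
      also have "\<dots> \<le> cl * (1/2)^n" using cl by simp
      finally show ?thesis using Bx[OF B(3), of n] by linarith
    qed
    show "norm (grad (fst (f (Suc n))) p - grad (fst (f n)) p) \<le> B * (1/2)^n"
      "norm (pd dt (fst (f (Suc n))) p - pd dt (fst (f n)) p) \<le> B * (1/2)^n" for n p
      using f(2)[of n] Bx[OF B(2), of n] order_trans unfolding Q_def by blast+
    show "norm (snd (f n) p) \<le> B * (1/2)^n" for n p
    proof -
      have "norm (snd (f n) p) \<le> (stress_rad * \<delta>) * (1/4)^n" using f(1)[of n] unfolding P_def by (simp add: mult.assoc)
      also have "\<dots> \<le> (stress_rad * \<delta>) * (1/2)^n" using r\<delta> h1 by (intro mult_left_mono) auto
      finally show ?thesis using Bx[OF B(4), of n] by linarith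
    qed
    show "norm (grad (fst (f n)) p) \<le> 1" for n p
    proof -
      have "d / 2 * (1 - (1/2)^n) \<le> d / 2 * 1" using d h1 by (intro mult_left_mono) auto
      moreover have "norm (grad (fst (f n)) p) \<le> d / 2 + d / 2 * (1 - (1/2)^n)" using f(1)[of n] unfolding P_def by blast
      ultimately show ?thesis using d by linarith
    qed
    show "fst p0 \<in> {0..T}" by (rule fp0)
    show "cl/2 \<le> norm (fst (f n) p0)" for n
    proof -
      have "cl * (1/2 + (1/2)^(n+1)) \<le> norm (fst (f n) p0)" using f(1)[of n] unfolding P_def by blast
      moreover have "cl * (1/2) \<le> cl * (1/2 + (1/2)^(n+1))" using cl by (intro mult_left_mono) auto
      ultimately show ?thesis by simp
    qed
  qed
qed

end

section \<open>Analysis on the torus\<close>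

abbreviation torus_measure :: "(real^2) measure" ("\<mu>") where "\<mu> \<equiv> lebesgue_on torus"

lemma torus_sets [simp]: "torus \<in> sets lebesgue"
  by (simp add: torus_def)

lemma torus_integrable: "continuous_on UNIV f \<Longrightarrow> integrable \<mu> f"
  for f :: "real^2 \<Rightarrow> 'b::euclidean_space"
  unfolding torus_def by (rule continuous_imp_integrable) (rule continuous_on_subset, auto)

lemma torus_integral_HK: "continuous_on UNIV f \<Longrightarrow> integral\<^sup>L \<mu> f = integral torus f"
  for f :: "real^2 \<Rightarrow> 'b::euclidean_space"
  by (intro lebesgue_integral_eq_integral torus_integrable torus_sets)

definition vol :: real where "vol = measure lebesgue torus"

lemma finite_torus: "finite_measure \<mu>"
  by (rule finite_measure_lebesgue_on) (simp add: torus_def)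

lemma vol_nonneg: "vol \<ge> 0" by (simp add: vol_def)

lemma torus_integral_bound:
  fixes f :: "real^2 \<Rightarrow> 'b::euclidean_space"
  assumes "\<And>x. x \<in> torus \<Longrightarrow> norm (f x) \<le> B"
  shows "norm (integral\<^sup>L \<mu> f) \<le> B * vol"
proof -
  interpret finite_measure "\<mu>" by (rule finite_torus)
  have "0 \<in> torus" by (simp add: torus_def mem_box_cart)
  then have B: "B \<ge> 0" using assms norm_ge_zero order_trans by blast
  have m: "measure \<mu> (space \<mu>) = vol"
    by (simp add: vol_def measure_restrict_space)
  have "norm (integral\<^sup>L \<mu> f) \<le> integral\<^sup>L \<mu> (\<lambda>x. B)"
    by (rule order_trans[OF integral_norm_bound integral_mono']) (use assms B in auto)
  then show ?thesis using m by (simp add: mult.commute)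
qed

lemma vec2_cbox: "(\<lambda>x::real^2. (x $ 1, x $ 2)) ` cbox u v = cbox (u $ 1, u $ 2) (v $ 1, v $ 2)"
proof (intro equalityI subsetI)
  fix y :: "real \<times> real" assume y: "y \<in> cbox (u $ 1, u $ 2) (v $ 1, v $ 2)"
  obtain a b where ab: "y = (a, b)" by (cases y)
  have "vector [a, b] \<in> cbox u v" using y by (auto simp: ab mem_box_cart forall_2 cbox_Pair_eq)
  then show "y \<in> (\<lambda>x::real^2. (x $ 1, x $ 2)) ` cbox u v" by (rule rev_image_eqI) (simp add: ab)
qed (auto simp: mem_box_cart cbox_Pair_eq)

lemma pair_cbox: "(\<lambda>p. vector [fst p, snd p] :: real^2) ` cbox (a, b) (c, d) = cbox (vector [a, b]) (vector [c, d])"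
proof (intro equalityI subsetI)
  fix y :: "real^2" assume y: "y \<in> cbox (vector [a, b]) (vector [c, d])"
  have "(y $ 1, y $ 2) \<in> cbox (a, b) (c, d)" using y by (simp add: mem_box_cart forall_2 cbox_Pair_eq)
  then show "y \<in> (\<lambda>p. vector [fst p, snd p] :: real^2) ` cbox (a, b) (c, d)"
    by (rule rev_image_eqI) (simp add: vec_eq_iff forall_2)
qed (auto simp: mem_box_cart forall_2 cbox_Pair_eq)

text \<open>The coordinate map between vectors and pairs preserves the content of boxes, as
  \<open>has_integral_twiddle\<close> asks, and so transports the iterated integrals over a product
  of intervals.\<close>

lemma torus_integral_iterated:
  fixes f :: "real^2 \<Rightarrow> 'b::euclidean_space"
  assumes f: "continuous_on UNIV f"
  shows "integral torus f = integral {-pi..pi} (\<lambda>x. integral {-pi..pi} (\<lambda>y. f (vector [x, y])))"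
    "integral torus f = integral {-pi..pi} (\<lambda>y. integral {-pi..pi} (\<lambda>x. f (vector [x, y])))"
proof -
  have cv: "continuous_on S (\<lambda>p. vector [fst p, snd p] :: real^2)" for S
  proof -
    have "(\<lambda>p. vector [fst p, snd p] :: real^2) = (\<lambda>p. fst p *\<^sub>R axis 1 1 + snd p *\<^sub>R axis 2 1)"
      by (auto simp: vec_eq_iff forall_2 axis_def)
    then show ?thesis by (simp only:) (intro continuous_intros)
  qed
  have cf: "continuous_on S (\<lambda>p. f (vector [fst p, snd p]))" for S
    by (rule continuous_on_compose2[OF f cv]) simp
  have cont: "measure lborel ((\<lambda>x::real^2. (x $ 1, x $ 2)) ` cbox u v) = 1 * measure lborel (cbox u v)" for u v
  proof (cases "cbox u v = {}")
    case False
    then have "u $ 1 \<le> v $ 1" "u $ 2 \<le> v $ 2" by (auto simp: interval_ne_empty_cart)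
    then show ?thesis using False unfolding vec2_cbox by (simp add: content_cbox_cart content_Pair UNIV_2)
  qed simp
  have "((\<lambda>p. f (vector [fst p, snd p])) has_integral integral (cbox (-pi, -pi) (pi, pi)) (\<lambda>p. f (vector [fst p, snd p]))) (cbox (-pi, -pi) (pi, pi))"
    by (intro integrable_integral integrable_continuous cf)
  then have "((\<lambda>x. f (vector [fst (x $ 1, x $ 2), snd (x $ 1, x $ 2)])) has_integral (1 / 1) *\<^sub>R integral (cbox (-pi, -pi) (pi, pi)) (\<lambda>p. f (vector [fst p, snd p])))
    ((\<lambda>p. vector [fst p, snd p] :: real^2) ` cbox (-pi, -pi) (pi, pi))"
  proof (rule has_integral_twiddle[where g = "\<lambda>x::real^2. (x $ 1, x $ 2)", rotated -1])
    show "\<exists>w z. (\<lambda>x::real^2. (x $ 1, x $ 2)) ` cbox u v = cbox w z" for u v using vec2_cbox by blast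
    show "\<exists>w z. (\<lambda>p. vector [fst p, snd p] :: real^2) ` cbox u v = cbox w z" for u v
      using pair_cbox[of "fst u" "snd u" "fst v" "snd v"] by auto
    show "isCont (\<lambda>x::real^2. (x $ 1, x $ 2)) x" for x by (intro continuous_intros)
    show "vector [fst (x $ 1, x $ 2), snd (x $ 1, x $ 2)] = x" for x :: "real^2" by (simp add: vec_eq_iff forall_2)
  qed (use cont in auto)
  then have "((\<lambda>x::real^2. f (vector [x $ 1, x $ 2])) has_integral integral (cbox (-pi, -pi) (pi, pi)) (\<lambda>p. f (vector [fst p, snd p]))) (cbox (vector [-pi, -pi]) (vector [pi, pi]))"
    unfolding pair_cbox by simp
  moreover have "vector [x $ 1, x $ 2] = x" for x :: "real^2" by (simp add: vec_eq_iff forall_2)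
  moreover have "torus = cbox (vector [-pi, -pi]) (vector [pi, pi])"
    by (auto simp: torus_def mem_box_cart forall_2)
  ultimately have i: "integral torus f = integral (cbox (-pi, -pi) (pi, pi)) (\<lambda>p. f (vector [fst p, snd p]))"
    by (simp add: integral_unique)
  show 1: "integral torus f = integral {-pi..pi} (\<lambda>x. integral {-pi..pi} (\<lambda>y. f (vector [x, y])))"
    unfolding i using integral_prod_continuous[OF cf, of "-pi" "-pi" pi pi] by simp
  show "integral torus f = integral {-pi..pi} (\<lambda>y. integral {-pi..pi} (\<lambda>x. f (vector [x, y])))"
    unfolding 1 using integral_swap_continuous[of "-pi" "-pi" pi pi "\<lambda>x y. f (vector [x, y])"] cf by (simp add: case_prod_beta')
qed

text \<open>The fundamental theorem of calculus on each coordinate line, with equal values at the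
  two ends by periodicity.\<close>

lemma torus_integral_pd:
  fixes g :: "real^2 \<Rightarrow> 'b::euclidean_space"
  assumes g: "smooth g" "torus_periodic g"
  shows "integral\<^sup>L \<mu> (pd (axis j 1) g) = 0"
proof -
  have c: "continuous_on UNIV (pd (axis j 1) g)" by (intro smooth_continuous_on smooth_pd g)
  have per: "g (x + (2 * pi) *\<^sub>R axis i 1) = g x" for x i using g(2) by (simp add: torus_periodic_def)
  have line: "integral {-pi..pi} (\<lambda>s. pd (axis j 1) g (x + s *\<^sub>R axis j 1)) = 0" for x
  proof -
    have "((\<lambda>s. pd (axis j 1) g (x + s *\<^sub>R axis j 1)) has_integral
        g (x + pi *\<^sub>R axis j 1) - g (x + (- pi) *\<^sub>R axis j 1)) {-pi..pi}"
      by (intro fundamental_theorem_of_calculus smooth_line_derivative g) auto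
    moreover have "g (x + pi *\<^sub>R axis j 1) = g (x + (- pi) *\<^sub>R axis j 1)"
    proof -
      have "x + (- pi) *\<^sub>R axis j 1 + (2 * pi) *\<^sub>R axis j 1 = x + pi *\<^sub>R axis j 1"
        unfolding add.assoc scaleR_add_left[symmetric] by simp
      from per[of "x + (- pi) *\<^sub>R axis j 1" j, unfolded this] show ?thesis .
    qed
    ultimately show ?thesis by (simp add: integral_unique)
  qed
  have v1: "vector [x, y] = vector [0, y] + x *\<^sub>R (axis 1 1 :: real^2)" "vector [x, y] = vector [x, 0] + y *\<^sub>R (axis 2 1 :: real^2)" for x y :: real
    by (simp_all add: vec_eq_iff forall_2 axis_def)
  show ?thesis
  proof (cases "j = 1")
    case True
    then show ?thesis unfolding torus_integral_HK[OF c] torus_integral_iterated(2)[OF c]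
      using line[of "vector [0, _]"] by (subst v1(1)) simp
  next
    case False
    then have "j = 2" using exhaust_2 by blast
    then show ?thesis unfolding torus_integral_HK[OF c] torus_integral_iterated(1)[OF c]
      using line[of "vector [_, 0]"] by (subst v1(2)) simp
  qed
qed

text \<open>Since \<open>sin ((x - a) / 2) sin ((b - x) / 2)\<close> is positive exactly on the periodic copies of \<open>(a, b)\<close>,
  \<open>win n\<close> increases to the indicator of that interval through periodic smooth functions.\<close>
definition win0 :: "real \<Rightarrow> real \<Rightarrow> real \<Rightarrow> real" where
  "win0 a b x = flat_exp 0 (sin ((x - a) / 2) * sin ((b - x) / 2))"

definition win :: "nat \<Rightarrow> real \<Rightarrow> real \<Rightarrow> real \<Rightarrow> real" where
  "win n a b x = win0 a b x / (win0 a b x + inverse (real (Suc n)))"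

lemma win0_nonneg: "win0 a b x \<ge> 0"
  by (simp add: win0_def flat_exp_def)

text \<open>A shift by \<open>2 * pi\<close> changes the sign of both sines, hence not their
  product.\<close>

lemma win_periodic: "win n a b (x + 2 * pi) = win n a b x"
proof -
  have "(x + 2 * pi - a) / 2 = (x - a) / 2 + pi" "(b - (x + 2 * pi)) / 2 = (b - x) / 2 - pi" by (simp_all add: add_divide_distrib diff_divide_distrib)
  then have "sin ((x + 2 * pi - a) / 2) = - sin ((x - a) / 2)" "sin ((b - (x + 2 * pi)) / 2) = - sin ((b - x) / 2)"
    by (simp_all only: sin_periodic_pi sin_minus_pi)
  then show ?thesis by (simp add: win_def win0_def)
qed

lemma smooth_win: "smooth f \<Longrightarrow> smooth (\<lambda>x. win n a b (f x))"
proof -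
  assume f: "smooth f"
  have p: "smooth (\<lambda>x. sin ((f x - a) / 2) * sin ((b - f x) / 2))"
    unfolding divide_inverse by (intro smooth_intros smooth_const f)
  have w: "smooth (\<lambda>x. win0 a b (f x))"
    unfolding win0_def by (rule smooth_compose[OF smooth_flat_exp p])
  have "win0 a b (f x) + inverse (real (Suc n)) \<noteq> 0" for x
    using win0_nonneg[of a b "f x"] by (smt (verit) inverse_positive_iff_positive of_nat_0_less_iff zero_less_Suc)
  then show ?thesis unfolding win_def by (intro smooth_divide smooth_add w smooth_const)
qed

lemma win_bounds: "0 \<le> win n a b x" "win n a b x \<le> 1"
proof -
  have 1: "win0 a b x \<ge> 0" by (rule win0_nonneg)
  have "win0 a b x + inverse (real (Suc n)) > 0" by (rule add_nonneg_pos[OF 1]) simp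
  then show "0 \<le> win n a b x" "win n a b x \<le> 1" unfolding win_def using 1 by (auto simp: divide_le_eq)
qed

text \<open>For points of the fundamental interval the halved differences lie in
  \<open>[-pi, pi]\<close>, where the sine has the sign of its argument.\<close>

lemma win0_pos_iff:
  assumes "x \<in> {-pi..pi}" "a \<in> {-pi..pi}" "b \<in> {-pi..pi}" "a < b"
  shows "win0 a b x > 0 \<longleftrightarrow> a < x \<and> x < b"
proof -
  have "win0 a b x > 0 \<longleftrightarrow> sin ((x - a) / 2) * sin ((b - x) / 2) > 0"
    by (simp add: win0_def flat_exp_def)
  also have "\<dots> \<longleftrightarrow> a < x \<and> x < b"
  proof (cases "a < x \<and> x < b")
    case True
    then have "sin ((x - a) / 2) > 0" "sin ((b - x) / 2) > 0" using assms by (auto intro!: sin_gt_zero)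
    then show ?thesis using True by simp
  next
    case False
    then consider "x \<le> a" | "x \<ge> b" by linarith
    then have "sin ((x - a) / 2) * sin ((b - x) / 2) \<le> 0"
    proof cases
      case 1
      then have "sin ((a - x) / 2) \<ge> 0" "sin ((b - x) / 2) \<ge> 0" using assms by (auto intro!: sin_ge_zero)
      moreover have "sin ((x - a) / 2) = - sin ((a - x) / 2)" by (simp flip: sin_minus add: minus_divide_left)
      ultimately show ?thesis by (simp add: mult_nonneg_nonneg)
    next
      case 2
      then have "sin ((x - a) / 2) \<ge> 0" "sin ((x - b) / 2) \<ge> 0" using assms by (auto intro!: sin_ge_zero)
      moreover have "sin ((b - x) / 2) = - sin ((x - b) / 2)" by (simp flip: sin_minus add: minus_divide_left)
      ultimately show ?thesis by (simp add: mult_nonneg_nonneg)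
    qed
    then show ?thesis using False by auto
  qed
  finally show ?thesis .
qed

lemma win_tendsto:
  assumes "x \<in> {-pi..pi}" "a \<in> {-pi..pi}" "b \<in> {-pi..pi}" "a < b"
  shows "(\<lambda>n. win n a b x) \<longlonglongrightarrow> indicator {a<..<b} x"
proof (cases "a < x \<and> x < b")
  case True
  then have p: "win0 a b x > 0" using win0_pos_iff[OF assms] by simp
  have "(\<lambda>n. win0 a b x / (win0 a b x + inverse (real (Suc n)))) \<longlonglongrightarrow> win0 a b x / (win0 a b x + 0)"
    by (intro tendsto_intros LIMSEQ_inverse_real_of_nat) (use p in simp)
  then show ?thesis using True p unfolding win_def by simp
next
  case False
  then have "win0 a b x = 0" using win0_pos_iff[OF assms] win0_nonneg[of a b x] by linarith
  then show ?thesis using False by (simp add: win_def)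
qed

lemma AE_torus_interior: "AE x in \<mu>. \<forall>i. x $ i \<in> {-pi<..<pi}"
proof -
  have n: "cbox (\<chi> i. -pi) (\<chi> i. pi) - box (\<chi> i. -pi) (\<chi> i. pi :: real^2) \<in> null_sets lebesgue"
    using negligible_frontier_interval negligible_iff_null_sets by blast
  have "AE x in lebesgue. x \<in> torus \<longrightarrow> (\<forall>i. x $ i \<in> {-pi<..<pi})"
    by (rule AE_I'[OF n]) (auto simp: torus_def mem_box_cart)
  then show ?thesis by (subst AE_restrict_space_iff) simp_all
qed

lemma orthogonal_box:
  fixes h :: "real^2 \<Rightarrow> real"
  assumes h: "integrable \<mu> h"
    and o: "\<And>phi. smooth phi \<Longrightarrow> torus_periodic phi \<Longrightarrow> (\<integral>x. h x * phi x \<partial>\<mu>) = 0"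
  shows "(\<integral>x. h x * indicator (box l u) x \<partial>\<mu>) = 0"
proof -
  have hm: "h \<in> borel_measurable \<mu>" using h by auto
  have "(indicator (box l u) :: real^2 \<Rightarrow> real) \<in> borel_measurable lebesgue" by (intro borel_measurable_indicator) simp
  then have im: "(\<lambda>x. indicator (box l u) x :: real) \<in> borel_measurable \<mu>"
    by (rule measurable_restrict_space1)
  \<comment> \<open>The box is clipped to the fundamental cell, in which \<open>win\<close>
    converges to indicators. If nothing is left, the indicator of the box vanishes in the interior
    of the cell.\<close>
  define a :: "real^2" where "a = (\<chi> i. max (l $ i) (-pi))"
  define b :: "real^2" where "b = (\<chi> i. min (u $ i) pi)"
  show ?thesis
  proof (cases "\<forall>i. a $ i < b $ i")
    case False
    then obtain i where "a $ i \<ge> b $ i" by (auto simp: not_less)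
    then have "max (l $ i) (-pi) \<ge> min (u $ i) pi" by (simp add: a_def b_def)
    then have "indicator (box l u) x = (0::real)" if "\<forall>i. x $ i \<in> {-pi<..<pi}" for x
      using that[rule_format, of i] by (auto simp: indicator_def mem_box_cart intro!: exI[of _ i])
    then have "(\<integral>x. h x * indicator (box l u) x \<partial>\<mu>) = (\<integral>x. 0 \<partial>\<mu>)"
      using AE_torus_interior by (intro integral_cong_AE borel_measurable_times hm im) auto
    then show ?thesis by simp
  next
    case True
    define phi where "phi n x = win n (a $ 1) (b $ 1) (x $ 1) * win n (a $ 2) (b $ 2) (x $ 2)" for n and x :: "real^2"
    have sm: "smooth (phi n)" for n unfolding phi_def[abs_def] by (intro smooth_mult smooth_win smooth_intros)
    have per: "torus_periodic (phi n)" for n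
      unfolding torus_periodic_def
    proof (intro allI)
      fix x :: "real^2" and i :: 2
      have "(x + (2 * pi) *\<^sub>R axis i 1) $ j = (if j = i then x $ j + 2 * pi else x $ j)" for j by (simp add: axis_def)
      then show "phi n (x + (2 * pi) *\<^sub>R axis i 1) = phi n x" by (simp add: phi_def win_periodic)
    qed
    have ab: "a $ i \<in> {-pi..pi}" "b $ i \<in> {-pi..pi}" "a $ i < b $ i" for i
    proof -
      show 1: "a $ i < b $ i" using True by blast
      have "a $ i \<ge> -pi" "b $ i \<le> pi" by (simp_all add: a_def b_def)
      then show "a $ i \<in> {-pi..pi}" "b $ i \<in> {-pi..pi}" using 1 by auto
    qed
    have lim: "(\<lambda>n. phi n x) \<longlonglongrightarrow> indicator (box l u) x" if x: "\<forall>i. x $ i \<in> {-pi<..<pi}" for x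
    proof -
      have xx: "x $ i \<in> {-pi..pi}" for i using x by (simp add: less_imp_le)
      have "(\<lambda>n. phi n x) \<longlonglongrightarrow> indicator {a$1<..<b$1} (x$1) * indicator {a$2<..<b$2} (x$2)"
        unfolding phi_def by (intro tendsto_mult win_tendsto xx ab)
      also have "indicator {a$1<..<b$1} (x$1) * indicator {a$2<..<b$2} (x$2) = (indicator (box l u) x :: real)"
        using x by (auto simp: indicator_def mem_box_cart forall_2 a_def b_def)
      finally show ?thesis .
    qed
    have meas: "phi n \<in> borel_measurable \<mu>" for n
      by (intro continuous_imp_measurable_on_sets_lebesgue smooth_continuous_on sm torus_sets)
    have "(\<lambda>n. \<integral>x. h x * phi n x \<partial>\<mu>) \<longlonglongrightarrow> (\<integral>x. h x * indicator (box l u) x \<partial>\<mu>)"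
    proof (rule integral_dominated_convergence[where w = "\<lambda>x. norm (h x)"])
      show "AE x in \<mu>. (\<lambda>n. h x * phi n x) \<longlonglongrightarrow> h x * indicator (box l u) x"
        using AE_torus_interior by (rule eventually_mono) (intro tendsto_mult tendsto_const lim)
      show "AE x in \<mu>. norm (h x * phi n x) \<le> norm (h x)" for n
      proof (intro AE_I2)
        fix x
        have "\<bar>phi n x\<bar> \<le> 1 * 1" unfolding phi_def abs_mult using win_bounds by (intro mult_mono) auto
        then show "norm (h x * phi n x) \<le> norm (h x)" by (simp add: abs_mult mult_left_le)
      qed
    qed (use h hm meas im in \<open>auto intro!: borel_measurable_times\<close>)
    then show ?thesis using o[OF sm per] by (simp add: LIMSEQ_const_iff)
  qed
qed

text \<open>The set function that integrates \<open>h\<close> over a subset of the torus vanishes on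
  boxes by \<open>orthogonal_box\<close>. Boxes are stable under intersection and generate the Borel
  sets, so it vanishes on these; completion extends this to all measurable subsets, and a density is
  determined almost everywhere.\<close>

lemma orthogonal_AE_zero:
  fixes h :: "real^2 \<Rightarrow> real"
  assumes h: "integrable \<mu> h"
    and o: "\<And>phi. smooth phi \<Longrightarrow> torus_periodic phi \<Longrightarrow> (\<integral>x. h x * phi x \<partial>\<mu>) = 0"
  shows "AE x in \<mu>. h x = 0"
proof -
  have one: "(\<integral>x. h x \<partial>\<mu>) = 0"
    using o[of "\<lambda>x. 1"] smooth_const by (simp add: torus_periodic_def)
  define M where "M = \<mu>"
  have sp: "space M = torus" by (simp add: M_def)
  have sM: "A \<inter> torus \<in> sets M" if "A \<in> sets lebesgue" for A
    using that by (auto simp: M_def sets_restrict_space)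
  have iM: "set_integrable M A h" if "A \<in> sets M" for A
    using h that unfolding set_integrable_def M_def by (rule integrable_mult_indicator[rotated])
  have Is: "Int_stable (range (\<lambda>(a, b). box a b :: (real^2) set))"
  proof (rule Int_stableI)
    fix A B assume "A \<in> range (\<lambda>(a, b). box a b :: (real^2) set)" "B \<in> range (\<lambda>(a, b). box a b :: (real^2) set)"
    then obtain a b c d where "A = box a b" "B = box c d" by auto
    then have "A \<inter> B = (\<lambda>(a, b). box a b) (\<Sum>i\<in>Basis. max (a \<bullet> i) (c \<bullet> i) *\<^sub>R i, \<Sum>i\<in>Basis. min (b \<bullet> i) (d \<bullet> i) *\<^sub>R i)"
      by (simp add: box_Int_box)
    then show "A \<inter> B \<in> range (\<lambda>(a, b). box a b :: (real^2) set)" by (rule range_eqI)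
  qed
  have zero: "(LINT x:A \<inter> torus|M. h x) = 0" if "A \<in> sets borel" for A
  proof -
    have A: "A \<in> sigma_sets UNIV (range (\<lambda>(a, b). box a b :: (real^2) set))"
      using that unfolding borel_eq_box by simp
    have leb: "B \<in> sets lebesgue" if "B \<in> sigma_sets UNIV (range (\<lambda>(a, b). box a b :: (real^2) set))" for B
    proof -
      have "B \<in> sets borel" using that unfolding borel_eq_box by simp
      then show ?thesis by simp
    qed
    show ?thesis
    proof (rule sigma_sets_induct_disjoint[OF Is _ A])
      fix B assume "B \<in> range (\<lambda>(a, b). box a b :: (real^2) set)"
      then obtain l u where B: "B = box l u" by auto
      have "(LINT x:B \<inter> torus|M. h x) = (\<integral>x. h x * indicator (box l u) x \<partial>M)"
        unfolding set_lebesgue_integral_def B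
        by (rule Bochner_Integration.integral_cong) (auto simp: sp indicator_def)
      then show "(LINT x:B \<inter> torus|M. h x) = 0" using orthogonal_box[OF h o] by (simp add: M_def)
    next
      fix B assume B: "B \<in> sigma_sets UNIV (range (\<lambda>(a, b). box a b :: (real^2) set))" "(LINT x:B \<inter> torus|M. h x) = 0"
      have iB: "integrable M (\<lambda>x. indicator (B \<inter> torus) x *\<^sub>R h x)"
        using iM[OF sM[OF leb[OF B(1)]]] by (simp add: set_integrable_def)
      have "(LINT x:(UNIV - B) \<inter> torus|M. h x) = (\<integral>x. h x - indicator (B \<inter> torus) x *\<^sub>R h x \<partial>M)"
        unfolding set_lebesgue_integral_def
        by (rule Bochner_Integration.integral_cong) (auto simp: sp indicator_def)
      also have "\<dots> = (\<integral>x. h x \<partial>M) - (\<integral>x. indicator (B \<inter> torus) x *\<^sub>R h x \<partial>M)"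
        using h iB by (intro Bochner_Integration.integral_diff) (simp_all add: M_def)
      finally show "(LINT x:(UNIV - B) \<inter> torus|M. h x) = 0"
        using B(2) one unfolding set_lebesgue_integral_def M_def by simp
    next
      fix B :: "nat \<Rightarrow> (real^2) set"
      assume B: "disjoint_family B" "range B \<subseteq> sigma_sets UNIV (range (\<lambda>(a, b). box a b :: (real^2) set))"
        "\<And>i. (LINT x:B i \<inter> torus|M. h x) = 0"
      have m: "B i \<inter> torus \<in> sets M" for i using B(2) by (intro sM leb) auto
      have "(LINT x:(\<Union>i. B i \<inter> torus)|M. h x) = (\<Sum>i. (LINT x:(B i \<inter> torus)|M. h x))"
      proof (rule lebesgue_integral_countable_add[OF m])
        show "B i \<inter> torus \<inter> (B j \<inter> torus) = {}" if "i \<noteq> j" for i j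
          using B(1) that by (auto simp: disjoint_family_on_def)
        show "set_integrable M (\<Union>i. B i \<inter> torus) h" by (intro iM sets.countable_UN) (use m in auto)
      qed
      then have "(LINT x:(\<Union>i. B i \<inter> torus)|M. h x) = 0" by (simp only: B(3) suminf_zero)
      moreover have "(\<Union>i. B i) \<inter> torus = (\<Union>i. B i \<inter> torus)" by blast
      ultimately show "(LINT x:(\<Union>i. B i) \<inter> torus|M. h x) = 0" by (simp only:)
    qed (auto simp: set_lebesgue_integral_def)
  qed
  have "AE x in M. h x = 0"
  proof (rule density_unique_real)
    show "integrable M h" "integrable M (\<lambda>x. 0 :: real)" using h by (simp_all add: M_def)
    fix A assume A: "A \<in> sets M"
    then obtain A' where A': "A = torus \<inter> A'" "A' \<in> sets lebesgue" by (auto simp: M_def sets_restrict_space)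
    from A'(2) obtain S N N' where S: "A' = S \<union> N" "N \<subseteq> N'" "N' \<in> null_sets lborel" "S \<in> sets lborel"
      by (rule sets_completionE)
    have "AE x in lebesgue. x \<notin> N'" using S(3) by (intro AE_completion AE_not_in)
    then have ae: "AE x in M. x \<notin> N'" unfolding M_def by (subst AE_restrict_space_iff) auto
    have "(LINT x:A|M. h x) = (LINT x:S \<inter> torus|M. h x)"
    proof (rule set_integral_cong_set)
      show "AE x in M. (x \<in> S \<inter> torus) = (x \<in> A)" using ae by (rule eventually_mono) (use S A' in auto)
      have S': "S \<inter> torus \<in> sets M" using S(4) by (intro sM) simp
      show "set_borel_measurable M (S \<inter> torus) h" "set_borel_measurable M A h"
        using iM[OF S'] iM[OF A] unfolding set_integrable_def set_borel_measurable_def by auto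
    qed
    then show "(LINT x:A|M. h x) = (LINT x:A|M. 0)" using zero S(4) by (simp add: set_lebesgue_integral_def)
  qed
  then show ?thesis unfolding M_def .
qed

section \<open>Square-integrable functions on the torus\<close>

lemma L2_torusD:
  assumes "w \<in> L2_torus"
  shows "torus_periodic w" "w \<in> borel_measurable \<mu>" "integrable \<mu> (\<lambda>x. (norm (w x))\<^sup>2)"
  using assms by (simp_all add: L2_torus_def L2_on_def)

lemma L2_torus_integrable:
  assumes w: "w \<in> L2_torus" shows "integrable \<mu> w"
proof -
  interpret finite_measure "\<mu>" by (rule finite_torus)
  have i: "integrable \<mu> (\<lambda>x. 1 + (norm (w x))\<^sup>2)"
    using L2_torusD(3)[OF w] by simp
  have "norm (w x) \<le> norm (1 + (norm (w x))\<^sup>2)" for x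
  proof -
    have "2 * norm (w x) \<le> (norm (w x))\<^sup>2 + 1" using sum_squares_bound[of "norm (w x)" 1] by simp
    then have "norm (w x) \<le> 1 + (norm (w x))\<^sup>2" using norm_ge_zero[of "w x"] by linarith
    then show ?thesis by simp
  qed
  then show ?thesis
    by (intro Bochner_Integration.integrable_bound[OF i L2_torusD(2)[OF w]] AE_I2)
qed

lemma torus_continuous_bounded:
  fixes g :: "real^2 \<Rightarrow> 'b::real_normed_vector"
  assumes "continuous_on UNIV g"
  obtains B where "B > 0" "\<And>x. x \<in> torus \<Longrightarrow> norm (g x) \<le> B"
proof -
  have "compact (g ` torus)"
    by (intro compact_continuous_image continuous_on_subset[OF assms]) (auto simp: torus_def)
  then obtain B where "\<And>y. y \<in> g ` torus \<Longrightarrow> norm y \<le> B" using compact_imp_bounded bounded_iff by metis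
  then show ?thesis using that[of "max B 1"] by (auto simp: le_max_iff_disj)
qed

lemma integrable_inner_continuous:
  fixes f g :: "real^2 \<Rightarrow> 'b::euclidean_space"
  assumes f: "integrable \<mu> f" and g: "continuous_on UNIV g"
  shows "integrable \<mu> (\<lambda>x. f x \<bullet> g x)"
proof -
  obtain B where B: "B > 0" "\<And>x. x \<in> torus \<Longrightarrow> norm (g x) \<le> B" using torus_continuous_bounded[OF g] by blast
  have gm: "g \<in> borel_measurable \<mu>"
    by (intro continuous_imp_measurable_on_sets_lebesgue continuous_on_subset[OF g] torus_sets) auto
  have fm: "f \<in> borel_measurable \<mu>" using f by simp
  show ?thesis
  proof (rule Bochner_Integration.integrable_bound[of _ "\<lambda>x. B *\<^sub>R f x"])
    show "integrable \<mu> (\<lambda>x. B *\<^sub>R f x)" using f by simp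
    show "(\<lambda>x. f x \<bullet> g x) \<in> borel_measurable \<mu>" using fm gm by simp
    show "AE x in \<mu>. norm (f x \<bullet> g x) \<le> norm (B *\<^sub>R f x)"
    proof (rule AE_I2)
      fix x assume "x \<in> space \<mu>"
      then have "norm (g x) \<le> B" using B by simp
      then have "norm (f x) * norm (g x) \<le> norm (f x) * B" by (rule mult_left_mono) simp
      then show "norm (f x \<bullet> g x) \<le> norm (B *\<^sub>R f x)"
        using Cauchy_Schwarz_ineq2[of "f x" "g x"] B(1) by (simp add: mult.commute)
    qed
  qed
qed

lemma continuous_L2_torus:
  assumes c: "continuous_on UNIV f" and p: "torus_periodic f"
  shows "f \<in> L2_torus"
proof -
  have "f \<in> borel_measurable \<mu>"
    by (intro continuous_imp_measurable_on_sets_lebesgue continuous_on_subset[OF c] torus_sets) simp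
  moreover have "integrable \<mu> (\<lambda>x. (norm (f x))\<^sup>2)"
    by (intro torus_integrable continuous_on_power continuous_on_norm c)
  ultimately show ?thesis using p by (simp add: L2_torus_def L2_on_def)
qed

lemma L2_torus_combination:
  assumes f: "f \<in> L2_torus" and g: "g \<in> L2_torus"
  shows "(\<lambda>x. r *\<^sub>R f x + s *\<^sub>R g x) \<in> L2_torus"
proof -
  have p: "torus_periodic (\<lambda>x. r *\<^sub>R f x + s *\<^sub>R g x)"
    using L2_torusD(1)[OF f] L2_torusD(1)[OF g] by (simp add: torus_periodic_def)
  have m: "(\<lambda>x. r *\<^sub>R f x + s *\<^sub>R g x) \<in> borel_measurable \<mu>"
    using L2_torusD(2)[OF f] L2_torusD(2)[OF g] by simp
  have i: "integrable \<mu> (\<lambda>x. 2 * r\<^sup>2 * (norm (f x))\<^sup>2 + 2 * s\<^sup>2 * (norm (g x))\<^sup>2)"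
    using L2_torusD(3)[OF f] L2_torusD(3)[OF g] by simp
  have "norm ((norm (r *\<^sub>R f x + s *\<^sub>R g x))\<^sup>2) \<le> norm (2 * r\<^sup>2 * (norm (f x))\<^sup>2 + 2 * s\<^sup>2 * (norm (g x))\<^sup>2)" for x
  proof -
    have "(norm (r *\<^sub>R f x + s *\<^sub>R g x))\<^sup>2 \<le> (norm (r *\<^sub>R f x) + norm (s *\<^sub>R g x))\<^sup>2"
      by (intro power_mono norm_triangle_ineq) simp
    also have "\<dots> \<le> 2 * (norm (r *\<^sub>R f x))\<^sup>2 + 2 * (norm (s *\<^sub>R g x))\<^sup>2"
      using sum_squares_bound[of "norm (r *\<^sub>R f x)" "norm (s *\<^sub>R g x)"] by (simp add: power2_sum)
    finally show ?thesis by (simp add: power_mult_distrib)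
  qed
  then have "integrable \<mu> (\<lambda>x. (norm (r *\<^sub>R f x + s *\<^sub>R g x))\<^sup>2)"
    using m by (intro Bochner_Integration.integrable_bound[OF i] AE_I2) auto
  then show ?thesis using p m by (simp add: L2_torus_def L2_on_def)
qed

definition K1 :: real where "K1 = (vol + 1) / 2"

lemma K1_pos: "K1 > 0" using vol_nonneg by (simp add: K1_def)

lemma L2_norm_nonneg: "L2_norm f \<ge> 0"
  by (simp add: L2_norm_def)

text \<open>Young's inequality with weight \<open>l\<close>, at \<open>l = N\<close>, which yields
  the constant \<open>K1 = (vol + 1) / 2\<close>. For \<open>N = 0\<close> the weight is sent to 0
  instead.\<close>

lemma L1_le_L2:
  assumes g: "g \<in> L2_torus"
  shows "(\<integral>x. norm (g x) \<partial>\<mu>) \<le> K1 * L2_norm g"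
proof -
  interpret finite_measure "\<mu>" by (rule finite_torus)
  define N where "N = L2_norm g"
  have N: "N \<ge> 0" "N\<^sup>2 = (\<integral>x. (norm (g x))\<^sup>2 \<partial>\<mu>)" by (simp_all add: N_def L2_norm_def)
  have m: "measure \<mu> (space \<mu>) = vol"
    by (simp add: vol_def measure_restrict_space)
  have le: "(\<integral>x. norm (g x) \<partial>\<mu>) \<le> l * vol / 2 + N\<^sup>2 / (2 * l)" if l: "l > 0" for l
  proof -
    have "(\<integral>x. norm (g x) \<partial>\<mu>) \<le> (\<integral>x. l / 2 + (norm (g x))\<^sup>2 / (2 * l) \<partial>\<mu>)"
    proof (rule integral_mono)
      show "integrable \<mu> (\<lambda>x. norm (g x))" using L2_torus_integrable[OF g] by simp
      show "integrable \<mu> (\<lambda>x. l / 2 + (norm (g x))\<^sup>2 / (2 * l))" using L2_torusD(3)[OF g] by simp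
      show "norm (g x) \<le> l / 2 + (norm (g x))\<^sup>2 / (2 * l)" for x
        using sum_squares_bound[of "norm (g x)" l] l by (simp add: field_simps power2_eq_square)
    qed
    also have "\<dots> = l * vol / 2 + N\<^sup>2 / (2 * l)"
      using L2_torusD(3)[OF g] m by (simp add: N(2) mult.commute)
    finally show ?thesis .
  qed
  show ?thesis
  proof (cases "N = 0")
    case True
    have "(\<integral>x. norm (g x) \<partial>\<mu>) \<le> 0 + e" if "e > 0" for e
    proof -
      have v: "vol + 1 > 0" using vol_nonneg by simp
      have "(\<integral>x. norm (g x) \<partial>\<mu>) \<le> 2 * e / (vol + 1) * vol / 2 + N\<^sup>2 / (2 * (2 * e / (vol + 1)))"
        using that v by (intro le) simp
      also have "\<dots> = e * vol / (vol + 1)" using True v by (simp add: divide_simps)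
      also have "\<dots> \<le> e" using v that by (simp add: divide_le_eq)
      finally show ?thesis by simp
    qed
    then have "(\<integral>x. norm (g x) \<partial>\<mu>) \<le> 0" by (rule field_le_epsilon)
    then show ?thesis using True by (simp add: N_def)
  next
    case False
    then have "(\<integral>x. norm (g x) \<partial>\<mu>) \<le> N * vol / 2 + N\<^sup>2 / (2 * N)" using N by (intro le) simp
    also have "\<dots> = K1 * N" using False by (simp add: K1_def field_simps power2_eq_square)
    finally show ?thesis by (simp add: N_def)
  qed
qed

lemma L2_norm_cong:
  assumes "f \<in> borel_measurable \<mu>" "g \<in> borel_measurable \<mu>" "AE x in \<mu>. f x = g x"
  shows "L2_norm f = L2_norm g"
  unfolding L2_norm_def using assms by (intro arg_cong[where f = sqrt] integral_cong_AE) auto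

lemma L2_norm_bound:
  assumes "\<And>x. x \<in> torus \<Longrightarrow> norm (f x) \<le> B" shows "L2_norm f \<le> B * sqrt vol"
proof -
  have "0 \<in> torus" by (simp add: torus_def mem_box_cart)
  then have B: "B \<ge> 0" using assms norm_ge_zero order_trans by blast
  have "norm (\<integral>x. (norm (f x))\<^sup>2 \<partial>\<mu>) \<le> B\<^sup>2 * vol"
    using assms by (intro torus_integral_bound) (simp add: power_mono)
  then have "(\<integral>x. (norm (f x))\<^sup>2 \<partial>\<mu>) \<le> B\<^sup>2 * vol" by simp
  then have "L2_norm f \<le> sqrt (B\<^sup>2 * vol)" unfolding L2_norm_def by (rule real_sqrt_le_mono)
  then show ?thesis using B by (simp add: real_sqrt_mult)
qed

section \<open>Weak gradients\<close>

lemma weak_gradientD: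
  assumes "has_weak_gradient w G"
  shows "w \<in> L2_torus" "G \<in> L2_torus"
    "\<And>phi i j. smooth phi \<Longrightarrow> torus_periodic phi \<Longrightarrow> (\<integral>x. w x $ i * pd (axis j 1) phi x \<partial>\<mu>)
       = - (\<integral>x. G x $ i $ j * phi x \<partial>\<mu>)"
  using assms unfolding has_weak_gradient_def pd_def by auto

lemma integrable_component:
  assumes f: "integrable \<mu> f" and c: "continuous_on UNIV phi"
  shows "integrable \<mu> (\<lambda>x. (f x :: real^2) $ i * phi x)"
    and "integrable \<mu> h \<Longrightarrow> integrable \<mu> (\<lambda>x. (h x :: mat2) $ i $ j * phi x)"
proof -
  have "integrable \<mu> (\<lambda>x. f x $ i)"
    by (rule integrable_bounded_linear[OF bounded_linear_vec_nth f])
  from integrable_inner_continuous[OF this c] show "integrable \<mu> (\<lambda>x. (f x :: real^2) $ i * phi x)"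
    by simp
  assume h: "integrable \<mu> h"
  have "integrable \<mu> (\<lambda>x. h x $ i $ j)"
    by (rule integrable_bounded_linear[OF bounded_linear_vec_nth integrable_bounded_linear[OF bounded_linear_vec_nth h]])
  from integrable_inner_continuous[OF this c] show "integrable \<mu> (\<lambda>x. h x $ i $ j * phi x)"
    by simp
qed

text \<open>The entries of the difference are orthogonal to every smooth periodic function. This
  makes the choice in \<open>weak_gradient\<close> harmless for norms and integrals.\<close>

lemma weak_gradient_unique:
  assumes "has_weak_gradient w G" "has_weak_gradient w H"
  shows "AE x in \<mu>. G x = H x"
proof -
  note G = weak_gradientD[OF assms(1)] and H = weak_gradientD[OF assms(2)]
  note iG = L2_torus_integrable[OF G(2)] and iH = L2_torus_integrable[OF H(2)] and iw = L2_torus_integrable[OF G(1)]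
  have "AE x in \<mu>. G x $ i $ j - H x $ i $ j = 0" for i j
  proof (rule orthogonal_AE_zero)
    show "integrable \<mu> (\<lambda>x. G x $ i $ j - H x $ i $ j)"
      using integrable_component(2)[OF iw continuous_on_const iG, of i j 1] integrable_component(2)[OF iw continuous_on_const iH, of i j 1] by simp
    fix phi :: "real^2 \<Rightarrow> real" assume p: "smooth phi" "torus_periodic phi"
    have c: "continuous_on UNIV phi" by (rule smooth_continuous_on[OF p(1)])
    have "(\<integral>x. (G x $ i $ j - H x $ i $ j) * phi x \<partial>\<mu>) =
      (\<integral>x. G x $ i $ j * phi x \<partial>\<mu>) - (\<integral>x. H x $ i $ j * phi x \<partial>\<mu>)"
      unfolding left_diff_distrib by (intro Bochner_Integration.integral_diff integrable_component(2)[OF iw c] iG iH)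
    also have "\<dots> = 0" using G(3)[OF p, of i j] H(3)[OF p, of i j] by simp
    finally show "(\<integral>x. (G x $ i $ j - H x $ i $ j) * phi x \<partial>\<mu>) = 0" .
  qed
  then have "AE x in \<mu>. \<forall>i\<in>UNIV. \<forall>j\<in>UNIV. G x $ i $ j - H x $ i $ j = 0"
    by (intro AE_finite_allI) auto
  then show ?thesis by (rule eventually_mono) (simp add: vec_eq_iff)
qed

lemma weak_gradient_works: "w \<in> H1 \<Longrightarrow> has_weak_gradient w (weak_gradient w)"
  unfolding H1_def weak_gradient_def mem_Collect_eq by (rule someI_ex[where P = "has_weak_gradient w"])

lemma weak_gradient_AE: "has_weak_gradient w G \<Longrightarrow> AE x in \<mu>. weak_gradient w x = G x"
  using weak_gradient_unique weak_gradient_works unfolding H1_def by blast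

lemma L2_norm_weak_gradient: assumes "has_weak_gradient w G" shows "L2_norm (weak_gradient w) = L2_norm G"
proof (rule L2_norm_cong)
  have "has_weak_gradient w (weak_gradient w)" using assms by (intro weak_gradient_works) (auto simp: H1_def)
  then show "weak_gradient w \<in> borel_measurable \<mu>" by (intro L2_torusD(2) weak_gradientD(2))
  show "G \<in> borel_measurable \<mu>" using assms by (intro L2_torusD(2) weak_gradientD(2))
qed (rule weak_gradient_AE[OF assms])

lemma weak_gradient_combination:
  assumes "has_weak_gradient w G" "has_weak_gradient z H"
  shows "has_weak_gradient (\<lambda>x. r *\<^sub>R w x + s *\<^sub>R z x) (\<lambda>x. r *\<^sub>R G x + s *\<^sub>R H x)"
  unfolding has_weak_gradient_def
proof (intro conjI allI impI L2_torus_combination)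
  note G = weak_gradientD[OF assms(1)] and H = weak_gradientD[OF assms(2)]
  show "w \<in> L2_torus" "z \<in> L2_torus" "G \<in> L2_torus" "H \<in> L2_torus" by (fact G H)+
  fix phi :: "real^2 \<Rightarrow> real" and i j :: 2 assume "smooth phi \<and> torus_periodic phi"
  then have p: "smooth phi" "torus_periodic phi" by auto
  note int = L2_torus_integrable[OF G(1)] L2_torus_integrable[OF H(1)] L2_torus_integrable[OF G(2)] L2_torus_integrable[OF H(2)]
  have c: "continuous_on UNIV phi" "continuous_on UNIV (pd (axis j 1) phi)" by (intro smooth_continuous_on smooth_pd p)+
  note I = integrable_component(1)[OF int(1) c(2), of i] integrable_component(1)[OF int(2) c(2), of i]
    integrable_component(2)[OF int(1) c(1) int(3), of i j] integrable_component(2)[OF int(1) c(1) int(4), of i j]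
  have "(\<integral>x. (r *\<^sub>R w x + s *\<^sub>R z x) $ i * pd (axis j 1) phi x \<partial>\<mu>) =
    (\<integral>x. r * (w x $ i * pd (axis j 1) phi x) + s * (z x $ i * pd (axis j 1) phi x) \<partial>\<mu>)"
    by (simp add: algebra_simps)
  also have "\<dots> = r * (\<integral>x. w x $ i * pd (axis j 1) phi x \<partial>\<mu>) + s * (\<integral>x. z x $ i * pd (axis j 1) phi x \<partial>\<mu>)"
    using I by simp
  also have "\<dots> = - (r * (\<integral>x. G x $ i $ j * phi x \<partial>\<mu>) + s * (\<integral>x. H x $ i $ j * phi x \<partial>\<mu>))"
    unfolding G(3)[OF p] H(3)[OF p] by simp
  also have "r * (\<integral>x. G x $ i $ j * phi x \<partial>\<mu>) + s * (\<integral>x. H x $ i $ j * phi x \<partial>\<mu>)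
    = (\<integral>x. r * (G x $ i $ j * phi x) + s * (H x $ i $ j * phi x) \<partial>\<mu>)"
    using I by simp
  also have "\<dots> = (\<integral>x. (r *\<^sub>R G x + s *\<^sub>R H x) $ i $ j * phi x \<partial>\<mu>)"
    by (simp add: algebra_simps)
  finally show "(\<integral>x. (r *\<^sub>R w x + s *\<^sub>R z x) $ i * frechet_derivative phi (at x) (axis j 1) \<partial>\<mu>) =
    - (\<integral>x. (r *\<^sub>R G x + s *\<^sub>R H x) $ i $ j * phi x \<partial>\<mu>)" by (simp add: pd_def)
qed

lemma tendsto_by_bound:
  fixes X :: "nat \<Rightarrow> 'a::real_normed_vector"
  assumes "\<And>n. norm (X n - L) \<le> e n * K" "e \<longlonglongrightarrow> 0"
  shows "X \<longlonglongrightarrow> L"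
proof -
  have "(\<lambda>n. e n * K) \<longlonglongrightarrow> 0" using tendsto_mult_right[OF assms(2), of K] by simp
  then have "(\<lambda>n. X n - L) \<longlonglongrightarrow> 0"
    by (rule Lim_null_comparison[rotated]) (use assms(1) in simp)
  then show ?thesis by (simp add: LIM_zero_iff)
qed

lemma smooth_weak_gradient:
  assumes u: "smooth u" "torus_periodic u"
  shows "has_weak_gradient u (\<lambda>x. \<chi> i j. pd (axis j 1) u x $ i)"
  unfolding has_weak_gradient_def
proof (intro conjI allI impI)
  show "u \<in> L2_torus" by (intro continuous_L2_torus smooth_continuous_on u)
  have sg: "smooth (\<lambda>x. \<chi> i j. pd (axis j 1) u x $ i)" by (intro smooth_intros u)
  have "pd v u (x + (2 * pi) *\<^sub>R axis i 1) = pd v u x" for v x i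
  proof -
    have "(\<lambda>x. u (x + (2 * pi) *\<^sub>R axis i 1)) = u" using u(2) by (simp add: torus_periodic_def)
    moreover have "((\<lambda>x. u (x + (2 * pi) *\<^sub>R axis i 1)) has_derivative (\<lambda>v. pd v u (x + (2 * pi) *\<^sub>R axis i 1))) (at x)"
      by (rule has_derivative_compose[where g = u, OF _ smooth_has_derivative[OF u(1)]]) (auto intro!: derivative_eq_intros)
    ultimately show ?thesis using pd_eqI by metis
  qed
  then show "(\<lambda>x. \<chi> i j. pd (axis j 1) u x $ i) \<in> L2_torus"
    by (intro continuous_L2_torus smooth_continuous_on sg) (simp add: torus_periodic_def)
  fix phi :: "real^2 \<Rightarrow> real" and i j :: 2 assume "smooth phi \<and> torus_periodic phi"
  then have p: "smooth phi" "torus_periodic phi" by auto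
  have sui: "smooth (\<lambda>x. u x $ i)" by (intro smooth_intros u)
  have sup: "smooth (\<lambda>x. u x $ i * phi x)" by (intro smooth_mult sui p)
  have pp: "torus_periodic (\<lambda>x. u x $ i * phi x)" using u(2) p(2) by (simp add: torus_periodic_def)
  have pr: "pd (axis j 1) (\<lambda>x. u x $ i * phi x) x = u x $ i * pd (axis j 1) phi x + pd (axis j 1) u x $ i * phi x" for x
    using pd_bilinear[OF bounded_bilinear_mult smooth_differentiable[OF sui] smooth_differentiable[OF p(1)], of "axis j 1" x]
      pd_vec_nth[OF smooth_differentiable[OF u(1)], of "axis j 1" i x] by simp
  have i1: "integrable \<mu> (\<lambda>x. u x $ i * pd (axis j 1) phi x)"
    by (intro torus_integrable smooth_continuous_on smooth_mult sui smooth_pd p)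
  have i2: "integrable \<mu> (\<lambda>x. pd (axis j 1) u x $ i * phi x)"
    by (intro torus_integrable smooth_continuous_on smooth_mult smooth_vec_nth smooth_pd u p)
  have "0 = (\<integral>x. u x $ i * pd (axis j 1) phi x + pd (axis j 1) u x $ i * phi x \<partial>\<mu>)"
    using torus_integral_pd[OF sup pp, of j] unfolding pr[abs_def] by simp
  also have "\<dots> = (\<integral>x. u x $ i * pd (axis j 1) phi x \<partial>\<mu>) + (\<integral>x. pd (axis j 1) u x $ i * phi x \<partial>\<mu>)"
    by (rule Bochner_Integration.integral_add[OF i1 i2])
  finally show "(\<integral>x. u x $ i * frechet_derivative phi (at x) (axis j 1) \<partial>\<mu>) =
    - (\<integral>x. (\<chi> i j. pd (axis j 1) u x $ i) $ i $ j * phi x \<partial>\<mu>)"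
    by (simp add: pd_def)
qed

lemma inner_bound:
  fixes g w :: "real^2 \<Rightarrow> 'b::euclidean_space"
  assumes w: "integrable \<mu> w" and g: "continuous_on UNIV g" "\<And>x. x \<in> torus \<Longrightarrow> norm (g x) \<le> d"
  shows "\<bar>\<integral>x. g x \<bullet> w x \<partial>\<mu>\<bar> \<le> d * (\<integral>x. norm (w x) \<partial>\<mu>)"
proof -
  have i: "integrable \<mu> (\<lambda>x. g x \<bullet> w x)"
    using integrable_inner_continuous[OF w g(1)] by (simp add: inner_commute)
  have "\<bar>\<integral>x. g x \<bullet> w x \<partial>\<mu>\<bar> \<le> (\<integral>x. norm (g x \<bullet> w x) \<partial>\<mu>)"
    using integral_norm_bound[of "\<mu>" "\<lambda>x. g x \<bullet> w x"] by simp
  also have "\<dots> \<le> (\<integral>x. d * norm (w x) \<partial>\<mu>)"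
  proof (rule integral_mono)
    fix x assume "x \<in> space \<mu>"
    then have "norm (g x) * norm (w x) \<le> d * norm (w x)" using g(2) by (intro mult_right_mono) auto
    then show "norm (g x \<bullet> w x) \<le> d * norm (w x)" using Cauchy_Schwarz_ineq2[of "g x" "w x"] by simp
  qed (use i w in auto)
  finally show ?thesis by simp
qed

lemma inner_diff_bound:
  fixes g h w :: "real^2 \<Rightarrow> 'b::euclidean_space"
  assumes w: "integrable \<mu> w" and g: "continuous_on UNIV g" "continuous_on UNIV h" "\<And>x. x \<in> torus \<Longrightarrow> norm (g x - h x) \<le> d"
  shows "\<bar>(\<integral>x. g x \<bullet> w x \<partial>\<mu>) - (\<integral>x. h x \<bullet> w x \<partial>\<mu>)\<bar> \<le> d * (\<integral>x. norm (w x) \<partial>\<mu>)"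
proof -
  have i: "integrable \<mu> (\<lambda>x. g x \<bullet> w x)" "integrable \<mu> (\<lambda>x. h x \<bullet> w x)"
    using integrable_inner_continuous[OF w] g(1,2) by (simp_all add: inner_commute)
  have "(\<integral>x. g x \<bullet> w x \<partial>\<mu>) - (\<integral>x. h x \<bullet> w x \<partial>\<mu>) = (\<integral>x. (g x - h x) \<bullet> w x \<partial>\<mu>)"
    unfolding inner_diff_left by (rule Bochner_Integration.integral_diff[OF i, symmetric])
  also have "\<bar>\<dots>\<bar> \<le> d * (\<integral>x. norm (w x) \<partial>\<mu>)"
    by (rule inner_bound[OF w]) (intro continuous_intros g, rule g(3))
  finally show ?thesis .
qed

lemma inner_tendsto:
  fixes g :: "nat \<Rightarrow> real^2 \<Rightarrow> 'b::euclidean_space" and h w :: "real^2 \<Rightarrow> 'b"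
  assumes "integrable \<mu> w" "\<And>n. continuous_on UNIV (g n)" "continuous_on UNIV h"
    "\<And>n x. norm (g n x - h x) \<le> e n" "e \<longlonglongrightarrow> 0"
  shows "(\<lambda>n. \<integral>x. g n x \<bullet> w x \<partial>\<mu>) \<longlonglongrightarrow> (\<integral>x. h x \<bullet> w x \<partial>\<mu>)"
  by (rule tendsto_by_bound[OF _ assms(5)], unfold real_norm_def, rule inner_diff_bound[OF assms(1-4)])

text \<open>Both sides of the defining identity are integrals against fixed functions and so pass to
  uniform limits.\<close>

lemma weak_gradient_uniform_limit:
  assumes G: "\<And>n. has_weak_gradient (w n) (G n)" and p: "torus_periodic w'" "torus_periodic G'"
    and c: "\<And>n. continuous_on UNIV (w n)" "\<And>n. continuous_on UNIV (G n)" "continuous_on UNIV w'" "continuous_on UNIV G'"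
    and e: "\<And>n x. norm (w n x - w' x) \<le> e n" "\<And>n x. norm (G n x - G' x) \<le> e n" "e \<longlonglongrightarrow> 0"
  shows "has_weak_gradient w' G'"
  unfolding has_weak_gradient_def
proof (intro conjI allI impI continuous_L2_torus c p)
  fix phi :: "real^2 \<Rightarrow> real" and i j :: 2 assume "smooth phi \<and> torus_periodic phi"
  then have phi: "smooth phi" "torus_periodic phi" by auto
  have i: "integrable \<mu> phi" "integrable \<mu> (pd (axis j 1) phi)"
    by (intro torus_integrable smooth_continuous_on smooth_pd phi)+
  have "norm (w n x $ i - w' x $ i) \<le> e n" for n x
    using order_trans[OF component_le_norm_cart[of "w n x - w' x" i] e(1)] by simp
  then have 1: "(\<lambda>n. \<integral>x. w n x $ i \<bullet> pd (axis j 1) phi x \<partial>\<mu>) \<longlonglongrightarrow> (\<integral>x. w' x $ i \<bullet> pd (axis j 1) phi x \<partial>\<mu>)"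
    by (intro inner_tendsto[OF i(2) _ _ _ e(3)] bounded_linear.continuous_on[OF bounded_linear_vec_nth] c)
  have "norm (G n x $ i $ j - G' x $ i $ j) \<le> e n" for n x
    using order_trans[OF entry_le_norm[of "G n x - G' x" i j] e(2)] by simp
  then have "(\<lambda>n. \<integral>x. G n x $ i $ j \<bullet> phi x \<partial>\<mu>) \<longlonglongrightarrow> (\<integral>x. G' x $ i $ j \<bullet> phi x \<partial>\<mu>)"
    by (intro inner_tendsto[OF i(1) _ _ _ e(3)] bounded_linear.continuous_on[OF bounded_linear_vec_nth] c)
  from LIMSEQ_unique[OF 1[unfolded inner_real_def weak_gradientD(3)[OF G phi]] tendsto_minus[OF this[unfolded inner_real_def]]]
  show "(\<integral>x. w' x $ i * frechet_derivative phi (at x) (axis j 1) \<partial>\<mu>) = - (\<integral>x. G' x $ i $ j * phi x \<partial>\<mu>)"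
    by (simp add: pd_def)
qed

text \<open>The entries of \<open>M\<close> serve as the test functions and \<open>w\<close> is
  merely in \<open>H1\<close>. In this way the equation of the smooth approximations can be tested
  with any element of \<open>H1\<close>.\<close>

lemma weak_gradient_dvg:
  fixes M :: "real^2 \<Rightarrow> mat2"
  assumes G: "has_weak_gradient w G" and M: "smooth M" "torus_periodic M"
  shows "(\<integral>x. w x \<bullet> (\<chi> i. \<Sum>j\<in>UNIV. pd (axis j 1) M x $ i $ j) \<partial>\<mu>) = - (\<integral>x. G x \<bullet> M x \<partial>\<mu>)"
proof -
  note iw = L2_torus_integrable[OF weak_gradientD(1)[OF G]] and iG = L2_torus_integrable[OF weak_gradientD(2)[OF G]]
  have sm: "smooth (\<lambda>x. M x $ i $ j)" for i j by (intro smooth_vec_nth M)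
  have pm: "torus_periodic (\<lambda>x. M x $ i $ j)" for i j using M(2) by (simp add: torus_periodic_def)
  have pdm: "pd v M x $ i $ j = pd v (\<lambda>x. M x $ i $ j) x" for v x i j
    using pd_vec_nth[OF smooth_differentiable[OF M(1)], of v i x] pd_vec_nth[OF smooth_differentiable[OF smooth_vec_nth[OF M(1)]], of v i j x] by simp
  note c = smooth_continuous_on[OF sm] smooth_continuous_on[OF smooth_pd[OF sm]]
  have "(\<integral>x. w x \<bullet> (\<chi> i. \<Sum>j\<in>UNIV. pd (axis j 1) M x $ i $ j) \<partial>\<mu>) =
    (\<integral>x. (\<Sum>i\<in>UNIV. \<Sum>j\<in>UNIV. w x $ i * pd (axis j 1) (\<lambda>x. M x $ i $ j) x) \<partial>\<mu>)"
    by (simp add: inner_vec_def pdm sum_distrib_left)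
  also have "\<dots> = (\<Sum>i\<in>UNIV. \<Sum>j\<in>UNIV. (\<integral>x. w x $ i * pd (axis j 1) (\<lambda>x. M x $ i $ j) x \<partial>\<mu>))"
    by (simp add: Bochner_Integration.integral_sum Bochner_Integration.integrable_sum integrable_component(1)[OF iw c(2)])
  also have "\<dots> = (\<Sum>i\<in>UNIV. \<Sum>j\<in>UNIV. - (\<integral>x. G x $ i $ j * M x $ i $ j \<partial>\<mu>))"
    by (simp add: weak_gradientD(3)[OF G sm pm])
  also have "\<dots> = - (\<integral>x. (\<Sum>i\<in>UNIV. \<Sum>j\<in>UNIV. G x $ i $ j * M x $ i $ j) \<partial>\<mu>)"
    by (simp add: Bochner_Integration.integral_sum Bochner_Integration.integrable_sum integrable_component(2)[OF iw c(1) iG] sum_negf)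
  also have "\<dots> = - (\<integral>x. G x \<bullet> M x \<partial>\<mu>)"
    by (simp add: inner_vec_def)
  finally show ?thesis .
qed

text \<open>The action of \<open>div Q\<close> on \<open>H^1\<close>; \<open>weak_gradient\<close> is a choice, well defined up to null sets.\<close>
definition pair :: "(real^2 \<Rightarrow> mat2) \<Rightarrow> (real^2 \<Rightarrow> real^2) \<Rightarrow> real" where
  "pair Q w = - (\<integral>x. weak_gradient w x \<bullet> Q x \<partial>\<mu>)"

lemma pair_eq:
  assumes G: "has_weak_gradient w G" and Q: "continuous_on UNIV Q"
  shows "pair Q w = - (\<integral>x. G x \<bullet> Q x \<partial>\<mu>)"
proof -
  have "has_weak_gradient w (weak_gradient w)" using G by (intro weak_gradient_works) (auto simp: H1_def)
  then have m: "weak_gradient w \<in> borel_measurable \<mu>" "G \<in> borel_measurable \<mu>"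
    using G by (auto intro!: L2_torusD(2) dest: weak_gradientD(2))
  have q: "Q \<in> borel_measurable \<mu>"
    by (intro continuous_imp_measurable_on_sets_lebesgue continuous_on_subset[OF Q] torus_sets) simp
  have "(\<integral>x. weak_gradient w x \<bullet> Q x \<partial>\<mu>) = (\<integral>x. G x \<bullet> Q x \<partial>\<mu>)"
    by (rule integral_cong_AE) (use m q weak_gradient_AE[OF G] in auto)
  then show ?thesis by (simp add: pair_def)
qed

lemma L2_le_H1: "L2_norm (weak_gradient w) \<le> H1_norm w"
  unfolding H1_norm_def by (rule real_le_rsqrt) simp

lemma pair_bound:
  assumes w: "w \<in> H1" and Q: "continuous_on UNIV Q" "\<And>x. x \<in> torus \<Longrightarrow> norm (Q x) \<le> B"
  shows "\<bar>pair Q w\<bar> \<le> B * K1 * H1_norm w"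
proof -
  note G = weak_gradientD(2)[OF weak_gradient_works[OF w]]
  have "0 \<in> torus" by (simp add: torus_def mem_box_cart)
  then have B: "B \<ge> 0" using Q(2) norm_ge_zero order_trans by blast
  have "\<bar>pair Q w\<bar> \<le> B * (\<integral>x. norm (weak_gradient w x) \<partial>\<mu>)"
    using inner_bound[OF L2_torus_integrable[OF G] Q] by (simp add: pair_def inner_commute)
  also have "\<dots> \<le> B * (K1 * L2_norm (weak_gradient w))" using B by (intro mult_left_mono L1_le_L2 G)
  also have "\<dots> \<le> B * (K1 * H1_norm w)" using B K1_pos by (intro mult_left_mono L2_le_H1) auto
  finally show ?thesis by (simp add: mult.assoc)
qed

lemma pair_diff:
  assumes w: "w \<in> H1" and Q: "continuous_on UNIV Q" "continuous_on UNIV R"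
  shows "pair Q w - pair R w = pair (\<lambda>x. Q x - R x) w"
proof -
  note iG = L2_torus_integrable[OF weak_gradientD(2)[OF weak_gradient_works[OF w]]]
  show ?thesis
    unfolding pair_def inner_diff_right
    using Bochner_Integration.integral_diff[OF integrable_inner_continuous[OF iG Q(1)] integrable_inner_continuous[OF iG Q(2)]] by simp
qed

lemma pair_combination:
  assumes w: "w \<in> H1" and z: "z \<in> H1" and Q: "continuous_on UNIV Q"
  shows "pair Q (\<lambda>x. r *\<^sub>R w x + s *\<^sub>R z x) = r * pair Q w + s * pair Q z"
proof -
  note G = weak_gradient_works[OF w] and H = weak_gradient_works[OF z]
  note i = integrable_inner_continuous[OF L2_torus_integrable[OF weak_gradientD(2)[OF G]] Q]
    integrable_inner_continuous[OF L2_torus_integrable[OF weak_gradientD(2)[OF H]] Q]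
  have "pair Q (\<lambda>x. r *\<^sub>R w x + s *\<^sub>R z x) = - (\<integral>x. r * (weak_gradient w x \<bullet> Q x) + s * (weak_gradient z x \<bullet> Q x) \<partial>\<mu>)"
    unfolding pair_eq[OF weak_gradient_combination[OF G H] Q] by (simp add: inner_add_left)
  also have "\<dots> = r * pair Q w + s * pair Q z" using i by (simp add: pair_def)
  finally show ?thesis .
qed

section \<open>Stress divergences as elements of the dual space\<close>

lemma pair_H_minus1:
  assumes Q: "continuous_on UNIV Q" shows "pair Q \<in> H_minus1"
proof -
  obtain B where B: "\<And>x. x \<in> torus \<Longrightarrow> norm (Q x) \<le> B" using torus_continuous_bounded[OF Q] by blast
  show ?thesis unfolding H_minus1_def using pair_combination[OF _ _ Q] pair_bound[OF _ Q B] by blast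
qed

text \<open>The zero function ensures that the supremum in \<open>H_minus1_norm\<close> is taken
  over a nonempty set.\<close>

lemma H1_zero: "(\<lambda>x. 0) \<in> H1" "H1_norm (\<lambda>x. 0) = 0"
proof -
  have z: "(\<lambda>x. 0) \<in> (L2_torus :: (real^2 \<Rightarrow> 'b::euclidean_space) set)"
    by (intro continuous_L2_torus continuous_on_const) (simp add: torus_periodic_def)
  have 0: "has_weak_gradient (\<lambda>x. 0) (\<lambda>x. 0)" unfolding has_weak_gradient_def by (simp add: z continuous_L2_torus torus_periodic_def)
  then show "(\<lambda>x. 0) \<in> H1" by (auto simp: H1_def)
  show "H1_norm (\<lambda>x. 0) = 0" unfolding H1_norm_def L2_norm_weak_gradient[OF 0] by (simp add: L2_norm_def)
qed

lemma H_minus1_norm_le: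
  assumes "\<And>w. w \<in> H1 \<Longrightarrow> H1_norm w \<le> 1 \<Longrightarrow> \<bar>F w\<bar> \<le> K"
  shows "H_minus1_norm F \<le> K"
  unfolding H_minus1_norm_def by (rule cSup_least) (use assms H1_zero in \<open>auto intro!: exI[of _ "\<lambda>x. 0"]\<close>)

lemma le_H_minus1_norm:
  assumes b: "\<And>w. w \<in> H1 \<Longrightarrow> H1_norm w \<le> 1 \<Longrightarrow> \<bar>F w\<bar> \<le> K" and w: "w \<in> H1" "H1_norm w \<le> 1"
  shows "\<bar>F w\<bar> \<le> H_minus1_norm F"
  unfolding H_minus1_norm_def by (rule cSup_upper) (use b w in \<open>auto intro!: bdd_aboveI[of _ K]\<close>)

lemma pair_bound1:
  assumes "w \<in> H1" "H1_norm w \<le> 1" "continuous_on UNIV Q" "\<And>x. x \<in> torus \<Longrightarrow> norm (Q x) \<le> B"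
  shows "\<bar>pair Q w\<bar> \<le> B * K1"
proof -
  have "0 \<in> torus" by (simp add: torus_def mem_box_cart)
  then have B: "B \<ge> 0" using assms(4) norm_ge_zero order_trans by blast
  have "B * K1 * H1_norm w \<le> B * K1 * 1" using B K1_pos assms(2) by (intro mult_left_mono) auto
  then show ?thesis using pair_bound[OF assms(1,3,4)] by simp
qed

text \<open>Uniformly close stresses have divergences that are close in the dual norm. The third
  bound is one-sided; exchanging the arguments supplies the other side.\<close>

lemma pair_norm_diff:
  assumes Q: "continuous_on UNIV Q" "continuous_on UNIV R" and B: "\<And>x. x \<in> torus \<Longrightarrow> norm (Q x - R x) \<le> B"
  shows "H_minus1_norm (\<lambda>w. pair Q w - pair R w) \<le> B * K1" "0 \<le> H_minus1_norm (\<lambda>w. pair Q w - pair R w)"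
    "H_minus1_norm (pair Q) - H_minus1_norm (pair R) \<le> B * K1"
proof -
  have c: "continuous_on UNIV (\<lambda>x. Q x - R x)" by (intro continuous_intros Q)
  have b: "\<bar>pair Q w - pair R w\<bar> \<le> B * K1" if "w \<in> H1" "H1_norm w \<le> 1" for w
    using pair_bound1[OF that c B] pair_diff[OF that(1) Q] by simp
  show "H_minus1_norm (\<lambda>w. pair Q w - pair R w) \<le> B * K1" by (rule H_minus1_norm_le) (rule b)
  show "0 \<le> H_minus1_norm (\<lambda>w. pair Q w - pair R w)"
    by (rule order_trans[OF abs_ge_zero le_H_minus1_norm[where F = "\<lambda>w. pair Q w - pair R w", OF b H1_zero(1)]])
      (simp_all add: H1_zero(2))
  obtain C where C: "\<And>x. x \<in> torus \<Longrightarrow> norm (R x) \<le> C" using torus_continuous_bounded[OF Q(2)] by blast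
  have "H_minus1_norm (pair Q) \<le> H_minus1_norm (pair R) + B * K1"
  proof (rule H_minus1_norm_le)
    fix w assume w: "w \<in> H1" "H1_norm w \<le> 1"
    have "\<bar>pair R w\<bar> \<le> H_minus1_norm (pair R)" by (rule le_H_minus1_norm[OF pair_bound1[OF _ _ Q(2) C] w])
    then show "\<bar>pair Q w\<bar> \<le> H_minus1_norm (pair R) + B * K1" using b[OF w] by linarith
  qed
  then show "H_minus1_norm (pair Q) - H_minus1_norm (pair R) \<le> B * K1" by simp
qed

section \<open>The limit is a weak solution\<close>

lemma geometric_limit:
  fixes f :: "nat \<Rightarrow> 'x \<Rightarrow> 'b::banach"
  assumes d: "\<And>n p. norm (f (Suc n) p - f n p) \<le> B * (1/2)^n"
  obtains g where "\<And>n p. norm (f n p - g p) \<le> 2 * B * (1/2)^n"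
proof -
  have "norm (f (Suc 0) p - f 0 p) \<le> B" for p using d[of 0 p] by simp
  then have B: "B \<ge> 0" by (rule order_trans[OF norm_ge_zero])
  \<comment> \<open>The factor \<open>1 - (1/2)^k\<close> strengthens the bound so that the
    induction closes.\<close>
  have k: "norm (f (n + k) p - f n p) \<le> 2 * B * (1/2)^n * (1 - (1/2)^k)" for n k p
  proof (induction k)
    case (Suc k)
    have "norm (f (n + Suc k) p - f n p) \<le> norm (f (n + Suc k) p - f (n + k) p) + norm (f (n + k) p - f n p)"
      using norm_triangle_ineq[of "f (n + Suc k) p - f (n + k) p" "f (n + k) p - f n p"] by simp
    also have "\<dots> \<le> B * (1/2)^(n + k) + 2 * B * (1/2)^n * (1 - (1/2)^k)"
      using d[of "n + k" p] Suc by simp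
    finally show ?case by (simp add: algebra_simps power_add)
  qed simp
  have k2: "norm (f (n + k) p - f n p) \<le> 2 * B * (1/2)^n" for n k p
  proof -
    have "2 * B * (1/2)^n * (1 - (1/2)^k) \<le> 2 * B * (1/2)^n * 1" using B by (intro mult_left_mono) auto
    then show ?thesis using k[of n k p] by simp
  qed
  have e0: "(\<lambda>n. 2 * B * (1/2)^n) \<longlonglongrightarrow> 0"
    using tendsto_mult_left[OF LIMSEQ_power_zero[of "1/2::real"], of "2 * B"] by simp
  have "Cauchy (\<lambda>n. f n p)" for p
  proof (rule metric_CauchyI)
    fix e :: real assume "e > 0"
    then have "\<forall>\<^sub>F n in sequentially. 2 * B * (1/2)^n < e / 2" using e0 by (intro order_tendstoD(2)[OF e0]) simp
    then obtain N where N: "2 * B * (1/2)^N < e / 2" by (auto simp: eventually_sequentially)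
    have "dist (f m p) (f N p) < e / 2" if "m \<ge> N" for m
      using k2[of N "m - N" p] N that by (simp add: dist_norm)
    note h = this
    have "dist (f m p) (f n p) < e" if "m \<ge> N" "n \<ge> N" for m n
      by (rule dist_triangle_half_l[OF h[OF that(1)] h[OF that(2)]])
    then show "\<exists>M. \<forall>m\<ge>M. \<forall>n\<ge>M. dist (f m p) (f n p) < e" by blast
  qed
  then have c: "(\<lambda>n. f n p) \<longlonglongrightarrow> lim (\<lambda>n. f n p)" for p
    by (simp add: Cauchy_convergent_iff convergent_LIMSEQ_iff)
  have "norm (f n p - lim (\<lambda>n. f n p)) \<le> 2 * B * (1/2)^n" for n p
  proof -
    have "(\<lambda>k. norm (f (n + k) p - f n p)) \<longlonglongrightarrow> norm (lim (\<lambda>n. f n p) - f n p)"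
      using LIMSEQ_ignore_initial_segment[OF c[of p], of n] by (intro tendsto_intros) (simp add: add.commute)
    then have "norm (lim (\<lambda>n. f n p) - f n p) \<le> 2 * B * (1/2)^n"
      by (rule LIMSEQ_le_const2) (use k2 in blast)
    then show ?thesis by (simp add: norm_minus_commute)
  qed
  then show ?thesis by (rule that)
qed

lemma smooth_slice: "smooth f \<Longrightarrow> smooth (\<lambda>x::real^2. f (t::real, x))"
  by (rule smooth_compose[where f = f]) (assumption, intro smooth_Pair smooth_const smooth_id)

lemma pd_slice: assumes "smooth f" shows "pd v (\<lambda>x::real^2. f (t::real, x)) x = pd (0, v) f (t, x)"
proof -
  have "((\<lambda>x. (t, x)) has_derivative (\<lambda>v. (0, v))) (at x)" by (auto intro!: derivative_eq_intros)
  from has_derivative_compose[OF this smooth_has_derivative[OF assms]]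
  show ?thesis by (rule pd_eqI[THEN trans]) simp
qed

lemma periodic_slice: assumes "sfield Per f" shows "torus_periodic (\<lambda>x. f (t, x))"
  unfolding torus_periodic_def
proof (intro allI)
  fix x :: "real^2" and i
  have "(t, x) + (2 * pi) *\<^sub>R dx i = (t, x + (2 * pi) *\<^sub>R axis i 1)" by (simp add: dx_def)
  then show "f (t, x + (2 * pi) *\<^sub>R axis i 1) = f (t, x)" using sfield_shift[OF assms, of "(t, x)" i] by simp
qed

lemma uniform_limit_geometric_continuous:
  fixes g :: "pt \<Rightarrow> 'b::euclidean_space"
  assumes "\<And>n p. norm (f n p - g p) \<le> e n" "e \<longlonglongrightarrow> 0" "\<And>n. continuous_on UNIV (f n)"
  shows "continuous_on UNIV g"
proof (rule uniform_limit_theorem)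
  show "uniform_limit UNIV f g sequentially"
  proof (rule uniform_limitI)
    fix d :: real assume "d > 0"
    then have "\<forall>\<^sub>F n in sequentially. e n < d" by (rule order_tendstoD(2)[OF assms(2)])
    then show "\<forall>\<^sub>F n in sequentially. \<forall>x\<in>UNIV. dist (f n x) (g x) < d"
      by (rule eventually_mono) (use assms(1) in \<open>auto simp: dist_norm intro: le_less_trans\<close>)
  qed
qed (use assms in auto)

lemma slice_close:
  fixes W :: "pt \<Rightarrow> 'b::metric_space"
  assumes W: "continuous_on UNIV W" and e: "e > 0"
  obtains d where "d > 0" "\<And>s t x. s \<in> {0..T} \<Longrightarrow> t \<in> {0..T} \<Longrightarrow> x \<in> torus \<Longrightarrow> \<bar>s - t\<bar> < d \<Longrightarrow> dist (W (s, x)) (W (t, x)) < e"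
proof -
  have "uniformly_continuous_on ({0..T} \<times> torus) W"
    by (intro compact_uniformly_continuous continuous_on_subset[OF W] compact_Times) (auto simp: torus_def)
  then obtain d where d: "d > 0" "\<And>p q. p \<in> {0..T} \<times> torus \<Longrightarrow> q \<in> {0..T} \<times> torus \<Longrightarrow> dist q p < d \<Longrightarrow> dist (W q) (W p) < e"
    unfolding uniformly_continuous_on_def using e by metis
  have "dist (W (s, x)) (W (t, x)) < e" if "s \<in> {0..T}" "t \<in> {0..T}" "x \<in> torus" "\<bar>s - t\<bar> < d" for s t x
    using d(2)[of "(t, x)" "(s, x)"] that by (simp add: dist_Pair_Pair dist_real_def)
  then show ?thesis using that[OF d(1)] by blast
qed

text \<open>\<open>C\<close> allows estimates with a constant factor, and
  \<open>s \<noteq> t\<close> admits difference quotients.\<close>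

lemma time_limitI:
  fixes f :: "real \<Rightarrow> real"
  assumes "\<And>e. e > 0 \<Longrightarrow> \<exists>d>0. \<forall>s\<in>{0..T}. \<bar>s - t\<bar> < d \<longrightarrow> s \<noteq> t \<longrightarrow> f s \<le> e * C" "\<And>s. f s \<ge> 0" "C > 0"
  shows "(f \<longlongrightarrow> 0) (at t within {0..T})"
proof (rule tendstoI)
  fix e :: real assume e: "e > 0"
  then obtain d where d: "d > 0" "\<And>s. s \<in> {0..T} \<Longrightarrow> \<bar>s - t\<bar> < d \<Longrightarrow> s \<noteq> t \<Longrightarrow> f s \<le> (e / 2 / C) * C"
    using assms(1)[of "e / 2 / C"] assms(3) by auto
  show "\<forall>\<^sub>F s in at t within {0..T}. dist (f s) 0 < e"
    unfolding eventually_at using d e assms(2,3) by (intro exI[of _ d]) (force simp: dist_real_def)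
qed

lemma C_time_L2:
  fixes W :: "pt \<Rightarrow> 'b::euclidean_space"
  assumes W: "continuous_on UNIV W" and p: "\<And>t. torus_periodic (\<lambda>x. W (t, x))"
  shows "(\<lambda>t x. W (t, x)) \<in> C_time T L2_torus L2_norm"
  unfolding C_time_def
proof (intro CollectI conjI ballI)
  have c: "continuous_on UNIV (\<lambda>x. W (t, x))" for t
    by (rule continuous_on_compose2[OF W]) (auto intro!: continuous_intros)
  show "(\<lambda>x. W (t, x)) \<in> L2_torus" for t by (rule continuous_L2_torus[OF c p])
  fix t assume t: "t \<in> {0..T}"
  show "((\<lambda>s. L2_norm (\<lambda>x. W (s, x) - W (t, x))) \<longlongrightarrow> 0) (at t within {0..T})"
  proof (rule time_limitI[where C = "sqrt vol + 1"])
    fix e :: real assume "e > 0"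
    then obtain d where d: "d > 0" "\<And>s t x. s \<in> {0..T} \<Longrightarrow> t \<in> {0..T} \<Longrightarrow> x \<in> torus \<Longrightarrow> \<bar>s - t\<bar> < d \<Longrightarrow> dist (W (s, x)) (W (t, x)) < e"
      using slice_close[OF W] by blast
    have "L2_norm (\<lambda>x. W (s, x) - W (t, x)) \<le> e * (sqrt vol + 1)" if s: "s \<in> {0..T}" "\<bar>s - t\<bar> < d" for s
    proof -
      have "L2_norm (\<lambda>x. W (s, x) - W (t, x)) \<le> e * sqrt vol"
        by (rule L2_norm_bound) (use d(2)[OF s(1) t _ s(2)] in \<open>simp add: dist_norm less_imp_le\<close>)
      then show ?thesis using \<open>e > 0\<close> by (simp add: algebra_simps)
    qed
    then show "\<exists>d>0. \<forall>s\<in>{0..T}. \<bar>s - t\<bar> < d \<longrightarrow> s \<noteq> t \<longrightarrow> L2_norm (\<lambda>x. W (s, x) - W (t, x)) \<le> e * (sqrt vol + 1)"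
      using d(1) by blast
  qed (use vol_nonneg in \<open>auto intro: L2_norm_nonneg add_nonneg_pos\<close>)
qed

text \<open>The derivative is uniformly continuous on the compact space-time region, so the mean
  value inequality gives convergence of the difference quotients uniformly in
  \<open>x\<close>.\<close>

lemma difference_quotient:
  fixes W W' :: "pt \<Rightarrow> 'b::real_normed_vector"
  assumes D: "\<And>t x. ((\<lambda>t. W (t, x)) has_vector_derivative W' (t, x)) (at t)" and c: "continuous_on UNIV W'" and d: "d > 0"
  obtains \<delta> where "\<delta> > 0" "\<And>s t x. s \<in> {0..T} \<Longrightarrow> t \<in> {0..T} \<Longrightarrow> \<bar>s - t\<bar> < \<delta> \<Longrightarrow> s \<noteq> t \<Longrightarrow> x \<in> torus \<Longrightarrow>
    norm ((W (s, x) - W (t, x)) /\<^sub>R (s - t) - W' (t, x)) \<le> d"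
proof -
  obtain \<delta> where \<delta>: "\<delta> > 0" "\<And>s t x. s \<in> {0..T} \<Longrightarrow> t \<in> {0..T} \<Longrightarrow> x \<in> torus \<Longrightarrow> \<bar>s - t\<bar> < \<delta> \<Longrightarrow> dist (W' (s, x)) (W' (t, x)) < d"
    using slice_close[OF c d] by blast
  show ?thesis
  proof (rule that[OF \<delta>(1)])
    fix s t x assume s: "s \<in> {0..T}" "\<bar>s - t\<bar> < \<delta>" "s \<noteq> t" and t: "t \<in> {0..T}" and x: "x \<in> torus"
    have bd: "norm (W (s, x) - W (t, x) - (s - t) *\<^sub>R W' (t, x)) \<le> norm (s - t) * d"
    proof (rule vector_differentiable_bound_linearization[where S = "closed_segment t s" and ?x0.0 = t])
      show "((\<lambda>t. W (t, x)) has_vector_derivative W' (r, x)) (at r within closed_segment t s)" for r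
        by (rule has_vector_derivative_at_within[OF D])
      fix r assume r: "r \<in> closed_segment t s"
      then have "r \<in> {0..T}" "\<bar>r - t\<bar> < \<delta>" using s t by (auto simp: closed_segment_eq_real_ivl split: if_splits)
      then show "norm (W' (r, x) - W' (t, x)) \<le> d" using \<delta>(2)[of r t x] t x by (simp add: dist_norm less_imp_le)
    qed auto
    have eq: "(W (s, x) - W (t, x)) /\<^sub>R (s - t) - W' (t, x) = (W (s, x) - W (t, x) - (s - t) *\<^sub>R W' (t, x)) /\<^sub>R (s - t)"
      using s(3) by (simp add: scaleR_diff_right)
    have "norm (z /\<^sub>R (s - t)) = norm z / \<bar>s - t\<bar>" for z :: 'b by (simp add: divide_inverse mult.commute)
    moreover have "0 < \<bar>s - t\<bar>" using s(3) by simp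
    ultimately show "norm ((W (s, x) - W (t, x)) /\<^sub>R (s - t) - W' (t, x)) \<le> d"
      unfolding eq using bd by (simp only: pos_divide_le_eq real_norm_def mult.commute)
  qed
qed

section \<open>Regularity of the limit\<close>

locale solution_limit = material a b c for a b c +
  fixes T \<tau> :: real and u :: "nat \<Rightarrow> pt \<Rightarrow> real^2" and R :: "nat \<Rightarrow> pt \<Rightarrow> mat2"
    and U V :: "pt \<Rightarrow> real^2" and G :: "pt \<Rightarrow> mat2" and e :: "nat \<Rightarrow> real"
  assumes T: "T > 0" and tau: "\<tau> > 0"
    and u: "\<And>n. sfield Per (u n)" and R: "\<And>n. sfield Per (R n)"
    and u0: "\<And>n p. fst p < \<tau> \<Longrightarrow> u n p = 0"
    and eqn: "\<And>n p. pd dt (pd dt (u n)) p = dvg (\<lambda>p. (mat 1 + grad (u n) p) ** (Sg (grad (u n) p) + R n p)) p"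
    and eU: "\<And>n p. norm (u n p - U p) \<le> e n" and eV: "\<And>n p. norm (pd dt (u n) p - V p) \<le> e n"
    and eG: "\<And>n p. norm (grad (u n) p - G p) \<le> e n" and eR: "\<And>n p. norm (R n p) \<le> e n"
    and e: "e \<longlonglongrightarrow> 0" and g1: "\<And>n p. norm (grad (u n) p) \<le> 1"
begin

lemma e_nonneg: "e n \<ge> 0"
  using eU[of n 0] norm_ge_zero order_trans by blast

lemma tendsto_fields: "(\<lambda>n. u n p) \<longlonglongrightarrow> U p" "(\<lambda>n. pd dt (u n) p) \<longlonglongrightarrow> V p" "(\<lambda>n. grad (u n) p) \<longlonglongrightarrow> G p"
  by (rule tendsto_by_bound[OF _ e, where K = 1], unfold mult_1_right, rule eU eV eG)+

lemma cont: "continuous_on UNIV U" "continuous_on UNIV V" "continuous_on UNIV G"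
proof -
  note sm = sfield_smooth[OF u]
  show "continuous_on UNIV U" by (rule uniform_limit_geometric_continuous[OF eU e smooth_continuous_on[OF sm]])
  show "continuous_on UNIV V" by (rule uniform_limit_geometric_continuous[OF eV e smooth_continuous_on[OF smooth_pd[OF sm]]])
  show "continuous_on UNIV G" by (rule uniform_limit_geometric_continuous[OF eG e smooth_continuous_on[OF smooth_grad[OF sm]]])
qed

lemma cont_slice: "continuous_on UNIV (\<lambda>x. U (t, x))" "continuous_on UNIV (\<lambda>x. V (t, x))" "continuous_on UNIV (\<lambda>x. G (t, x))"
  by (rule continuous_on_compose2[OF cont(1)] continuous_on_compose2[OF cont(2)] continuous_on_compose2[OF cont(3)],
      auto intro!: continuous_intros)+

lemma periodic_limit:
  assumes f: "\<And>n. sfield Per (f n)" and l: "\<And>p. (\<lambda>n. f n p) \<longlonglongrightarrow> g p" shows "torus_periodic (\<lambda>x. g (t, x))"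
  unfolding torus_periodic_def
proof (intro allI)
  fix x :: "real^2" and i
  have "(\<lambda>n. f n (t, x)) \<longlonglongrightarrow> g (t, x + (2 * pi) *\<^sub>R axis i 1)"
    using l[of "(t, x + (2 * pi) *\<^sub>R axis i 1)"] periodic_slice[OF f, of _ t] by (simp add: torus_periodic_def)
  then show "g (t, x + (2 * pi) *\<^sub>R axis i 1) = g (t, x)" using LIMSEQ_unique l by blast
qed

lemma periodic: "torus_periodic (\<lambda>x. U (t, x))" "torus_periodic (\<lambda>x. V (t, x))" "torus_periodic (\<lambda>x. G (t, x))"
  by (rule periodic_limit[OF _ tendsto_fields(1)], intro u)
    (rule periodic_limit[OF _ tendsto_fields(2)], intro sfield_intros u,
     rule periodic_limit[OF _ tendsto_fields(3)], intro sfield_intros u)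

lemma zero: assumes "fst p < \<tau>" shows "U p = 0" "V p = 0" "pd dt (u n) p = 0"
proof -
  have v: "pd dt (u n) p = 0" for n
  proof -
    have o: "open (fst -` {..<\<tau>} :: pt set)" by (intro open_vimage continuous_intros open_lessThan)
    have "(u n has_derivative (\<lambda>_. 0)) (at p)"
      by (rule has_derivative_transform_within_open[of "\<lambda>_. 0", OF has_derivative_const o]) (use assms u0 in auto)
    then show ?thesis by (rule pd_eqI)
  qed
  show "pd dt (u n) p = 0" by (rule v)
  show "U p = 0" using tendsto_fields(1)[of p] u0[OF assms] by (simp add: LIMSEQ_const_iff)
  show "V p = 0" using tendsto_fields(2)[of p] v by (simp add: LIMSEQ_const_iff)
qed

lemma G_bound: "norm (G p) \<le> 1"
  by (rule LIMSEQ_le_const2[OF tendsto_norm[OF tendsto_fields(3)]]) (use g1 in blast)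

lemma u_derivative: "(u n has_derivative (\<lambda>v. fst v *\<^sub>R pd dt (u n) p + grad (u n) p *v snd v)) (at p)"
proof -
  note sm = sfield_smooth[OF u]
  have "pd v (u n) p = fst v *\<^sub>R pd dt (u n) p + grad (u n) p *v snd v" for v
  proof -
    have "v = fst v *\<^sub>R dt + (0, snd v)" by (simp add: dt_def prod_eq_iff)
    then have "pd v (u n) p = pd (fst v *\<^sub>R dt + (0, snd v)) (u n) p" by simp
    then show ?thesis by (simp add: pd_add_dir pd_scaleR_dir grad_mv sm)
  qed
  then have eq: "(\<lambda>v. pd v (u n) p) = (\<lambda>v. fst v *\<^sub>R pd dt (u n) p + grad (u n) p *v snd v)" by blast
  show ?thesis using smooth_has_derivative[OF sm, of n p] unfolding eq .
qed

lemma U_derivative: "(U has_derivative (\<lambda>v. fst v *\<^sub>R V p + G p *v snd v)) (at p)"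
proof -
  have "\<exists>g. \<forall>x\<in>UNIV. (\<lambda>n. u n x) \<longlonglongrightarrow> g x \<and> (g has_derivative (\<lambda>v. fst v *\<^sub>R V x + G x *v snd v)) (at x within UNIV)"
  proof (rule has_derivative_sequence[where f = u and f' = "\<lambda>n x v. fst v *\<^sub>R pd dt (u n) x + grad (u n) x *v snd v" and ?x0.0 = 0 and l = "U 0"])
    show "(u n has_derivative (\<lambda>v. fst v *\<^sub>R pd dt (u n) x + grad (u n) x *v snd v)) (at x within UNIV)" for n x
      by (rule u_derivative)
    fix d :: real assume "d > 0"
    \<comment> \<open>One third for the velocity and two thirds for the gradient, because of the
      factor 2 in \<open>norm_mv_le\<close>.\<close>
    then have "\<forall>\<^sub>F n in sequentially. e n < d / 3" by (intro order_tendstoD(2)[OF e]) simp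
    then show "\<forall>\<^sub>F n in sequentially. \<forall>x\<in>UNIV. \<forall>h. norm (fst h *\<^sub>R pd dt (u n) x + grad (u n) x *v snd h -
        (fst h *\<^sub>R V x + G x *v snd h)) \<le> d * norm h"
    proof (rule eventually_mono, intro ballI allI)
      fix n x and h :: pt assume n: "e n < d / 3"
      have h: "\<bar>fst h\<bar> \<le> norm h" "norm (snd h) \<le> norm h"
        using norm_fst_le[of "fst h" "snd h"] norm_snd_le[of "snd h" "fst h"] by simp_all
      have "norm (fst h *\<^sub>R (pd dt (u n) x - V x)) \<le> norm h * e n"
        unfolding norm_scaleR by (intro mult_mono eV) (use h in auto)
      moreover have "norm ((grad (u n) x - G x) *v snd h) \<le> 2 * e n * norm h"
        by (rule order_trans[OF norm_mv_le], intro mult_mono) (use eG h e_nonneg in auto)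
      moreover have "fst h *\<^sub>R pd dt (u n) x + grad (u n) x *v snd h - (fst h *\<^sub>R V x + G x *v snd h) =
        fst h *\<^sub>R (pd dt (u n) x - V x) + (grad (u n) x - G x) *v snd h"
        by (simp add: algebra_simps mv_lin)
      ultimately have "norm (fst h *\<^sub>R pd dt (u n) x + grad (u n) x *v snd h - (fst h *\<^sub>R V x + G x *v snd h)) \<le> 3 * e n * norm h"
        using norm_triangle_ineq[of "fst h *\<^sub>R (pd dt (u n) x - V x)" "(grad (u n) x - G x) *v snd h"] by (simp add: algebra_simps)
      also have "\<dots> \<le> d * norm h" using n by (intro mult_right_mono) auto
      finally show "norm (fst h *\<^sub>R pd dt (u n) x + grad (u n) x *v snd h - (fst h *\<^sub>R V x + G x *v snd h)) \<le> d * norm h" .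
    qed
  qed (auto intro: tendsto_fields)
  then obtain g where g: "\<And>x. (\<lambda>n. u n x) \<longlonglongrightarrow> g x" "\<And>x. (g has_derivative (\<lambda>v. fst v *\<^sub>R V x + G x *v snd v)) (at x)" by auto
  have "g = U" using LIMSEQ_unique[OF g(1) tendsto_fields(1)] by blast
  then show ?thesis using g(2) by simp
qed

lemma C1_U: "C1_spacetime T (\<lambda>t x. U (t, x))"
  unfolding C1_spacetime_def
proof (intro conjI ballI periodic)
  define D :: "pt \<Rightarrow> (pt \<Rightarrow>\<^sub>L (real^2))" where "D p = Blinfun (\<lambda>v. fst v *\<^sub>R V p + G p *v snd v)" for p
  have D: "blinfun_apply (D p) = (\<lambda>v. fst v *\<^sub>R V p + G p *v snd v)" for p
    unfolding D_def by (rule bounded_linear_Blinfun_apply[OF has_derivative_bounded_linear[OF U_derivative]])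
  have "continuous_on ({0..T} \<times> UNIV) D"
    by (rule continuous_on_blinfun_componentwise)
      (auto simp: D intro!: continuous_intros continuous_on_subset[OF cont(2)]
        bounded_bilinear.continuous_on[OF bounded_bilinear_mv] continuous_on_subset[OF cont(3)])
  moreover have "((\<lambda>(t, x). U (t, x)) has_derivative blinfun_apply (D p)) (at p within {0..T} \<times> UNIV)" for p
    unfolding D by (rule has_derivative_at_withinI) (simp add: U_derivative)
  ultimately show "\<exists>u'. continuous_on ({0..T} \<times> UNIV) u' \<and>
    (\<forall>p\<in>{0..T} \<times> UNIV. ((\<lambda>(t, x). U (t, x)) has_derivative blinfun_apply (u' p)) (at p within {0..T} \<times> UNIV))" by blast
qed

lemma U_time_derivative: "((\<lambda>t. U (t, x)) has_vector_derivative V (t, x)) (at t within S)"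
proof -
  have "((\<lambda>t. (t, x)) has_derivative (\<lambda>h. (h, 0))) (at t within S)" by (auto intro!: derivative_eq_intros)
  from has_derivative_compose[OF this U_derivative]
  show ?thesis by (simp add: has_vector_derivative_def)
qed

lemma grad_slice: "(\<chi> i j. pd (axis j 1) (\<lambda>x. u n (t, x)) x $ i) = grad (u n) (t, x)"
  by (simp add: grad_def pd_slice[OF sfield_smooth[OF u]] dx_def vec_eq_iff)

lemma weak_gradient_U: "has_weak_gradient (\<lambda>x. U (t, x)) (\<lambda>x. G (t, x))"
proof (rule weak_gradient_uniform_limit[where w = "\<lambda>n x. u n (t, x)" and G = "\<lambda>n x. grad (u n) (t, x)", OF _ _ _ _ _ _ _ _ _ e])
  show "has_weak_gradient (\<lambda>x. u n (t, x)) (\<lambda>x. grad (u n) (t, x))" for n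
    using smooth_weak_gradient[OF smooth_slice[OF sfield_smooth[OF u]] periodic_slice[OF u], of n t] unfolding grad_slice .
  show "continuous_on UNIV (\<lambda>x. u n (t, x))" "continuous_on UNIV (\<lambda>x. grad (u n) (t, x))" for n
    by (intro smooth_continuous_on smooth_slice smooth_grad sfield_smooth[OF u])+
qed (intro cont_slice periodic eU eG)+

lemma U_C_time_H1: "(\<lambda>t x. U (t, x)) \<in> C_time T H1 H1_norm"
  unfolding C_time_def
proof (intro CollectI conjI ballI)
  show "(\<lambda>x. U (t, x)) \<in> H1" for t using weak_gradient_U by (auto simp: H1_def)
  fix t assume t: "t \<in> {0..T}"
  \<comment> \<open>By uniqueness of weak gradients, the \<open>H1\<close> norm of the difference
    can be computed from \<open>G\<close>.\<close>
  have w: "has_weak_gradient (\<lambda>x. U (s, x) - U (t, x)) (\<lambda>x. G (s, x) - G (t, x))" for s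
    using weak_gradient_combination[OF weak_gradient_U[of s] weak_gradient_U[of t], of 1 "-1"] by simp
  have "((\<lambda>s. sqrt ((L2_norm (\<lambda>x. U (s, x) - U (t, x)))\<^sup>2 + (L2_norm (\<lambda>x. G (s, x) - G (t, x)))\<^sup>2)) \<longlongrightarrow> sqrt (0\<^sup>2 + 0\<^sup>2))
    (at t within {0..T})"
    using C_time_L2[OF cont(1) periodic(1), of T] C_time_L2[OF cont(3) periodic(3), of T] t
    unfolding C_time_def by (intro tendsto_intros) auto
  then show "((\<lambda>s. H1_norm (\<lambda>x. U (s, x) - U (t, x))) \<longlongrightarrow> 0) (at t within {0..T})"
    unfolding H1_norm_def L2_norm_weak_gradient[OF w] by simp
qed

lemma C1_time: "C1_time_L2 T (\<lambda>t x. U (t, x)) (\<lambda>t x. V (t, x))"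
  unfolding C1_time_L2_def
proof (intro conjI ballI C_time_L2 cont periodic)
  fix t assume t: "t \<in> {0..T}"
  show "((\<lambda>s. L2_norm (\<lambda>x. (U (s, x) - U (t, x)) /\<^sub>R (s - t) - V (t, x))) \<longlongrightarrow> 0) (at t within {0..T})"
  proof (rule time_limitI[where C = "sqrt vol + 1"])
    fix d :: real assume d: "d > 0"
    obtain \<delta> where \<delta>: "\<delta> > 0" "\<And>s t x. s \<in> {0..T} \<Longrightarrow> t \<in> {0..T} \<Longrightarrow> \<bar>s - t\<bar> < \<delta> \<Longrightarrow> s \<noteq> t \<Longrightarrow> x \<in> torus \<Longrightarrow>
        norm ((U (s, x) - U (t, x)) /\<^sub>R (s - t) - V (t, x)) \<le> d"
      by (rule difference_quotient[OF U_time_derivative cont(2) d]) (rule that; assumption)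
    have "L2_norm (\<lambda>x. (U (s, x) - U (t, x)) /\<^sub>R (s - t) - V (t, x)) \<le> d * (sqrt vol + 1)"
      if s: "s \<in> {0..T}" "\<bar>s - t\<bar> < \<delta>" "s \<noteq> t" for s
    proof -
      have "L2_norm (\<lambda>x. (U (s, x) - U (t, x)) /\<^sub>R (s - t) - V (t, x)) \<le> d * sqrt vol"
        by (rule L2_norm_bound) (rule \<delta>(2)[OF s(1) t s(2,3)])
      then show ?thesis using d by (simp add: algebra_simps)
    qed
    then show "\<exists>\<delta>>0. \<forall>s\<in>{0..T}. \<bar>s - t\<bar> < \<delta> \<longrightarrow> s \<noteq> t \<longrightarrow>
       L2_norm (\<lambda>x. (U (s, x) - U (t, x)) /\<^sub>R (s - t) - V (t, x)) \<le> d * (sqrt vol + 1)" using \<delta>(1) by blast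
  qed (use vol_nonneg in \<open>auto intro: L2_norm_nonneg add_nonneg_pos\<close>)
qed

end

section \<open>Integrals over time and space-time\<close>

lemma time_integral:
  fixes f :: "real \<Rightarrow> 'b::euclidean_space"
  assumes "continuous_on {0..T} f"
  shows "integrable (lebesgue_on {0<..<T}) f" "integral\<^sup>L (lebesgue_on {0<..<T}) f = integral {0..T} f"
proof -
  have "set_integrable lebesgue {0..T} f" by (rule absolutely_integrable_continuous_real[OF assms])
  then have "set_integrable lebesgue {0<..<T} f" by (rule set_integrable_subset) auto
  then show i: "integrable (lebesgue_on {0<..<T}) f" by (simp add: integrable_restrict_space set_integrable_def)
  have "integral\<^sup>L (lebesgue_on {0<..<T}) f = integral {0<..<T} f"
    by (rule lebesgue_integral_eq_integral[OF i]) simp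
  also have "\<dots> = integral {0..T} f"
    using integral_open_interval[of 0 T f] by (simp add: box_real)
  finally show "integral\<^sup>L (lebesgue_on {0<..<T}) f = integral {0..T} f" .
qed

lemma spacetime_cbox: "{0..T::real} \<times> torus = cbox (0, \<chi> i. -pi) (T, \<chi> i. pi)"
  unfolding torus_def cbox_Pair_eq box_real by simp

lemma spacetime_sets: "{0<..<T::real} \<times> torus \<in> sets lebesgue" "{0..T} \<times> torus \<in> sets lebesgue"
proof -
  have "open (fst -` {0<..<T} :: pt set)" by (intro open_vimage continuous_intros open_greaterThanLessThan)
  then have "(fst -` {0<..<T} :: pt set) \<inter> ({0..T} \<times> torus) \<in> sets borel"
    unfolding spacetime_cbox by (intro sets.Int) auto
  moreover have "{0<..<T::real} \<times> torus = (fst -` {0<..<T}) \<inter> ({0..T} \<times> torus)" by auto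
  ultimately show "{0<..<T::real} \<times> torus \<in> sets lebesgue" by simp
  show "{0..T} \<times> torus \<in> sets lebesgue" unfolding spacetime_cbox by simp
qed

lemma spacetime_integral:
  fixes f :: "pt \<Rightarrow> 'b::euclidean_space"
  assumes f: "continuous_on UNIV f"
  shows "integrable (lebesgue_on ({0<..<T} \<times> torus)) f"
    "integral\<^sup>L (lebesgue_on ({0<..<T} \<times> torus)) f = integral ({0..T} \<times> torus) f"
proof -
  have "set_integrable lebesgue ({0..T} \<times> torus) f"
    unfolding spacetime_cbox by (rule absolutely_integrable_continuous[OF continuous_on_subset[OF f]]) simp
  then have "set_integrable lebesgue ({0<..<T} \<times> torus) f" by (rule set_integrable_subset) (auto simp: spacetime_sets)
  then show i: "integrable (lebesgue_on ({0<..<T} \<times> torus)) f" by (simp add: integrable_restrict_space set_integrable_def spacetime_sets)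
  \<comment> \<open>The slices at the times 0 and \<open>T\<close> are null sets, so open and closed
    time intervals give the same integral.\<close>
  have n: "negligible {p :: pt. fst p = s}" for s
  proof -
    have "(1, 0) \<in> (Basis :: pt set)" by (simp add: Basis_prod_def)
    from negligible_standard_hyperplane[OF this, of s] show ?thesis by (simp add: inner_prod_def)
  qed
  have "integral\<^sup>L (lebesgue_on ({0<..<T} \<times> torus)) f = integral ({0<..<T} \<times> torus) f"
    by (rule lebesgue_integral_eq_integral[OF i spacetime_sets(1)])
  also have "\<dots> = integral ({0..T} \<times> torus) f"
  proof (rule integral_spike_set)
    show "negligible {p \<in> {0<..<T} \<times> torus - {0..T} \<times> torus. f p \<noteq> 0}" by (rule negligible_subset[OF negligible_empty]) auto
    show "negligible {p \<in> {0..T} \<times> torus - {0<..<T} \<times> torus. f p \<noteq> 0}"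
      by (rule negligible_subset[OF negligible_Un[OF n[of 0] n[of T]]]) auto
  qed
  finally show "integral\<^sup>L (lebesgue_on ({0<..<T} \<times> torus)) f = integral ({0..T} \<times> torus) f" .
qed

lemma spacetime_iterated:
  fixes f :: "pt \<Rightarrow> 'b::euclidean_space"
  assumes f: "continuous_on UNIV f"
  shows "integral ({0..T} \<times> torus) f = integral {0..T} (\<lambda>t. integral torus (\<lambda>x. f (t, x)))"
    "integral ({0..T} \<times> torus) f = integral torus (\<lambda>x. integral {0..T} (\<lambda>t. f (t, x)))"
proof -
  have c: "continuous_on S f" for S by (rule continuous_on_subset[OF f]) simp
  show 1: "integral ({0..T} \<times> torus) f = integral {0..T} (\<lambda>t. integral torus (\<lambda>x. f (t, x)))"
    unfolding spacetime_cbox unfolding torus_def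
    using integral_prod_continuous[OF c, of 0 "\<chi> i. -pi" T "\<chi> i. pi"] by simp
  show "integral ({0..T} \<times> torus) f = integral torus (\<lambda>x. integral {0..T} (\<lambda>t. f (t, x)))"
    unfolding 1 unfolding torus_def
    using integral_swap_continuous[of 0 "\<chi> i. -pi" T "\<chi> i. pi" "\<lambda>t x. f (t, x)"] c by (simp add: case_prod_beta')
qed

lemma continuous_on_slice: "continuous_on UNIV W \<Longrightarrow> continuous_on UNIV (\<lambda>x. W (t, x))"
  by (rule continuous_on_compose2[where g = W]) (auto intro!: continuous_intros)

lemma inner_continuous_time:
  fixes W :: "pt \<Rightarrow> 'b::euclidean_space"
  assumes w: "integrable \<mu> w" and W: "continuous_on UNIV W"
  shows "continuous_on {0..T} (\<lambda>t. \<integral>x. W (t, x) \<bullet> w x \<partial>\<mu>)"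
  unfolding continuous_on_iff
proof (intro ballI allI impI)
  fix t d :: real assume t: "t \<in> {0..T}" and d: "d > 0"
  define N where "N = (\<integral>x. norm (w x) \<partial>\<mu>)"
  have N: "N \<ge> 0" by (simp add: N_def)
  define d' where "d' = d / (N + 1)"
  have d': "d' > 0" "d' * N < d" using d N by (auto simp: d'_def field_simps)
  obtain \<delta> where \<delta>: "\<delta> > 0" "\<And>s t x. s \<in> {0..T} \<Longrightarrow> t \<in> {0..T} \<Longrightarrow> x \<in> torus \<Longrightarrow> \<bar>s - t\<bar> < \<delta> \<Longrightarrow> dist (W (s, x)) (W (t, x)) < d'"
    using slice_close[OF W d'(1)] by blast
  show "\<exists>\<delta>>0. \<forall>s\<in>{0..T}. dist s t < \<delta> \<longrightarrow> dist (\<integral>x. W (s, x) \<bullet> w x \<partial>\<mu>) (\<integral>x. W (t, x) \<bullet> w x \<partial>\<mu>) < d"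
  proof (intro exI[of _ \<delta>] conjI ballI impI \<delta>(1))
    fix s assume s: "s \<in> {0..T}" "dist s t < \<delta>"
    have "norm (W (s, x) - W (t, x)) \<le> d'" if "x \<in> torus" for x
      using \<delta>(2)[OF s(1) t that] s(2) by (simp add: dist_norm dist_real_def less_imp_le)
    from inner_diff_bound[OF w continuous_on_slice[OF W] continuous_on_slice[OF W] this]
    show "dist (\<integral>x. W (s, x) \<bullet> w x \<partial>\<mu>) (\<integral>x. W (t, x) \<bullet> w x \<partial>\<mu>) < d"
      using d'(2) unfolding dist_real_def N_def by linarith
  qed
qed

lemma smooth_time_derivative: "smooth f \<Longrightarrow> ((\<lambda>t. f (t, x)) has_vector_derivative pd dt f (t, x)) (at t within S)"
  for f :: "pt \<Rightarrow> 'b::euclidean_space"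
  using smooth_line_derivative[of f "(0, x)" dt t S] by (simp add: dt_def)

text \<open>\<open>w\<close> is only integrable, but the difference quotients of \<open>f\<close>
  converge uniformly in \<open>x\<close>, which suffices under the pairing.\<close>

lemma inner_time_derivative:
  fixes f :: "pt \<Rightarrow> 'b::euclidean_space"
  assumes w: "integrable \<mu> w" and f: "smooth f" and t: "t \<in> {0..T}"
  shows "((\<lambda>t. \<integral>x. f (t, x) \<bullet> w x \<partial>\<mu>) has_real_derivative (\<integral>x. pd dt f (t, x) \<bullet> w x \<partial>\<mu>)) (at t within {0..T})"
  unfolding has_field_derivative_iff
proof (rule LIM_zero_cancel, rule tendsto_norm_zero_cancel, rule time_limitI)
  define N where "N = (\<integral>x. norm (w x) \<partial>\<mu>)"
  have N: "N \<ge> 0" by (simp add: N_def)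
  show "0 < N + 1" using N by simp
  fix d :: real assume d: "d > 0"
  have c: "continuous_on UNIV f" "continuous_on UNIV (pd dt f)" by (intro smooth_continuous_on smooth_pd f)+
  obtain \<delta> where \<delta>: "\<delta> > 0" "\<And>s t x. s \<in> {0..T} \<Longrightarrow> t \<in> {0..T} \<Longrightarrow> \<bar>s - t\<bar> < \<delta> \<Longrightarrow> s \<noteq> t \<Longrightarrow> x \<in> torus \<Longrightarrow>
    norm ((f (s, x) - f (t, x)) /\<^sub>R (s - t) - pd dt f (t, x)) \<le> d"
    by (rule difference_quotient[OF smooth_time_derivative[OF f] c(2) d]) (rule that; assumption)
  have "norm (((\<integral>x. f (s, x) \<bullet> w x \<partial>\<mu>) - (\<integral>x. f (t, x) \<bullet> w x \<partial>\<mu>)) / (s - t)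
    - (\<integral>x. pd dt f (t, x) \<bullet> w x \<partial>\<mu>)) \<le> d * (N + 1)" if s: "s \<in> {0..T}" "\<bar>s - t\<bar> < \<delta>" "s \<noteq> t" for s
  proof -
    have i: "integrable \<mu> (\<lambda>x. f (r, x) \<bullet> w x)" for r
      using integrable_inner_continuous[OF w continuous_on_slice[OF c(1)]] by (simp add: inner_commute)
    have "((\<integral>x. f (s, x) \<bullet> w x \<partial>\<mu>) - (\<integral>x. f (t, x) \<bullet> w x \<partial>\<mu>)) / (s - t) =
      (\<integral>x. ((f (s, x) - f (t, x)) /\<^sub>R (s - t)) \<bullet> w x \<partial>\<mu>)"
      using i by (simp add: inner_diff_left divide_inverse mult.commute)
    moreover have "\<bar>(\<integral>x. ((f (s, x) - f (t, x)) /\<^sub>R (s - t)) \<bullet> w x \<partial>\<mu>) - (\<integral>x. pd dt f (t, x) \<bullet> w x \<partial>\<mu>)\<bar> \<le> d * N"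
      unfolding N_def
      by (rule inner_diff_bound[OF w]) (intro continuous_intros continuous_on_slice c, intro continuous_on_slice c, rule \<delta>(2)[OF s(1) t s(2,3)])
    ultimately show ?thesis using d by (simp add: algebra_simps)
  qed
  then show "\<exists>\<delta>>0. \<forall>s\<in>{0..T}. \<bar>s - t\<bar> < \<delta> \<longrightarrow> s \<noteq> t \<longrightarrow>
    norm (((\<integral>x. f (s, x) \<bullet> w x \<partial>\<mu>) - (\<integral>x. f (t, x) \<bullet> w x \<partial>\<mu>)) / (s - t)
    - (\<integral>x. pd dt f (t, x) \<bullet> w x \<partial>\<mu>)) \<le> d * (N + 1)" using \<delta>(1) by blast
qed simp

lemma compact_bound:
  fixes f :: "'a::topological_space \<Rightarrow> 'b::real_normed_vector" and g :: "'a \<Rightarrow> 'c::real_normed_vector"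
  assumes S: "compact S" and f: "continuous_on S f" and g: "continuous_on S g"
  obtains C where "C > 0" "\<And>x. x \<in> S \<Longrightarrow> norm (f x) \<le> C" "\<And>x. x \<in> S \<Longrightarrow> norm (g x) \<le> C"
proof -
  obtain C D where CD: "\<forall>y\<in>f ` S. norm y \<le> C" "\<forall>y\<in>g ` S. norm y \<le> D"
    using compact_imp_bounded[OF compact_continuous_image[OF f S]] compact_imp_bounded[OF compact_continuous_image[OF g S]]
    unfolding bounded_iff by blast
  show ?thesis
  proof (rule that[of "max 1 (max C D)"])
    show "norm (f x) \<le> max 1 (max C D)" if "x \<in> S" for x using bspec[OF CD(1) imageI[OF that]] by linarith
    show "norm (g x) \<le> max 1 (max C D)" if "x \<in> S" for x using bspec[OF CD(2) imageI[OF that]] by linarith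
  qed simp
qed

section \<open>Passage to the limit in the equation\<close>

context solution_limit
begin

definition P0 :: "mat2 \<Rightarrow> mat2" where "P0 A = (mat 1 + A) ** Sg A"

lemma P0: "first_PK a b c = P0"
  by (rule ext) (simp add: P0_def first_PK_def Sg_def)

lemma smooth_P0: "smooth P0"
  unfolding P0_def[abs_def] by (intro smooth_intros smooth_const smooth_id)

lemma cont_PG: "continuous_on UNIV (\<lambda>p. P0 (G p))"
  by (rule continuous_on_compose2[OF smooth_continuous_on[OF smooth_P0, of UNIV] cont(3)]) simp

definition "MM n p = (mat 1 + grad (u n) p) ** (Sg (grad (u n) p) + R n p)"

lemma sfield_MM: "sfield Per (MM n)"
  unfolding MM_def[abs_def] by (intro sfield_intros u R)

text \<open>All gradients lie in the unit ball, on which \<open>P0\<close> is uniformly continuous,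
  and the errors \<open>R n\<close> tend to 0 uniformly; so the full stresses of the approximations
  converge to the true stress of the limit.\<close>

lemma MM_uniform:
  assumes d: "d > 0" obtains N where "\<And>n p. n \<ge> N \<Longrightarrow> norm (MM n p - P0 (G p)) \<le> d"
proof -
  have "uniformly_continuous_on (cball 0 1) P0"
    by (intro compact_uniformly_continuous smooth_continuous_on smooth_P0 compact_cball)
  then obtain \<delta> where \<delta>: "\<delta> > 0" "\<And>A B. A \<in> cball 0 1 \<Longrightarrow> B \<in> cball 0 1 \<Longrightarrow> dist B A < \<delta> \<Longrightarrow> dist (P0 B) (P0 A) < d / 2"
    unfolding uniformly_continuous_on_def using d half_gt_zero by metis
  obtain K :: real where K: "K > 0" "\<And>(A :: mat2) (B :: mat2). norm (A ** B) \<le> norm A * norm B * K"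
    using bounded_bilinear.pos_bounded[OF bounded_bilinear_mm] by blast
  define L where "L = (norm (mat 1 :: mat2) + 1) * K"
  have L: "L > 0" unfolding L_def using K(1) by (intro mult_pos_pos add_nonneg_pos) auto
  have "\<forall>\<^sub>F n in sequentially. e n < min \<delta> (d / 2 / L)"
    by (rule order_tendstoD(2)[OF e]) (use \<delta> d L in auto)
  then obtain N where N: "\<And>n. n \<ge> N \<Longrightarrow> e n < min \<delta> (d / 2 / L)" by (auto simp: eventually_sequentially)
  show ?thesis
  proof (rule that[of N])
    fix n p assume "n \<ge> N"
    then have n: "e n < \<delta>" "e n * L < d / 2" using N[of n] L by (auto simp: pos_less_divide_eq)
    have "dist (P0 (grad (u n) p)) (P0 (G p)) < d / 2"
    proof (rule \<delta>(2))
      show "dist (grad (u n) p) (G p) < \<delta>" unfolding dist_norm using eG[of n p] n(1) by linarith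
    qed (use g1 G_bound in auto)
    moreover have "norm ((mat 1 + grad (u n) p) ** R n p) \<le> d / 2"
    proof -
      have "norm (mat 1 + grad (u n) p) \<le> norm (mat 1 :: mat2) + 1"
        using norm_triangle_ineq[of "mat 1" "grad (u n) p"] g1[of n p] by linarith
      then have "norm (mat 1 + grad (u n) p) * norm (R n p) * K \<le> (norm (mat 1 :: mat2) + 1) * e n * K"
        using eR[of n p] K(1) by (intro mult_right_mono mult_mono) auto
      also have "\<dots> = e n * L" by (simp add: L_def)
      finally show ?thesis using K(2)[of "mat 1 + grad (u n) p" "R n p"] n(2) by linarith
    qed
    moreover have eq: "MM n p - P0 (G p) = (P0 (grad (u n) p) - P0 (G p)) + (mat 1 + grad (u n) p) ** R n p"
      by (simp add: MM_def P0_def mm_lin)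
    ultimately show "norm (MM n p - P0 (G p)) \<le> d"
      unfolding eq dist_norm
      using norm_triangle_ineq[of "P0 (grad (u n) p) - P0 (G p)" "(mat 1 + grad (u n) p) ** R n p"] by linarith
  qed
qed

lemma fields_close:
  assumes d: "d > 0" obtains n where "\<And>p. norm (MM n p - P0 (G p)) \<le> d" "\<And>p. norm (pd dt (u n) p - V p) \<le> d"
proof -
  obtain N where N: "\<And>n p. n \<ge> N \<Longrightarrow> norm (MM n p - P0 (G p)) \<le> d" using MM_uniform[OF d] by blast
  have "\<forall>\<^sub>F n in sequentially. e n < d \<and> n \<ge> N" by (intro eventually_conj order_tendstoD(2)[OF e d] eventually_ge_at_top)
  then obtain n where n: "e n < d" "n \<ge> N" by (auto simp: eventually_sequentially)
  show ?thesis
  proof (rule that[of n])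
    show "norm (pd dt (u n) p - V p) \<le> d" for p using eV[of n p] n by linarith
  qed (rule N[OF n(2)])
qed

definition "FF t = pair (\<lambda>x. P0 (G (t, x)))"

lemma cont_PG_slice: "continuous_on UNIV (\<lambda>x. P0 (G (t, x)))"
  by (rule continuous_on_slice[OF cont_PG])

text \<open>The limit stress is uniformly continuous on the compact space-time region, and
  \<open>pair_norm_diff\<close> transfers this to the dual norm.\<close>

lemma FF_close:
  assumes d: "d > 0"
  obtains \<delta> where "\<delta> > 0" "\<And>s t. s \<in> {0..T} \<Longrightarrow> t \<in> {0..T} \<Longrightarrow> \<bar>s - t\<bar> < \<delta> \<Longrightarrow> H_minus1_norm (\<lambda>w. FF s w - FF t w) \<le> d"
    "\<And>s t. s \<in> {0..T} \<Longrightarrow> t \<in> {0..T} \<Longrightarrow> \<bar>s - t\<bar> < \<delta> \<Longrightarrow> \<bar>H_minus1_norm (FF s) - H_minus1_norm (FF t)\<bar> \<le> d"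
proof -
  have dK: "d / K1 > 0" using d K1_pos by simp
  obtain \<delta> where \<delta>: "\<delta> > 0" "\<And>s t x. s \<in> {0..T} \<Longrightarrow> t \<in> {0..T} \<Longrightarrow> x \<in> torus \<Longrightarrow> \<bar>s - t\<bar> < \<delta> \<Longrightarrow> dist (P0 (G (s, x))) (P0 (G (t, x))) < d / K1"
    using slice_close[OF cont_PG dK] by blast
  have *: "H_minus1_norm (\<lambda>w. FF s w - FF t w) \<le> d \<and> H_minus1_norm (FF s) - H_minus1_norm (FF t) \<le> d"
    if st: "s \<in> {0..T}" "t \<in> {0..T}" "\<bar>s - t\<bar> < \<delta>" for s t
  proof -
    have "norm (P0 (G (s, x)) - P0 (G (t, x))) \<le> d / K1" if "x \<in> torus" for x
      using \<delta>(2)[OF st(1,2) that st(3)] by (simp add: dist_norm)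
    from pair_norm_diff(1,3)[OF cont_PG_slice cont_PG_slice this]
    show ?thesis using K1_pos unfolding FF_def by simp
  qed
  show ?thesis
  proof (rule that[OF \<delta>(1)])
    fix s t assume st: "s \<in> {0..T}" "t \<in> {0..T}" "\<bar>s - t\<bar> < \<delta>"
    show "H_minus1_norm (\<lambda>w. FF s w - FF t w) \<le> d" using *[OF st] by blast
    show "\<bar>H_minus1_norm (FF s) - H_minus1_norm (FF t)\<bar> \<le> d"
      using *[OF st] *[OF st(2,1)] st(3) by (simp add: abs_le_iff abs_minus_commute)
  qed
qed

lemma FF_mem: "FF t \<in> H_minus1"
  unfolding FF_def by (rule pair_H_minus1[OF cont_PG_slice])

lemma FF_diff_nonneg: "0 \<le> H_minus1_norm (\<lambda>w. FF s w - FF t w)"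
proof -
  have c: "continuous_on UNIV (\<lambda>x. P0 (G (s, x)) - P0 (G (t, x)))" by (intro continuous_intros cont_PG_slice)
  obtain B where B: "\<And>x. x \<in> torus \<Longrightarrow> norm (P0 (G (s, x)) - P0 (G (t, x))) \<le> B"
    using torus_continuous_bounded[OF c] by blast
  show ?thesis unfolding FF_def by (rule pair_norm_diff(2)[OF cont_PG_slice cont_PG_slice B])
qed

lemma FF_time: "FF \<in> L2_time_H_minus1 T"
  unfolding L2_time_H_minus1_def
proof (intro CollectI conjI ballI)
  show "FF t \<in> H_minus1" for t by (rule FF_mem)
  have "continuous_on {0..T} (\<lambda>t. H_minus1_norm (FF t))"
    unfolding continuous_on_iff
  proof (intro ballI allI impI)
    fix t d :: real assume t: "t \<in> {0..T}" and "d > 0"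
    then have d2: "d / 2 > 0" by simp
    obtain \<delta> where \<delta>: "\<delta> > 0" "\<And>s t. s \<in> {0..T} \<Longrightarrow> t \<in> {0..T} \<Longrightarrow> \<bar>s - t\<bar> < \<delta> \<Longrightarrow> \<bar>H_minus1_norm (FF s) - H_minus1_norm (FF t)\<bar> \<le> d / 2"
      using FF_close[OF d2] by metis
    have "dist (H_minus1_norm (FF s)) (H_minus1_norm (FF t)) < d" if "s \<in> {0..T}" "dist s t < \<delta>" for s
    proof -
      have "\<bar>H_minus1_norm (FF s) - H_minus1_norm (FF t)\<bar> \<le> d / 2"
        by (rule \<delta>(2)[OF that(1) t]) (use that(2) in \<open>simp add: dist_real_def\<close>)
      then show ?thesis using \<open>d > 0\<close> unfolding dist_real_def by linarith
    qed
    then show "\<exists>\<delta>>0. \<forall>s\<in>{0..T}. dist s t < \<delta> \<longrightarrow> dist (H_minus1_norm (FF s)) (H_minus1_norm (FF t)) < d"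
      using \<delta>(1) by blast
  qed
  then show "integrable (lebesgue_on {0<..<T}) (\<lambda>t. (H_minus1_norm (FF t))\<^sup>2)"
    by (intro time_integral(1) continuous_on_power)
  \<comment> \<open>Simple functions that take the value of \<open>FF\<close> at the left end of a
    grid cell of length \<open>T / (n + 1)\<close>; at most \<open>n + 1\<close> grid points
    occur.\<close>
  define k where "k n t = \<lfloor>t / T * (real n + 1)\<rfloor>" for n :: nat and t
  define gr where "gr n j = T * (real_of_int j / (real n + 1))" for n :: nat and j :: int
  define S where "S n t = FF (gr n (k n t))" for n t
  have k: "k n t \<in> {0..int n}" if "t \<in> {0<..<T}" for n t
  proof -
    have "0 \<le> t / T * (real n + 1)" using that T by simp
    moreover have "t / T * (real n + 1) < 1 * (real n + 1)" using that T by (intro mult_strict_right_mono) auto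
    ultimately show ?thesis unfolding k_def by (auto simp: floor_le_iff)
  qed
  have gr: "gr n (k n t) \<in> {0..T} \<and> \<bar>gr n (k n t) - t\<bar> \<le> T / (real n + 1)" if t: "t \<in> {0<..<T}" for n t
  proof -
    have 0: "0 \<le> real_of_int (k n t)" using k[OF t, of n] by simp
    have 1: "real_of_int (k n t) \<le> t / T * (real n + 1)" "t / T * (real n + 1) < real_of_int (k n t) + 1"
      unfolding k_def by linarith+
    have "gr n (k n t) \<le> T * ((t / T * (real n + 1)) / (real n + 1))"
      unfolding gr_def using 1(1) T by (intro mult_left_mono divide_right_mono) auto
    also have "\<dots> = t" using T by simp
    finally have 2: "gr n (k n t) \<le> t" .
    have "T * ((t / T * (real n + 1)) / (real n + 1)) \<le> T * ((real_of_int (k n t) + 1) / (real n + 1))"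
      using 1(2) T by (intro mult_left_mono divide_right_mono) auto
    also have "\<dots> = gr n (k n t) + T / (real n + 1)" by (simp add: gr_def add_divide_distrib distrib_left)
    finally have "T * ((t / T * (real n + 1)) / (real n + 1)) \<le> gr n (k n t) + T / (real n + 1)" .
    moreover have "T * ((t / T * (real n + 1)) / (real n + 1)) = t" using T by simp
    ultimately have 3: "t \<le> gr n (k n t) + T / (real n + 1)" by simp
    have 4: "0 \<le> gr n (k n t)" using 0 T by (simp add: gr_def)
    show ?thesis using 2 3 4 t by auto
  qed
  show "\<exists>S. (\<forall>n::nat. finite (S n ` {0<..<T}) \<and> S n ` {0<..<T} \<subseteq> H_minus1 \<and>
                 (\<forall>L. {t\<in>{0<..<T}. S n t = L} \<in> sets lebesgue)) \<and>
          (AE t in lebesgue_on {0<..<T}. (\<lambda>n. H_minus1_norm (\<lambda>w. S n t w - FF t w)) \<longlonglongrightarrow> 0)"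
  proof (intro exI[of _ S] conjI allI)
    show "finite (S n ` {0<..<T})" for n
    proof (rule finite_subset)
      show "S n ` {0<..<T} \<subseteq> (\<lambda>j. FF (gr n j)) ` {0..int n}" using k by (auto simp: S_def)
    qed simp
    show "S n ` {0<..<T} \<subseteq> H_minus1" for n using FF_mem by (auto simp: S_def)
    show "{t\<in>{0<..<T}. S n t = L} \<in> sets lebesgue" for n L
    proof -
      have "k n \<in> measurable borel (count_space UNIV)"
        unfolding k_def[abs_def] by measurable
      from measurable_sets[OF this, of "{j. FF (gr n j) = L}"]
      have "k n -` {j. FF (gr n j) = L} \<in> sets borel" by simp
      then have "{0<..<T} \<inter> k n -` {j. FF (gr n j) = L} \<in> sets borel" by (intro sets.Int) auto
      moreover have "{t\<in>{0<..<T}. S n t = L} = {0<..<T} \<inter> k n -` {j. FF (gr n j) = L}" by (auto simp: S_def)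
      ultimately show ?thesis by simp
    qed
    show "AE t in lebesgue_on {0<..<T}. (\<lambda>n. H_minus1_norm (\<lambda>w. S n t w - FF t w)) \<longlonglongrightarrow> 0"
    proof (rule AE_I2)
      fix t assume "t \<in> space (lebesgue_on {0<..<T})"
      then have t: "t \<in> {0<..<T}" by simp
      show "(\<lambda>n. H_minus1_norm (\<lambda>w. S n t w - FF t w)) \<longlonglongrightarrow> 0"
      proof (rule tendstoI)
        fix d :: real assume "d > 0"
        then have d2: "d / 2 > 0" by simp
        obtain \<delta> where \<delta>: "\<delta> > 0" "\<And>s t. s \<in> {0..T} \<Longrightarrow> t \<in> {0..T} \<Longrightarrow> \<bar>s - t\<bar> < \<delta> \<Longrightarrow> H_minus1_norm (\<lambda>w. FF s w - FF t w) \<le> d / 2"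
          using FF_close[OF d2] by metis
        have "(\<lambda>n. T / (real n + 1)) \<longlonglongrightarrow> 0"
          using LIMSEQ_Suc[OF lim_const_over_n[of T]] by (simp add: add.commute)
        then have "\<forall>\<^sub>F n in sequentially. T / (real n + 1) < \<delta>" using \<delta>(1) by (rule order_tendstoD(2))
        then show "\<forall>\<^sub>F n in sequentially. dist (H_minus1_norm (\<lambda>w. S n t w - FF t w)) 0 < d"
        proof (rule eventually_mono)
          fix n assume n: "T / (real n + 1) < \<delta>"
          have "H_minus1_norm (\<lambda>w. S n t w - FF t w) \<le> d / 2"
            unfolding S_def using gr[OF t, of n] n t by (intro \<delta>(2)) auto
          then show "dist (H_minus1_norm (\<lambda>w. S n t w - FF t w)) 0 < d"
            using FF_diff_nonneg[of "gr n (k n t)" t] \<open>d > 0\<close> by (simp add: S_def dist_real_def)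
        qed
      qed
    qed
  qed
qed

lemma dvg_MM_slice: "(\<chi> i. \<Sum>j\<in>UNIV. pd (axis j 1) (\<lambda>x. MM n (t, x)) x $ i $ j) = pd dt (pd dt (u n)) (t, x)"
  unfolding eqn MM_def[symmetric, abs_def] dvg_def
  by (simp add: pd_slice[OF sfield_smooth[OF sfield_MM]] dx_def)

text \<open>The equation of the approximation integrated by parts in space only, since the time
  derivative is treated differently in the two uses.\<close>

lemma acceleration:
  assumes w: "has_weak_gradient w H"
  shows "(\<integral>x. pd dt (pd dt (u n)) (t, x) \<bullet> w x \<partial>\<mu>) = - (\<integral>x. H x \<bullet> MM n (t, x) \<partial>\<mu>)"
  using weak_gradient_dvg[OF w smooth_slice[OF sfield_smooth[OF sfield_MM]] periodic_slice[OF sfield_MM], of n t]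
  unfolding dvg_MM_slice by (simp add: inner_commute)

text \<open>For the approximations, \<open>acceleration\<close> says that \<open>An\<close> has
  derivative \<open>- Bn\<close>. Multiplied by \<open>phi\<close>, which vanishes at both ends,
  this integrates to 0. \<open>An\<close> and \<open>Bn\<close> converge uniformly in time, so the
  limit \<open>J\<close> is below every positive number.\<close>

lemma weak_acceleration: "weak_time_derivative T (\<lambda>t x. V (t, x)) FF"
  unfolding weak_time_derivative_def
proof (intro allI impI ballI)
  fix phi :: "real \<Rightarrow> real" and w
  assume "smooth phi \<and> (\<exists>t0 t1. 0 < t0 \<and> t1 < T \<and> (\<forall>t. t \<notin> {t0..t1} \<longrightarrow> phi t = 0))" and w: "w \<in> H1"
  then obtain t0 t1 where phi: "smooth phi" and ab: "0 < t0" "t1 < T" "\<And>t. t \<notin> {t0..t1} \<Longrightarrow> phi t = 0" by blast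
  have phi0: "phi 0 = 0" "phi T = 0" using ab T by auto
  have dphi: "(phi has_real_derivative pd 1 phi t) (at t within S)" for t S
    using smooth_line_derivative[OF phi, of 0 1 t S] by (simp add: has_real_derivative_iff_has_vector_derivative)
  have der: "deriv phi t = pd 1 phi t" for t using dphi[of t UNIV] by (simp add: DERIV_imp_deriv)
  have cphi: "continuous_on S phi" "continuous_on S (pd 1 phi)" for S by (intro smooth_continuous_on smooth_pd phi)+
  define g where "g = weak_gradient w"
  have wg: "has_weak_gradient w g" unfolding g_def by (rule weak_gradient_works[OF w])
  have iw: "integrable \<mu> w" and ig: "integrable \<mu> g"
    using L2_torus_integrable weak_gradientD(1,2)[OF wg] by auto
  define A where "A t = (\<integral>x. V (t, x) \<bullet> w x \<partial>\<mu>)" for t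
  define B where "B t = (\<integral>x. P0 (G (t, x)) \<bullet> g x \<partial>\<mu>)" for t
  define An where "An n t = (\<integral>x. pd dt (u n) (t, x) \<bullet> w x \<partial>\<mu>)" for n t
  define Bn where "Bn n t = (\<integral>x. MM n (t, x) \<bullet> g x \<partial>\<mu>)" for n t
  have sv: "smooth (pd dt (u n))" for n by (intro smooth_pd sfield_smooth[OF u])
  have cM: "continuous_on UNIV (MM n)" for n by (rule smooth_continuous_on[OF sfield_smooth[OF sfield_MM]])
  have cAB: "continuous_on {0..T} A" "continuous_on {0..T} B" "continuous_on {0..T} (An n)" "continuous_on {0..T} (Bn n)" for n
    unfolding A_def[abs_def] B_def[abs_def] An_def[abs_def] Bn_def[abs_def]
    by (intro inner_continuous_time iw ig cont cont_PG cM smooth_continuous_on sv)+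
  define J where "J = integral {0..T} (\<lambda>t. pd 1 phi t * A t - phi t * B t)"
  have zero: "integral {0..T} (\<lambda>t. pd 1 phi t * An n t - phi t * Bn n t) = 0" for n
  proof -
    have "((\<lambda>t. phi t * An n t) has_vector_derivative (pd 1 phi t * An n t - phi t * Bn n t)) (at t within {0..T})" if t: "t \<in> {0..T}" for t
    proof -
      have "(An n has_real_derivative - Bn n t) (at t within {0..T})"
        using inner_time_derivative[OF iw sv t, of n] acceleration[OF wg, of n t]
        by (simp add: An_def[abs_def] Bn_def inner_commute)
      from DERIV_mult[OF dphi this] show ?thesis
        by (simp add: has_real_derivative_iff_has_vector_derivative[symmetric] mult.commute)
    qed
    then have "((\<lambda>t. pd 1 phi t * An n t - phi t * Bn n t) has_integral (phi T * An n T - phi 0 * An n 0)) {0..T}"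
      using T by (intro fundamental_theorem_of_calculus) auto
    then show ?thesis using phi0 by (simp add: integral_unique)
  qed
  have cJ: "continuous_on {0..T} (\<lambda>t. pd 1 phi t * A t - phi t * B t)" "continuous_on {0..T} (\<lambda>t. pd 1 phi t * An n t - phi t * Bn n t)" for n
    by (intro continuous_intros cphi cAB)+
  obtain C where C': "C > 0" "\<And>t. t \<in> {0..T} \<Longrightarrow> norm (phi t) \<le> C" "\<And>t. t \<in> {0..T} \<Longrightarrow> norm (pd 1 phi t) \<le> C"
    using compact_bound[OF compact_Icc cphi] by metis
  note C = C'[unfolded real_norm_def]
  define N where "N = (\<integral>x. norm (w x) \<partial>\<mu>) + (\<integral>x. norm (g x) \<partial>\<mu>)"
  have N: "N \<ge> 0" by (simp add: N_def)
  have "\<bar>J\<bar> \<le> 0 + d" if d: "d > 0" for d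
  proof -
    define d' where "d' = d / (C * N * T + 1)"
    have CNT: "C * N * T \<ge> 0" using C(1) N T by simp
    have d': "d' > 0" "d' * (C * N * T) \<le> d" using d CNT by (auto simp: d'_def field_simps)
    obtain n where n: "\<And>p. norm (MM n p - P0 (G p)) \<le> d'" "\<And>p. norm (pd dt (u n) p - V p) \<le> d'" using fields_close[OF d'(1)] by blast
    have a: "\<bar>An n t - A t\<bar> \<le> d' * (\<integral>x. norm (w x) \<partial>\<mu>)" for t
      unfolding An_def A_def
    proof (rule inner_diff_bound[OF iw])
      show "norm (pd dt (u n) (t, x) - V (t, x)) \<le> d'" for x by (rule n)
    qed (intro continuous_on_slice smooth_continuous_on sv cont)+
    have b: "\<bar>Bn n t - B t\<bar> \<le> d' * (\<integral>x. norm (g x) \<partial>\<mu>)" for t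
      unfolding Bn_def B_def
    proof (rule inner_diff_bound[OF ig])
      show "norm (MM n (t, x) - P0 (G (t, x))) \<le> d'" for x by (rule n)
    qed (intro continuous_on_slice cM cont_PG)+
    have "J = integral {0..T} (\<lambda>t. (pd 1 phi t * A t - phi t * B t) - (pd 1 phi t * An n t - phi t * Bn n t))"
      unfolding J_def using zero[of n]
      by (subst Henstock_Kurzweil_Integration.integral_diff) (auto intro!: integrable_continuous_real cJ)
    also have "norm \<dots> \<le> (C * (d' * N)) * (T - 0)"
    proof (rule integral_bound)
      fix t assume t: "t \<in> {0..T}"
      have "\<bar>pd 1 phi t * (A t - An n t)\<bar> \<le> C * (d' * (\<integral>x. norm (w x) \<partial>\<mu>))"
        unfolding abs_mult using C t a[of t] by (intro mult_mono) (auto simp: abs_minus_commute)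
      moreover have "\<bar>phi t * (B t - Bn n t)\<bar> \<le> C * (d' * (\<integral>x. norm (g x) \<partial>\<mu>))"
        unfolding abs_mult using C t b[of t] by (intro mult_mono) (auto simp: abs_minus_commute)
      moreover have "(pd 1 phi t * A t - phi t * B t) - (pd 1 phi t * An n t - phi t * Bn n t) = pd 1 phi t * (A t - An n t) - phi t * (B t - Bn n t)"
        by (simp add: algebra_simps)
      moreover have "C * (d' * N) = C * (d' * (\<integral>x. norm (w x) \<partial>\<mu>)) + C * (d' * (\<integral>x. norm (g x) \<partial>\<mu>))"
        by (simp add: N_def algebra_simps)
      ultimately show "norm ((pd 1 phi t * A t - phi t * B t) - (pd 1 phi t * An n t - phi t * Bn n t)) \<le> C * (d' * N)"
        unfolding real_norm_def by linarith
    qed (use T in \<open>auto intro!: continuous_intros cJ\<close>)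
    also have "(C * (d' * N)) * (T - 0) = d' * (C * N * T)" by simp
    finally show ?thesis using d'(2) by simp
  qed
  then have "\<bar>J\<bar> \<le> 0" by (rule field_le_epsilon)
  then have "integral {0..T} (\<lambda>t. pd 1 phi t * A t) - integral {0..T} (\<lambda>t. phi t * B t) = 0"
    unfolding J_def by (subst (asm) Henstock_Kurzweil_Integration.integral_diff)
      (auto intro!: integrable_continuous_real continuous_intros cphi cAB)
  moreover have "FF t w = - B t" for t unfolding FF_def pair_def B_def g_def by (simp add: inner_commute)
  moreover have "L2_inner (\<lambda>x. V (t, x)) w = A t" for t by (simp add: L2_inner_def A_def)
  moreover have "(\<integral>t. pd 1 phi t * A t \<partial>lebesgue_on {0<..<T}) = integral {0..T} (\<lambda>t. pd 1 phi t * A t)"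
    "(\<integral>t. phi t * B t \<partial>lebesgue_on {0<..<T}) = integral {0..T} (\<lambda>t. phi t * B t)"
    by (intro time_integral(2) continuous_intros cphi cAB)+
  ultimately show "(\<integral>t. deriv phi t * L2_inner (\<lambda>x. V (t, x)) w \<partial>lebesgue_on {0<..<T}) = - (\<integral>t. phi t * FF t w \<partial>lebesgue_on {0<..<T})"
    by (simp add: der)
qed

text \<open>Each \<open>u n\<close> satisfies the identity with stress \<open>MM n\<close>, by parts
  in space and time, and \<open>fields_close\<close> passes to the limit. The boundary term at
  \<open>T\<close> vanishes with the test function. The one at 0 vanishes with the velocity, as the
  approximations are zero before \<open>\<tau>\<close>, whatever the test function does
  there.\<close>

lemma weak_formulation:
  assumes "eta \<in> test_functions T"
  shows "(\<integral>(t, x). V (t, x) \<bullet> vector_derivative (\<lambda>s. eta s x) (at t)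
                 - P0 (G (t, x)) \<bullet> jacobian (eta t) (at x) \<partial>lebesgue_on ({0<..<T} \<times> torus)) = 0"
proof -
  define E where "E p = eta (fst p) (snd p)" for p
  have eta: "eta t x = E (t, x)" for t x by (simp add: E_def)
  have E: "smooth E" "\<And>t. torus_periodic (\<lambda>x. E (t, x))"
    using assms by (simp_all add: test_functions_def E_def[abs_def] case_prod_beta')
  have ET: "E (T, x) = 0" for x using assms by (auto simp: test_functions_def E_def)
  define I where "I p = V p \<bullet> pd dt E p - P0 (G p) \<bullet> grad E p" for p
  define In where "In n p = pd dt (u n) p \<bullet> pd dt E p - MM n p \<bullet> grad E p" for n p
  have vd: "vector_derivative (\<lambda>s. E (s, x)) (at t) = pd dt E (t, x)" for t x
    by (rule vector_derivative_at[OF smooth_time_derivative[OF E(1)]])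
  have jac: "jacobian (\<lambda>x. E (t, x)) (at x) = grad E (t, x)" for t x
    using pd_slice[OF E(1), of _ t x] by (simp add: jacobian_def matrix_def grad_def vec_eq_iff pd_def dx_def)
  have eqI: "(\<lambda>(t, x). V (t, x) \<bullet> vector_derivative (\<lambda>s. eta s x) (at t) - P0 (G (t, x)) \<bullet> jacobian (eta t) (at x)) = I"
  proof -
    have e: "eta = (\<lambda>t x. E (t, x))" by (intro ext) (simp add: E_def)
    show ?thesis unfolding e vd jac by (rule ext) (simp add: I_def case_prod_beta')
  qed
  have cE: "continuous_on UNIV E" "continuous_on UNIV (pd dt E)" "continuous_on UNIV (grad E)"
    by (intro smooth_continuous_on smooth_pd smooth_grad E)+
  have sv: "smooth (pd dt (u n))" for n by (intro smooth_pd sfield_smooth[OF u])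
  have cM: "continuous_on UNIV (MM n)" for n by (rule smooth_continuous_on[OF sfield_smooth[OF sfield_MM]])
  have cI: "continuous_on UNIV I" "continuous_on UNIV (In n)" for n
    unfolding I_def[abs_def] In_def[abs_def] by (intro continuous_intros cE cont cont_PG cM smooth_continuous_on sv)+
  have zero: "integral ({0..T} \<times> torus) (In n) = 0" for n
  proof -
    define g where "g p = pd dt (u n) p \<bullet> E p" for p
    have sg: "smooth g" unfolding g_def[abs_def] by (intro smooth_inner sv E)
    have cg: "continuous_on UNIV (pd dt g)" by (intro smooth_continuous_on smooth_pd sg)
    have pg: "pd dt g p = pd dt (u n) p \<bullet> pd dt E p + pd dt (pd dt (u n)) p \<bullet> E p" for p
      unfolding g_def[abs_def] by (rule pd_bilinear[OF bounded_bilinear_inner smooth_differentiable[OF sv] smooth_differentiable[OF E(1)]])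
    have "integral torus (\<lambda>x. In n (t, x)) = integral torus (\<lambda>x. pd dt g (t, x))" for t
    proof -
      have wE: "has_weak_gradient (\<lambda>x. E (t, x)) (\<lambda>x. grad E (t, x))"
      proof -
        have "(\<chi> i j. pd (axis j 1) (\<lambda>x. E (t, x)) x $ i) = grad E (t, x)" for x
          by (simp add: grad_def pd_slice[OF E(1)] dx_def vec_eq_iff)
        then show ?thesis using smooth_weak_gradient[OF smooth_slice[OF E(1), of t] E(2)[of t]] by simp
      qed
      have ca: "continuous_on UNIV (pd dt (pd dt (u n)))" by (intro smooth_continuous_on smooth_pd sv)
      have i: "integrable \<mu> (\<lambda>x. In n (t, x))" "integrable \<mu> (\<lambda>x. pd dt g (t, x))"
        by (intro torus_integrable continuous_on_slice cI cg)+
      have i2: "integrable \<mu> (\<lambda>x. pd dt (pd dt (u n)) (t, x) \<bullet> E (t, x))"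
        "integrable \<mu> (\<lambda>x. grad E (t, x) \<bullet> MM n (t, x))"
        by (intro torus_integrable continuous_intros continuous_on_slice[OF ca] continuous_on_slice[OF cE(1)]
          continuous_on_slice[OF cE(3)] continuous_on_slice[OF cM])+
      have "(\<integral>x. pd dt g (t, x) \<partial>\<mu>) - (\<integral>x. In n (t, x) \<partial>\<mu>) =
        (\<integral>x. pd dt g (t, x) - In n (t, x) \<partial>\<mu>)"
        by (rule Bochner_Integration.integral_diff[OF i(2,1), symmetric])
      also have "\<dots> = (\<integral>x. pd dt (pd dt (u n)) (t, x) \<bullet> E (t, x) + grad E (t, x) \<bullet> MM n (t, x) \<partial>\<mu>)"
        by (simp add: pg In_def inner_commute)
      also have "\<dots> = 0"
        using acceleration[OF wE, of n t] i2 by simp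
      finally show ?thesis
        using torus_integral_HK[OF continuous_on_slice[OF cI(2)], of n t] torus_integral_HK[OF continuous_on_slice[OF cg], of t] by simp
    qed
    then have "integral ({0..T} \<times> torus) (In n) = integral ({0..T} \<times> torus) (pd dt g)"
      unfolding spacetime_iterated(1)[OF cI(2)] spacetime_iterated(1)[OF cg] by simp
    also have "\<dots> = integral torus (\<lambda>x. integral {0..T} (\<lambda>t. pd dt g (t, x)))" by (rule spacetime_iterated(2)[OF cg])
    also have "(\<lambda>x. integral {0..T} (\<lambda>t. pd dt g (t, x))) = (\<lambda>x. 0)"
    proof
      fix x
      have "((\<lambda>t. pd dt g (t, x)) has_integral (g (T, x) - g (0, x))) {0..T}"
        using T by (intro fundamental_theorem_of_calculus smooth_time_derivative[OF sg]) auto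
      moreover have "g (T, x) = 0" "g (0, x) = 0" using zero(3)[of "(0, x)" n] tau by (simp_all add: g_def ET)
      ultimately show "integral {0..T} (\<lambda>t. pd dt g (t, x)) = 0" by (simp add: integral_unique)
    qed
    finally show ?thesis by simp
  qed
  have k: "compact ({0..T} \<times> torus)" unfolding spacetime_cbox by (rule compact_cbox)
  obtain C where C: "C > 0" "\<And>p. p \<in> {0..T} \<times> torus \<Longrightarrow> norm (pd dt E p) \<le> C" "\<And>p. p \<in> {0..T} \<times> torus \<Longrightarrow> norm (grad E p) \<le> C"
    using compact_bound[OF k continuous_on_subset[OF cE(2) subset_UNIV] continuous_on_subset[OF cE(3) subset_UNIV]] by metis
  define K where "K = measure lborel ({0..T} \<times> torus)"
  have K: "K \<ge> 0" by (simp add: K_def)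
  have "\<bar>integral ({0..T} \<times> torus) I\<bar> \<le> 0 + d" if d: "d > 0" for d
  proof -
    define d' where "d' = d / (2 * C * K + 1)"
    have CK: "2 * C * K \<ge> 0" using C(1) K by simp
    have d': "d' > 0" "2 * C * d' * K \<le> d" using d CK by (auto simp: d'_def field_simps)
    obtain n where n: "\<And>p. norm (MM n p - P0 (G p)) \<le> d'" "\<And>p. norm (pd dt (u n) p - V p) \<le> d'" using fields_close[OF d'(1)] by blast
    have i: "I integrable_on ({0..T} \<times> torus)" "In n integrable_on ({0..T} \<times> torus)"
      unfolding spacetime_cbox by (intro integrable_continuous continuous_on_subset[OF cI(1)] continuous_on_subset[OF cI(2)] subset_UNIV)+
    have h: "((\<lambda>p. I p - In n p) has_integral (integral ({0..T} \<times> torus) I - integral ({0..T} \<times> torus) (In n))) ({0..T} \<times> torus)"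
      by (intro has_integral_diff integrable_integral i)
    have "norm (integral ({0..T} \<times> torus) I - integral ({0..T} \<times> torus) (In n)) \<le> (2 * C * d') * K"
      unfolding K_def
    proof (rule has_integral_bound[OF _ h[unfolded spacetime_cbox], folded spacetime_cbox])
      show "0 \<le> 2 * C * d'" using C(1) d' by simp
      fix p assume p: "p \<in> {0..T} \<times> torus"
      have "I p - In n p = (V p - pd dt (u n) p) \<bullet> pd dt E p + (MM n p - P0 (G p)) \<bullet> grad E p"
        by (simp add: I_def In_def inner_diff_left)
      moreover have "\<bar>(V p - pd dt (u n) p) \<bullet> pd dt E p\<bar> \<le> d' * C"
        by (rule order_trans[OF Cauchy_Schwarz_ineq2], intro mult_mono C p)
          (use n(2)[of p] d' in \<open>auto simp: norm_minus_commute\<close>)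
      moreover have "\<bar>(MM n p - P0 (G p)) \<bullet> grad E p\<bar> \<le> d' * C"
        by (rule order_trans[OF Cauchy_Schwarz_ineq2], intro mult_mono C p)
          (use n(1)[of p] d' in auto)
      moreover have "2 * C * d' = d' * C + d' * C" by simp
      ultimately show "norm (I p - In n p) \<le> 2 * C * d'" unfolding real_norm_def by linarith
    qed
    then show ?thesis using zero[of n] d'(2) by simp
  qed
  then have "\<bar>integral ({0..T} \<times> torus) I\<bar> \<le> 0" by (rule field_le_epsilon)
  then show ?thesis unfolding eqI spacetime_integral(2)[OF cI(1)] by simp
qed

lemma spacetime_measurable: "continuous_on UNIV f \<Longrightarrow> f \<in> borel_measurable (lebesgue_on ({0..T} \<times> torus))"
  for f :: "pt \<Rightarrow> 'b::euclidean_space"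
  by (rule continuous_imp_measurable_on_sets_lebesgue[OF continuous_on_subset spacetime_sets(2)]) auto

theorem weak_solution_limit: "weak_solution (first_PK a b c) T (\<lambda>x. 0) (\<lambda>x. 0) (\<lambda>t x. U (t, x))"
  unfolding weak_solution_def P0
proof (intro exI[of _ "\<lambda>t x. G (t, x)"] exI[of _ "\<lambda>t x. V (t, x)"] exI[of _ FF] conjI ballI)
  show "(\<lambda>(t, x). U (t, x)) \<in> borel_measurable (lebesgue_on ({0..T} \<times> torus))"
    "(\<lambda>(t, x). V (t, x)) \<in> borel_measurable (lebesgue_on ({0..T} \<times> torus))"
    "(\<lambda>(t, x). G (t, x)) \<in> borel_measurable (lebesgue_on ({0..T} \<times> torus))"
    using spacetime_measurable[OF cont(1)] spacetime_measurable[OF cont(2)] spacetime_measurable[OF cont(3)]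
    by (simp_all add: case_prod_beta')
  have "(\<lambda>p. P0 (G p)) \<in> borel_measurable (lebesgue_on ({0<..<T} \<times> torus))"
    by (intro continuous_imp_measurable_on_sets_lebesgue spacetime_sets continuous_on_subset[OF cont_PG]) auto
  moreover have "integrable (lebesgue_on ({0<..<T} \<times> torus)) (\<lambda>p. (norm (P0 (G p)))\<^sup>2)"
    by (intro spacetime_integral(1) continuous_on_power continuous_on_norm cont_PG)
  ultimately show "(\<lambda>(t, x). P0 (G (t, x))) \<in> L2_on ({0<..<T} \<times> torus)"
    by (simp add: L2_on_def case_prod_beta')
  show "AE x in \<mu>. U (0, x) = 0" "AE x in \<mu>. V (0, x) = 0"
    using tau by (simp_all add: zero)
  show "(\<integral>(t, x). V (t, x) \<bullet> vector_derivative (\<lambda>s. eta s x) (at t) - P0 (G (t, x)) \<bullet> jacobian (eta t) (at x)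
      \<partial>lebesgue_on ({0<..<T} \<times> torus)) = - (\<integral>x. 0 \<bullet> eta 0 x \<partial>\<mu>)"
    if "eta \<in> test_functions T" for eta
    using weak_formulation[OF that] by simp
qed (rule U_C_time_H1 C1_time FF_time weak_acceleration weak_gradient_U)+

end

theorem theorem1p7:
  fixes T :: real
    and a :: "2 \<Rightarrow> real" and b :: "2 \<Rightarrow> 2 \<Rightarrow> real" and c :: real
  assumes "T > 0"
    and "\<And>r s. b r s = b s r"
    and "a 1 = 0"
    and "- 2 * a 2 > 0"
    and "4 * b 1 1 + 4 * a 2 > 0"
    and "b 1 1 * b 2 2 - (b 1 2)\<^sup>2 > 0"
    and "3 * b 1 1 + 2 * c = 0"
    and "2 * b 1 1 + 8 * b 1 2 + 2 * a 2 + 4 * c \<noteq> 0"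
  shows "\<exists>u :: real \<Rightarrow> real^2 \<Rightarrow> real^2.
           weak_solution (first_PK a b c) T (\<lambda>x. 0) (\<lambda>x. 0) u \<and>
           C1_spacetime T u \<and>
           (\<exists>t\<in>{0..T}. \<exists>x. u t x \<noteq> 0)"
proof -
  interpret material a b c by (unfold_locales; fact assms)
  show ?thesis
  proof (rule approximating_sequence[OF assms(1)], goal_cases)
    case (1 u R \<tau> B cl p0)
    note A = 1
    note l = A(8-10)
    \<comment> \<open>\<open>2 * B\<close> is the sum of the geometric series; all three fields
      share one rate, as \<open>solution_limit\<close> expects.\<close>
    obtain U where U: "\<And>n p. norm (u n p - U p) \<le> 2 * B * (1/2)^n" by (rule geometric_limit[of u B, OF l(1)]) (rule that)
    obtain G where G: "\<And>n p. norm (grad (u n) p - G p) \<le> 2 * B * (1/2)^n" by (rule geometric_limit[of "\<lambda>n. grad (u n)" B, OF l(2)]) (rule that)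
    obtain V where V: "\<And>n p. norm (pd dt (u n) p - V p) \<le> 2 * B * (1/2)^n" by (rule geometric_limit[of "\<lambda>n. pd dt (u n)" B, OF l(3)]) (rule that)
    have e: "(\<lambda>n. 2 * B * (1/2)^n) \<longlonglongrightarrow> 0"
      using tendsto_mult_left[OF LIMSEQ_power_zero[of "1/2::real"], of "2 * B"] by simp
    have R2: "norm (R n p) \<le> 2 * B * (1/2)^n" for n p
    proof -
      have "0 \<le> B * (1/2)^n" using A(2) by simp
      then show ?thesis using A(11)[of n p] by linarith
    qed
    interpret solution_limit a b c T \<tau> u R U V G "\<lambda>n. 2 * B * (1/2)^n"
      by unfold_locales (fact assms(1) A U V G R2 e)+
    \<comment> \<open>The lower bound at \<open>p0\<close> passes to the limit and shows that the
      solution is not zero.\<close>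
    have "cl \<le> norm (U p0)" by (rule LIMSEQ_le_const[OF tendsto_norm[OF tendsto_fields(1)]]) (use A(14) in blast)
    then have "U (fst p0, snd p0) \<noteq> 0" using A(3) by auto
    then show ?case using weak_solution_limit C1_U A(13) by blast
  qed
qed

end
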